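(* There is an equivalence of categories $\mathcal O(W_q)\sim \mathrm{Vect}$, where $\mathrm{Vect}$ is the category of (complex) vector spaces. The equivalence is given by $$M\mapsto M^{co\rho},\qquad V\mapsto B_q^{--}\otimes V,$$ where $M\in\mathcal O(W_q)$, $V\in\mathrm{Vect}$, and $M^{co\rho}=\{m\in M\mid\rho(m)=1\otimes m\}$ is the set of coinvariants.
   Context: All vector spaces and tensor products are over $\mathbb C$. Let $q\in\mathbb{C}^*$ be not a root of unity; powers $q^r$, $r\in\mathbb Q$, are taken with respect to a fixed homomorphism $\mathbb Q\to\mathbb C^*$, $1\mapsto q$. Let $\mathfrak g$ be a finite dimensional complex semisimple Lie algebra with Cartan subalgebra $\mathfrak h$, $n=\dim\mathfrak h$, simple roots $\alpha_1,\dots,\alpha_n$, root lattice $Q$, weight lattice $\mathcal P$, $\mathcal P_+=\mathcal P\cap(\mathbb Q\otimes_{\mathbb Z}Q)$, $(\cdot,\cdot)$ the inner product on $\mathfrak h^*$ given by the Killing form, $q_i=q^{(\alpha_i,\alpha_i)/2}$. $\widetilde{U_q^+}$ is the Hopf algebra generated by $e_i$ ($1\le i\le n$), $t_\lambda^{\pm1}$ ($\lambda\in\mathcal P_+$) with relations $t_\lambda t_\mu=t_{\lambda+\mu}$, $t_0=1$, $t_\lambda e_it_\lambda^{-1}=q^{(\alpha_i,\lambda)}e_i$, and $\Delta(t_\lambda)=t_\lambda\otimes t_\lambda$, $\Delta(e_i)=e_i\otimes t_i^{-1}+1\otimes e_i$, $\varepsilon(e_i)=0$, $\varepsilon(t_\lambda)=1$,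 where $t_i=t_{\alpha_i}$. $\widetilde{U_q^-}$ is the Hopf algebra generated by $f_i$, ${t'_\lambda}^{\pm1}$ with relations $t'_\lambda t'_\mu=t'_{\lambda+\mu}$, $t'_0=1$, $t'_\lambda f_i{t'_\lambda}^{-1}=q^{-(\alpha_i,\lambda)}f_i$, and $\Delta(t'_\lambda)=t'_\lambda\otimes t'_\lambda$, $\Delta(f_i)=f_i\otimes1+t'_i\otimes f_i$, $\varepsilon(f_i)=0$, $\varepsilon(t'_\lambda)=1$, where $t'_i=t'_{\alpha_i}$. The bilinear form $\varphi:\widetilde{U_q^+}\times\widetilde{U_q^-}\to\mathbb C$ is determined by $\varphi(a,bb')=\sum\varphi(a_{(1)},b)\varphi(a_{(2)},b')$, $\varphi(aa',b)=\sum\varphi(a,b_{(2)})\varphi(a',b_{(1)})$, $\varphi(a,1)=\varepsilon(a)$, $\varphi(1,b)=\varepsilon(b)$ and $\varphi(e_i,f_j)=\delta_{ij}/(q_i^{-1}-q_i)$, $\varphi(t_\lambda,t'_\mu)=q^{-(\lambda,\mu)}$, $\varphi(e_i,t'_\lambda)=\varphi(t_\lambda,f_i)=0$. $U_q^+$ and $U_q^-$ are the quotients of $\widetilde{U_q^+},\widetilde{U_q^-}$ by the left and right radicals of $\varphi$; $\varphi$ also denotes the induced nondegenerate pairing. Put $e_i'=(q_i^{-1}-q_i)t_ie_i$, so $\varphi(e_i',f_j)=\delta_{ij}$. The Heisenberg double $H_\varphi(U_q^+,U_q^-)$ is $U_q^-\otimes U_q^+$ (pure tensors $b\sharp a$)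 with product $(b\sharp a)(b'\sharp a')=\sum\varphi(a_{(1)},b'_{(1)})\,bb'_{(2)}\sharp a_{(2)}a'$. The q-Boson algebra is $B_q(\mathfrak g)=H_\varphi(U_q^+,U_q^-)/(t_\lambda-t'_\lambda:\lambda\in\mathcal P_+)$; in it $e_i'f_j=q^{-(\alpha_i,\alpha_j)}f_je_i'+\delta_{ij}$. $B_q^{++}$, $B_q^{--}$ are the subalgebras generated by the $e_i'$, resp. the $f_i$ (identified with the corresponding subalgebras of $U_q^+$, $U_q^-$; $\varphi$ restricts to a pairing $B_q^{++}\times B_q^{--}\to\mathbb C$, nondegenerate in each degree for the gradings $\deg e_i'=\deg f_i=1$). The quantized Weyl algebra $W_q=W_q(\mathfrak g)$ is the subalgebra of $B_q(\mathfrak g)$ generated by all $e_i'$ and $f_j$. $\mathcal O(W_q)$ is the full subcategory of left $W_q$-modules $M$ such that for any $m\in M$ there is an integer $l>0$ such that $e'_{i_1}\cdots e'_{i_l}.m=0$ for all $1\le i_1,\dots,i_l\le n$. For $M\in\mathcal O(W_q)$, the linear map $\rho:M\to B_q^{--}\otimes M$, $\rho(m)=\sum m_{(-1)}\otimes m_{(0)}$, is the left $B_q^{--}$-comodule structure determined by $e.m=\sum\varphi(e,m_{(-1)})m_{(0)}$ for all $e\in B_q^{++}$. For a vector space $V$, $B_q^{--}\otimes V$ is the $W_q$-module with $f.(x\otimes v)=fx\otimes v$ and $e.(x\otimes v)=\sum\varphi(e,x_{(1)})x_{(2)}\otimes v$ for $f,x\in B_q^{--}$, $e\in B_q^{++}$,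 $v\in V$.
   Formalization: As printed, the quotient of the Heisenberg double by t_λ − t'_λ is zero for g ≠ 0, since t_λ t'_λ = q^{-(λ,λ)} t'_λ t_λ. B_q(g) is instead taken as the subalgebra of the Heisenberg double generated by the f_j, e'_i and t_λ; W_q is its subalgebra generated by the e'_i and f_j. *)

theory Defs
  imports
    Complex_Main
    "HOL-Algebra.Module"
    "HOL-Algebra.QuotRing"
    "HOL-Algebra.Subrings"
    "HOL-Library.FuncSet"
    "HOL-Library.Function_Algebras"
begin

section \<open>Complex semisimple Lie algebras\<close>

locale complex_lie_algebra = vector_space scale
  for scale :: "complex \<Rightarrow> 'g::ab_group_add \<Rightarrow> 'g" (infixr \<open>*s\<close> 75) +
  fixes br :: "'g \<Rightarrow> 'g \<Rightarrow> 'g"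
  assumes finite_dim: "\<exists>B. finite B \<and> span B = UNIV"
    and br_add_left: "br (x + y) z = br x z + br y z"
    and br_add_right: "br x (y + z) = br x y + br x z"
    and br_scale_left: "br (c *s x) y = c *s br x y"
    and br_scale_right: "br x (c *s y) = c *s br x y"
    and br_self: "br x x = 0"
    and jacobi: "br x (br y z) + br y (br z x) + br z (br x y) = 0"
begin

definition lie_ideal :: "'g set \<Rightarrow> bool" where
  "lie_ideal I \<longleftrightarrow> subspace I \<and> (\<forall>x. \<forall>y\<in>I. br x y \<in> I)"

definition lie_subalgebra :: "'g set \<Rightarrow> bool" where
  "lie_subalgebra S \<longleftrightarrow> subspace S \<and> (\<forall>x\<in>S. \<forall>y\<in>S. br x y \<in> S)"

definition bracket_space :: "'g set \<Rightarrow> 'g set \<Rightarrow> 'g set" where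
  "bracket_space S T = span {br x y | x y. x \<in> S \<and> y \<in> T}"

definition solvable_sub :: "'g set \<Rightarrow> bool" where
  "solvable_sub S \<longleftrightarrow> (\<exists>k. ((\<lambda>D. bracket_space D D) ^^ k) S = {0})"

definition nilpotent_sub :: "'g set \<Rightarrow> bool" where
  "nilpotent_sub S \<longleftrightarrow> (\<exists>k. (bracket_space S ^^ k) S = {0})"

definition semisimple :: bool where
  "semisimple \<longleftrightarrow> (\<forall>I. lie_ideal I \<and> solvable_sub I \<longrightarrow> I = {0})"

definition cartan_subalgebra :: "'g set \<Rightarrow> bool" where
  "cartan_subalgebra H \<longleftrightarrow>
     lie_subalgebra H \<and> nilpotent_sub H \<and> {x. \<forall>h\<in>H. br x h \<in> H} = H"

definition lin_trace :: "('g \<Rightarrow> 'g) \<Rightarrow> complex" where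
  "lin_trace f = (let B = (SOME B. finite B \<and> independent B \<and> span B = UNIV)
                  in \<Sum>b\<in>B. representation B (f b) b)"

definition killing :: "'g \<Rightarrow> 'g \<Rightarrow> complex" where
  "killing x y = lin_trace (\<lambda>z. br x (br y z))"

text \<open>Functionals on a subspace \<open>H\<close> are represented by functions vanishing outside \<open>H\<close>, so that
  \<open>dual_space H\<close> is closed under the pointwise operations of
  \<^theory>\<open>HOL-Library.Function_Algebras\<close>.\<close>

definition dual_space :: "'g set \<Rightarrow> ('g \<Rightarrow> complex) set" where
  "dual_space H = {\<mu>. (\<forall>x\<in>H. \<forall>y\<in>H. \<mu> (x + y) = \<mu> x + \<mu> y) \<and>
                      (\<forall>c. \<forall>x\<in>H. \<mu> (c *s x) = c * \<mu> x) \<and>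
                      (\<forall>x. x \<notin> H \<longrightarrow> \<mu> x = 0)}"

definition killing_vec :: "'g set \<Rightarrow> ('g \<Rightarrow> complex) \<Rightarrow> 'g" where
  "killing_vec H \<mu> = (THE h. h \<in> H \<and> (\<forall>x\<in>H. killing h x = \<mu> x))"

definition weight_form :: "'g set \<Rightarrow> ('g \<Rightarrow> complex) \<Rightarrow> ('g \<Rightarrow> complex) \<Rightarrow> complex" where
  "weight_form H \<mu> \<nu> = killing (killing_vec H \<mu>) (killing_vec H \<nu>)"

definition root_set :: "'g set \<Rightarrow> ('g \<Rightarrow> complex) set" where
  "root_set H = {\<beta> \<in> dual_space H. \<beta> \<noteq> 0 \<and> (\<exists>x. x \<noteq> 0 \<and> (\<forall>h\<in>H. br h x = \<beta> h *s x))}"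

definition simple_roots :: "'g set \<Rightarrow> (nat \<Rightarrow> 'g \<Rightarrow> complex) \<Rightarrow> bool" where
  "simple_roots H \<alpha> \<longleftrightarrow>
     (\<forall>i<dim H. \<alpha> i \<in> root_set H) \<and>
     (\<forall>c. (\<Sum>i<dim H. (\<lambda>x. c i * \<alpha> i x)) = 0 \<longrightarrow> (\<forall>i<dim H. c i = 0)) \<and>
     (\<forall>\<beta>\<in>root_set H. \<exists>k :: nat \<Rightarrow> int.
        \<beta> = (\<Sum>i<dim H. (\<lambda>x. of_int (k i) * \<alpha> i x)) \<and>
        ((\<forall>i<dim H. k i \<ge> 0) \<or> (\<forall>i<dim H. k i \<le> 0)))"

definition weight_lattice :: "'g set \<Rightarrow> ('g \<Rightarrow> complex) set" where
  "weight_lattice H = {\<mu> \<in> dual_space H.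
     \<forall>\<beta>\<in>root_set H. 2 * weight_form H \<mu> \<beta> / weight_form H \<beta> \<beta> \<in> \<int>}"

definition rational_root_span :: "'g set \<Rightarrow> (nat \<Rightarrow> 'g \<Rightarrow> complex) \<Rightarrow> ('g \<Rightarrow> complex) set" where
  "rational_root_span H \<alpha> =
     {\<Sum>i<dim H. (\<lambda>x. of_rat (r i) * \<alpha> i x) | r :: nat \<Rightarrow> rat. True}"

end


section \<open>Algebras, tensor products and quotients over the complex numbers\<close>

text \<open>Complex vector spaces and associative algebras are both \<^type>\<open>module\<close> records over \<open>CC\<close>;
  for a vector space the fields \<open>mult\<close> and \<open>one\<close> are irrelevant.\<close>

type_synonym 'a calg = "(complex, 'a) module"

definition CC :: "complex calg" where
  "CC = \<lparr>carrier = UNIV, mult = (*), one = 1, zero = 0, add = (+), smult = (*)\<rparr>"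

definition alg_hom :: "'a calg \<Rightarrow> 'b calg \<Rightarrow> ('a \<Rightarrow> 'b) set" where
  "alg_hom A B = {f \<in> ring_hom A B. \<forall>c. \<forall>x\<in>carrier A. f (c \<odot>\<^bsub>A\<^esub> x) = c \<odot>\<^bsub>B\<^esub> f x}"

definition subalg :: "'a calg \<Rightarrow> 'a set \<Rightarrow> 'a calg" where
  "subalg A S = A\<lparr>carrier := \<Inter>{N. subring N A \<and> submodule N CC A \<and> S \<subseteq> N}\<rparr>"

definition submodule_gen :: "'a calg \<Rightarrow> 'a set \<Rightarrow> 'a set" where
  "submodule_gen M S = \<Inter>{N. submodule N CC M \<and> S \<subseteq> N}"

definition quot :: "'a calg \<Rightarrow> 'a set \<Rightarrow> 'a set calg" where
  "quot A I = \<lparr>carrier = a_rcosets\<^bsub>A\<^esub> I, mult = rcoset_mult A I, one = I +>\<^bsub>A\<^esub> \<one>\<^bsub>A\<^esub>,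
     zero = I, add = set_add A, smult = (\<lambda>c X. \<Union>x\<in>X. I +>\<^bsub>A\<^esub> (c \<odot>\<^bsub>A\<^esub> x))\<rparr>"

definition delta :: "'a \<Rightarrow> 'a \<Rightarrow> complex" where
  "delta a = (\<lambda>x. if x = a then 1 else 0)"

definition supp :: "('a \<Rightarrow> complex) \<Rightarrow> 'a set" where
  "supp r = {x. r x \<noteq> 0}"

text \<open>The monoid algebra: its underlying space is the free vector space on the carrier.\<close>

definition monoid_algebra :: "('a, 'm) monoid_scheme \<Rightarrow> ('a \<Rightarrow> complex) calg" where
  "monoid_algebra G = \<lparr>carrier = {r. finite (supp r) \<and> supp r \<subseteq> carrier G},
     mult = (\<lambda>r s z. \<Sum>(x, y)\<in>supp r \<times> supp s. if x \<otimes>\<^bsub>G\<^esub> y = z then r x * s y else 0),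
     one = delta \<one>\<^bsub>G\<^esub>, zero = (\<lambda>x. 0), add = (\<lambda>r s x. r x + s x),
     smult = (\<lambda>c r x. c * r x)\<rparr>"

definition free_algebra :: "'x set \<Rightarrow> ('x list \<Rightarrow> complex) calg" where
  "free_algebra X = monoid_algebra \<lparr>carrier = lists X, mult = (@), one = []\<rparr>"

definition bilin_rels :: "'a calg \<Rightarrow> 'b calg \<Rightarrow> ('a \<times> 'b \<Rightarrow> complex) set" where
  "bilin_rels A B =
     {delta (a \<oplus>\<^bsub>A\<^esub> a', b) - delta (a, b) - delta (a', b) | a a' b.
        a \<in> carrier A \<and> a' \<in> carrier A \<and> b \<in> carrier B} \<union>
     {delta (a, b \<oplus>\<^bsub>B\<^esub> b') - delta (a, b) - delta (a, b') | a b b'.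
        a \<in> carrier A \<and> b \<in> carrier B \<and> b' \<in> carrier B} \<union>
     {delta (c \<odot>\<^bsub>A\<^esub> a, b) - (\<lambda>p. c * delta (a, b) p) | c a b.
        a \<in> carrier A \<and> b \<in> carrier B} \<union>
     {delta (a, c \<odot>\<^bsub>B\<^esub> b) - (\<lambda>p. c * delta (a, b) p) | c a b.
        a \<in> carrier A \<and> b \<in> carrier B}"

definition bilin_kernel :: "'a calg \<Rightarrow> 'b calg \<Rightarrow> ('a \<times> 'b \<Rightarrow> complex) set" where
  "bilin_kernel A B = submodule_gen (monoid_algebra (A \<times>\<times> B)) (bilin_rels A B)"

text \<open>For algebras, the product inherited from the direct product monoid is the usual product
  \<open>(a \<otimes> b)(a' \<otimes> b') = aa' \<otimes> bb'\<close>.\<close>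

definition tensor :: "'a calg \<Rightarrow> 'b calg \<Rightarrow> ('a \<times> 'b \<Rightarrow> complex) set calg" where
  "tensor A B = quot (monoid_algebra (A \<times>\<times> B)) (bilin_kernel A B)"

definition pure :: "'a calg \<Rightarrow> 'b calg \<Rightarrow> 'a \<Rightarrow> 'b \<Rightarrow> ('a \<times> 'b \<Rightarrow> complex) set" where
  "pure A B a b = bilin_kernel A B +>\<^bsub>monoid_algebra (A \<times>\<times> B)\<^esub> delta (a, b)"

text \<open>\<open>tlift C f t\<close> is the value at \<open>t\<close> of the linear map on a tensor product induced by the
  bilinear map \<open>f\<close>; thus \<open>tlift C f (\<Delta> x)\<close> is the Sweedler sum of \<open>f x\<^sub>(\<^sub>1\<^sub>) x\<^sub>(\<^sub>2\<^sub>)\<close>.\<close>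

definition tlift :: "'c calg \<Rightarrow> ('a \<Rightarrow> 'b \<Rightarrow> 'c) \<Rightarrow> ('a \<times> 'b \<Rightarrow> complex) set \<Rightarrow> 'c" where
  "tlift C f t = (let r = (SOME r. r \<in> t) in
     \<Oplus>\<^bsub>C\<^esub>p\<in>supp r. r p \<odot>\<^bsub>C\<^esub> f (fst p) (snd p))"


section \<open>The Hopf algebras and the pairing\<close>

record 'w qdatum =
  rank :: nat
  sroot :: "nat \<Rightarrow> 'w"
  wts :: "'w set"
  ip :: "'w \<Rightarrow> 'w \<Rightarrow> complex"
  qexp :: "rat \<Rightarrow> complex"

definition lie_qdatum :: "(complex \<Rightarrow> 'g \<Rightarrow> 'g) \<Rightarrow> ('g \<Rightarrow> 'g \<Rightarrow> 'g) \<Rightarrow> 'g::ab_group_add set \<Rightarrow>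
    (nat \<Rightarrow> 'g \<Rightarrow> complex) \<Rightarrow> (rat \<Rightarrow> complex) \<Rightarrow> ('g \<Rightarrow> complex) qdatum" where
  "lie_qdatum scale br H \<alpha> qe =
     \<lparr>rank = vector_space.dim scale H, sroot = \<alpha>,
      wts = complex_lie_algebra.weight_lattice scale br H \<inter>
            complex_lie_algebra.rational_root_span scale H \<alpha>,
      ip = complex_lie_algebra.weight_form scale br H, qexp = qe\<rparr>"

text \<open>The inner products of weights that occur below are rational complex numbers.\<close>

definition qpow :: "('w, 'z) qdatum_scheme \<Rightarrow> complex \<Rightarrow> complex" where
  "qpow D z = qexp D (THE r. of_rat r = z)"

definition qi :: "('w, 'z) qdatum_scheme \<Rightarrow> nat \<Rightarrow> complex" where
  "qi D i = qpow D (ip D (sroot D i) (sroot D i) / 2)"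

datatype 'w gen = Gen nat | Tor 'w

type_synonym 'w tU = "('w gen list \<Rightarrow> complex) set"
type_synonym 'w U = "'w tU set"
type_synonym 'w Heis = "('w U \<times> 'w U \<Rightarrow> complex) set"

definition gen_set :: "'w qdatum \<Rightarrow> 'w gen set" where
  "gen_set D = Gen ` {..<rank D} \<union> Tor ` wts D"

text \<open>The index of the generators runs through \<open>0..<n\<close>. The inverse of \<open>t\<^sub>\<mu>\<close> is \<open>t\<close> at \<open>-\<mu>\<close>, by the
  first two families of relations. The sign \<open>s\<close> is \<open>1\<close> for the positive and \<open>-1\<close> for the negative
  algebra.\<close>

definition U_rels :: "'w::ab_group_add qdatum \<Rightarrow> complex \<Rightarrow> ('w gen list \<Rightarrow> complex) set" where
  "U_rels D s =
     {delta [Tor \<mu>, Tor \<nu>] - delta [Tor (\<mu> + \<nu>)] | \<mu> \<nu>. \<mu> \<in> wts D \<and> \<nu> \<in> wts D} \<union>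
     {delta [Tor 0] - delta []} \<union>
     {delta [Tor \<mu>, Gen i, Tor (- \<mu>)] - (\<lambda>p. qpow D (s * ip D (sroot D i) \<mu>) * delta [Gen i] p)
        | \<mu> i. \<mu> \<in> wts D \<and> i < rank D}"

definition tU :: "'w::ab_group_add qdatum \<Rightarrow> complex \<Rightarrow> 'w tU calg" where
  "tU D s = quot (free_algebra (gen_set D)) (Idl\<^bsub>free_algebra (gen_set D)\<^esub> (U_rels D s))"

definition tgen :: "'w::ab_group_add qdatum \<Rightarrow> complex \<Rightarrow> 'w gen \<Rightarrow> 'w tU" where
  "tgen D s g = (Idl\<^bsub>free_algebra (gen_set D)\<^esub> (U_rels D s)) +>\<^bsub>free_algebra (gen_set D)\<^esub> delta [g]"

abbreviation "tUp D \<equiv> tU D 1"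
abbreviation "tUm D \<equiv> tU D (-1)"
abbreviation "te D i \<equiv> tgen D 1 (Gen i)"
abbreviation "tt D \<mu> \<equiv> tgen D 1 (Tor \<mu>)"
abbreviation "tf D i \<equiv> tgen D (-1) (Gen i)"
abbreviation "tt' D \<mu> \<equiv> tgen D (-1) (Tor \<mu>)"

record 'w hopf_data =
  cop_p :: "'w tU \<Rightarrow> ('w tU \<times> 'w tU \<Rightarrow> complex) set"
  cou_p :: "'w tU \<Rightarrow> complex"
  cop_m :: "'w tU \<Rightarrow> ('w tU \<times> 'w tU \<Rightarrow> complex) set"
  cou_m :: "'w tU \<Rightarrow> complex"
  pairing :: "'w tU \<Rightarrow> 'w tU \<Rightarrow> complex"

text \<open>Being algebra homomorphisms, the coproducts and counits are determined by their values on
  generators; coassociativity, the counit law and the antipode are consequences.\<close>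

definition is_hopf_p :: "'w::ab_group_add qdatum \<Rightarrow> 'w hopf_data \<Rightarrow> bool" where
  "is_hopf_p D P \<longleftrightarrow>
     cop_p P \<in> alg_hom (tUp D) (tensor (tUp D) (tUp D)) \<and>
     cou_p P \<in> alg_hom (tUp D) CC \<and>
     (\<forall>\<mu>\<in>wts D. cop_p P (tt D \<mu>) = pure (tUp D) (tUp D) (tt D \<mu>) (tt D \<mu>) \<and>
                 cou_p P (tt D \<mu>) = 1) \<and>
     (\<forall>i<rank D. cop_p P (te D i) =
          pure (tUp D) (tUp D) (te D i) (tt D (- sroot D i))
            \<oplus>\<^bsub>tensor (tUp D) (tUp D)\<^esub> pure (tUp D) (tUp D) \<one>\<^bsub>tUp D\<^esub> (te D i) \<and>
        cou_p P (te D i) = 0)"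

definition is_hopf_m :: "'w::ab_group_add qdatum \<Rightarrow> 'w hopf_data \<Rightarrow> bool" where
  "is_hopf_m D P \<longleftrightarrow>
     cop_m P \<in> alg_hom (tUm D) (tensor (tUm D) (tUm D)) \<and>
     cou_m P \<in> alg_hom (tUm D) CC \<and>
     (\<forall>\<mu>\<in>wts D. cop_m P (tt' D \<mu>) = pure (tUm D) (tUm D) (tt' D \<mu>) (tt' D \<mu>) \<and>
                 cou_m P (tt' D \<mu>) = 1) \<and>
     (\<forall>i<rank D. cop_m P (tf D i) =
          pure (tUm D) (tUm D) (tf D i) \<one>\<^bsub>tUm D\<^esub>
            \<oplus>\<^bsub>tensor (tUm D) (tUm D)\<^esub> pure (tUm D) (tUm D) (tt' D (sroot D i)) (tf D i) \<and>
        cou_m P (tf D i) = 0)"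

definition bilinear_form :: "'a calg \<Rightarrow> 'b calg \<Rightarrow> ('a \<Rightarrow> 'b \<Rightarrow> complex) \<Rightarrow> bool" where
  "bilinear_form A B \<phi> \<longleftrightarrow>
     (\<forall>a\<in>carrier A. \<forall>a'\<in>carrier A. \<forall>b\<in>carrier B. \<phi> (a \<oplus>\<^bsub>A\<^esub> a') b = \<phi> a b + \<phi> a' b) \<and>
     (\<forall>a\<in>carrier A. \<forall>b\<in>carrier B. \<forall>b'\<in>carrier B. \<phi> a (b \<oplus>\<^bsub>B\<^esub> b') = \<phi> a b + \<phi> a b') \<and>
     (\<forall>c. \<forall>a\<in>carrier A. \<forall>b\<in>carrier B.
        \<phi> (c \<odot>\<^bsub>A\<^esub> a) b = c * \<phi> a b \<and> \<phi> a (c \<odot>\<^bsub>B\<^esub> b) = c * \<phi> a b)"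

definition is_pairing :: "'w::ab_group_add qdatum \<Rightarrow> 'w hopf_data \<Rightarrow> bool" where
  "is_pairing D P \<longleftrightarrow> (let \<phi> = pairing P in
     bilinear_form (tUp D) (tUm D) \<phi> \<and>
     (\<forall>a\<in>carrier (tUp D). \<forall>b\<in>carrier (tUm D). \<forall>b'\<in>carrier (tUm D).
        \<phi> a (b \<otimes>\<^bsub>tUm D\<^esub> b') = tlift CC (\<lambda>a1 a2. \<phi> a1 b * \<phi> a2 b') (cop_p P a)) \<and>
     (\<forall>a\<in>carrier (tUp D). \<forall>a'\<in>carrier (tUp D). \<forall>b\<in>carrier (tUm D).
        \<phi> (a \<otimes>\<^bsub>tUp D\<^esub> a') b = tlift CC (\<lambda>b1 b2. \<phi> a b2 * \<phi> a' b1) (cop_m P b)) \<and>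
     (\<forall>a\<in>carrier (tUp D). \<phi> a \<one>\<^bsub>tUm D\<^esub> = cou_p P a) \<and>
     (\<forall>b\<in>carrier (tUm D). \<phi> \<one>\<^bsub>tUp D\<^esub> b = cou_m P b) \<and>
     (\<forall>i<rank D. \<forall>j<rank D.
        \<phi> (te D i) (tf D j) = (if i = j then 1 / (inverse (qi D i) - qi D i) else 0)) \<and>
     (\<forall>\<mu>\<in>wts D. \<forall>\<nu>\<in>wts D. \<phi> (tt D \<mu>) (tt' D \<nu>) = qpow D (- ip D \<mu> \<nu>)) \<and>
     (\<forall>i<rank D. \<forall>\<mu>\<in>wts D. \<phi> (te D i) (tt' D \<mu>) = 0 \<and> \<phi> (tt D \<mu>) (tf D i) = 0))"

definition left_rad :: "'w::ab_group_add qdatum \<Rightarrow> 'w hopf_data \<Rightarrow> 'w tU set" where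
  "left_rad D P = {a \<in> carrier (tUp D). \<forall>b\<in>carrier (tUm D). pairing P a b = 0}"

definition right_rad :: "'w::ab_group_add qdatum \<Rightarrow> 'w hopf_data \<Rightarrow> 'w tU set" where
  "right_rad D P = {b \<in> carrier (tUm D). \<forall>a\<in>carrier (tUp D). pairing P a b = 0}"

definition Up :: "'w::ab_group_add qdatum \<Rightarrow> 'w hopf_data \<Rightarrow> 'w U calg" where
  "Up D P = quot (tUp D) (left_rad D P)"

definition Um :: "'w::ab_group_add qdatum \<Rightarrow> 'w hopf_data \<Rightarrow> 'w U calg" where
  "Um D P = quot (tUm D) (right_rad D P)"

text \<open>Coproducts and pairing induced on the quotients.\<close>

definition quot_cop :: "'a calg \<Rightarrow> 'a set \<Rightarrow> ('a \<Rightarrow> ('a \<times> 'a \<Rightarrow> complex) set) \<Rightarrow>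
    'a set \<Rightarrow> ('a set \<times> 'a set \<Rightarrow> complex) set" where
  "quot_cop A I \<Delta> X = tlift (tensor (quot A I) (quot A I))
     (\<lambda>a b. pure (quot A I) (quot A I) (I +>\<^bsub>A\<^esub> a) (I +>\<^bsub>A\<^esub> b)) (\<Delta> (SOME a. a \<in> X))"

definition Delta_p :: "'w::ab_group_add qdatum \<Rightarrow> 'w hopf_data \<Rightarrow> 'w U \<Rightarrow> 'w Heis" where
  "Delta_p D P = quot_cop (tUp D) (left_rad D P) (cop_p P)"

definition Delta_m :: "'w::ab_group_add qdatum \<Rightarrow> 'w hopf_data \<Rightarrow> 'w U \<Rightarrow> 'w Heis" where
  "Delta_m D P = quot_cop (tUm D) (right_rad D P) (cop_m P)"

definition phi :: "'w hopf_data \<Rightarrow> 'w U \<Rightarrow> 'w U \<Rightarrow> complex" where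
  "phi P X Y = pairing P (SOME a. a \<in> X) (SOME b. b \<in> Y)"

definition gt :: "'w::ab_group_add qdatum \<Rightarrow> 'w hopf_data \<Rightarrow> 'w \<Rightarrow> 'w U" where
  "gt D P \<mu> = left_rad D P +>\<^bsub>tUp D\<^esub> tt D \<mu>"

definition ge :: "'w::ab_group_add qdatum \<Rightarrow> 'w hopf_data \<Rightarrow> nat \<Rightarrow> 'w U" where
  "ge D P i = left_rad D P +>\<^bsub>tUp D\<^esub> te D i"

definition gf :: "'w::ab_group_add qdatum \<Rightarrow> 'w hopf_data \<Rightarrow> nat \<Rightarrow> 'w U" where
  "gf D P i = right_rad D P +>\<^bsub>tUm D\<^esub> tf D i"

definition ge' :: "'w::ab_group_add qdatum \<Rightarrow> 'w hopf_data \<Rightarrow> nat \<Rightarrow> 'w U" where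
  "ge' D P i = (inverse (qi D i) - qi D i) \<odot>\<^bsub>Up D P\<^esub> (gt D P (sroot D i) \<otimes>\<^bsub>Up D P\<^esub> ge D P i)"

definition Bpp :: "'w::ab_group_add qdatum \<Rightarrow> 'w hopf_data \<Rightarrow> 'w U calg" where
  "Bpp D P = subalg (Up D P) (ge' D P ` {..<rank D})"

definition Bmm :: "'w::ab_group_add qdatum \<Rightarrow> 'w hopf_data \<Rightarrow> 'w U calg" where
  "Bmm D P = subalg (Um D P) (gf D P ` {..<rank D})"


section \<open>The Heisenberg double, the q-Boson algebra and the quantized Weyl algebra\<close>

definition sharp :: "'w::ab_group_add qdatum \<Rightarrow> 'w hopf_data \<Rightarrow> 'w U \<Rightarrow> 'w U \<Rightarrow> 'w Heis" where
  "sharp D P b a = pure (Um D P) (Up D P) b a"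

definition heis_mult :: "'w::ab_group_add qdatum \<Rightarrow> 'w hopf_data \<Rightarrow> 'w Heis \<Rightarrow> 'w Heis \<Rightarrow> 'w Heis" where
  "heis_mult D P x y = (let T = tensor (Um D P) (Up D P) in
     tlift T (\<lambda>b a.
       tlift T (\<lambda>b' a'.
         tlift T (\<lambda>a1 a2.
           tlift T (\<lambda>b1 b2.
             phi P a1 b1 \<odot>\<^bsub>T\<^esub> sharp D P (b \<otimes>\<^bsub>Um D P\<^esub> b2) (a2 \<otimes>\<^bsub>Up D P\<^esub> a'))
           (Delta_m D P b'))
         (Delta_p D P a))
       y)
     x)"

definition heis :: "'w::ab_group_add qdatum \<Rightarrow> 'w hopf_data \<Rightarrow> 'w Heis calg" where
  "heis D P = (tensor (Um D P) (Up D P))\<lparr>mult := heis_mult D P\<rparr>"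

text \<open>In the Heisenberg double \<open>t\<^sub>\<mu> t'\<^sub>\<nu> = q\<^sup>-\<^sup>(\<^sup>\<mu>\<^sup>,\<^sup>\<nu>\<^sup>) t'\<^sub>\<nu> t\<^sub>\<mu>\<close>, so the two-sided ideal generated by the
  elements \<open>t\<^sub>\<mu> - t'\<^sub>\<mu>\<close> contains a unit and the quotient by it would be the zero algebra.
  Since \<open>t\<^sub>\<mu>\<close> and \<open>t'\<^sub>\<mu>\<close> have the same commutation relations with all \<open>e'\<^sub>i\<close> and \<open>f\<^sub>j\<close>, what is meant
  is the algebra with one of the two tori: the subalgebra generated by the \<open>f\<^sub>j\<close>, \<open>e'\<^sub>i\<close> and \<open>t\<^sub>\<mu>\<close>.
  In it \<open>e'\<^sub>i f\<^sub>j = q\<^sup>-\<^sup>(\<^sup>\<alpha>\<^sub>i\<^sup>,\<^sup>\<alpha>\<^sub>j\<^sup>) f\<^sub>j e'\<^sub>i + \<delta>\<^sub>i\<^sub>j\<close>, and \<open>Bpp\<close> and \<open>Bmm\<close> embed by \<open>a \<mapsto> 1 \<sharp> a\<close> and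
  \<open>b \<mapsto> b \<sharp> 1\<close>.\<close>

definition inl_H :: "'w::ab_group_add qdatum \<Rightarrow> 'w hopf_data \<Rightarrow> 'w U \<Rightarrow> 'w Heis" where
  "inl_H D P b = sharp D P b \<one>\<^bsub>Up D P\<^esub>"

definition inr_H :: "'w::ab_group_add qdatum \<Rightarrow> 'w hopf_data \<Rightarrow> 'w U \<Rightarrow> 'w Heis" where
  "inr_H D P a = sharp D P \<one>\<^bsub>Um D P\<^esub> a"

definition q_boson :: "'w::ab_group_add qdatum \<Rightarrow> 'w hopf_data \<Rightarrow> 'w Heis calg" where
  "q_boson D P = subalg (heis D P)
     ((\<lambda>j. inl_H D P (gf D P j)) ` {..<rank D} \<union> (\<lambda>i. inr_H D P (ge' D P i)) ` {..<rank D} \<union>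
      (\<lambda>\<mu>. inr_H D P (gt D P \<mu>)) ` wts D)"

definition Wq :: "'w::ab_group_add qdatum \<Rightarrow> 'w hopf_data \<Rightarrow> 'w Heis calg" where
  "Wq D P = subalg (q_boson D P)
     ((\<lambda>j. inl_H D P (gf D P j)) ` {..<rank D} \<union> (\<lambda>i. inr_H D P (ge' D P i)) ` {..<rank D})"


section \<open>Categories\<close>

record ('o, 'm) cat =
  Obj :: "'o set"
  Hom :: "'o \<Rightarrow> 'o \<Rightarrow> 'm set"
  Idm :: "'o \<Rightarrow> 'm"
  Cmp :: "'o \<Rightarrow> 'o \<Rightarrow> 'o \<Rightarrow> 'm \<Rightarrow> 'm \<Rightarrow> 'm"

text \<open>\<open>Cmp C X Y Z g f\<close> is the composite of \<open>f : X \<rightarrow> Y\<close> and \<open>g : Y \<rightarrow> Z\<close>.\<close>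

definition category :: "('o, 'm) cat \<Rightarrow> bool" where
  "category C \<longleftrightarrow>
     (\<forall>X\<in>Obj C. Idm C X \<in> Hom C X X) \<and>
     (\<forall>X\<in>Obj C. \<forall>Y\<in>Obj C. \<forall>Z\<in>Obj C. \<forall>f\<in>Hom C X Y. \<forall>g\<in>Hom C Y Z. Cmp C X Y Z g f \<in> Hom C X Z) \<and>
     (\<forall>X\<in>Obj C. \<forall>Y\<in>Obj C. \<forall>f\<in>Hom C X Y.
        Cmp C X X Y f (Idm C X) = f \<and> Cmp C X Y Y (Idm C Y) f = f) \<and>
     (\<forall>X\<in>Obj C. \<forall>Y\<in>Obj C. \<forall>Z\<in>Obj C. \<forall>V\<in>Obj C.
        \<forall>f\<in>Hom C X Y. \<forall>g\<in>Hom C Y Z. \<forall>h\<in>Hom C Z V.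
          Cmp C X Z V h (Cmp C X Y Z g f) = Cmp C X Y V (Cmp C Y Z V h g) f)"

record ('o, 'm, 'p, 'n) func =
  FOb :: "'o \<Rightarrow> 'p"
  FMor :: "'o \<Rightarrow> 'o \<Rightarrow> 'm \<Rightarrow> 'n"

definition is_functor :: "('o, 'm) cat \<Rightarrow> ('p, 'n) cat \<Rightarrow> ('o, 'm, 'p, 'n) func \<Rightarrow> bool" where
  "is_functor C D F \<longleftrightarrow>
     (\<forall>X\<in>Obj C. FOb F X \<in> Obj D) \<and>
     (\<forall>X\<in>Obj C. \<forall>Y\<in>Obj C. \<forall>f\<in>Hom C X Y. FMor F X Y f \<in> Hom D (FOb F X) (FOb F Y)) \<and>
     (\<forall>X\<in>Obj C. FMor F X X (Idm C X) = Idm D (FOb F X)) \<and>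
     (\<forall>X\<in>Obj C. \<forall>Y\<in>Obj C. \<forall>Z\<in>Obj C. \<forall>f\<in>Hom C X Y. \<forall>g\<in>Hom C Y Z.
        FMor F X Z (Cmp C X Y Z g f) =
        Cmp D (FOb F X) (FOb F Y) (FOb F Z) (FMor F Y Z g) (FMor F X Y f))"

definition id_functor :: "('o, 'm, 'o, 'm) func" where
  "id_functor = \<lparr>FOb = (\<lambda>X. X), FMor = (\<lambda>X Y f. f)\<rparr>"

definition comp_functor :: "('p, 'n, 'r, 'k) func \<Rightarrow> ('o, 'm, 'p, 'n) func \<Rightarrow>
    ('o, 'm, 'r, 'k) func" where
  "comp_functor G F = \<lparr>FOb = (\<lambda>X. FOb G (FOb F X)),
     FMor = (\<lambda>X Y f. FMor G (FOb F X) (FOb F Y) (FMor F X Y f))\<rparr>"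

definition is_iso :: "('o, 'm) cat \<Rightarrow> 'o \<Rightarrow> 'o \<Rightarrow> 'm \<Rightarrow> bool" where
  "is_iso C X Y f \<longleftrightarrow> f \<in> Hom C X Y \<and>
     (\<exists>g\<in>Hom C Y X. Cmp C X Y X g f = Idm C X \<and> Cmp C Y X Y f g = Idm C Y)"

definition natural_iso :: "('o, 'm) cat \<Rightarrow> ('p, 'n) cat \<Rightarrow> ('o, 'm, 'p, 'n) func \<Rightarrow>
    ('o, 'm, 'p, 'n) func \<Rightarrow> ('o \<Rightarrow> 'n) \<Rightarrow> bool" where
  "natural_iso C D F G \<eta> \<longleftrightarrow>
     (\<forall>X\<in>Obj C. is_iso D (FOb F X) (FOb G X) (\<eta> X)) \<and>
     (\<forall>X\<in>Obj C. \<forall>Y\<in>Obj C. \<forall>f\<in>Hom C X Y.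
        Cmp D (FOb F X) (FOb F Y) (FOb G Y) (\<eta> Y) (FMor F X Y f) =
        Cmp D (FOb F X) (FOb G X) (FOb G Y) (FMor G X Y f) (\<eta> X))"

definition equivalence_of_categories :: "('o, 'm) cat \<Rightarrow> ('p, 'n) cat \<Rightarrow>
    ('o, 'm, 'p, 'n) func \<Rightarrow> ('p, 'n, 'o, 'm) func \<Rightarrow> bool" where
  "equivalence_of_categories C D F G \<longleftrightarrow>
     category C \<and> category D \<and> is_functor C D F \<and> is_functor D C G \<and>
     (\<exists>\<eta>. natural_iso C C id_functor (comp_functor G F) \<eta>) \<and>
     (\<exists>\<epsilon>. natural_iso D D (comp_functor F G) id_functor \<epsilon>)"


section \<open>Vector spaces and modules over the quantized Weyl algebra\<close>

text \<open>The type \<open>'u\<close> plays the role of the universe: objects are structures whose carrier is a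
  subset of \<open>'u\<close>. Morphisms are extensional functions, so that equal maps are equal morphisms.\<close>

definition lin_maps :: "'u calg \<Rightarrow> 'v calg \<Rightarrow> ('u \<Rightarrow> 'v) set" where
  "lin_maps V V' = {f \<in> carrier V \<rightarrow>\<^sub>E carrier V'.
     (\<forall>x\<in>carrier V. \<forall>y\<in>carrier V. f (x \<oplus>\<^bsub>V\<^esub> y) = f x \<oplus>\<^bsub>V'\<^esub> f y) \<and>
     (\<forall>c. \<forall>x\<in>carrier V. f (c \<odot>\<^bsub>V\<^esub> x) = c \<odot>\<^bsub>V'\<^esub> f x)}"

definition Vect :: "('u calg, 'u \<Rightarrow> 'u) cat" where
  "Vect = \<lparr>Obj = {V. module CC V}, Hom = lin_maps, Idm = (\<lambda>V. restrict (\<lambda>x. x) (carrier V)),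
           Cmp = (\<lambda>X Y Z g f. compose (carrier X) g f)\<rparr>"

definition left_module :: "'a calg \<Rightarrow> 'u calg \<Rightarrow> ('a \<Rightarrow> 'u \<Rightarrow> 'u) \<Rightarrow> bool" where
  "left_module A V act \<longleftrightarrow> module CC V \<and>
     (\<forall>a\<in>carrier A. \<forall>v\<in>carrier V. act a v \<in> carrier V) \<and>
     (\<forall>a\<in>carrier A. \<forall>v\<in>carrier V. \<forall>w\<in>carrier V. act a (v \<oplus>\<^bsub>V\<^esub> w) = act a v \<oplus>\<^bsub>V\<^esub> act a w) \<and>
     (\<forall>a\<in>carrier A. \<forall>b\<in>carrier A. \<forall>v\<in>carrier V.
        act (a \<oplus>\<^bsub>A\<^esub> b) v = act a v \<oplus>\<^bsub>V\<^esub> act b v \<and> act (a \<otimes>\<^bsub>A\<^esub> b) v = act a (act b v)) \<and>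
     (\<forall>c. \<forall>a\<in>carrier A. \<forall>v\<in>carrier V.
        act (c \<odot>\<^bsub>A\<^esub> a) v = c \<odot>\<^bsub>V\<^esub> act a v \<and> act a (c \<odot>\<^bsub>V\<^esub> v) = c \<odot>\<^bsub>V\<^esub> act a v) \<and>
     (\<forall>v\<in>carrier V. act \<one>\<^bsub>A\<^esub> v = v)"

type_synonym ('w, 'u) wmod = "'u calg \<times> ('w Heis \<Rightarrow> 'u \<Rightarrow> 'u)"

definition OWq :: "'w::ab_group_add qdatum \<Rightarrow> 'w hopf_data \<Rightarrow>
    (('w, 'u) wmod, 'u \<Rightarrow> 'u) cat" where
  "OWq D P = \<lparr>
     Obj = {(V, act). left_module (Wq D P) V act \<and>
       (\<forall>m\<in>carrier V. \<exists>l>0. \<forall>is. length is = l \<and> set is \<subseteq> {..<rank D} \<longrightarrow>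
          foldr (\<lambda>i x. act (inr_H D P (ge' D P i)) x) is m = \<zero>\<^bsub>V\<^esub>)},
     Hom = (\<lambda>M N. {f \<in> lin_maps (fst M) (fst N).
       \<forall>w\<in>carrier (Wq D P). \<forall>m\<in>carrier (fst M). f (snd M w m) = snd N w (f m)}),
     Idm = (\<lambda>M. restrict (\<lambda>x. x) (carrier (fst M))),
     Cmp = (\<lambda>X Y Z g f. compose (carrier (fst X)) g f)\<rparr>"

definition coaction :: "'w::ab_group_add qdatum \<Rightarrow> 'w hopf_data \<Rightarrow> ('w, 'u) wmod \<Rightarrow>
    'u \<Rightarrow> ('w U \<times> 'u \<Rightarrow> complex) set" where
  "coaction D P M m = (THE t. t \<in> carrier (tensor (Bmm D P) (fst M)) \<and>
     (\<forall>e\<in>carrier (Bpp D P).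
        snd M (inr_H D P e) m = tlift (fst M) (\<lambda>x v. phi P e x \<odot>\<^bsub>fst M\<^esub> v) t))"

definition coinvariants :: "'w::ab_group_add qdatum \<Rightarrow> 'w hopf_data \<Rightarrow> ('w, 'u) wmod \<Rightarrow> 'u set" where
  "coinvariants D P M =
     {m \<in> carrier (fst M). coaction D P M m = pure (Bmm D P) (fst M) \<one>\<^bsub>Bmm D P\<^esub> m}"

definition coinv_functor :: "'w::ab_group_add qdatum \<Rightarrow> 'w hopf_data \<Rightarrow>
    (('w, 'u) wmod, 'u \<Rightarrow> 'u, 'u calg, 'u \<Rightarrow> 'u) func" where
  "coinv_functor D P = \<lparr>
     FOb = (\<lambda>M. (fst M)\<lparr>carrier := coinvariants D P M\<rparr>),
     FMor = (\<lambda>M N f. restrict f (coinvariants D P M))\<rparr>"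

definition skew_act :: "'w::ab_group_add qdatum \<Rightarrow> 'w hopf_data \<Rightarrow> 'w U \<Rightarrow> 'w U \<Rightarrow> 'w U" where
  "skew_act D P e x = tlift (Um D P) (\<lambda>x1 x2. phi P e x1 \<odot>\<^bsub>Um D P\<^esub> x2) (Delta_m D P x)"

definition ind_act :: "'w::ab_group_add qdatum \<Rightarrow> 'w hopf_data \<Rightarrow> 'u calg \<Rightarrow>
    'w Heis \<Rightarrow> ('w U \<times> 'u \<Rightarrow> complex) set \<Rightarrow> ('w U \<times> 'u \<Rightarrow> complex) set" where
  "ind_act D P V = (SOME act.
     left_module (Wq D P) (tensor (Bmm D P) V) act \<and>
     (\<forall>f\<in>carrier (Bmm D P). \<forall>x\<in>carrier (Bmm D P). \<forall>v\<in>carrier V.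
        act (inl_H D P f) (pure (Bmm D P) V x v) = pure (Bmm D P) V (f \<otimes>\<^bsub>Bmm D P\<^esub> x) v) \<and>
     (\<forall>e\<in>carrier (Bpp D P). \<forall>x\<in>carrier (Bmm D P). \<forall>v\<in>carrier V.
        act (inr_H D P e) (pure (Bmm D P) V x v) = pure (Bmm D P) V (skew_act D P e x) v))"

text \<open>The tensor product of \<open>Bmm\<close> with a vector space in \<open>'u\<close> is moved back into \<open>'u\<close> along an
  injection of its carrier. For every type \<open>'u\<close> there is one: a vector space with carrier in
  \<open>'u\<close> is either zero or at least as large as the continuum, whereas \<open>Bmm\<close> is at most as large as
  the continuum.\<close>

definition embed :: "'w::ab_group_add qdatum \<Rightarrow> 'w hopf_data \<Rightarrow> 'u calg \<Rightarrow>
    ('w U \<times> 'u \<Rightarrow> complex) set \<Rightarrow> 'u" where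
  "embed D P V = (SOME j. inj_on j (carrier (tensor (Bmm D P) V)))"

definition unembed :: "'w::ab_group_add qdatum \<Rightarrow> 'w hopf_data \<Rightarrow> 'u calg \<Rightarrow>
    'u \<Rightarrow> ('w U \<times> 'u \<Rightarrow> complex) set" where
  "unembed D P V = inv_into (carrier (tensor (Bmm D P) V)) (embed D P V)"

definition transport :: "'a calg \<Rightarrow> ('a \<Rightarrow> 'u) \<Rightarrow> ('u \<Rightarrow> 'a) \<Rightarrow> 'u calg" where
  "transport T j k = \<lparr>carrier = j ` carrier T, mult = (\<lambda>x y. j (k x \<otimes>\<^bsub>T\<^esub> k y)), one = j \<one>\<^bsub>T\<^esub>,
     zero = j \<zero>\<^bsub>T\<^esub>, add = (\<lambda>x y. j (k x \<oplus>\<^bsub>T\<^esub> k y)), smult = (\<lambda>c x. j (c \<odot>\<^bsub>T\<^esub> k x))\<rparr>"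

definition ind_functor :: "'w::ab_group_add qdatum \<Rightarrow> 'w hopf_data \<Rightarrow>
    ('u calg, 'u \<Rightarrow> 'u, ('w, 'u) wmod, 'u \<Rightarrow> 'u) func" where
  "ind_functor D P = \<lparr>
     FOb = (\<lambda>V. (transport (tensor (Bmm D P) V) (embed D P V) (unembed D P V),
                 \<lambda>w y. embed D P V (ind_act D P V w (unembed D P V y)))),
     FMor = (\<lambda>V V' f. restrict
       (\<lambda>y. embed D P V' (tlift (tensor (Bmm D P) V') (\<lambda>x v. pure (Bmm D P) V' x (f v))
                            (unembed D P V y)))
       (embed D P V ` carrier (tensor (Bmm D P) V)))\<rparr>"

end

theory Submission
  imports Defs
begin

text \<open>
  The idea. In \<^term>\<open>Wq D P\<close> the two families of generators are related by
  \<open>e'\<^sub>i f\<^sub>j = \<chi>\<^sub>i\<^sub>j f\<^sub>j e'\<^sub>i + \<delta>\<^sub>i\<^sub>j\<close> only (\<open>weyl_relation\<close>), so the module induced from a vector space \<open>V\<close> is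
  \<open>B \<otimes> V\<close>, where \<open>B\<close> is the algebra generated by the \<open>f\<^sub>j\<close>. Let \<open>E\<close> be the algebra generated by the \<open>e'\<^sub>i\<close>. The action of
  \<open>E\<close> on \<open>B\<close> is adjoint to right multiplication: \<open>\<phi>(c, a.x) = \<phi>(c a, x)\<close> (\<open>\<phi>_act\<close>). The pairing of \<open>E\<close> and \<open>B\<close> is
  nondegenerate (\<open>nondeg_M\<close>, \<open>nondeg_E\<close>) and pairs words of different length to zero (\<open>\<phi>_ew_fw\<close>). Hence a tensor in
  \<open>B \<otimes> V\<close> amounts to a linear map from \<open>E\<close> to \<open>V\<close> that vanishes on long words (\<open>cc_eqI\<close>, \<open>tensor_of_functional\<close>), and
  \<open>a\<close> in \<open>E\<close> acts on such maps by \<open>g \<mapsto> g(\<sqdot> a)\<close>. Two consequences: a vector \<open>m\<close> of a module in the category \<open>O\<close> has a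
  unique coaction, namely the tensor of the functional \<open>e \<mapsto> e m\<close> (\<open>coaction_ex1\<close>), and the coinvariants are the vectors
  killed by all \<open>e'\<^sub>i\<close> (\<open>coinvariants_iff\<close>). In \<open>B \<otimes> V\<close> these are the tensors \<open>1 \<otimes> v\<close> (\<open>coinv_Ind\<close>), which gives the counit
  of the equivalence.

  For a module \<open>M\<close> in \<open>O\<close> with coinvariants \<open>M\<^sub>0\<close>, the map \<open>Phi: B \<otimes> M\<^sub>0 \<rightarrow> M\<close>, \<open>x \<otimes> v \<mapsto> x v\<close>, is linear over the
  quantized Weyl algebra (\<open>Phi_equivariant\<close>). It is injective (\<open>Phi_zero\<close>): its kernel is stable under the locally
  nilpotent \<open>e'\<^sub>i\<close>, so if it were nonzero, it would contain some \<open>1 \<otimes> v\<close> with \<open>v \<noteq> 0\<close>, but this is mapped to \<open>v\<close>. It is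
  surjective (\<open>Phi_surj_aux\<close>): by induction on the nilpotency degree of \<open>m\<close> in \<open>M\<close> the vectors \<open>e'\<^sub>i m\<close> have preimages
  \<open>t\<^sub>i\<close>. The degree zero coordinates of the preimages of \<open>e m\<close>, for \<open>e\<close> in \<open>E\<close> of positive degree, form a functional on \<open>E\<close>, hence
  come from a tensor \<open>t\<close>, which satisfies \<open>e'\<^sub>i t = t\<^sub>i\<close>. So \<open>m - Phi t\<close> is coinvariant, and \<open>m\<close> is in the image.
  In other words, \<open>B \<otimes> M\<^sub>0\<close> is an injective object for \<open>E\<close>, as a graded dual of a free module.

  The rest provides the setting. Identities between Sweedler sums are proved by testing against the
  pairing, which is enough because functionals on the factors separate tensors (\<open>tensor_separate\<close>). The Heisenberg
  double acts on the negative Borel algebra (\<open>rep_hmul\<close>), and this yields the module structure on \<open>B \<otimes> V\<close>. That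
  weights and roots satisfy what the relations require follows from the existence of counits and coproducts
  with the prescribed values (\<open>U_rels_carrier\<close>, \<open>minus_root_wts\<close>).
\<close>

section \<open>Complex vector spaces and linear maps\<close>

lemma CC_simps [simp]:
  "carrier CC = UNIV" "x \<otimes>\<^bsub>CC\<^esub> y = x * y" "\<one>\<^bsub>CC\<^esub> = 1" "\<zero>\<^bsub>CC\<^esub> = 0" "x \<oplus>\<^bsub>CC\<^esub> y = x + y"
  "x \<odot>\<^bsub>CC\<^esub> y = x * y"
  by (simp_all add: CC_def)

lemma cring_CC: "cring CC"
proof (rule cringI)
  show "abelian_group CC"
  proof (rule abelian_groupI)
    fix x show "\<exists>y\<in>carrier CC. y \<oplus>\<^bsub>CC\<^esub> x = \<zero>\<^bsub>CC\<^esub>"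
      by (rule bexI[of _ "- x"]) auto
  qed auto
  show "comm_monoid CC" by (rule comm_monoidI) auto
qed (auto simp: algebra_simps)

text \<open>The additive inverse of \<open>x\<close> is \<open>(-1) x\<close>, so the group axioms reduce to those of a monoid.\<close>

lemma module_CCI:
  assumes add: "\<And>x y. x \<in> carrier V \<Longrightarrow> y \<in> carrier V \<Longrightarrow> x \<oplus>\<^bsub>V\<^esub> y \<in> carrier V"
    and zero: "\<zero>\<^bsub>V\<^esub> \<in> carrier V"
    and assoc: "\<And>x y z. x \<in> carrier V \<Longrightarrow> y \<in> carrier V \<Longrightarrow> z \<in> carrier V \<Longrightarrow>
                  (x \<oplus>\<^bsub>V\<^esub> y) \<oplus>\<^bsub>V\<^esub> z = x \<oplus>\<^bsub>V\<^esub> (y \<oplus>\<^bsub>V\<^esub> z)"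
    and comm: "\<And>x y. x \<in> carrier V \<Longrightarrow> y \<in> carrier V \<Longrightarrow> x \<oplus>\<^bsub>V\<^esub> y = y \<oplus>\<^bsub>V\<^esub> x"
    and l_zero: "\<And>x. x \<in> carrier V \<Longrightarrow> \<zero>\<^bsub>V\<^esub> \<oplus>\<^bsub>V\<^esub> x = x"
    and sm: "\<And>c x. x \<in> carrier V \<Longrightarrow> c \<odot>\<^bsub>V\<^esub> x \<in> carrier V"
    and ldist: "\<And>a b x. x \<in> carrier V \<Longrightarrow> (a + b) \<odot>\<^bsub>V\<^esub> x = a \<odot>\<^bsub>V\<^esub> x \<oplus>\<^bsub>V\<^esub> b \<odot>\<^bsub>V\<^esub> x"
    and rdist: "\<And>a x y. x \<in> carrier V \<Longrightarrow> y \<in> carrier V \<Longrightarrow>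
                  a \<odot>\<^bsub>V\<^esub> (x \<oplus>\<^bsub>V\<^esub> y) = a \<odot>\<^bsub>V\<^esub> x \<oplus>\<^bsub>V\<^esub> a \<odot>\<^bsub>V\<^esub> y"
    and sassoc: "\<And>a b x. x \<in> carrier V \<Longrightarrow> (a * b) \<odot>\<^bsub>V\<^esub> x = a \<odot>\<^bsub>V\<^esub> (b \<odot>\<^bsub>V\<^esub> x)"
    and sone: "\<And>x. x \<in> carrier V \<Longrightarrow> 1 \<odot>\<^bsub>V\<^esub> x = x"
    and szero: "\<And>x. x \<in> carrier V \<Longrightarrow> 0 \<odot>\<^bsub>V\<^esub> x = \<zero>\<^bsub>V\<^esub>"
  shows "module CC V"
proof (rule moduleI)
  show "abelian_group V"
  proof (rule abelian_groupI)
    fix x assume x: "x \<in> carrier V"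
    have "(-1) \<odot>\<^bsub>V\<^esub> x \<oplus>\<^bsub>V\<^esub> x = (-1 + 1) \<odot>\<^bsub>V\<^esub> x"
      using ldist[OF x, of "-1" 1] sone[OF x] by simp
    then show "\<exists>y\<in>carrier V. y \<oplus>\<^bsub>V\<^esub> x = \<zero>\<^bsub>V\<^esub>"
      using szero[OF x] sm[OF x] by (intro bexI[of _ "(-1) \<odot>\<^bsub>V\<^esub> x"]) auto
  qed (use assms in auto)
qed (use assms in \<open>auto intro: cring_CC\<close>)

lemma module_CC: "module CC CC"
  by (rule module_CCI) (auto simp: algebra_simps)

context
  fixes V :: "'a calg"
  assumes V: "module CC V"
begin

interpretation V: module CC V by (fact V)

lemma vs_add [simp]: "x \<in> carrier V \<Longrightarrow> y \<in> carrier V \<Longrightarrow> x \<oplus>\<^bsub>V\<^esub> y \<in> carrier V" by simp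
lemma vs_zero [simp]: "\<zero>\<^bsub>V\<^esub> \<in> carrier V" by simp
lemma vs_smult [simp]: "x \<in> carrier V \<Longrightarrow> c \<odot>\<^bsub>V\<^esub> x \<in> carrier V" by simp
lemma vs_assoc: "x \<in> carrier V \<Longrightarrow> y \<in> carrier V \<Longrightarrow> z \<in> carrier V \<Longrightarrow>
    (x \<oplus>\<^bsub>V\<^esub> y) \<oplus>\<^bsub>V\<^esub> z = x \<oplus>\<^bsub>V\<^esub> (y \<oplus>\<^bsub>V\<^esub> z)" by (rule V.a_assoc)
lemma vs_comm: "x \<in> carrier V \<Longrightarrow> y \<in> carrier V \<Longrightarrow> x \<oplus>\<^bsub>V\<^esub> y = y \<oplus>\<^bsub>V\<^esub> x" by (rule V.a_comm)
lemma vs_lcomm: "x \<in> carrier V \<Longrightarrow> y \<in> carrier V \<Longrightarrow> z \<in> carrier V \<Longrightarrow>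
    x \<oplus>\<^bsub>V\<^esub> (y \<oplus>\<^bsub>V\<^esub> z) = y \<oplus>\<^bsub>V\<^esub> (x \<oplus>\<^bsub>V\<^esub> z)" by (rule V.a_lcomm)
lemma vs_l_zero [simp]: "x \<in> carrier V \<Longrightarrow> \<zero>\<^bsub>V\<^esub> \<oplus>\<^bsub>V\<^esub> x = x" by simp
lemma vs_r_zero [simp]: "x \<in> carrier V \<Longrightarrow> x \<oplus>\<^bsub>V\<^esub> \<zero>\<^bsub>V\<^esub> = x" by simp
lemma vs_ldist: "x \<in> carrier V \<Longrightarrow> (a + b) \<odot>\<^bsub>V\<^esub> x = a \<odot>\<^bsub>V\<^esub> x \<oplus>\<^bsub>V\<^esub> b \<odot>\<^bsub>V\<^esub> x"
  using V.smult_l_distr[of a b x] by simp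
lemma vs_rdist: "x \<in> carrier V \<Longrightarrow> y \<in> carrier V \<Longrightarrow>
    a \<odot>\<^bsub>V\<^esub> (x \<oplus>\<^bsub>V\<^esub> y) = a \<odot>\<^bsub>V\<^esub> x \<oplus>\<^bsub>V\<^esub> a \<odot>\<^bsub>V\<^esub> y"
  using V.smult_r_distr[of a x y] by simp
lemma vs_sassoc: "x \<in> carrier V \<Longrightarrow> a \<odot>\<^bsub>V\<^esub> (b \<odot>\<^bsub>V\<^esub> x) = (a * b) \<odot>\<^bsub>V\<^esub> x"
  using V.smult_assoc1[of a b x] by simp
lemma vs_sone [simp]: "x \<in> carrier V \<Longrightarrow> 1 \<odot>\<^bsub>V\<^esub> x = x"
  using V.smult_one[of x] by simp
lemma vs_szero [simp]: "x \<in> carrier V \<Longrightarrow> 0 \<odot>\<^bsub>V\<^esub> x = \<zero>\<^bsub>V\<^esub>"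
  using V.smult_l_null[of x] by simp
lemma vs_smult_zero [simp]: "c \<odot>\<^bsub>V\<^esub> \<zero>\<^bsub>V\<^esub> = \<zero>\<^bsub>V\<^esub>"
  using V.smult_r_null[of c] by simp
lemma vs_left_minus: "x \<in> carrier V \<Longrightarrow> (-1) \<odot>\<^bsub>V\<^esub> x \<oplus>\<^bsub>V\<^esub> x = \<zero>\<^bsub>V\<^esub>"
  using vs_ldist[of x "-1" 1] by simp
lemma vs_minus [simp]: "x \<in> carrier V \<Longrightarrow> \<ominus>\<^bsub>V\<^esub> x = (-1) \<odot>\<^bsub>V\<^esub> x"
  by (rule V.minus_equality[OF vs_left_minus]) auto
lemma vs_diff_eq_zero:
  assumes "x \<in> carrier V" "y \<in> carrier V" "x \<oplus>\<^bsub>V\<^esub> (-1) \<odot>\<^bsub>V\<^esub> y = \<zero>\<^bsub>V\<^esub>"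
  shows "x = y"
proof -
  have "x = x \<oplus>\<^bsub>V\<^esub> ((-1) \<odot>\<^bsub>V\<^esub> y \<oplus>\<^bsub>V\<^esub> y)" using assms(1,2) by (simp add: vs_left_minus)
  also have "\<dots> = (x \<oplus>\<^bsub>V\<^esub> (-1) \<odot>\<^bsub>V\<^esub> y) \<oplus>\<^bsub>V\<^esub> y"
    using assms(1,2) vs_assoc[of x "(-1) \<odot>\<^bsub>V\<^esub> y" y] by simp
  also have "\<dots> = y" using assms by simp
  finally show ?thesis .
qed
lemma vs_right_minus: "x \<in> carrier V \<Longrightarrow> x \<oplus>\<^bsub>V\<^esub> (-1) \<odot>\<^bsub>V\<^esub> x = \<zero>\<^bsub>V\<^esub>"
  using vs_ldist[of x 1 "-1"] by simp

lemma submodule_CC_iff: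
  "submodule N CC V \<longleftrightarrow> N \<subseteq> carrier V \<and> \<zero>\<^bsub>V\<^esub> \<in> N \<and> (\<forall>x\<in>N. \<forall>y\<in>N. x \<oplus>\<^bsub>V\<^esub> y \<in> N) \<and>
     (\<forall>c. \<forall>x\<in>N. c \<odot>\<^bsub>V\<^esub> x \<in> N)" (is "_ \<longleftrightarrow> ?R")
proof
  assume N: "submodule N CC V"
  interpret N: submodule N CC V by (fact N)
  show ?R
    using N.subset N.one_closed N.m_closed N.smult_closed by auto
next
  assume R: ?R
  then show "submodule N CC V"
    using vs_minus by (intro V.submoduleI) (auto simp: subset_iff)
qed

lemma submodule_restrict:
  assumes "submodule N CC V" shows "module CC (V\<lparr>carrier := N\<rparr>)"
  using submodule.submodule_is_module[OF assms V] .

end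

definition lin :: "'a calg \<Rightarrow> 'b calg \<Rightarrow> ('a \<Rightarrow> 'b) \<Rightarrow> bool" where
  "lin V W f \<longleftrightarrow> (\<forall>x\<in>carrier V. f x \<in> carrier W) \<and>
     (\<forall>x\<in>carrier V. \<forall>y\<in>carrier V. f (x \<oplus>\<^bsub>V\<^esub> y) = f x \<oplus>\<^bsub>W\<^esub> f y) \<and>
     (\<forall>c. \<forall>x\<in>carrier V. f (c \<odot>\<^bsub>V\<^esub> x) = c \<odot>\<^bsub>W\<^esub> f x)"

lemma linI:
  assumes "\<And>x. x \<in> carrier V \<Longrightarrow> f x \<in> carrier W"
    "\<And>x y. x \<in> carrier V \<Longrightarrow> y \<in> carrier V \<Longrightarrow> f (x \<oplus>\<^bsub>V\<^esub> y) = f x \<oplus>\<^bsub>W\<^esub> f y"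
    "\<And>c x. x \<in> carrier V \<Longrightarrow> f (c \<odot>\<^bsub>V\<^esub> x) = c \<odot>\<^bsub>W\<^esub> f x"
  shows "lin V W f"
  using assms by (auto simp: lin_def)

lemma lin_closed: "lin V W f \<Longrightarrow> x \<in> carrier V \<Longrightarrow> f x \<in> carrier W"
  by (auto simp: lin_def)
lemma lin_add: "lin V W f \<Longrightarrow> x \<in> carrier V \<Longrightarrow> y \<in> carrier V \<Longrightarrow> f (x \<oplus>\<^bsub>V\<^esub> y) = f x \<oplus>\<^bsub>W\<^esub> f y"
  by (auto simp: lin_def)
lemma lin_smult: "lin V W f \<Longrightarrow> x \<in> carrier V \<Longrightarrow> f (c \<odot>\<^bsub>V\<^esub> x) = c \<odot>\<^bsub>W\<^esub> f x"
  by (auto simp: lin_def)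
lemma lin_zero:
  fixes V :: "'a calg" and W :: "'b calg"
  assumes "module CC V" "module CC W" "lin V W f" shows "f \<zero>\<^bsub>V\<^esub> = \<zero>\<^bsub>W\<^esub>"
  using lin_smult[OF assms(3), of "\<zero>\<^bsub>V\<^esub>" 0] lin_closed[OF assms(3), of "\<zero>\<^bsub>V\<^esub>"]
    vs_szero[OF assms(1)] vs_szero[OF assms(2)] vs_zero[OF assms(1)] by simp

lemma lin_cong:
  assumes "lin V W f" "module CC V" "\<And>x. x \<in> carrier V \<Longrightarrow> f x = g x"
  shows "lin V W g"
  using assms by (auto simp: lin_def)

lemma lin_comp: "lin V W f \<Longrightarrow> lin W X g \<Longrightarrow> lin V X (\<lambda>x. g (f x))"
  by (auto simp: lin_def)
lemma lin_id: "module CC V \<Longrightarrow> lin V V (\<lambda>x. x)"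
  by (auto simp: lin_def)
lemma lin_plus:
  assumes "module CC W" "lin V W f" "lin V W g" shows "lin V W (\<lambda>x. f x \<oplus>\<^bsub>W\<^esub> g x)"
  using assms(2,3) vs_add[OF assms(1)] vs_assoc[OF assms(1)] vs_lcomm[OF assms(1)] vs_rdist[OF assms(1)]
  by (auto simp: lin_def)
lemma lin_scale:
  assumes "module CC W" "lin V W f" shows "lin V W (\<lambda>x. c \<odot>\<^bsub>W\<^esub> f x)"
  using assms(2) vs_smult[OF assms(1)] vs_rdist[OF assms(1)] vs_sassoc[OF assms(1)]
  by (auto simp: lin_def mult.commute)
lemma lin_scale_left:
  assumes "module CC W" "lin V CC f" "w \<in> carrier W" shows "lin V W (\<lambda>x. f x \<odot>\<^bsub>W\<^esub> w)"
  using assms(2,3) vs_smult[OF assms(1)] vs_ldist[OF assms(1)] vs_sassoc[OF assms(1)]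
  by (auto simp: lin_def)
lemma lin_zero_map:
  assumes "module CC W" shows "lin V W (\<lambda>x. \<zero>\<^bsub>W\<^esub>)"
  using vs_zero[OF assms] vs_smult_zero[OF assms] vs_l_zero[OF assms] by (auto simp: lin_def)
lemma lin_mult_CC: "lin V CC f \<Longrightarrow> lin V CC (\<lambda>x. f x * c)"
  by (auto simp: lin_def algebra_simps)
lemma lin_mult_CC': "lin V CC f \<Longrightarrow> lin V CC (\<lambda>x. c * f x)"
  by (auto simp: lin_def algebra_simps)

definition bilin :: "'a calg \<Rightarrow> 'b calg \<Rightarrow> 'c calg \<Rightarrow> ('a \<Rightarrow> 'b \<Rightarrow> 'c) \<Rightarrow> bool" where
  "bilin A B C f \<longleftrightarrow> (\<forall>a\<in>carrier A. lin B C (f a)) \<and> (\<forall>b\<in>carrier B. lin A C (\<lambda>a. f a b))"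

lemma bilinI:
  assumes "\<And>a. a \<in> carrier A \<Longrightarrow> lin B C (f a)" "\<And>b. b \<in> carrier B \<Longrightarrow> lin A C (\<lambda>a. f a b)"
  shows "bilin A B C f"
  using assms by (auto simp: bilin_def)
lemma bilin1: "bilin A B C f \<Longrightarrow> a \<in> carrier A \<Longrightarrow> lin B C (f a)" by (simp add: bilin_def)
lemma bilin2: "bilin A B C f \<Longrightarrow> b \<in> carrier B \<Longrightarrow> lin A C (\<lambda>a. f a b)" by (simp add: bilin_def)
lemma bilin_closed: "bilin A B C f \<Longrightarrow> a \<in> carrier A \<Longrightarrow> b \<in> carrier B \<Longrightarrow> f a b \<in> carrier C"
  by (auto simp: bilin_def lin_def)

text \<open>Quotients and structures transported along a map arise as images; they inherit all laws.\<close>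

lemma module_surj:
  fixes V :: "'a calg" and Q :: "'b calg"
  assumes V: "module CC V" and Q: "carrier Q = f ` carrier V" "\<zero>\<^bsub>Q\<^esub> = f \<zero>\<^bsub>V\<^esub>"
    and add: "\<And>x y. x \<in> carrier V \<Longrightarrow> y \<in> carrier V \<Longrightarrow> f x \<oplus>\<^bsub>Q\<^esub> f y = f (x \<oplus>\<^bsub>V\<^esub> y)"
    and sm: "\<And>c x. x \<in> carrier V \<Longrightarrow> c \<odot>\<^bsub>Q\<^esub> f x = f (c \<odot>\<^bsub>V\<^esub> x)"
  shows "module CC Q"
proof -
  note V' = vs_add[OF V] vs_zero[OF V] vs_smult[OF V] vs_assoc[OF V] vs_l_zero[OF V]
    vs_ldist[OF V] vs_rdist[OF V] vs_sassoc[OF V] vs_sone[OF V] vs_szero[OF V]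
  have comm: "f (x \<oplus>\<^bsub>V\<^esub> y) = f (y \<oplus>\<^bsub>V\<^esub> x)" if "x \<in> carrier V" "y \<in> carrier V" for x y
    using vs_comm[OF V that] by simp
  show ?thesis
    by (rule module_CCI) (auto simp: Q V' add sm intro: comm)
qed

text \<open>Associativity is kept separate from the bilinear product: the Heisenberg double and the algebras
  inside it enter only through the ways in which they act.\<close>

definition nalg :: "'a calg \<Rightarrow> bool" where
  "nalg A \<longleftrightarrow> module CC A \<and> bilin A A A (\<lambda>x y. x \<otimes>\<^bsub>A\<^esub> y) \<and> \<one>\<^bsub>A\<^esub> \<in> carrier A"

definition alg :: "'a calg \<Rightarrow> bool" where
  "alg A \<longleftrightarrow> nalg A \<and> monoid A"

lemma algD: "alg A \<Longrightarrow> nalg A" "alg A \<Longrightarrow> monoid A" "alg A \<Longrightarrow> module CC A"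
  by (auto simp: alg_def nalg_def)

lemma nalgD:
  assumes "nalg A"
  shows "module CC A" "bilin A A A (\<lambda>x y. x \<otimes>\<^bsub>A\<^esub> y)" "\<one>\<^bsub>A\<^esub> \<in> carrier A"
  using assms by (auto simp: nalg_def)

lemma nalg_mult [simp]: "nalg A \<Longrightarrow> x \<in> carrier A \<Longrightarrow> y \<in> carrier A \<Longrightarrow> x \<otimes>\<^bsub>A\<^esub> y \<in> carrier A"
  unfolding nalg_def using bilin_closed[of A A A "\<lambda>x y. x \<otimes>\<^bsub>A\<^esub> y"] by blast

lemma nalg_lin1: "nalg A \<Longrightarrow> a \<in> carrier A \<Longrightarrow> lin A A (\<lambda>x. a \<otimes>\<^bsub>A\<^esub> x)"
  by (auto simp: nalg_def bilin_def)
lemma nalg_lin2: "nalg A \<Longrightarrow> a \<in> carrier A \<Longrightarrow> lin A A (\<lambda>x. x \<otimes>\<^bsub>A\<^esub> a)"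
  by (auto simp: nalg_def bilin_def)

lemma alg_ring:
  assumes "alg A" shows "ring A"
proof -
  have A: "nalg A" "monoid A" "module CC A" using assms by (auto simp: alg_def nalg_def)
  show ?thesis
  proof (rule ringI)
    show "abelian_group A" using A(3) by (simp add: module_def)
    show "monoid A" by fact
    fix x y z assume *: "x \<in> carrier A" "y \<in> carrier A" "z \<in> carrier A"
    show "(x \<oplus>\<^bsub>A\<^esub> y) \<otimes>\<^bsub>A\<^esub> z = x \<otimes>\<^bsub>A\<^esub> z \<oplus>\<^bsub>A\<^esub> y \<otimes>\<^bsub>A\<^esub> z"
      using lin_add[OF nalg_lin2[OF A(1) *(3)] *(1,2)] by simp
    show "z \<otimes>\<^bsub>A\<^esub> (x \<oplus>\<^bsub>A\<^esub> y) = z \<otimes>\<^bsub>A\<^esub> x \<oplus>\<^bsub>A\<^esub> z \<otimes>\<^bsub>A\<^esub> y"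
      using lin_add[OF nalg_lin1[OF A(1) *(3)] *(1,2)] by simp
  qed
qed

lemma alg_assoc: "alg A \<Longrightarrow> x \<in> carrier A \<Longrightarrow> y \<in> carrier A \<Longrightarrow> z \<in> carrier A \<Longrightarrow>
    (x \<otimes>\<^bsub>A\<^esub> y) \<otimes>\<^bsub>A\<^esub> z = x \<otimes>\<^bsub>A\<^esub> (y \<otimes>\<^bsub>A\<^esub> z)"
  by (auto dest: algD intro: monoid.m_assoc)
lemma alg_one [simp]: "alg A \<Longrightarrow> x \<in> carrier A \<Longrightarrow> \<one>\<^bsub>A\<^esub> \<otimes>\<^bsub>A\<^esub> x = x"
  "alg A \<Longrightarrow> x \<in> carrier A \<Longrightarrow> x \<otimes>\<^bsub>A\<^esub> \<one>\<^bsub>A\<^esub> = x"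
  by (auto dest: algD simp: monoid.l_one monoid.r_one)

lemma alg_surj:
  assumes A: "alg A" and Q: "carrier Q = f ` carrier A" "\<zero>\<^bsub>Q\<^esub> = f \<zero>\<^bsub>A\<^esub>" "\<one>\<^bsub>Q\<^esub> = f \<one>\<^bsub>A\<^esub>"
    and add: "\<And>x y. x \<in> carrier A \<Longrightarrow> y \<in> carrier A \<Longrightarrow> f x \<oplus>\<^bsub>Q\<^esub> f y = f (x \<oplus>\<^bsub>A\<^esub> y)"
    and mult: "\<And>x y. x \<in> carrier A \<Longrightarrow> y \<in> carrier A \<Longrightarrow> f x \<otimes>\<^bsub>Q\<^esub> f y = f (x \<otimes>\<^bsub>A\<^esub> y)"
    and sm: "\<And>c x. x \<in> carrier A \<Longrightarrow> c \<odot>\<^bsub>Q\<^esub> f x = f (c \<odot>\<^bsub>A\<^esub> x)"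
  shows "alg Q"
proof -
  have A': "nalg A" "module CC A" using A by (auto simp: alg_def nalg_def)
  note c = nalg_mult[OF A'(1)] nalgD(3)[OF A'(1)] vs_add[OF A'(2)] vs_smult[OF A'(2)]
  have "module CC Q" by (rule module_surj[OF A'(2) Q(1,2) add sm])
  moreover have "bilin Q Q Q (\<lambda>x y. x \<otimes>\<^bsub>Q\<^esub> y)"
    by (auto simp: bilin_def lin_def Q add mult sm c lin_add[OF nalg_lin1[OF A'(1)]]
        lin_add[OF nalg_lin2[OF A'(1)]] lin_smult[OF nalg_lin1[OF A'(1)]]
        lin_smult[OF nalg_lin2[OF A'(1)]])
  moreover have "monoid Q"
    by (rule monoidI) (auto simp: Q mult c alg_assoc[OF A] alg_one[OF A])
  ultimately show ?thesis using Q c by (auto simp: alg_def nalg_def)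
qed

section \<open>Quotients\<close>

context
  fixes V :: "'a calg" and N :: "'a set"
  assumes V: "module CC V" and N: "submodule N CC V"
begin

interpretation V: module CC V by (fact V)
interpretation N: abelian_subgroup N V
  by (rule abelian_subgroupI3) (use N V.abelian_group_axioms in
      \<open>auto simp: submodule_def additive_subgroup_def\<close>)

lemma quot_carrier: "carrier (quot V N) = (\<lambda>x. N +>\<^bsub>V\<^esub> x) ` carrier V"
  by (auto simp: quot_def A_RCOSETS_def' image_def)

lemma coset_eq_iff:
  assumes "x \<in> carrier V" "y \<in> carrier V"
  shows "N +>\<^bsub>V\<^esub> x = N +>\<^bsub>V\<^esub> y \<longleftrightarrow> x \<oplus>\<^bsub>V\<^esub> (-1) \<odot>\<^bsub>V\<^esub> y \<in> N"
proof -
  have "N +>\<^bsub>V\<^esub> x = N +>\<^bsub>V\<^esub> y \<longleftrightarrow> x \<in> N +>\<^bsub>V\<^esub> y"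
    using N.a_rcos_self[OF assms(1)] N.a_repr_independence'[OF _ assms(2)] by metis
  then show ?thesis
    using N.a_rcos_module[OF assms(2,1)] vs_minus[OF V assms(2)] by simp
qed

lemma coset_eq_zero_iff:
  assumes "x \<in> carrier V"
  shows "N +>\<^bsub>V\<^esub> x = \<zero>\<^bsub>quot V N\<^esub> \<longleftrightarrow> x \<in> N"
  using assms coset_eq_iff[OF assms vs_zero[OF V]]
  by (simp add: quot_def vs_smult_zero[OF V] vs_r_zero[OF V] V.a_coset_add_zero N.a_subset)

lemma quot_add: "x \<in> carrier V \<Longrightarrow> y \<in> carrier V \<Longrightarrow>
    (N +>\<^bsub>V\<^esub> x) \<oplus>\<^bsub>quot V N\<^esub> (N +>\<^bsub>V\<^esub> y) = N +>\<^bsub>V\<^esub> (x \<oplus>\<^bsub>V\<^esub> y)"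
  by (simp add: quot_def N.a_rcos_sum)

lemma mem_coset: "x \<in> carrier V \<Longrightarrow> y \<in> N +>\<^bsub>V\<^esub> x \<Longrightarrow> y \<in> carrier V \<and> N +>\<^bsub>V\<^esub> y = N +>\<^bsub>V\<^esub> x"
  using N.a_elemrcos_carrier[of x y] N.a_repr_independence'[of y x] by simp

lemma quot_smult:
  assumes x: "x \<in> carrier V"
  shows "c \<odot>\<^bsub>quot V N\<^esub> (N +>\<^bsub>V\<^esub> x) = N +>\<^bsub>V\<^esub> (c \<odot>\<^bsub>V\<^esub> x)"
proof -
  have "N +>\<^bsub>V\<^esub> (c \<odot>\<^bsub>V\<^esub> y) = N +>\<^bsub>V\<^esub> (c \<odot>\<^bsub>V\<^esub> x)" if "y \<in> N +>\<^bsub>V\<^esub> x" for y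
  proof -
    have y: "y \<in> carrier V" "y \<oplus>\<^bsub>V\<^esub> (-1) \<odot>\<^bsub>V\<^esub> x \<in> N"
      using mem_coset[OF x that] coset_eq_iff[of y x] x by auto
    then have "c \<odot>\<^bsub>V\<^esub> (y \<oplus>\<^bsub>V\<^esub> (-1) \<odot>\<^bsub>V\<^esub> x) \<in> N"
      using N by (auto simp: submodule_CC_iff[OF V])
    moreover have "c \<odot>\<^bsub>V\<^esub> (y \<oplus>\<^bsub>V\<^esub> (-1) \<odot>\<^bsub>V\<^esub> x) = c \<odot>\<^bsub>V\<^esub> y \<oplus>\<^bsub>V\<^esub> (-1) \<odot>\<^bsub>V\<^esub> (c \<odot>\<^bsub>V\<^esub> x)"
      using x y(1) vs_smult[OF V] by (simp add: vs_rdist[OF V] vs_sassoc[OF V])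
    ultimately show ?thesis
      using coset_eq_iff[of "c \<odot>\<^bsub>V\<^esub> y" "c \<odot>\<^bsub>V\<^esub> x"] vs_smult[OF V] x y(1) by simp
  qed
  then have "(\<Union>y\<in>N +>\<^bsub>V\<^esub> x. N +>\<^bsub>V\<^esub> (c \<odot>\<^bsub>V\<^esub> y)) = N +>\<^bsub>V\<^esub> (c \<odot>\<^bsub>V\<^esub> x)"
    using N.a_rcos_self[OF x] by blast
  then show ?thesis by (simp add: quot_def)
qed

lemma quot_zero: "\<zero>\<^bsub>quot V N\<^esub> = N +>\<^bsub>V\<^esub> \<zero>\<^bsub>V\<^esub>"
  by (simp add: quot_def V.a_coset_add_zero N.a_subset)

lemma quot_module: "module CC (quot V N)"
  by (rule module_surj[OF V quot_carrier quot_zero quot_add quot_smult])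

lemma quot_proj: "lin V (quot V N) (\<lambda>x. N +>\<^bsub>V\<^esub> x)"
  by (rule linI) (auto simp: quot_carrier quot_add quot_smult)

lemma some_coset:
  assumes "X \<in> carrier (quot V N)"
  shows "(SOME x. x \<in> X) \<in> carrier V" "N +>\<^bsub>V\<^esub> (SOME x. x \<in> X) = X"
proof -
  obtain x where x: "x \<in> carrier V" "X = N +>\<^bsub>V\<^esub> x" using assms by (auto simp: quot_carrier)
  then have "x \<in> X" using N.a_rcos_self[OF x(1)] by simp
  then have "(SOME x. x \<in> X) \<in> X" by (rule someI)
  then show "(SOME x. x \<in> X) \<in> carrier V" "N +>\<^bsub>V\<^esub> (SOME x. x \<in> X) = X"
    using mem_coset[OF x(1)] x(2) by blast+
qed

end

definition alg_ideal :: "'a calg \<Rightarrow> 'a set \<Rightarrow> bool" where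
  "alg_ideal A N \<longleftrightarrow> submodule N CC A \<and> (\<forall>a\<in>carrier A. \<forall>x\<in>N. a \<otimes>\<^bsub>A\<^esub> x \<in> N \<and> x \<otimes>\<^bsub>A\<^esub> a \<in> N)"

lemma quot_alg:
  assumes A: "alg A" and AN: "alg_ideal A N"
  shows "alg (quot A N)"
    and "\<And>x y. x \<in> carrier A \<Longrightarrow> y \<in> carrier A \<Longrightarrow>
           (N +>\<^bsub>A\<^esub> x) \<otimes>\<^bsub>quot A N\<^esub> (N +>\<^bsub>A\<^esub> y) = N +>\<^bsub>A\<^esub> (x \<otimes>\<^bsub>A\<^esub> y)"
    and "\<one>\<^bsub>quot A N\<^esub> = N +>\<^bsub>A\<^esub> \<one>\<^bsub>A\<^esub>"
proof -
  have N: "submodule N CC A" and lr: "\<And>a x. a \<in> carrier A \<Longrightarrow> x \<in> N \<Longrightarrow> a \<otimes>\<^bsub>A\<^esub> x \<in> N \<and> x \<otimes>\<^bsub>A\<^esub> a \<in> N"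
    using AN by (auto simp: alg_ideal_def)
  have V: "module CC A" using A by (simp add: alg_def nalg_def)
  interpret ring A by (rule alg_ring[OF A])
  have I: "ideal N A"
    using N lr by (intro idealI[OF alg_ring[OF A]]) (auto simp: submodule_def)
  show m: "(N +>\<^bsub>A\<^esub> x) \<otimes>\<^bsub>quot A N\<^esub> (N +>\<^bsub>A\<^esub> y) = N +>\<^bsub>A\<^esub> (x \<otimes>\<^bsub>A\<^esub> y)"
    if "x \<in> carrier A" "y \<in> carrier A" for x y
    using ideal.rcoset_mult_add[OF I that] by (simp add: quot_def)
  show o: "\<one>\<^bsub>quot A N\<^esub> = N +>\<^bsub>A\<^esub> \<one>\<^bsub>A\<^esub>" by (simp add: quot_def)
  show "alg (quot A N)"
    by (rule alg_surj[OF A quot_carrier[OF V N] quot_zero[OF V N] o quot_add[OF V N] m quot_smult[OF V N]])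
qed

section \<open>Monoid algebras\<close>

lemma monoid_algebra_simps:
  "carrier (monoid_algebra G) = {r. finite (supp r) \<and> supp r \<subseteq> carrier G}"
  "\<one>\<^bsub>monoid_algebra G\<^esub> = delta \<one>\<^bsub>G\<^esub>"
  "\<zero>\<^bsub>monoid_algebra G\<^esub> = (\<lambda>x. 0)"
  "r \<oplus>\<^bsub>monoid_algebra G\<^esub> s = (\<lambda>x. r x + s x)"
  "c \<odot>\<^bsub>monoid_algebra G\<^esub> r = (\<lambda>x. c * r x)"
  by (simp_all add: monoid_algebra_def)

lemma supp_delta [simp]: "supp (delta x) = {x}"
  by (auto simp: supp_def delta_def)

lemma delta_carrier [simp]: "delta x \<in> carrier (monoid_algebra G) \<longleftrightarrow> x \<in> carrier G"
  by (simp add: monoid_algebra_simps)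

lemma module_monoid_algebra: "module CC (monoid_algebra G)"
proof (rule module_CCI)
  fix r s :: "'a \<Rightarrow> complex" and c
  assume r: "r \<in> carrier (monoid_algebra G)"
  have "supp (\<lambda>x. c * r x) \<subseteq> supp r" by (auto simp: supp_def)
  with r show "c \<odot>\<^bsub>monoid_algebra G\<^esub> r \<in> carrier (monoid_algebra G)"
    by (auto simp: monoid_algebra_simps intro: finite_subset)
  assume s: "s \<in> carrier (monoid_algebra G)"
  have "supp (\<lambda>x. r x + s x) \<subseteq> supp r \<union> supp s" by (auto simp: supp_def)
  with r s show "r \<oplus>\<^bsub>monoid_algebra G\<^esub> s \<in> carrier (monoid_algebra G)"
    by (auto simp: monoid_algebra_simps intro: finite_subset)
qed (auto simp: monoid_algebra_simps supp_def algebra_simps)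

lemma monoid_algebra_induct [consumes 1, case_names zero delta add smult]:
  assumes r: "r \<in> carrier (monoid_algebra G)"
    and z: "P (\<lambda>x. 0)" and d: "\<And>x. x \<in> carrier G \<Longrightarrow> P (delta x)"
    and a: "\<And>r s. r \<in> carrier (monoid_algebra G) \<Longrightarrow> s \<in> carrier (monoid_algebra G) \<Longrightarrow>
              P r \<Longrightarrow> P s \<Longrightarrow> P (\<lambda>x. r x + s x)"
    and m: "\<And>c r. r \<in> carrier (monoid_algebra G) \<Longrightarrow> P r \<Longrightarrow> P (\<lambda>x. c * r x)"
  shows "P r"
proof -
  have fin: "finite S \<Longrightarrow> S \<subseteq> carrier G \<Longrightarrow> supp r \<subseteq> S \<Longrightarrow> P r" for S r
  proof (induction S arbitrary: r rule: finite_induct)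
    case empty
    then have "r = (\<lambda>x. 0)" by (auto simp: supp_def)
    with z show ?case by simp
  next
    case (insert y S)
    define r' where "r' = (\<lambda>x. if x = y then 0 else r x)"
    have sub: "supp r' \<subseteq> S" using insert.prems by (auto simp: supp_def r'_def split: if_splits)
    then have r': "r' \<in> carrier (monoid_algebra G)"
      using insert by (auto simp: monoid_algebra_simps intro: finite_subset)
    have "P r'" using insert.IH sub insert.prems by blast
    moreover have "P (\<lambda>x. r y * delta y x)" using insert.prems by (intro m d) auto
    moreover have "(\<lambda>x. r y * delta y x) \<in> carrier (monoid_algebra G)"
      using insert.prems by (auto simp: monoid_algebra_simps supp_def delta_def)
    ultimately have "P (\<lambda>x. r' x + r y * delta y x)" using a[OF r'] by simp
    moreover have "(\<lambda>x. r' x + r y * delta y x) = r" by (auto simp: r'_def delta_def)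
    ultimately show ?case by simp
  qed
  show ?thesis using r fin[of "supp r" r] by (auto simp: monoid_algebra_simps)
qed

lemma lin_eq_on_deltas:
  assumes "lin (monoid_algebra G) W L" "lin (monoid_algebra G) W L'" "module CC W"
    and "\<And>x. x \<in> carrier G \<Longrightarrow> L (delta x) = L' (delta x)" and r: "r \<in> carrier (monoid_algebra G)"
  shows "L r = L' r"
  using r
proof (induction rule: monoid_algebra_induct)
  case zero
  then show ?case
    using lin_zero[OF module_monoid_algebra assms(3,1)] lin_zero[OF module_monoid_algebra assms(3,2)]
    by (simp add: monoid_algebra_simps)
next
  case (add r s)
  then show ?case
    using lin_add[OF assms(1), of r s] lin_add[OF assms(2), of r s] by (simp add: monoid_algebra_simps)
next
  case (smult c r)
  then show ?case
    using lin_smult[OF assms(1), of r c] lin_smult[OF assms(2), of r c] by (simp add: monoid_algebra_simps)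
qed (use assms in auto)

text \<open>The linear extension of a function on the basis.\<close>

definition linext :: "'c calg \<Rightarrow> ('a \<Rightarrow> 'c) \<Rightarrow> ('a \<Rightarrow> complex) \<Rightarrow> 'c" where
  "linext C f r = (\<Oplus>\<^bsub>C\<^esub>p\<in>supp r. r p \<odot>\<^bsub>C\<^esub> f p)"

lemma linext_superset:
  assumes C: "module CC C" and f: "\<And>x. x \<in> S \<Longrightarrow> f x \<in> carrier C"
    and S: "finite S" "supp r \<subseteq> S"
  shows "linext C f r = (\<Oplus>\<^bsub>C\<^esub>p\<in>S. r p \<odot>\<^bsub>C\<^esub> f p)"
proof -
  interpret C: module CC C by (fact C)
  show ?thesis unfolding linext_def
  proof (rule C.add.finprod_mono_neutral_cong_left[OF S])
    fix i assume "i \<in> S - supp r"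
    then show "r i \<odot>\<^bsub>C\<^esub> f i = \<zero>\<^bsub>C\<^esub>" using f vs_szero[OF C] by (auto simp: supp_def)
  qed (use f vs_smult[OF C] in auto)
qed

lemma linext_delta:
  assumes C: "module CC C" and f: "f x \<in> carrier C"
  shows "linext C f (delta x) = f x"
proof -
  interpret C: module CC C by (fact C)
  show ?thesis
    using f vs_sone[OF C f] C.finsum_insert[of "{}" x "\<lambda>p. delta x p \<odot>\<^bsub>C\<^esub> f p"]
    unfolding linext_def supp_delta
    by (simp add: delta_def)
qed

lemma lin_linext:
  assumes C: "module CC C" and f: "\<And>x. x \<in> carrier G \<Longrightarrow> f x \<in> carrier C"
  shows "lin (monoid_algebra G) C (linext C f)"
proof -
  interpret C: module CC C by (fact C)
  show ?thesis
  proof (rule linI)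
    fix r assume r: "r \<in> carrier (monoid_algebra G)"
    then have fr: "finite (supp r)" "supp r \<subseteq> carrier G" by (auto simp: monoid_algebra_simps)
    then have fr': "\<And>x. x \<in> supp r \<Longrightarrow> f x \<in> carrier C" using f by blast
    then show "linext C f r \<in> carrier C"
      unfolding linext_def using vs_smult[OF C] by (intro C.finsum_closed) auto
    show "linext C f (c \<odot>\<^bsub>monoid_algebra G\<^esub> r) = c \<odot>\<^bsub>C\<^esub> linext C f r" for c
    proof -
      have "linext C f (\<lambda>x. c * r x) = (\<Oplus>\<^bsub>C\<^esub>p\<in>supp r. (c * r p) \<odot>\<^bsub>C\<^esub> f p)"
        by (rule linext_superset[OF C]) (use fr fr' in \<open>auto simp: supp_def\<close>)
      also have "\<dots> = (\<Oplus>\<^bsub>C\<^esub>p\<in>supp r. c \<odot>\<^bsub>C\<^esub> (r p \<odot>\<^bsub>C\<^esub> f p))"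
        by (rule C.finsum_cong') (use fr' vs_sassoc[OF C] vs_smult[OF C] in auto)
      also have "\<dots> = c \<odot>\<^bsub>C\<^esub> linext C f r"
        unfolding linext_def
        by (rule C.finsum_smult_ldistr[symmetric]) (use fr fr' vs_smult[OF C] in auto)
      finally show ?thesis by (simp add: monoid_algebra_simps)
    qed
    fix s assume s: "s \<in> carrier (monoid_algebra G)"
    define S where "S = supp r \<union> supp s"
    have S: "finite S" "S \<subseteq> carrier G" "supp r \<subseteq> S" "supp s \<subseteq> S" "supp (\<lambda>x. r x + s x) \<subseteq> S"
      using r s by (auto simp: monoid_algebra_simps S_def supp_def)
    then have fS: "\<And>x. x \<in> S \<Longrightarrow> f x \<in> carrier C" using f by blast
    have "linext C f (\<lambda>x. r x + s x) = (\<Oplus>\<^bsub>C\<^esub>p\<in>S. (r p + s p) \<odot>\<^bsub>C\<^esub> f p)"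
      by (rule linext_superset[OF C fS S(1,5)])
    also have "\<dots> = (\<Oplus>\<^bsub>C\<^esub>p\<in>S. r p \<odot>\<^bsub>C\<^esub> f p \<oplus>\<^bsub>C\<^esub> s p \<odot>\<^bsub>C\<^esub> f p)"
      by (rule C.finsum_cong') (use fS vs_ldist[OF C] vs_smult[OF C] in auto)
    also have "\<dots> = (\<Oplus>\<^bsub>C\<^esub>p\<in>S. r p \<odot>\<^bsub>C\<^esub> f p) \<oplus>\<^bsub>C\<^esub> (\<Oplus>\<^bsub>C\<^esub>p\<in>S. s p \<odot>\<^bsub>C\<^esub> f p)"
      by (rule C.finsum_addf) (use fS vs_smult[OF C] in auto)
    also have "\<dots> = linext C f r \<oplus>\<^bsub>C\<^esub> linext C f s"
      using linext_superset[OF C fS S(1,3)] linext_superset[OF C fS S(1,4)] by simp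
    finally show "linext C f (r \<oplus>\<^bsub>monoid_algebra G\<^esub> s) = linext C f r \<oplus>\<^bsub>C\<^esub> linext C f s"
      by (simp add: monoid_algebra_simps)
  qed
qed

lemma linext_cong:
  assumes C: "module CC C" and "\<And>x. x \<in> carrier G \<Longrightarrow> f x \<in> carrier C"
    and "\<And>x. x \<in> carrier G \<Longrightarrow> f x = g x"
    and "r \<in> carrier (monoid_algebra G)"
  shows "linext C f r = linext C g r"
proof -
  interpret C: module CC C by (fact C)
  have "supp r \<subseteq> carrier G" using assms by (auto simp: monoid_algebra_simps)
  then show ?thesis unfolding linext_def
    by (intro C.finsum_cong') (use assms vs_smult[OF C] in \<open>auto simp: subset_iff\<close>)
qed

context
  fixes G :: "('a, 'm) monoid_scheme"
  assumes G: "monoid G"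
begin

lemma ma_mult_superset:
  assumes "finite S" "supp r \<subseteq> S" "finite T" "supp s \<subseteq> T"
  shows "(r \<otimes>\<^bsub>monoid_algebra G\<^esub> s) z = (\<Sum>x\<in>S. \<Sum>y\<in>T. if x \<otimes>\<^bsub>G\<^esub> y = z then r x * s y else 0)"
proof -
  have "(r \<otimes>\<^bsub>monoid_algebra G\<^esub> s) z =
      (\<Sum>(x,y)\<in>S \<times> T. if x \<otimes>\<^bsub>G\<^esub> y = z then r x * s y else 0)"
    unfolding monoid_algebra_def using assms
    by (simp, intro sum.mono_neutral_left) (auto simp: supp_def split: if_splits)
  then show ?thesis by (simp add: sum.cartesian_product)
qed

lemma delta_mult:
  "delta x \<otimes>\<^bsub>monoid_algebra G\<^esub> delta y = delta (x \<otimes>\<^bsub>G\<^esub> y)"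
proof
  fix z
  have "(delta x \<otimes>\<^bsub>monoid_algebra G\<^esub> delta y) z =
      (\<Sum>u\<in>{x}. \<Sum>v\<in>{y}. if u \<otimes>\<^bsub>G\<^esub> v = z then delta x u * delta y v else 0)"
    by (rule ma_mult_superset) simp_all
  then show "(delta x \<otimes>\<^bsub>monoid_algebra G\<^esub> delta y) z = delta (x \<otimes>\<^bsub>G\<^esub> y) z"
    by (auto simp: delta_def)
qed

lemma nalg_monoid_algebra: "nalg (monoid_algebra G)"
  unfolding nalg_def
proof (intro conjI module_monoid_algebra bilinI linI)
  interpret monoid G by (fact G)
  let ?A = "monoid_algebra G"
  show "\<one>\<^bsub>?A\<^esub> \<in> carrier ?A" by (simp add: monoid_algebra_simps(2))
  fix r s assume r: "r \<in> carrier ?A" and s: "s \<in> carrier ?A"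
  have "supp (r \<otimes>\<^bsub>?A\<^esub> s) \<subseteq> (\<lambda>(x,y). x \<otimes>\<^bsub>G\<^esub> y) ` (supp r \<times> supp s)"
  proof
    fix z assume "z \<in> supp (r \<otimes>\<^bsub>?A\<^esub> s)"
    then have "(\<Sum>(x,y)\<in>supp r \<times> supp s. if x \<otimes>\<^bsub>G\<^esub> y = z then r x * s y else 0) \<noteq> 0"
      by (simp add: supp_def monoid_algebra_def)
    then obtain p where "p \<in> supp r \<times> supp s"
      "(case p of (x,y) \<Rightarrow> if x \<otimes>\<^bsub>G\<^esub> y = z then r x * s y else 0) \<noteq> 0"
      using sum.not_neutral_contains_not_neutral by blast
    then show "z \<in> (\<lambda>(x,y). x \<otimes>\<^bsub>G\<^esub> y) ` (supp r \<times> supp s)" by (auto split: if_splits)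
  qed
  moreover have "(\<lambda>(x,y). x \<otimes>\<^bsub>G\<^esub> y) ` (supp r \<times> supp s) \<subseteq> carrier G"
    using r s by (auto simp: monoid_algebra_simps subset_iff)
  ultimately show "r \<otimes>\<^bsub>?A\<^esub> s \<in> carrier ?A"
    using r s by (auto simp: monoid_algebra_simps intro: finite_subset)
  then show "r \<otimes>\<^bsub>?A\<^esub> s \<in> carrier ?A" .
  have fr: "finite (supp r)" and fs: "finite (supp s)" using r s by (auto simp: monoid_algebra_simps)
  show "r \<otimes>\<^bsub>?A\<^esub> (c \<odot>\<^bsub>?A\<^esub> s) = c \<odot>\<^bsub>?A\<^esub> (r \<otimes>\<^bsub>?A\<^esub> s)" for c
  proof
    fix z
    have "supp (\<lambda>x. c * s x) \<subseteq> supp s" by (auto simp: supp_def)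
    then show "(r \<otimes>\<^bsub>?A\<^esub> (c \<odot>\<^bsub>?A\<^esub> s)) z = (c \<odot>\<^bsub>?A\<^esub> (r \<otimes>\<^bsub>?A\<^esub> s)) z"
      using ma_mult_superset[OF fr order_refl fs, of "\<lambda>x. c * s x" z]
        ma_mult_superset[OF fr order_refl fs order_refl, of z]
      by (simp add: monoid_algebra_simps sum_distrib_left if_distrib mult.left_commute cong: if_cong)
  qed
  show "(c \<odot>\<^bsub>?A\<^esub> r) \<otimes>\<^bsub>?A\<^esub> s = c \<odot>\<^bsub>?A\<^esub> (r \<otimes>\<^bsub>?A\<^esub> s)" for c
  proof
    fix z
    have "supp (\<lambda>x. c * r x) \<subseteq> supp r" by (auto simp: supp_def)
    then show "((c \<odot>\<^bsub>?A\<^esub> r) \<otimes>\<^bsub>?A\<^esub> s) z = (c \<odot>\<^bsub>?A\<^esub> (r \<otimes>\<^bsub>?A\<^esub> s)) z"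
      using ma_mult_superset[OF fr _ fs order_refl, of "\<lambda>x. c * r x" z]
        ma_mult_superset[OF fr order_refl fs order_refl, of z]
      by (simp add: monoid_algebra_simps sum_distrib_left if_distrib mult.assoc cong: if_cong)
  qed
  fix t assume t: "t \<in> carrier ?A"
  then have ft: "finite (supp t)" by (auto simp: monoid_algebra_simps)
  show "r \<otimes>\<^bsub>?A\<^esub> (s \<oplus>\<^bsub>?A\<^esub> t) = r \<otimes>\<^bsub>?A\<^esub> s \<oplus>\<^bsub>?A\<^esub> r \<otimes>\<^bsub>?A\<^esub> t"
  proof
    fix z
    have T: "finite (supp s \<union> supp t)" using fs ft by simp
    have "supp (\<lambda>x. s x + t x) \<subseteq> supp s \<union> supp t" by (auto simp: supp_def)
    then show "(r \<otimes>\<^bsub>?A\<^esub> (s \<oplus>\<^bsub>?A\<^esub> t)) z = (r \<otimes>\<^bsub>?A\<^esub> s \<oplus>\<^bsub>?A\<^esub> r \<otimes>\<^bsub>?A\<^esub> t) z"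
      using ma_mult_superset[OF fr order_refl T, of _ z]
      by (simp add: monoid_algebra_simps sum.distrib[symmetric] if_distrib distrib_left cong: if_cong; intro sum.cong refl; simp)
  qed
  show "(s \<oplus>\<^bsub>?A\<^esub> t) \<otimes>\<^bsub>?A\<^esub> r = s \<otimes>\<^bsub>?A\<^esub> r \<oplus>\<^bsub>?A\<^esub> t \<otimes>\<^bsub>?A\<^esub> r"
  proof
    fix z
    have T: "finite (supp s \<union> supp t)" using fs ft by simp
    have "supp (\<lambda>x. s x + t x) \<subseteq> supp s \<union> supp t" by (auto simp: supp_def)
    then show "((s \<oplus>\<^bsub>?A\<^esub> t) \<otimes>\<^bsub>?A\<^esub> r) z = (s \<otimes>\<^bsub>?A\<^esub> r \<oplus>\<^bsub>?A\<^esub> t \<otimes>\<^bsub>?A\<^esub> r) z"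
      using ma_mult_superset[OF T _ fr order_refl, of _ z]
      by (simp add: monoid_algebra_simps sum.distrib[symmetric] if_distrib distrib_right cong: if_cong; intro sum.cong refl; simp)
  qed
qed

text \<open>Both sides of the associative law are linear in each argument, and on basis elements the law is
  that of the monoid.\<close>

lemma alg_monoid_algebra: "alg (monoid_algebra G)"
proof -
  let ?A = "monoid_algebra G"
  interpret G: monoid G by (fact G)
  note n = nalg_monoid_algebra
  note l1 = nalg_lin1[OF n] and l2 = nalg_lin2[OF n] and m = module_monoid_algebra[of G]
  have "(r \<otimes>\<^bsub>?A\<^esub> s) \<otimes>\<^bsub>?A\<^esub> t = r \<otimes>\<^bsub>?A\<^esub> (s \<otimes>\<^bsub>?A\<^esub> t)"
    if r: "r \<in> carrier ?A" and s: "s \<in> carrier ?A" and t: "t \<in> carrier ?A" for r s t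
  proof -
    have 1: "(delta x \<otimes>\<^bsub>?A\<^esub> delta y) \<otimes>\<^bsub>?A\<^esub> t = delta x \<otimes>\<^bsub>?A\<^esub> (delta y \<otimes>\<^bsub>?A\<^esub> t)"
      if "x \<in> carrier G" "y \<in> carrier G" for x y
      by (rule lin_eq_on_deltas[of G ?A "\<lambda>t. (delta x \<otimes>\<^bsub>?A\<^esub> delta y) \<otimes>\<^bsub>?A\<^esub> t" "\<lambda>t. delta x \<otimes>\<^bsub>?A\<^esub> (delta y \<otimes>\<^bsub>?A\<^esub> t)", OF _ _ m _ t])
         (use that n in \<open>auto intro!: l1 lin_comp[OF l1 l1] simp: delta_mult G.m_assoc\<close>)
    have 2: "(delta x \<otimes>\<^bsub>?A\<^esub> s) \<otimes>\<^bsub>?A\<^esub> t = delta x \<otimes>\<^bsub>?A\<^esub> (s \<otimes>\<^bsub>?A\<^esub> t)"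
      if "x \<in> carrier G" for x
      by (rule lin_eq_on_deltas[of G ?A "\<lambda>s. (delta x \<otimes>\<^bsub>?A\<^esub> s) \<otimes>\<^bsub>?A\<^esub> t" "\<lambda>s. delta x \<otimes>\<^bsub>?A\<^esub> (s \<otimes>\<^bsub>?A\<^esub> t)", OF _ _ m _ s])
         (use that t 1 in \<open>auto intro!: lin_comp[OF l1 l2] lin_comp[OF l2 l1]\<close>)
    show ?thesis
      by (rule lin_eq_on_deltas[of G ?A "\<lambda>r. (r \<otimes>\<^bsub>?A\<^esub> s) \<otimes>\<^bsub>?A\<^esub> t" "\<lambda>r. r \<otimes>\<^bsub>?A\<^esub> (s \<otimes>\<^bsub>?A\<^esub> t)", OF _ _ m _ r])
         (use s t n 2 in \<open>auto intro!: lin_comp[OF l2 l2] l2\<close>)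
  qed
  moreover have "\<one>\<^bsub>?A\<^esub> \<otimes>\<^bsub>?A\<^esub> r = r" "r \<otimes>\<^bsub>?A\<^esub> \<one>\<^bsub>?A\<^esub> = r" if r: "r \<in> carrier ?A" for r
    by (rule lin_eq_on_deltas[OF _ lin_id[OF m] m _ r],
        auto intro!: l1 l2 simp: monoid_algebra_simps(2) delta_mult)+
  ultimately have "monoid ?A" using n by (intro monoidI) (auto simp: nalgD)
  then show ?thesis using n by (simp add: alg_def)
qed

end

section \<open>Tensor products\<close>

lemma submodule_gen:
  assumes V: "module CC V" and S: "S \<subseteq> carrier V"
  shows "submodule (submodule_gen V S) CC V" "S \<subseteq> submodule_gen V S"
    and "\<And>N. submodule N CC V \<Longrightarrow> S \<subseteq> N \<Longrightarrow> submodule_gen V S \<subseteq> N"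
proof -
  have "submodule (carrier V) CC V" using module.carrier_is_submodule[OF V] .
  then have "submodule_gen V S \<subseteq> carrier V" using S by (auto simp: submodule_gen_def)
  then show "submodule (submodule_gen V S) CC V"
    unfolding submodule_CC_iff[OF V] unfolding submodule_gen_def by (auto simp: submodule_CC_iff[OF V])
qed (auto simp: submodule_gen_def)

context
  fixes A :: "'a calg" and B :: "'b calg"
  assumes A: "module CC A" and B: "module CC B"
begin

abbreviation (input) "FP \<equiv> monoid_algebra (A \<times>\<times> B)"
abbreviation (input) "KP \<equiv> bilin_kernel A B"

lemma delta_diffs:
  "delta x - delta y - delta z = delta x \<oplus>\<^bsub>FP\<^esub> (-1) \<odot>\<^bsub>FP\<^esub> (delta y \<oplus>\<^bsub>FP\<^esub> delta z)"
  "delta x - (\<lambda>p. c * delta y p) = delta x \<oplus>\<^bsub>FP\<^esub> (-1) \<odot>\<^bsub>FP\<^esub> (c \<odot>\<^bsub>FP\<^esub> delta y)"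
  by (auto simp: monoid_algebra_simps)

lemma bilin_rels_carrier: "bilin_rels A B \<subseteq> carrier FP"
proof -
  note m = module_monoid_algebra[of "A \<times>\<times> B"]
  have "delta x - delta y - delta z \<in> carrier FP"
    if "x \<in> carrier A \<times> carrier B" "y \<in> carrier A \<times> carrier B" "z \<in> carrier A \<times> carrier B" for x y z
    unfolding delta_diffs
    using that by (intro vs_add[OF m] vs_smult[OF m]) auto
  moreover have "delta x - (\<lambda>p. c * delta y p) \<in> carrier FP"
    if "x \<in> carrier A \<times> carrier B" "y \<in> carrier A \<times> carrier B" for x y c
    unfolding delta_diffs
    using that by (intro vs_add[OF m] vs_smult[OF m]) auto
  ultimately show ?thesis
    unfolding bilin_rels_def using vs_add[OF A] vs_smult[OF A] vs_add[OF B] vs_smult[OF B] by fastforce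
qed

lemma bilin_kernel_sub: "submodule KP CC FP"
  and bilin_kernel_rels: "bilin_rels A B \<subseteq> KP"
  and bilin_kernel_least: "\<And>N. submodule N CC FP \<Longrightarrow> bilin_rels A B \<subseteq> N \<Longrightarrow> KP \<subseteq> N"
  unfolding bilin_kernel_def
  by (rule submodule_gen[OF module_monoid_algebra bilin_rels_carrier]; assumption)+

lemma module_tensor: "module CC (tensor A B)"
  unfolding tensor_def by (rule quot_module[OF module_monoid_algebra bilin_kernel_sub])

lemma pure_carrier: "a \<in> carrier A \<Longrightarrow> b \<in> carrier B \<Longrightarrow> pure A B a b \<in> carrier (tensor A B)"
  unfolding tensor_def pure_def
  using lin_closed[OF quot_proj[OF module_monoid_algebra bilin_kernel_sub]] by simp

lemma bilin_rels_mem: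
  assumes "a \<in> carrier A" "a' \<in> carrier A" "b \<in> carrier B" "b' \<in> carrier B"
  shows "delta (a \<oplus>\<^bsub>A\<^esub> a', b) - delta (a, b) - delta (a', b) \<in> bilin_rels A B"
    and "delta (a, b \<oplus>\<^bsub>B\<^esub> b') - delta (a, b) - delta (a, b') \<in> bilin_rels A B"
    and "delta (c \<odot>\<^bsub>A\<^esub> a, b) - (\<lambda>p. c * delta (a, b) p) \<in> bilin_rels A B"
    and "delta (a, c \<odot>\<^bsub>B\<^esub> b) - (\<lambda>p. c * delta (a, b) p) \<in> bilin_rels A B"
  unfolding bilin_rels_def using assms by blast+

lemma bilin_pure: "bilin A B (tensor A B) (pure A B)"
proof -
  note m = module_monoid_algebra[of "A \<times>\<times> B"]
  note q = quot_add[OF m bilin_kernel_sub, folded tensor_def] quot_smult[OF m bilin_kernel_sub, folded tensor_def]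
  note e = coset_eq_iff[OF m bilin_kernel_sub]
  have add: "pure A B a b \<oplus>\<^bsub>tensor A B\<^esub> pure A B a' b' = pure A B a'' b''"
    if "a \<in> carrier A" "b \<in> carrier B" "a' \<in> carrier A" "b' \<in> carrier B" "a'' \<in> carrier A" "b'' \<in> carrier B"
      "delta (a'',b'') - delta (a,b) - delta (a',b') \<in> bilin_rels A B" for a b a' b' a'' b''
  proof -
    have "delta (a'',b'') - delta (a,b) - delta (a',b') \<in> KP" using that bilin_kernel_rels by blast
    then have "KP +>\<^bsub>FP\<^esub> delta (a'',b'') = KP +>\<^bsub>FP\<^esub> (delta (a,b) \<oplus>\<^bsub>FP\<^esub> delta (a',b'))"
      using e[of "delta (a'',b'')" "delta (a,b) \<oplus>\<^bsub>FP\<^esub> delta (a',b')"] that vs_add[OF m]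
      unfolding delta_diffs by simp
    then show ?thesis
      unfolding pure_def using that q(1)[of "delta (a,b)" "delta (a',b')"] by simp
  qed
  have sm: "c \<odot>\<^bsub>tensor A B\<^esub> pure A B a b = pure A B a'' b''"
    if "a \<in> carrier A" "b \<in> carrier B" "a'' \<in> carrier A" "b'' \<in> carrier B"
      "delta (a'',b'') - (\<lambda>p. c * delta (a,b) p) \<in> bilin_rels A B" for a b c a'' b''
  proof -
    have "delta (a'',b'') - (\<lambda>p. c * delta (a,b) p) \<in> KP" using that bilin_kernel_rels by blast
    then have "KP +>\<^bsub>FP\<^esub> delta (a'',b'') = KP +>\<^bsub>FP\<^esub> (c \<odot>\<^bsub>FP\<^esub> delta (a,b))"
      using e[of "delta (a'',b'')" "c \<odot>\<^bsub>FP\<^esub> delta (a,b)"] that vs_smult[OF m]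
      unfolding delta_diffs by simp
    then show ?thesis
      unfolding pure_def using that q(2)[of "delta (a,b)" c] by simp
  qed
  show ?thesis
  proof (intro bilinI linI pure_carrier)
    fix a b a' b' c
    assume *: "a \<in> carrier A" "b \<in> carrier B" "a' \<in> carrier A" "b' \<in> carrier B"
    show "pure A B a (b \<oplus>\<^bsub>B\<^esub> b') = pure A B a b \<oplus>\<^bsub>tensor A B\<^esub> pure A B a b'"
      using * by (intro add[symmetric] bilin_rels_mem vs_add[OF B])
    show "pure A B (a \<oplus>\<^bsub>A\<^esub> a') b = pure A B a b \<oplus>\<^bsub>tensor A B\<^esub> pure A B a' b"
      using * by (intro add[symmetric] bilin_rels_mem vs_add[OF A])
    show "pure A B a (c \<odot>\<^bsub>B\<^esub> b) = c \<odot>\<^bsub>tensor A B\<^esub> pure A B a b"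
      using * by (intro sm[symmetric] bilin_rels_mem vs_smult[OF B])
    show "pure A B (c \<odot>\<^bsub>A\<^esub> a) b = c \<odot>\<^bsub>tensor A B\<^esub> pure A B a b"
      using * by (intro sm[symmetric] bilin_rels_mem vs_smult[OF A])
  qed
qed

text \<open>Scalars can be absorbed into a pure tensor, so sums of pure tensors exhaust the tensor product.\<close>

lemma tensor_induct [consumes 1, case_names pure add]:
  assumes t: "t \<in> carrier (tensor A B)"
    and p: "\<And>a b. a \<in> carrier A \<Longrightarrow> b \<in> carrier B \<Longrightarrow> P (pure A B a b)"
    and a: "\<And>s t. s \<in> carrier (tensor A B) \<Longrightarrow> t \<in> carrier (tensor A B) \<Longrightarrow> P s \<Longrightarrow> P t \<Longrightarrow> P (s \<oplus>\<^bsub>tensor A B\<^esub> t)"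
  shows "P t"
proof -
  note m = module_monoid_algebra[of "A \<times>\<times> B"]
  note pr = quot_proj[OF m bilin_kernel_sub, folded tensor_def]
  note T = module_tensor
  let ?p = "\<lambda>r. KP +>\<^bsub>FP\<^esub> r"
  have *: "?p (\<lambda>p. c * r p) = c \<odot>\<^bsub>tensor A B\<^esub> ?p r" if "r \<in> carrier FP" for c r
    using lin_smult[OF pr that, of c] by (simp add: monoid_algebra_simps)
  have "\<forall>c. P (c \<odot>\<^bsub>tensor A B\<^esub> ?p r)" if "r \<in> carrier FP" for r
    using that
  proof (induction rule: monoid_algebra_induct)
    case zero
    have "?p (\<lambda>p. 0) = \<zero>\<^bsub>tensor A B\<^esub>" using lin_zero[OF m T pr] by (simp add: monoid_algebra_simps)
    moreover have "\<zero>\<^bsub>tensor A B\<^esub> = pure A B \<zero>\<^bsub>A\<^esub> \<zero>\<^bsub>B\<^esub>"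
      using lin_zero[OF B T bilin1[OF bilin_pure vs_zero[OF A]]] by simp
    ultimately show ?case using p[OF vs_zero[OF A] vs_zero[OF B]] vs_smult_zero[OF T] by simp
  next
    case (delta x)
    then obtain x1 x2 where x: "x = (x1,x2)" "x1 \<in> carrier A" "x2 \<in> carrier B" by auto
    then show ?case
      using p[OF x(2) vs_smult[OF B x(3)]] lin_smult[OF bilin1[OF bilin_pure x(2)] x(3)]
      by (simp add: pure_def)
  next
    case (add r s)
    have "?p (\<lambda>x. r x + s x) = ?p r \<oplus>\<^bsub>tensor A B\<^esub> ?p s"
      using lin_add[OF pr add(1,2)] by (simp add: monoid_algebra_simps)
    then show ?case
      using add a lin_closed[OF pr] vs_smult[OF T] vs_rdist[OF T] by simp
  next
    case (smult c r)
    then show ?case using lin_closed[OF pr] by (simp add: * vs_sassoc[OF T])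
  qed
  moreover obtain r where "r \<in> carrier FP" "t = ?p r" using t by (auto simp: tensor_def quot_carrier[OF m bilin_kernel_sub])
  ultimately show ?thesis using vs_sone[OF T t] by metis
qed

lemma lin_eq_on_pure:
  assumes "lin (tensor A B) W L" "lin (tensor A B) W L'"
    and "\<And>a b. a \<in> carrier A \<Longrightarrow> b \<in> carrier B \<Longrightarrow> L (pure A B a b) = L' (pure A B a b)"
    and t: "t \<in> carrier (tensor A B)"
  shows "L t = L' t"
  using t
proof (induction rule: tensor_induct)
  case (add s t)
  then show ?case
    using lin_add[OF assms(1), of s t] lin_add[OF assms(2), of s t] by simp
qed (use assms in auto)

lemma bilin_linext_kernel:
  assumes C: "module CC C" and f: "bilin A B C f" and k: "k \<in> KP"
  shows "linext C (\<lambda>p. f (fst p) (snd p)) k = \<zero>\<^bsub>C\<^esub>"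
proof -
  note m = module_monoid_algebra[of "A \<times>\<times> B"]
  let ?L = "linext C (\<lambda>p. f (fst p) (snd p))"
  have L: "lin FP C ?L" by (rule lin_linext[OF C]) (auto intro: bilin_closed[OF f])
  let ?N = "{k \<in> carrier FP. ?L k = \<zero>\<^bsub>C\<^esub>}"
  have N: "submodule ?N CC FP"
    using lin_zero[OF m C L] lin_add[OF L] lin_smult[OF L] vs_add[OF m] vs_smult[OF m] vs_zero[OF m]
      vs_smult_zero[OF C] vs_l_zero[OF C] vs_zero[OF C]
    by (auto simp: submodule_CC_iff[OF m])
  have L_delta: "?L (delta (a,b)) = f a b" if "a \<in> carrier A" "b \<in> carrier B" for a b
    using linext_delta[OF C, of "\<lambda>p. f (fst p) (snd p)" "(a,b)"] that bilin_closed[OF f] by simp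
  have add: "?L (delta x - delta y - delta z) = \<zero>\<^bsub>C\<^esub>"
    if "x \<in> carrier A \<times> carrier B" "y \<in> carrier A \<times> carrier B" "z \<in> carrier A \<times> carrier B"
      "f (fst x) (snd x) = f (fst y) (snd y) \<oplus>\<^bsub>C\<^esub> f (fst z) (snd z)" for x y z
  proof -
    have "?L (delta x - delta y - delta z) = ?L (delta x) \<oplus>\<^bsub>C\<^esub> (-1) \<odot>\<^bsub>C\<^esub> (?L (delta y) \<oplus>\<^bsub>C\<^esub> ?L (delta z))"
      unfolding delta_diffs
      using that vs_add[OF m] vs_smult[OF m] by (auto simp: lin_add[OF L] lin_smult[OF L])
    then show ?thesis
      using that L_delta bilin_closed[OF f] vs_right_minus[OF C] vs_add[OF C] by (cases x, cases y, cases z) auto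
  qed
  have sm: "?L (delta x - (\<lambda>p. c * delta y p)) = \<zero>\<^bsub>C\<^esub>"
    if "x \<in> carrier A \<times> carrier B" "y \<in> carrier A \<times> carrier B"
      "f (fst x) (snd x) = c \<odot>\<^bsub>C\<^esub> f (fst y) (snd y)" for x y c
  proof -
    have "?L (delta x - (\<lambda>p. c * delta y p)) = ?L (delta x) \<oplus>\<^bsub>C\<^esub> (-1) \<odot>\<^bsub>C\<^esub> (c \<odot>\<^bsub>C\<^esub> ?L (delta y))"
      unfolding delta_diffs
      using that vs_add[OF m] vs_smult[OF m] by (auto simp: lin_add[OF L] lin_smult[OF L])
    then show ?thesis
      using that L_delta bilin_closed[OF f] vs_right_minus[OF C] vs_smult[OF C] by (cases x, cases y) auto
  qed
  have "bilin_rels A B \<subseteq> ?N"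
  proof
    fix r assume r: "r \<in> bilin_rels A B"
    then have "r \<in> carrier FP" using bilin_rels_carrier by blast
    moreover have "?L r = \<zero>\<^bsub>C\<^esub>"
      using r unfolding bilin_rels_def
      using lin_add[OF bilin1[OF f]] lin_add[OF bilin2[OF f]] lin_smult[OF bilin1[OF f]] lin_smult[OF bilin2[OF f]]
        vs_add[OF A] vs_smult[OF A] vs_add[OF B] vs_smult[OF B]
      by (auto intro!: add sm)
    ultimately show "r \<in> ?N" by simp
  qed
  then show ?thesis using bilin_kernel_least[OF N] k by blast
qed

text \<open>The extension of a bilinear map kills the defining relations of the tensor product, so the value
  of \<^const>\<open>tlift\<close> does not depend on the representative that its definition picks.\<close>

lemma tlift_coset:
  assumes C: "module CC C" and f: "bilin A B C f" and r: "r \<in> carrier FP"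
  shows "tlift C f (KP +>\<^bsub>FP\<^esub> r) = linext C (\<lambda>p. f (fst p) (snd p)) r"
proof -
  note m = module_monoid_algebra[of "A \<times>\<times> B"]
  let ?L = "linext C (\<lambda>p. f (fst p) (snd p))"
  have L: "lin FP C ?L" by (rule lin_linext[OF C]) (auto intro: bilin_closed[OF f])
  define s where "s = (SOME s. s \<in> KP +>\<^bsub>FP\<^esub> r)"
  have X: "KP +>\<^bsub>FP\<^esub> r \<in> carrier (quot FP KP)" using r by (auto simp: quot_carrier[OF m bilin_kernel_sub])
  have s: "s \<in> carrier FP" "KP +>\<^bsub>FP\<^esub> s = KP +>\<^bsub>FP\<^esub> r"
    using some_coset[OF m bilin_kernel_sub X] by (auto simp: s_def)
  then have "s \<oplus>\<^bsub>FP\<^esub> (-1) \<odot>\<^bsub>FP\<^esub> r \<in> KP" using coset_eq_iff[OF m bilin_kernel_sub s(1) r] by simp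
  then have "?L (s \<oplus>\<^bsub>FP\<^esub> (-1) \<odot>\<^bsub>FP\<^esub> r) = \<zero>\<^bsub>C\<^esub>" by (rule bilin_linext_kernel[OF C f])
  then have "?L s \<oplus>\<^bsub>C\<^esub> (-1) \<odot>\<^bsub>C\<^esub> ?L r = \<zero>\<^bsub>C\<^esub>"
    using s(1) r vs_smult[OF m] by (simp add: lin_add[OF L] lin_smult[OF L])
  then have "?L s = ?L r" using vs_diff_eq_zero[OF C] lin_closed[OF L] s(1) r by blast
  then show ?thesis by (simp add: tlift_def s_def linext_def)
qed

lemma tlift_pure:
  assumes C: "module CC C" and f: "bilin A B C f" and "a \<in> carrier A" "b \<in> carrier B"
  shows "tlift C f (pure A B a b) = f a b"
  using tlift_coset[OF C f, of "delta (a,b)"] linext_delta[OF C, of "\<lambda>p. f (fst p) (snd p)" "(a,b)"]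
    bilin_closed[OF f assms(3,4)] assms(3,4) by (simp add: pure_def)

lemma lin_tlift:
  assumes C: "module CC C" and f: "bilin A B C f"
  shows "lin (tensor A B) C (tlift C f)"
proof -
  note m = module_monoid_algebra[of "A \<times>\<times> B"]
  let ?L = "linext C (\<lambda>p. f (fst p) (snd p))"
  have L: "lin FP C ?L" by (rule lin_linext[OF C]) (auto intro: bilin_closed[OF f])
  show ?thesis
    using vs_add[OF m] vs_smult[OF m]
    unfolding tensor_def
    by (intro linI)
       (auto simp: quot_carrier[OF m bilin_kernel_sub] quot_add[OF m bilin_kernel_sub] quot_smult[OF m bilin_kernel_sub]
         tlift_coset[OF C f] lin_closed[OF L] lin_add[OF L] lin_smult[OF L])
qed

lemma tlift_cong:
  assumes C: "module CC C" and "\<And>a b. a \<in> carrier A \<Longrightarrow> b \<in> carrier B \<Longrightarrow> f a b \<in> carrier C"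
    "\<And>a b. a \<in> carrier A \<Longrightarrow> b \<in> carrier B \<Longrightarrow> f a b = g a b"
    and "t \<in> carrier (tensor A B)"
  shows "tlift C f t = tlift C g t"
proof -
  note m = module_monoid_algebra[of "A \<times>\<times> B"]
  have "(SOME r. r \<in> t) \<in> carrier FP"
    using some_coset(1)[OF m bilin_kernel_sub] assms(4) by (simp add: tensor_def)
  then show ?thesis
    using linext_cong[OF C, of "A \<times>\<times> B" "\<lambda>p. f (fst p) (snd p)" "\<lambda>p. g (fst p) (snd p)"] assms
    by (auto simp: tlift_def linext_def)
qed

lemma tlift_comp:
  assumes C: "module CC C" and C': "module CC C'" and f: "bilin A B C f" and L: "lin C C' L"
    and t: "t \<in> carrier (tensor A B)"
  shows "L (tlift C f t) = tlift C' (\<lambda>a b. L (f a b)) t"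
proof -
  have g: "bilin A B C' (\<lambda>a b. L (f a b))"
    by (rule bilinI) (auto intro: lin_comp[OF bilin1[OF f] L] lin_comp[OF bilin2[OF f] L])
  show ?thesis
    by (rule lin_eq_on_pure[OF lin_comp[OF lin_tlift[OF C f] L] lin_tlift[OF C' g] _ t])
       (simp add: tlift_pure[OF C f] tlift_pure[OF C' g])
qed

text \<open>This makes iterated Sweedler sums linear in every argument, so that all identities below can be
  checked on pure tensors.\<close>

lemma lin_tlift_param:
  assumes C: "module CC C" and f: "\<And>x. x \<in> carrier X \<Longrightarrow> bilin A B C (f x)"
    and X: "module CC X"
    and l: "\<And>a b. a \<in> carrier A \<Longrightarrow> b \<in> carrier B \<Longrightarrow> lin X C (\<lambda>x. f x a b)"
    and t: "t \<in> carrier (tensor A B)"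
  shows "lin X C (\<lambda>x. tlift C (f x) t)"
  using t
proof (induction rule: tensor_induct)
  case (pure a b)
  show ?case
    by (rule lin_cong[OF l[OF pure] X]) (simp add: tlift_pure[OF C f pure])
next
  case (add s t)
  show ?case
    by (rule lin_cong[OF lin_plus[OF C add(3,4)] X])
       (simp add: lin_add[OF lin_tlift[OF C f] add(1,2)])
qed

end

text \<open>Sweedler sums over independent coproducts commute.\<close>

lemma tlift_swap:
  assumes A: "module CC A" and B: "module CC B" and A': "module CC A'" and B': "module CC B'"
    and C: "module CC C"
    and 1: "\<And>a b. a \<in> carrier A \<Longrightarrow> b \<in> carrier B \<Longrightarrow> bilin A' B' C (f a b)"
    and 2: "\<And>a' b'. a' \<in> carrier A' \<Longrightarrow> b' \<in> carrier B' \<Longrightarrow> bilin A B C (\<lambda>a b. f a b a' b')"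
    and s: "s \<in> carrier (tensor A B)" and t: "t \<in> carrier (tensor A' B')"
  shows "tlift C (\<lambda>a b. tlift C (f a b) t) s = tlift C (\<lambda>a' b'. tlift C (\<lambda>a b. f a b a' b') s) t"
proof -
  have b1: "bilin A B C (\<lambda>a b. tlift C (f a b) t)" if "t \<in> carrier (tensor A' B')" for t
    by (intro bilinI lin_tlift_param[OF A' B' C]) (use A B that in \<open>auto intro: 1 bilin1[OF 1] bilin2[OF 1] bilin1[OF 2] bilin2[OF 2]\<close>)
  have b2: "bilin A' B' C (\<lambda>a' b'. tlift C (\<lambda>a b. f a b a' b') s)"
    by (intro bilinI lin_tlift_param[OF A B C]) (use A' B' s in \<open>auto intro: 2 bilin1[OF 1] bilin2[OF 1] bilin1[OF 2] bilin2[OF 2]\<close>)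
  have l: "lin (tensor A' B') C (\<lambda>t. tlift C (\<lambda>a b. tlift C (f a b) t) s)"
    by (rule lin_tlift_param[OF A B C b1 module_tensor[OF A' B'] _ s]) (use lin_tlift[OF A' B' C 1] in auto)
  show ?thesis
  proof (rule lin_eq_on_pure[OF A' B' l lin_tlift[OF A' B' C b2] _ t])
    fix a' b' assume ab: "a' \<in> carrier A'" "b' \<in> carrier B'"
    have "tlift C (\<lambda>a b. tlift C (f a b) (pure A' B' a' b')) s = tlift C (\<lambda>a b. f a b a' b') s"
      by (rule tlift_cong[OF A B C _ _ s]) (use ab in \<open>auto simp: tlift_pure[OF A' B' C 1] intro: bilin_closed[OF 1]\<close>)
    then show "tlift C (\<lambda>a b. tlift C (f a b) (pure A' B' a' b')) s
       = tlift C (\<lambda>a' b'. tlift C (\<lambda>a b. f a b a' b') s) (pure A' B' a' b')"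
      using tlift_pure[OF A' B' C b2 ab] by simp
  qed
qed

text \<open>Multiplication by a pure tensor \<open>p \<otimes> q\<close> comes from a pair of linear maps, hence carries the bilinearity
  relations to bilinearity relations; for a general factor use linearity.\<close>

lemma bilin_kernel_mult:
  assumes A: "alg A" and B: "alg B" and k: "k \<in> bilin_kernel A B"
    and x: "x \<in> carrier (monoid_algebra (A \<times>\<times> B))"
  shows "x \<otimes>\<^bsub>monoid_algebra (A \<times>\<times> B)\<^esub> k \<in> bilin_kernel A B"
    and "k \<otimes>\<^bsub>monoid_algebra (A \<times>\<times> B)\<^esub> x \<in> bilin_kernel A B"
proof -
  let ?F = "monoid_algebra (A \<times>\<times> B)" and ?K = "bilin_kernel A B"
  note mA = algD(3)[OF A] and mB = algD(3)[OF B] and nA = algD(1)[OF A] and nB = algD(1)[OF B]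
  have mon: "monoid (A \<times>\<times> B)" by (rule DirProd_monoid[OF algD(2)[OF A] algD(2)[OF B]])
  note n = nalg_monoid_algebra[OF mon] and m = module_monoid_algebra[of "A \<times>\<times> B"]
  note l1 = nalg_lin1[OF n] and l2 = nalg_lin2[OF n]
  note K = bilin_kernel_sub[OF mA mB] bilin_kernel_rels[OF mA mB]
  note K' = K(1)[unfolded submodule_CC_iff[OF m]]
  note c = nalg_mult[OF nA] nalg_mult[OF nB] vs_add[OF mA] vs_add[OF mB] vs_smult[OF mA] vs_smult[OF mB]
  note d = lin_add[OF nalg_lin1[OF nA]] lin_add[OF nalg_lin1[OF nB]] lin_add[OF nalg_lin2[OF nA]]
    lin_add[OF nalg_lin2[OF nB]] lin_smult[OF nalg_lin1[OF nA]] lin_smult[OF nalg_lin1[OF nB]]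
    lin_smult[OF nalg_lin2[OF nA]] lin_smult[OF nalg_lin2[OF nB]]
  have rels: "delta (a \<oplus>\<^bsub>A\<^esub> a', b) - delta (a, b) - delta (a', b) \<in> ?K"
    "delta (a, b \<oplus>\<^bsub>B\<^esub> b') - delta (a, b) - delta (a, b') \<in> ?K"
    "delta (c \<odot>\<^bsub>A\<^esub> a, b) - (\<lambda>p. c * delta (a, b) p) \<in> ?K"
    "delta (a, c \<odot>\<^bsub>B\<^esub> b) - (\<lambda>p. c * delta (a, b) p) \<in> ?K"
    if "a \<in> carrier A" "a' \<in> carrier A" "b \<in> carrier B" "b' \<in> carrier B" for a a' b b' c
    by (rule subsetD[OF K(2)], rule bilin_rels_mem[OF mA mB]; fact that)+
  have left: "L k \<in> ?K"
    if L: "lin ?F ?F L"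
      and Ld: "\<And>a b. a \<in> carrier A \<Longrightarrow> b \<in> carrier B \<Longrightarrow> L (delta (a,b)) = delta (f a, g b)"
      and f: "lin A A f" and g: "lin B B g" for L f g
  proof -
    let ?N = "{k \<in> carrier ?F. L k \<in> ?K}"
    have N: "submodule ?N CC ?F"
      using K' lin_zero[OF m m L] lin_add[OF L] lin_smult[OF L] vs_add[OF m] vs_smult[OF m] vs_zero[OF m]
      by (auto simp: submodule_CC_iff[OF m])
    have La: "L (delta x - delta y - delta z) = L (delta x) - L (delta y) - L (delta z)"
      if "x \<in> carrier A \<times> carrier B" "y \<in> carrier A \<times> carrier B" "z \<in> carrier A \<times> carrier B" for x y z
    proof -
      have "L (delta x - delta y - delta z) = L (delta x) \<oplus>\<^bsub>?F\<^esub> (-1) \<odot>\<^bsub>?F\<^esub> (L (delta y) \<oplus>\<^bsub>?F\<^esub> L (delta z))"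
        unfolding delta_diffs(1)[OF mA mB] using that vs_add[OF m] vs_smult[OF m]
        by (auto simp: lin_add[OF L] lin_smult[OF L])
      then show ?thesis by (auto simp: monoid_algebra_simps)
    qed
    have Ls: "L (delta x - (\<lambda>p. c * delta y p)) = L (delta x) - (\<lambda>p. c * L (delta y) p)"
      if "x \<in> carrier A \<times> carrier B" "y \<in> carrier A \<times> carrier B" for x y c
    proof -
      have "L (delta x - (\<lambda>p. c * delta y p)) = L (delta x) \<oplus>\<^bsub>?F\<^esub> (-1) \<odot>\<^bsub>?F\<^esub> (c \<odot>\<^bsub>?F\<^esub> L (delta y))"
        unfolding delta_diffs(2)[OF mA mB] using that vs_add[OF m] vs_smult[OF m]
        by (auto simp: lin_add[OF L] lin_smult[OF L])
      then show ?thesis by (auto simp: monoid_algebra_simps)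
    qed
    have "bilin_rels A B \<subseteq> ?N"
    proof
      fix r assume r: "r \<in> bilin_rels A B"
      moreover have "L r \<in> ?K"
        using r unfolding bilin_rels_def
        by (auto simp: La Ls Ld c lin_add[OF f] lin_add[OF g] lin_smult[OF f] lin_smult[OF g]
            intro!: rels lin_closed[OF f] lin_closed[OF g])
      ultimately show "r \<in> ?N" using bilin_rels_carrier[OF mA mB] by blast
    qed
    then show ?thesis using bilin_kernel_least[OF mA mB N] k by blast
  qed
  have d1: "delta p \<otimes>\<^bsub>?F\<^esub> k \<in> ?K" and d2: "k \<otimes>\<^bsub>?F\<^esub> delta p \<in> ?K" if p: "p \<in> carrier A \<times> carrier B" for p
  proof -
    show "delta p \<otimes>\<^bsub>?F\<^esub> k \<in> ?K"
      by (rule left[of "\<lambda>k. delta p \<otimes>\<^bsub>?F\<^esub> k" "\<lambda>a. fst p \<otimes>\<^bsub>A\<^esub> a" "\<lambda>b. snd p \<otimes>\<^bsub>B\<^esub> b"])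
        (use p in \<open>auto intro!: l1 nalg_lin1[OF nA] nalg_lin1[OF nB] simp: delta_mult[OF mon] mult_DirProd'\<close>)
    show "k \<otimes>\<^bsub>?F\<^esub> delta p \<in> ?K"
      by (rule left[of "\<lambda>k. k \<otimes>\<^bsub>?F\<^esub> delta p" "\<lambda>a. a \<otimes>\<^bsub>A\<^esub> fst p" "\<lambda>b. b \<otimes>\<^bsub>B\<^esub> snd p"])
        (use p in \<open>auto intro!: l2 nalg_lin2[OF nA] nalg_lin2[OF nB] simp: delta_mult[OF mon] mult_DirProd'\<close>)
  qed
  have kF: "k \<in> carrier ?F" using K' k by blast
  have "x \<otimes>\<^bsub>?F\<^esub> k \<in> ?K \<and> k \<otimes>\<^bsub>?F\<^esub> x \<in> ?K"
    using x
  proof (induction rule: monoid_algebra_induct)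
    case zero
    show ?case using lin_zero[OF m m l1[OF kF]] lin_zero[OF m m l2[OF kF]] K' by (simp add: monoid_algebra_simps)
  next
    case (add r s)
    then show ?case using lin_add[OF l1[OF kF] add(1,2)] lin_add[OF l2[OF kF] add(1,2)] K'
      by (auto simp: monoid_algebra_simps)
  next
    case (smult c r)
    then show ?case using lin_smult[OF l1[OF kF] smult(1), of c] lin_smult[OF l2[OF kF] smult(1), of c] K'
      by (auto simp: monoid_algebra_simps)
  qed (use d1 d2 in auto)
  then show "x \<otimes>\<^bsub>?F\<^esub> k \<in> ?K" "k \<otimes>\<^bsub>?F\<^esub> x \<in> ?K" by auto
qed

lemma alg_tensor:
  assumes A: "alg A" and B: "alg B"
  shows "alg (tensor A B)"
    and "\<And>a b a' b'. a \<in> carrier A \<Longrightarrow> b \<in> carrier B \<Longrightarrow> a' \<in> carrier A \<Longrightarrow> b' \<in> carrier B \<Longrightarrow>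
          pure A B a b \<otimes>\<^bsub>tensor A B\<^esub> pure A B a' b' = pure A B (a \<otimes>\<^bsub>A\<^esub> a') (b \<otimes>\<^bsub>B\<^esub> b')"
    and "\<one>\<^bsub>tensor A B\<^esub> = pure A B \<one>\<^bsub>A\<^esub> \<one>\<^bsub>B\<^esub>"
proof -
  have mon: "monoid (A \<times>\<times> B)" by (rule DirProd_monoid[OF algD(2)[OF A] algD(2)[OF B]])
  have "alg_ideal (monoid_algebra (A \<times>\<times> B)) (bilin_kernel A B)"
    using bilin_kernel_sub[OF algD(3)[OF A] algD(3)[OF B]] bilin_kernel_mult[OF A B] by (simp add: alg_ideal_def)
  note q = quot_alg[OF alg_monoid_algebra[OF mon] this]
  show "alg (tensor A B)" unfolding tensor_def by (rule q(1))
  show "pure A B a b \<otimes>\<^bsub>tensor A B\<^esub> pure A B a' b' = pure A B (a \<otimes>\<^bsub>A\<^esub> a') (b \<otimes>\<^bsub>B\<^esub> b')"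
    if "a \<in> carrier A" "b \<in> carrier B" "a' \<in> carrier A" "b' \<in> carrier B" for a b a' b'
    unfolding tensor_def pure_def using that by (subst q(2)) (auto simp: delta_mult[OF mon])
  show "\<one>\<^bsub>tensor A B\<^esub> = pure A B \<one>\<^bsub>A\<^esub> \<one>\<^bsub>B\<^esub>"
    unfolding tensor_def pure_def using q(3) by (simp add: monoid_algebra_simps(2))
qed

lemma tlift_mult:
  assumes A: "alg A" and B: "alg B" and C: "module CC C" and f: "bilin A B C f"
    and s: "s \<in> carrier (tensor A B)" and t: "t \<in> carrier (tensor A B)"
  shows "tlift C f (s \<otimes>\<^bsub>tensor A B\<^esub> t) =
         tlift C (\<lambda>a b. tlift C (\<lambda>a' b'. f (a \<otimes>\<^bsub>A\<^esub> a') (b \<otimes>\<^bsub>B\<^esub> b')) t) s"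
proof -
  note mA = algD(3)[OF A] and mB = algD(3)[OF B] and nA = algD(1)[OF A] and nB = algD(1)[OF B]
  note T = alg_tensor[OF A B] and nT = algD(1)[OF alg_tensor(1)[OF A B]]
  note pb = bilin_pure[OF mA mB]
  have 1: "bilin A B C (\<lambda>a' b'. f (a \<otimes>\<^bsub>A\<^esub> a') (b \<otimes>\<^bsub>B\<^esub> b'))" if "a \<in> carrier A" "b \<in> carrier B" for a b
    using that by (intro bilinI) (auto intro: lin_comp[OF nalg_lin1[OF nA] bilin2[OF f]]
        lin_comp[OF nalg_lin1[OF nB] bilin1[OF f]] nalg_mult[OF nA] nalg_mult[OF nB])
  have 2: "bilin A B C (\<lambda>a b. tlift C (\<lambda>a' b'. f (a \<otimes>\<^bsub>A\<^esub> a') (b \<otimes>\<^bsub>B\<^esub> b')) t)"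
    by (intro bilinI lin_tlift_param[OF mA mB C 1 _ _ t])
       (auto intro: mA mB lin_comp[OF nalg_lin2[OF nA] bilin2[OF f]]
        lin_comp[OF nalg_lin2[OF nB] bilin1[OF f]] nalg_mult[OF nA] nalg_mult[OF nB])
  show ?thesis
  proof (rule lin_eq_on_pure[OF mA mB lin_comp[OF nalg_lin2[OF nT t] lin_tlift[OF mA mB C f]] lin_tlift[OF mA mB C 2] _ s])
    fix a b assume ab: "a \<in> carrier A" "b \<in> carrier B"
    have "tlift C f (pure A B a b \<otimes>\<^bsub>tensor A B\<^esub> t) = tlift C (\<lambda>a' b'. f (a \<otimes>\<^bsub>A\<^esub> a') (b \<otimes>\<^bsub>B\<^esub> b')) t"
      by (rule lin_eq_on_pure[OF mA mB lin_comp[OF nalg_lin1[OF nT pure_carrier[OF mA mB ab]] lin_tlift[OF mA mB C f]]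
              lin_tlift[OF mA mB C 1[OF ab]] _ t])
        (use ab in \<open>simp add: T(2) tlift_pure[OF mA mB C f] tlift_pure[OF mA mB C 1] nalg_mult[OF nA] nalg_mult[OF nB]\<close>)
    then show "tlift C f (pure A B a b \<otimes>\<^bsub>tensor A B\<^esub> t) =
      tlift C (\<lambda>a b. tlift C (\<lambda>a' b'. f (a \<otimes>\<^bsub>A\<^esub> a') (b \<otimes>\<^bsub>B\<^esub> b')) t) (pure A B a b)"
      by (simp add: tlift_pure[OF mA mB C 2 ab])
  qed
qed

subsection \<open>Functionals separate tensors\<close>

definition tsum :: "'a calg \<Rightarrow> 'b calg \<Rightarrow> ('a \<times> 'b) list \<Rightarrow> ('a \<times> 'b \<Rightarrow> complex) set" where
  "tsum A B xs = foldr (\<lambda>p s. pure A B (fst p) (snd p) \<oplus>\<^bsub>tensor A B\<^esub> s) xs \<zero>\<^bsub>tensor A B\<^esub>"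

context
  fixes A :: "'a calg" and B :: "'b calg"
  assumes A: "module CC A" and B: "module CC B"
begin

lemma tsum_simps [simp]:
  "tsum A B [] = \<zero>\<^bsub>tensor A B\<^esub>"
  "tsum A B (p # xs) = pure A B (fst p) (snd p) \<oplus>\<^bsub>tensor A B\<^esub> tsum A B xs"
  by (simp_all add: tsum_def)

lemma tsum_carrier: "set xs \<subseteq> carrier A \<times> carrier B \<Longrightarrow> tsum A B xs \<in> carrier (tensor A B)"
  by (induction xs) (auto intro!: vs_add[OF module_tensor] vs_zero[OF module_tensor] pure_carrier A B)

lemma tsum_append: "set xs \<subseteq> carrier A \<times> carrier B \<Longrightarrow> set ys \<subseteq> carrier A \<times> carrier B \<Longrightarrow>
    tsum A B (xs @ ys) = tsum A B xs \<oplus>\<^bsub>tensor A B\<^esub> tsum A B ys"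
proof (induction xs)
  case (Cons p xs)
  then show ?case
    using vs_assoc[OF module_tensor[OF A B] _ tsum_carrier tsum_carrier, of "pure A B (fst p) (snd p)" xs ys]
      pure_carrier[OF A B] by auto
qed (simp add: vs_l_zero[OF module_tensor[OF A B]] tsum_carrier)

lemma tensor_is_tsum: "t \<in> carrier (tensor A B) \<Longrightarrow> \<exists>xs. set xs \<subseteq> carrier A \<times> carrier B \<and> t = tsum A B xs"
proof (induction rule: tensor_induct[OF A B, consumes 1, case_names pure add])
  case (pure a b)
  then show ?case
    by (intro exI[of _ "[(a,b)]"]) (simp add: vs_r_zero[OF module_tensor[OF A B]] pure_carrier[OF A B])
next
  case (add s t)
  then obtain xs ys where "set xs \<subseteq> carrier A \<times> carrier B" "s = tsum A B xs"
      "set ys \<subseteq> carrier A \<times> carrier B" "t = tsum A B ys" by blast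
  then show ?case by (intro exI[of _ "xs @ ys"]) (simp add: tsum_append)
qed

lemma bilin_functional: "lin A CC \<phi> \<Longrightarrow> bilin A B B (\<lambda>a b. \<phi> a \<odot>\<^bsub>B\<^esub> b)"
  by (intro bilinI lin_scale_left[OF B] lin_scale[OF B] lin_id[OF B])

text \<open>If \<open>\<phi>(a) \<noteq> 0\<close> for one entry \<open>a \<otimes> b\<close> of a sum of pure tensors in the common kernel, then \<open>b\<close>
  is a combination of the other second entries, so the tensor is a sum of fewer pure tensors.\<close>

lemma tensor_separate:
  assumes \<Phi>: "\<And>\<phi>. \<phi> \<in> \<Phi> \<Longrightarrow> lin A CC \<phi>"
    and sep: "\<And>a. a \<in> carrier A \<Longrightarrow> (\<And>\<phi>. \<phi> \<in> \<Phi> \<Longrightarrow> \<phi> a = 0) \<Longrightarrow> a = \<zero>\<^bsub>A\<^esub>"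
    and t: "t \<in> carrier (tensor A B)"
    and z: "\<And>\<phi>. \<phi> \<in> \<Phi> \<Longrightarrow> tlift B (\<lambda>a b. \<phi> a \<odot>\<^bsub>B\<^esub> b) t = \<zero>\<^bsub>B\<^esub>"
  shows "t = \<zero>\<^bsub>tensor A B\<^esub>"
proof -
  note T = module_tensor[OF A B] and pb = bilin_pure[OF A B]
  note Lin = lin_tlift[OF A B B bilin_functional[OF \<Phi>]]
  have key: "tsum A B xs = \<zero>\<^bsub>tensor A B\<^esub>"
    if "length xs = n" "set xs \<subseteq> carrier A \<times> carrier B"
       "\<And>\<phi>. \<phi> \<in> \<Phi> \<Longrightarrow> tlift B (\<lambda>a b. \<phi> a \<odot>\<^bsub>B\<^esub> b) (tsum A B xs) = \<zero>\<^bsub>B\<^esub>" for n xs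
    using that
  proof (induction n arbitrary: xs)
    case 0
    then show ?case by simp
  next
    case (Suc n)
    show ?case
    proof (cases "\<forall>p\<in>set xs. fst p = \<zero>\<^bsub>A\<^esub>")
      case True
      have "pure A B \<zero>\<^bsub>A\<^esub> b = \<zero>\<^bsub>tensor A B\<^esub>" if "b \<in> carrier B" for b
        using lin_zero[OF A T bilin2[OF pb that]] .
      with True Suc.prems(2) show ?thesis
      proof (induction xs)
        case (Cons p xs)
        then show ?case by (auto simp: vs_l_zero[OF T] vs_zero[OF T])
      qed simp
    next
      case False
      then obtain p where p: "p \<in> set xs" "fst p \<noteq> \<zero>\<^bsub>A\<^esub>" by blast
      obtain a b where ab: "p = (a,b)" "a \<in> carrier A" "b \<in> carrier B" using p(1) Suc.prems(2) by (cases p) auto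
      obtain \<phi> where \<phi>: "\<phi> \<in> \<Phi>" "\<phi> a \<noteq> 0" using sep[OF ab(2)] p ab by auto
      obtain ys zs where xs: "xs = ys @ p # zs" using p(1) by (meson split_list)
      define ws where "ws = ys @ zs"
      have ws: "set ws \<subseteq> carrier A \<times> carrier B" "length ws = n" and yz: "set ys \<subseteq> carrier A \<times> carrier B"  "set zs \<subseteq> carrier A \<times> carrier B"
        using Suc.prems xs by (auto simp: ws_def)
      let ?L = "tlift B (\<lambda>a b. \<phi> a \<odot>\<^bsub>B\<^esub> b)"
      note L = Lin[OF \<phi>(1)] and l\<phi> = \<Phi>[OF \<phi>(1)]
      have Lpure: "?L (pure A B a b) = \<phi> a \<odot>\<^bsub>B\<^esub> b" if "a \<in> carrier A" "b \<in> carrier B" for a b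
        by (rule tlift_pure[OF A B B bilin_functional[OF l\<phi>] that])
      \<comment> \<open>Since \<open>\<phi>(a) b + \<Sum> \<phi>(c) d = 0\<close>, the summand \<open>a \<otimes> b\<close> is \<open>\<Sum> k \<phi>(c) a \<otimes> d\<close>; the map \<open>g\<close> distributes it.\<close>
      define k where "k = - 1 / \<phi> a"
      define g where "g = (\<lambda>p. (fst p \<oplus>\<^bsub>A\<^esub> (k * \<phi> (fst p)) \<odot>\<^bsub>A\<^esub> a, snd p :: 'b))"
      have txs: "tsum A B xs = pure A B a b \<oplus>\<^bsub>tensor A B\<^esub> tsum A B ws"
        using yz ab pure_carrier[OF A B]
        by (simp add: xs ws_def tsum_append vs_lcomm[OF T] tsum_carrier)
      have g: "set (map g us) \<subseteq> carrier A \<times> carrier B" if "set us \<subseteq> carrier A \<times> carrier B" for us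
        using that ab vs_add[OF A] vs_smult[OF A] by (auto simp: g_def)
      have tg: "tsum A B (map g us) = tsum A B us \<oplus>\<^bsub>tensor A B\<^esub> pure A B a (k \<odot>\<^bsub>B\<^esub> ?L (tsum A B us))"
        if "set us \<subseteq> carrier A \<times> carrier B" for us
        using that
      proof (induction us)
        case Nil
        show ?case using lin_zero[OF T B L] lin_zero[OF B T bilin1[OF pb ab(2)]]
          by (simp add: vs_smult_zero[OF B] vs_l_zero[OF T] vs_zero[OF T])
      next
        case (Cons q us)
        obtain c d where q: "q = (c,d)" "c \<in> carrier A" "d \<in> carrier B" using Cons.prems by (cases q) auto
        have us: "set us \<subseteq> carrier A \<times> carrier B" using Cons.prems by simp
        note Lu = lin_closed[OF L tsum_carrier[OF us]]
        have 1: "pure A B (c \<oplus>\<^bsub>A\<^esub> (k * \<phi> c) \<odot>\<^bsub>A\<^esub> a) d = pure A B c d \<oplus>\<^bsub>tensor A B\<^esub> (k * \<phi> c) \<odot>\<^bsub>tensor A B\<^esub> pure A B a d"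
          using q ab vs_smult[OF A] by (simp add: lin_add[OF bilin2[OF pb]] lin_smult[OF bilin2[OF pb]])
        have 2: "pure A B a (k \<odot>\<^bsub>B\<^esub> (\<phi> c \<odot>\<^bsub>B\<^esub> d \<oplus>\<^bsub>B\<^esub> ?L (tsum A B us))) =
            (k * \<phi> c) \<odot>\<^bsub>tensor A B\<^esub> pure A B a d \<oplus>\<^bsub>tensor A B\<^esub> pure A B a (k \<odot>\<^bsub>B\<^esub> ?L (tsum A B us))"
          using q ab Lu vs_smult[OF B] vs_add[OF B]
          by (simp add: vs_rdist[OF B] vs_sassoc[OF B] lin_add[OF bilin1[OF pb]] lin_smult[OF bilin1[OF pb]])
        have 3: "?L (tsum A B (q # us)) = \<phi> c \<odot>\<^bsub>B\<^esub> d \<oplus>\<^bsub>B\<^esub> ?L (tsum A B us)"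
          using q us by (simp add: lin_add[OF L] pure_carrier[OF A B] tsum_carrier Lpure)
        show ?case
          using Cons.IH[OF us] q ab Lu us unfolding 3 2
          by (simp add: g_def 1 vs_assoc[OF T] vs_lcomm[OF T] vs_smult[OF T] vs_smult[OF B] vs_add[OF T]
              pure_carrier[OF A B] tsum_carrier)
      qed
      have "\<phi> a \<odot>\<^bsub>B\<^esub> b \<oplus>\<^bsub>B\<^esub> ?L (tsum A B ws) = \<zero>\<^bsub>B\<^esub>"
        using Suc.prems(3)[OF \<phi>(1)] ab ws unfolding txs
        by (simp add: lin_add[OF L] pure_carrier[OF A B] tsum_carrier Lpure)
      then have "k \<odot>\<^bsub>B\<^esub> (\<phi> a \<odot>\<^bsub>B\<^esub> b \<oplus>\<^bsub>B\<^esub> ?L (tsum A B ws)) = \<zero>\<^bsub>B\<^esub>" by (simp add: vs_smult_zero[OF B])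
      then have "(-1) \<odot>\<^bsub>B\<^esub> b \<oplus>\<^bsub>B\<^esub> k \<odot>\<^bsub>B\<^esub> ?L (tsum A B ws) = \<zero>\<^bsub>B\<^esub>"
        using \<phi>(2) ab lin_closed[OF L tsum_carrier[OF ws(1)]]
        by (simp add: k_def vs_rdist[OF B] vs_sassoc[OF B] vs_smult[OF B])
      then have "k \<odot>\<^bsub>B\<^esub> ?L (tsum A B ws) = b"
        using vs_diff_eq_zero[OF B _ ab(3)] vs_comm[OF B] vs_smult[OF B] ab(3) lin_closed[OF L tsum_carrier[OF ws(1)]]
        by metis
      then have eq: "tsum A B (map g ws) = tsum A B xs"
        unfolding txs tg[OF ws(1)] using vs_comm[OF T pure_carrier[OF A B ab(2,3)] tsum_carrier[OF ws(1)]] by simp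
      show ?thesis
        using Suc.IH[of "map g ws"] g[OF ws(1)] ws(2) Suc.prems(3) unfolding eq by simp
    qed
  qed
  show ?thesis using tensor_is_tsum[OF t] key z by metis
qed

lemma tensor_eq_by_functionals:
  assumes \<Phi>: "\<And>\<phi>. \<phi> \<in> \<Phi> \<Longrightarrow> lin A CC \<phi>"
    and sep: "\<And>a. a \<in> carrier A \<Longrightarrow> (\<And>\<phi>. \<phi> \<in> \<Phi> \<Longrightarrow> \<phi> a = 0) \<Longrightarrow> a = \<zero>\<^bsub>A\<^esub>"
    and s: "s \<in> carrier (tensor A B)" and t: "t \<in> carrier (tensor A B)"
    and z: "\<And>\<phi>. \<phi> \<in> \<Phi> \<Longrightarrow> tlift B (\<lambda>a b. \<phi> a \<odot>\<^bsub>B\<^esub> b) s = tlift B (\<lambda>a b. \<phi> a \<odot>\<^bsub>B\<^esub> b) t"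
  shows "s = t"
proof -
  note T = module_tensor[OF A B]
  have "s \<oplus>\<^bsub>tensor A B\<^esub> (-1) \<odot>\<^bsub>tensor A B\<^esub> t = \<zero>\<^bsub>tensor A B\<^esub>"
  proof (rule tensor_separate[OF \<Phi> sep])
    fix \<phi> assume \<phi>: "\<phi> \<in> \<Phi>"
    note L = lin_tlift[OF A B B bilin_functional[OF \<Phi>[OF \<phi>]]]
    show "tlift B (\<lambda>a b. \<phi> a \<odot>\<^bsub>B\<^esub> b) (s \<oplus>\<^bsub>tensor A B\<^esub> (-1) \<odot>\<^bsub>tensor A B\<^esub> t) = \<zero>\<^bsub>B\<^esub>"
      using s t z[OF \<phi>] vs_smult[OF T] vs_right_minus[OF B] lin_closed[OF L]
      by (simp add: lin_add[OF L] lin_smult[OF L])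
  qed (use s t vs_add[OF T] vs_smult[OF T] in auto)
  then show ?thesis using vs_diff_eq_zero[OF T s t] by blast
qed

lemma bilin_functionals: "lin A CC \<phi> \<Longrightarrow> lin B CC \<psi> \<Longrightarrow> bilin A B CC (\<lambda>a b. \<phi> a * \<psi> b)"
  by (intro bilinI lin_mult_CC lin_mult_CC')

lemma tensor_eq_by_functional_pairs:
  assumes \<Phi>: "\<And>\<phi>. \<phi> \<in> \<Phi> \<Longrightarrow> lin A CC \<phi>" and \<Psi>: "\<And>\<psi>. \<psi> \<in> \<Psi> \<Longrightarrow> lin B CC \<psi>"
    and sepA: "\<And>a. a \<in> carrier A \<Longrightarrow> (\<And>\<phi>. \<phi> \<in> \<Phi> \<Longrightarrow> \<phi> a = 0) \<Longrightarrow> a = \<zero>\<^bsub>A\<^esub>"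
    and sepB: "\<And>b. b \<in> carrier B \<Longrightarrow> (\<And>\<psi>. \<psi> \<in> \<Psi> \<Longrightarrow> \<psi> b = 0) \<Longrightarrow> b = \<zero>\<^bsub>B\<^esub>"
    and s: "s \<in> carrier (tensor A B)" and t: "t \<in> carrier (tensor A B)"
    and z: "\<And>\<phi> \<psi>. \<phi> \<in> \<Phi> \<Longrightarrow> \<psi> \<in> \<Psi> \<Longrightarrow> tlift CC (\<lambda>a b. \<phi> a * \<psi> b) s = tlift CC (\<lambda>a b. \<phi> a * \<psi> b) t"
  shows "s = t"
proof (rule tensor_eq_by_functionals[OF \<Phi> sepA s t])
  fix \<phi> assume \<phi>: "\<phi> \<in> \<Phi>"
  note L = lin_tlift[OF A B B bilin_functional[OF \<Phi>[OF \<phi>]]]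
  let ?d = "tlift B (\<lambda>a b. \<phi> a \<odot>\<^bsub>B\<^esub> b) s \<oplus>\<^bsub>B\<^esub> (-1) \<odot>\<^bsub>B\<^esub> tlift B (\<lambda>a b. \<phi> a \<odot>\<^bsub>B\<^esub> b) t"
  have cl: "tlift B (\<lambda>a b. \<phi> a \<odot>\<^bsub>B\<^esub> b) s \<in> carrier B" "tlift B (\<lambda>a b. \<phi> a \<odot>\<^bsub>B\<^esub> b) t \<in> carrier B"
    using lin_closed[OF L] s t by auto
  have "?d = \<zero>\<^bsub>B\<^esub>"
  proof (rule sepB)
    fix \<psi> assume \<psi>: "\<psi> \<in> \<Psi>"
    have *: "\<psi> (tlift B (\<lambda>a b. \<phi> a \<odot>\<^bsub>B\<^esub> b) u) = tlift CC (\<lambda>a b. \<phi> a * \<psi> b) u" if "u \<in> carrier (tensor A B)" for u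
    proof -
      have "\<psi> (tlift B (\<lambda>a b. \<phi> a \<odot>\<^bsub>B\<^esub> b) u) = tlift CC (\<lambda>a b. \<psi> (\<phi> a \<odot>\<^bsub>B\<^esub> b)) u"
        by (rule tlift_comp[OF A B B module_CC bilin_functional[OF \<Phi>[OF \<phi>]] \<Psi>[OF \<psi>] that])
      also have "\<dots> = tlift CC (\<lambda>a b. \<phi> a * \<psi> b) u"
        by (rule tlift_cong[OF A B module_CC _ _ that]) (use lin_smult[OF \<Psi>[OF \<psi>]] in auto)
      finally show ?thesis .
    qed
    show "\<psi> ?d = 0"
      using cl vs_smult[OF B] z[OF \<phi> \<psi>] s t by (simp add: lin_add[OF \<Psi>[OF \<psi>]] lin_smult[OF \<Psi>[OF \<psi>]] *)
  qed (use cl vs_add[OF B] vs_smult[OF B] in auto)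
  then show "tlift B (\<lambda>a b. \<phi> a \<odot>\<^bsub>B\<^esub> b) s = tlift B (\<lambda>a b. \<phi> a \<odot>\<^bsub>B\<^esub> b) t"
    using vs_diff_eq_zero[OF B cl] by blast
qed

end

section \<open>Generated subalgebras\<close>

definition subalgebra :: "'a calg \<Rightarrow> 'a set \<Rightarrow> bool" where
  "subalgebra A N \<longleftrightarrow> N \<subseteq> carrier A \<and> \<one>\<^bsub>A\<^esub> \<in> N \<and> (\<forall>x\<in>N. \<forall>y\<in>N. x \<oplus>\<^bsub>A\<^esub> y \<in> N) \<and>
     (\<forall>c. \<forall>x\<in>N. c \<odot>\<^bsub>A\<^esub> x \<in> N) \<and> (\<forall>x\<in>N. \<forall>y\<in>N. x \<otimes>\<^bsub>A\<^esub> y \<in> N)"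

lemma subalgebra_iff:
  assumes "module CC A"
  shows "subring N A \<and> submodule N CC A \<longleftrightarrow> subalgebra A N"
proof -
  have "\<zero>\<^bsub>A\<^esub> \<in> N" if "N \<subseteq> carrier A" "\<one>\<^bsub>A\<^esub> \<in> N" "\<forall>c. \<forall>x\<in>N. c \<odot>\<^bsub>A\<^esub> x \<in> N"
    using that vs_szero[OF assms, of "\<one>\<^bsub>A\<^esub>"] by (metis subsetD)
  then show ?thesis
    unfolding subring_def subalgebra_def using submodule_CC_iff[OF assms, of N]
    by (auto simp: submonoid_def submodule_def)
qed

lemma subalg_ops [simp]:
  "\<one>\<^bsub>subalg A S\<^esub> = \<one>\<^bsub>A\<^esub>" "\<zero>\<^bsub>subalg A S\<^esub> = \<zero>\<^bsub>A\<^esub>" "x \<oplus>\<^bsub>subalg A S\<^esub> y = x \<oplus>\<^bsub>A\<^esub> y"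
  "x \<otimes>\<^bsub>subalg A S\<^esub> y = x \<otimes>\<^bsub>A\<^esub> y" "c \<odot>\<^bsub>subalg A S\<^esub> x = c \<odot>\<^bsub>A\<^esub> x"
  by (simp_all add: subalg_def)

context
  fixes A :: "'a calg" and S
  assumes A: "nalg A" and S: "S \<subseteq> carrier A"
begin

lemma subalg_carrier: "carrier (subalg A S) = \<Inter>{N. subalgebra A N \<and> S \<subseteq> N}"
  by (simp add: subalg_def subalgebra_iff[OF nalgD(1)[OF A], symmetric] conj_assoc)

lemma subalgebra_carrier: "subalgebra A (carrier A)"
  using nalgD[OF A] nalg_mult[OF A] vs_add[OF nalgD(1)[OF A]] vs_smult[OF nalgD(1)[OF A]]
  by (auto simp: subalgebra_def)

lemma subalgebra_subalg: "subalgebra A (carrier (subalg A S))"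
proof -
  have "carrier (subalg A S) \<subseteq> carrier A" using subalgebra_carrier S by (auto simp: subalg_carrier)
  then show ?thesis
    unfolding subalgebra_def[of A "carrier (subalg A S)"] by (auto simp: subalg_carrier subalgebra_def)
qed

lemma subalg_sub: "x \<in> carrier (subalg A S) \<Longrightarrow> x \<in> carrier A"
  using subalgebra_subalg by (auto simp: subalgebra_def)

lemma subalg_gen: "s \<in> S \<Longrightarrow> s \<in> carrier (subalg A S)"
  by (auto simp: subalg_carrier)

lemma subalg_induct [consumes 1, case_names gen one add smult mult]:
  assumes x: "x \<in> carrier (subalg A S)"
    and "\<And>s. s \<in> S \<Longrightarrow> P s" "P \<one>\<^bsub>A\<^esub>"
    and "\<And>x y. x \<in> carrier (subalg A S) \<Longrightarrow> y \<in> carrier (subalg A S) \<Longrightarrow> P x \<Longrightarrow> P y \<Longrightarrow> P (x \<oplus>\<^bsub>A\<^esub> y)"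
    and "\<And>c x. x \<in> carrier (subalg A S) \<Longrightarrow> P x \<Longrightarrow> P (c \<odot>\<^bsub>A\<^esub> x)"
    and "\<And>x y. x \<in> carrier (subalg A S) \<Longrightarrow> y \<in> carrier (subalg A S) \<Longrightarrow> P x \<Longrightarrow> P y \<Longrightarrow> P (x \<otimes>\<^bsub>A\<^esub> y)"
  shows "P x"
proof -
  have "subalgebra A {x \<in> carrier (subalg A S). P x}"
    using assms(2-) subalgebra_subalg unfolding subalgebra_def by auto
  then have "carrier (subalg A S) \<subseteq> {x \<in> carrier (subalg A S). P x}"
    using assms(2) subalg_gen by (subst (1) subalg_carrier) blast
  then show ?thesis using x by blast
qed

lemma module_subalg: "module CC (subalg A S)"
proof -
  have "submodule (carrier (subalg A S)) CC A"
    using subalgebra_subalg subalgebra_iff[OF nalgD(1)[OF A]] by blast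
  then show ?thesis
    using submodule_restrict[OF nalgD(1)[OF A]] by (simp add: subalg_def)
qed

lemma lin_subalg: "lin A W f \<Longrightarrow> lin (subalg A S) W f"
  using subalg_sub by (auto simp: lin_def)

lemma nalg_subalg: "nalg (subalg A S)"
  unfolding nalg_def
proof (intro conjI module_subalg bilinI)
  fix a assume a: "a \<in> carrier (subalg A S)"
  show "lin (subalg A S) (subalg A S) (\<lambda>x. a \<otimes>\<^bsub>subalg A S\<^esub> x)" "lin (subalg A S) (subalg A S) (\<lambda>x. x \<otimes>\<^bsub>subalg A S\<^esub> a)"
    using lin_subalg[OF nalg_lin1[OF A subalg_sub[OF a]]] lin_subalg[OF nalg_lin2[OF A subalg_sub[OF a]]]
      subalgebra_subalg a unfolding lin_def subalgebra_def by auto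
qed (use subalgebra_subalg in \<open>auto simp: subalgebra_def\<close>)

end

lemma alg_subalg:
  assumes A: "alg A" and S: "S \<subseteq> carrier A"
  shows "alg (subalg A S)"
proof -
  note n = algD(1)[OF A]
  have "monoid (subalg A S)"
    using nalg_subalg[OF n S] subalg_sub[OF n S]
    by (intro monoidI) (auto simp: alg_assoc[OF A] alg_one[OF A]
        dest: nalgD(3) nalg_mult[OF nalg_subalg[OF n S]])
  then show ?thesis using nalg_subalg[OF n S] by (simp add: alg_def)
qed

definition word :: "'a calg \<Rightarrow> (nat \<Rightarrow> 'a) \<Rightarrow> nat list \<Rightarrow> 'a" where
  "word A g u = foldr (\<lambda>i x. g i \<otimes>\<^bsub>A\<^esub> x) u \<one>\<^bsub>A\<^esub>"

lemma word_simps [simp]: "word A g [] = \<one>\<^bsub>A\<^esub>" "word A g (i # u) = g i \<otimes>\<^bsub>A\<^esub> word A g u"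
  by (simp_all add: word_def)

lemma word_closed:
  assumes "nalg A" "\<And>i. i \<in> I \<Longrightarrow> g i \<in> carrier A" "u \<in> lists I"
  shows "word A g u \<in> carrier A"
  using assms(3) by (induction u) (auto intro: nalgD(3) nalg_mult assms)

lemma word_append:
  assumes A: "alg A" and g: "\<And>i. i \<in> I \<Longrightarrow> g i \<in> carrier A" and u: "u \<in> lists I" and v: "v \<in> lists I"
  shows "word A g (u @ v) = word A g u \<otimes>\<^bsub>A\<^esub> word A g v"
  using u
proof (induction u)
  case Nil
  then show ?case using alg_one(1)[OF A] word_closed[of A I g v] algD(1)[OF A] g v by simp
next
  case (Cons i u)
  then have i: "i \<in> I" and u: "u \<in> lists I" by auto
  have "word A g u \<in> carrier A" "word A g v \<in> carrier A"
    using word_closed[of A I g] algD(1)[OF A] g u v by blast+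
  then show ?case
    using Cons.IH alg_assoc[OF A g[OF i]] by simp
qed

text \<open>The span of the words contains the generators and is closed under products, because products of
  words are words.\<close>

lemma subalg_word_induct [consumes 3, case_names word add smult]:
  assumes A: "alg A" and g: "\<And>i. i \<in> I \<Longrightarrow> g i \<in> carrier A"
    and x: "x \<in> carrier (subalg A (g ` I))"
    and w: "\<And>u. u \<in> lists I \<Longrightarrow> P (word A g u)"
    and a: "\<And>x y. x \<in> carrier (subalg A (g ` I)) \<Longrightarrow> y \<in> carrier (subalg A (g ` I)) \<Longrightarrow> P x \<Longrightarrow> P y \<Longrightarrow> P (x \<oplus>\<^bsub>A\<^esub> y)"
    and m: "\<And>c x. x \<in> carrier (subalg A (g ` I)) \<Longrightarrow> P x \<Longrightarrow> P (c \<odot>\<^bsub>A\<^esub> x)"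
  shows "P x"
proof -
  note n = algD(1)[OF A] and V = algD(3)[OF A]
  have gA: "g ` I \<subseteq> carrier A" using g by blast
  note sa = subalgebra_subalg[OF n gA, unfolded subalgebra_def]
  have W': "word A g u \<in> carrier (subalg A (g ` I))" if "u \<in> lists I" for u
    using that by (induction u) (use sa subalg_gen[OF n gA] in auto)
  let ?S = "submodule_gen A (word A g ` lists I)"
  have W: "word A g ` lists I \<subseteq> carrier A" using word_closed[of A I g] n g by blast
  note S = submodule_gen[OF V W]
  note S1 = S(1)[unfolded submodule_CC_iff[OF V]]
  have mult1: "word A g u \<otimes>\<^bsub>A\<^esub> y \<in> ?S" if u: "u \<in> lists I" and y: "y \<in> ?S" for u y
  proof -
    have "word A g u \<in> carrier A" using W u by blast
    note l = nalg_lin1[OF n this]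
    have "submodule {y \<in> carrier A. word A g u \<otimes>\<^bsub>A\<^esub> y \<in> ?S} CC A"
      using S1 lin_zero[OF V V l] lin_add[OF l] lin_smult[OF l] vs_add[OF V] vs_smult[OF V] vs_zero[OF V]
      by (auto simp: submodule_CC_iff[OF V])
    moreover have "word A g v \<in> {y \<in> carrier A. word A g u \<otimes>\<^bsub>A\<^esub> y \<in> ?S}" if v: "v \<in> lists I" for v
    proof -
      have "u @ v \<in> lists I" using u v by simp
      then have "word A g (u @ v) \<in> ?S" using S(2) by blast
      then show ?thesis using v W word_append[OF A g u v] by auto
    qed
    ultimately have "?S \<subseteq> {y \<in> carrier A. word A g u \<otimes>\<^bsub>A\<^esub> y \<in> ?S}" by (intro S(3)) auto
    then show ?thesis using y by blast
  qed
  have mult2: "x \<otimes>\<^bsub>A\<^esub> y \<in> ?S" if x: "x \<in> ?S" and y: "y \<in> ?S" for x y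
  proof -
    have yA: "y \<in> carrier A" using y S1 by blast
    note l = nalg_lin2[OF n yA]
    have "submodule {x \<in> carrier A. x \<otimes>\<^bsub>A\<^esub> y \<in> ?S} CC A"
      using S1 lin_zero[OF V V l] lin_add[OF l] lin_smult[OF l] vs_add[OF V] vs_smult[OF V] vs_zero[OF V]
      by (auto simp: submodule_CC_iff[OF V])
    moreover have "word A g v \<in> {x \<in> carrier A. x \<otimes>\<^bsub>A\<^esub> y \<in> ?S}" if v: "v \<in> lists I" for v
      using W mult1[OF v y] imageI[OF v, of "word A g"] by blast
    ultimately have "?S \<subseteq> {x \<in> carrier A. x \<otimes>\<^bsub>A\<^esub> y \<in> ?S}" by (intro S(3)) auto
    then show ?thesis using x by blast
  qed
  have one: "\<one>\<^bsub>A\<^esub> \<in> ?S" using S(2) by (metis image_eqI lists.Nil subsetD word_simps(1))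
  have gen: "g i \<in> ?S" if "i \<in> I" for i
  proof -
    have "[i] \<in> lists I" using that by simp
    then have "word A g [i] \<in> ?S" using S(2) by blast
    then show ?thesis using alg_one(2)[OF A g[OF that]] by simp
  qed
  have "subalgebra A ?S" unfolding subalgebra_def using S1 one mult2 by blast
  moreover have "g ` I \<subseteq> ?S" using gen by blast
  moreover have "g ` I \<subseteq> carrier A" using g by blast
  ultimately have "x \<in> ?S" using x subalg_carrier[OF n, of "g ` I"] by blast
  moreover have "submodule {x \<in> carrier (subalg A (g ` I)). P x} CC A"
  proof -
    have "P \<zero>\<^bsub>A\<^esub>" using m[of "word A g []" 0] w[of "[]"] nalgD(3)[OF n] vs_szero[OF V] sa by simp
    moreover have "\<zero>\<^bsub>A\<^esub> \<in> carrier (subalg A (g ` I))" using vs_zero[OF module_subalg[OF n gA]] by simp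
    ultimately show ?thesis using a m sa by (auto simp: submodule_CC_iff[OF V])
  qed
  moreover have "word A g ` lists I \<subseteq> {x \<in> carrier (subalg A (g ` I)). P x}" using W' w by blast
  ultimately show ?thesis using S(3) by blast
qed

section \<open>Hopf pairings and the Heisenberg double\<close>

text \<open>Two algebras in duality. The coproducts enter through the pairing only: since the pairing is
  nondegenerate, an element of a tensor square is determined by its pairings with pairs of elements
  (\<open>eqAA\<close>, \<open>eqBB\<close>), and linearity of the coproducts, the counit law and the compatibilities below all
  follow by testing.\<close>

locale hopf_pair =
  fixes A :: "'a calg" and B :: "'b calg" and \<phi> :: "'a \<Rightarrow> 'b \<Rightarrow> complex"
    and dA :: "'a \<Rightarrow> ('a \<times> 'a \<Rightarrow> complex) set" and dB :: "'b \<Rightarrow> ('b \<times> 'b \<Rightarrow> complex) set"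
  assumes A: "alg A" and B: "alg B" and \<phi>: "bilin A B CC \<phi>"
    and nondegA: "\<And>a. a \<in> carrier A \<Longrightarrow> (\<And>b. b \<in> carrier B \<Longrightarrow> \<phi> a b = 0) \<Longrightarrow> a = \<zero>\<^bsub>A\<^esub>"
    and nondegB: "\<And>b. b \<in> carrier B \<Longrightarrow> (\<And>a. a \<in> carrier A \<Longrightarrow> \<phi> a b = 0) \<Longrightarrow> b = \<zero>\<^bsub>B\<^esub>"
    and dA: "\<And>a. a \<in> carrier A \<Longrightarrow> dA a \<in> carrier (tensor A A)"
    and dB: "\<And>b. b \<in> carrier B \<Longrightarrow> dB b \<in> carrier (tensor B B)"
    and \<phi>_multB: "\<And>a b b'. a \<in> carrier A \<Longrightarrow> b \<in> carrier B \<Longrightarrow> b' \<in> carrier B \<Longrightarrow>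
          \<phi> a (b \<otimes>\<^bsub>B\<^esub> b') = tlift CC (\<lambda>a1 a2. \<phi> a1 b * \<phi> a2 b') (dA a)"
    and \<phi>_multA: "\<And>a a' b. a \<in> carrier A \<Longrightarrow> a' \<in> carrier A \<Longrightarrow> b \<in> carrier B \<Longrightarrow>
          \<phi> (a \<otimes>\<^bsub>A\<^esub> a') b = tlift CC (\<lambda>b1 b2. \<phi> a b2 * \<phi> a' b1) (dB b)"
    and dA_mult: "\<And>a a'. a \<in> carrier A \<Longrightarrow> a' \<in> carrier A \<Longrightarrow> dA (a \<otimes>\<^bsub>A\<^esub> a') = dA a \<otimes>\<^bsub>tensor A A\<^esub> dA a'"
    and dB_mult: "\<And>b b'. b \<in> carrier B \<Longrightarrow> b' \<in> carrier B \<Longrightarrow> dB (b \<otimes>\<^bsub>B\<^esub> b') = dB b \<otimes>\<^bsub>tensor B B\<^esub> dB b'"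
    and dA_one: "dA \<one>\<^bsub>A\<^esub> = pure A A \<one>\<^bsub>A\<^esub> \<one>\<^bsub>A\<^esub>"
    and dB_one: "dB \<one>\<^bsub>B\<^esub> = pure B B \<one>\<^bsub>B\<^esub> \<one>\<^bsub>B\<^esub>"
    and \<phi>_one_one: "\<phi> \<one>\<^bsub>A\<^esub> \<one>\<^bsub>B\<^esub> = 1"
begin

lemmas mA = algD(3)[OF A] and mB = algD(3)[OF B] and nA = algD(1)[OF A] and nB = algD(1)[OF B]
lemmas \<phi>1 = bilin1[OF \<phi>] and \<phi>2 = bilin2[OF \<phi>]
lemmas oneA = nalgD(3)[OF nA] and oneB = nalgD(3)[OF nB]
lemmas multA = nalg_mult[OF nA] and multB = nalg_mult[OF nB]
lemmas mAA = module_tensor[OF mA mA] and mBB = module_tensor[OF mB mB] and mT = module_tensor[OF mB mA]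
lemmas pT = bilin_pure[OF mB mA]

lemma eqA:
  assumes "a \<in> carrier A" "a' \<in> carrier A" "\<And>b. b \<in> carrier B \<Longrightarrow> \<phi> a b = \<phi> a' b"
  shows "a = a'"
proof (rule vs_diff_eq_zero[OF mA assms(1,2)], rule nondegA)
  fix b assume b: "b \<in> carrier B"
  show "\<phi> (a \<oplus>\<^bsub>A\<^esub> (-1) \<odot>\<^bsub>A\<^esub> a') b = 0"
    using assms b vs_smult[OF mA] by (simp add: lin_add[OF \<phi>2] lin_smult[OF \<phi>2])
qed (use assms vs_add[OF mA] vs_smult[OF mA] in auto)

lemma eqB:
  assumes "b \<in> carrier B" "b' \<in> carrier B" "\<And>a. a \<in> carrier A \<Longrightarrow> \<phi> a b = \<phi> a b'"
  shows "b = b'"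
proof (rule vs_diff_eq_zero[OF mB assms(1,2)], rule nondegB)
  fix a assume a: "a \<in> carrier A"
  show "\<phi> a (b \<oplus>\<^bsub>B\<^esub> (-1) \<odot>\<^bsub>B\<^esub> b') = 0"
    using assms a vs_smult[OF mB] by (simp add: lin_add[OF \<phi>1] lin_smult[OF \<phi>1])
qed (use assms vs_add[OF mB] vs_smult[OF mB] in auto)

lemma bilin_\<phi>\<phi>A: "b \<in> carrier B \<Longrightarrow> b' \<in> carrier B \<Longrightarrow> bilin A A CC (\<lambda>x y. \<phi> x b * \<phi> y b')"
  by (intro bilin_functionals[OF mA mA] \<phi>2)
lemma bilin_\<phi>\<phi>B: "a \<in> carrier A \<Longrightarrow> a' \<in> carrier A \<Longrightarrow> bilin B B CC (\<lambda>x y. \<phi> a y * \<phi> a' x)"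
  by (intro bilinI lin_mult_CC lin_mult_CC' \<phi>1)

lemma eqAA:
  assumes "s \<in> carrier (tensor A A)" "t \<in> carrier (tensor A A)"
    "\<And>b b'. b \<in> carrier B \<Longrightarrow> b' \<in> carrier B \<Longrightarrow>
       tlift CC (\<lambda>x y. \<phi> x b * \<phi> y b') s = tlift CC (\<lambda>x y. \<phi> x b * \<phi> y b') t"
  shows "s = t"
proof (rule tensor_eq_by_functional_pairs[OF mA mA,
      of "(\<lambda>b a. \<phi> a b) ` carrier B" "(\<lambda>b a. \<phi> a b) ` carrier B"])
  show "\<And>a. a \<in> carrier A \<Longrightarrow> (\<And>\<psi>. \<psi> \<in> (\<lambda>b a. \<phi> a b) ` carrier B \<Longrightarrow> \<psi> a = 0) \<Longrightarrow> a = \<zero>\<^bsub>A\<^esub>"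
    using nondegA by blast
  then show "\<And>a. a \<in> carrier A \<Longrightarrow> (\<And>\<psi>. \<psi> \<in> (\<lambda>b a. \<phi> a b) ` carrier B \<Longrightarrow> \<psi> a = 0) \<Longrightarrow> a = \<zero>\<^bsub>A\<^esub>" .
qed (use assms \<phi>2 in auto)

lemma eqBB:
  assumes "s \<in> carrier (tensor B B)" "t \<in> carrier (tensor B B)"
    "\<And>a a'. a \<in> carrier A \<Longrightarrow> a' \<in> carrier A \<Longrightarrow>
       tlift CC (\<lambda>x y. \<phi> a y * \<phi> a' x) s = tlift CC (\<lambda>x y. \<phi> a y * \<phi> a' x) t"
  shows "s = t"
proof (rule tensor_eq_by_functional_pairs[OF mB mB, of "\<phi> ` carrier A" "\<phi> ` carrier A"])
  show "\<And>b. b \<in> carrier B \<Longrightarrow> (\<And>\<psi>. \<psi> \<in> \<phi> ` carrier A \<Longrightarrow> \<psi> b = 0) \<Longrightarrow> b = \<zero>\<^bsub>B\<^esub>"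
    using nondegB by blast
  then show "\<And>b. b \<in> carrier B \<Longrightarrow> (\<And>\<psi>. \<psi> \<in> \<phi> ` carrier A \<Longrightarrow> \<psi> b = 0) \<Longrightarrow> b = \<zero>\<^bsub>B\<^esub>" .
  fix f g assume "f \<in> \<phi> ` carrier A" "g \<in> \<phi> ` carrier A"
  then obtain a a' where "a \<in> carrier A" "a' \<in> carrier A" "f = \<phi> a" "g = \<phi> a'" by blast
  then show "tlift CC (\<lambda>a b. f a * g b) s = tlift CC (\<lambda>a b. f a * g b) t"
    using assms(3)[of a' a] by (simp add: mult.commute)
qed (use assms \<phi>1 in auto)

lemma lin_dA: "lin A (tensor A A) dA"
proof (rule linI[OF dA])
  note L = lin_tlift[OF mA mA module_CC bilin_\<phi>\<phi>A]
  fix x assume x: "x \<in> carrier A"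
  show "dA (c \<odot>\<^bsub>A\<^esub> x) = c \<odot>\<^bsub>tensor A A\<^esub> dA x" for c
    by (rule eqAA) (use x in \<open>simp_all add: dA vs_smult[OF mA] vs_smult[OF mAA] lin_smult[OF L]
      \<phi>_multB[symmetric] lin_smult[OF \<phi>2] multB\<close>)
  fix y assume y: "y \<in> carrier A"
  show "dA (x \<oplus>\<^bsub>A\<^esub> y) = dA x \<oplus>\<^bsub>tensor A A\<^esub> dA y"
    by (rule eqAA) (use x y in \<open>simp_all add: dA vs_add[OF mA] vs_add[OF mAA] lin_add[OF L]
      \<phi>_multB[symmetric] lin_add[OF \<phi>2] multB\<close>)
qed

lemma lin_dB: "lin B (tensor B B) dB"
proof (rule linI[OF dB])
  note L = lin_tlift[OF mB mB module_CC bilin_\<phi>\<phi>B]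
  fix x assume x: "x \<in> carrier B"
  show "dB (c \<odot>\<^bsub>B\<^esub> x) = c \<odot>\<^bsub>tensor B B\<^esub> dB x" for c
    by (rule eqBB) (use x in \<open>simp_all add: dB vs_smult[OF mB] vs_smult[OF mBB] lin_smult[OF L]
      \<phi>_multA[symmetric] lin_smult[OF \<phi>1] multA\<close>)
  fix y assume y: "y \<in> carrier B"
  show "dB (x \<oplus>\<^bsub>B\<^esub> y) = dB x \<oplus>\<^bsub>tensor B B\<^esub> dB y"
    by (rule eqBB) (use x y in \<open>simp_all add: dB vs_add[OF mB] vs_add[OF mBB] lin_add[OF L]
      \<phi>_multA[symmetric] lin_add[OF \<phi>1] multA\<close>)
qed

subsection \<open>The action of one algebra on the other\<close>

definition act :: "'a \<Rightarrow> 'b \<Rightarrow> 'b" where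
  "act a x = tlift B (\<lambda>x1 x2. \<phi> a x1 \<odot>\<^bsub>B\<^esub> x2) (dB x)"

lemma bilin_act_inner: "a \<in> carrier A \<Longrightarrow> bilin B B B (\<lambda>x1 x2. \<phi> a x1 \<odot>\<^bsub>B\<^esub> x2)"
  by (rule bilin_functional[OF mB mB \<phi>1])

lemma bilin_act: "bilin A B B act"
proof (rule bilinI)
  fix a assume "a \<in> carrier A"
  then show "lin B B (act a)"
    unfolding act_def by (intro lin_comp[OF lin_dB] lin_tlift[OF mB mB mB] bilin_act_inner)
next
  fix x assume x: "x \<in> carrier B"
  show "lin A B (\<lambda>a. act a x)"
    unfolding act_def
    by (rule lin_tlift_param[OF mB mB mB bilin_act_inner mA _ dB[OF x]])
       (auto intro: lin_scale_left[OF mB \<phi>2])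
qed

lemmas act1 = bilin1[OF bilin_act] and act2 = bilin2[OF bilin_act]
lemmas act_closed = bilin_closed[OF bilin_act]

lemma \<phi>_act:
  assumes "c \<in> carrier A" "a \<in> carrier A" "x \<in> carrier B"
  shows "\<phi> c (act a x) = \<phi> (c \<otimes>\<^bsub>A\<^esub> a) x"
proof -
  have "\<phi> c (act a x) = tlift CC (\<lambda>x1 x2. \<phi> c (\<phi> a x1 \<odot>\<^bsub>B\<^esub> x2)) (dB x)"
    unfolding act_def by (rule tlift_comp[OF mB mB mB module_CC bilin_act_inner \<phi>1 dB]) fact+
  also have "\<dots> = tlift CC (\<lambda>x1 x2. \<phi> c x2 * \<phi> a x1) (dB x)"
    by (rule tlift_cong[OF mB mB module_CC _ _ dB]) (use assms in \<open>auto simp: lin_smult[OF \<phi>1]\<close>)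
  also have "\<dots> = \<phi> (c \<otimes>\<^bsub>A\<^esub> a) x" using \<phi>_multA assms by simp
  finally show ?thesis .
qed

lemma act_mult:
  assumes "a \<in> carrier A" "a' \<in> carrier A" "x \<in> carrier B"
  shows "act (a \<otimes>\<^bsub>A\<^esub> a') x = act a (act a' x)"
  by (rule eqB) (use assms in \<open>simp_all add: \<phi>_act act_closed multA alg_assoc[OF A]\<close>)

lemma act_one: "x \<in> carrier B \<Longrightarrow> act \<one>\<^bsub>A\<^esub> x = x"
  by (rule eqB) (simp_all add: \<phi>_act act_closed oneA alg_one[OF A])

lemma act_on_one: "a \<in> carrier A \<Longrightarrow> act a \<one>\<^bsub>B\<^esub> = \<phi> a \<one>\<^bsub>B\<^esub> \<odot>\<^bsub>B\<^esub> \<one>\<^bsub>B\<^esub>"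
  unfolding act_def dB_one by (rule tlift_pure[OF mB mB mB bilin_act_inner]) (auto intro: oneB)

lemma bilin_act_times:
  assumes "b \<in> carrier B" "x \<in> carrier B"
  shows "bilin A A B (\<lambda>a1 a2. act a1 b \<otimes>\<^bsub>B\<^esub> act a2 x)"
  using assms by (intro bilinI) (auto intro: lin_comp[OF act2 nalg_lin1[OF nB]] lin_comp[OF act2 nalg_lin2[OF nB]] act_closed)

text \<open>The action makes \<open>B\<close> a module algebra. Tested against \<open>\<phi>(c, \<sqdot>)\<close>, both sides expand to the
  same double Sweedler sum over the coproducts of \<open>c\<close> and \<open>a\<close>.\<close>

lemma act_times:
  assumes a: "a \<in> carrier A" and b: "b \<in> carrier B" and x: "x \<in> carrier B"
  shows "act a (b \<otimes>\<^bsub>B\<^esub> x) = tlift B (\<lambda>a1 a2. act a1 b \<otimes>\<^bsub>B\<^esub> act a2 x) (dA a)"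
proof (rule eqB)
  note ba = bilin_act_times[OF b x]
  show "act a (b \<otimes>\<^bsub>B\<^esub> x) \<in> carrier B" by (intro act_closed multB assms)
  show "tlift B (\<lambda>a1 a2. act a1 b \<otimes>\<^bsub>B\<^esub> act a2 x) (dA a) \<in> carrier B"
    by (rule lin_closed[OF lin_tlift[OF mA mA mB ba] dA[OF a]])
  fix c assume c: "c \<in> carrier A"
  have "\<phi> c (act a (b \<otimes>\<^bsub>B\<^esub> x)) = tlift CC (\<lambda>p q. \<phi> p b * \<phi> q x) (dA c \<otimes>\<^bsub>tensor A A\<^esub> dA a)"
    using assms c by (simp add: \<phi>_act multB multA \<phi>_multB dA_mult)
  also have "\<dots> = tlift CC (\<lambda>p q. tlift CC (\<lambda>p' q'. \<phi> (p \<otimes>\<^bsub>A\<^esub> p') b * \<phi> (q \<otimes>\<^bsub>A\<^esub> q') x) (dA a)) (dA c)"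
    by (rule tlift_mult[OF A A module_CC bilin_\<phi>\<phi>A[OF b x] dA[OF c] dA[OF a]])
  also have "\<dots> = tlift CC (\<lambda>p' q'. tlift CC (\<lambda>p q. \<phi> (p \<otimes>\<^bsub>A\<^esub> p') b * \<phi> (q \<otimes>\<^bsub>A\<^esub> q') x) (dA c)) (dA a)"
    by (rule tlift_swap[OF mA mA mA mA module_CC _ _ dA[OF c] dA[OF a]])
       (auto intro!: bilin_functionals[OF mA mA] lin_comp[OF nalg_lin1[OF nA] \<phi>2] lin_comp[OF nalg_lin2[OF nA] \<phi>2] b x)
  also have "\<dots> = tlift CC (\<lambda>p' q'. \<phi> c (act p' b \<otimes>\<^bsub>B\<^esub> act q' x)) (dA a)"
  proof (rule tlift_cong[OF mA mA module_CC _ _ dA[OF a]])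
    fix p' q' assume pq: "p' \<in> carrier A" "q' \<in> carrier A"
    have "\<phi> c (act p' b \<otimes>\<^bsub>B\<^esub> act q' x) = tlift CC (\<lambda>p q. \<phi> p (act p' b) * \<phi> q (act q' x)) (dA c)"
      using pq b x c by (simp add: \<phi>_multB act_closed)
    also have "\<dots> = tlift CC (\<lambda>p q. \<phi> (p \<otimes>\<^bsub>A\<^esub> p') b * \<phi> (q \<otimes>\<^bsub>A\<^esub> q') x) (dA c)"
      by (rule tlift_cong[OF mA mA module_CC _ _ dA[OF c]]) (use pq b x in \<open>auto simp: \<phi>_act\<close>)
    finally show "tlift CC (\<lambda>p q. \<phi> (p \<otimes>\<^bsub>A\<^esub> p') b * \<phi> (q \<otimes>\<^bsub>A\<^esub> q') x) (dA c) = \<phi> c (act p' b \<otimes>\<^bsub>B\<^esub> act q' x)" ..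
  qed auto
  also have "\<dots> = \<phi> c (tlift B (\<lambda>a1 a2. act a1 b \<otimes>\<^bsub>B\<^esub> act a2 x) (dA a))"
    by (rule tlift_comp[OF mA mA mB module_CC ba \<phi>1[OF c] dA[OF a], symmetric])
  finally show "\<phi> c (act a (b \<otimes>\<^bsub>B\<^esub> x)) = \<phi> c (tlift B (\<lambda>a1 a2. act a1 b \<otimes>\<^bsub>B\<^esub> act a2 x) (dA a))" .
qed

subsection \<open>The Heisenberg double\<close>

abbreviation "T \<equiv> tensor B A"

definition hmul :: "('b \<times> 'a \<Rightarrow> complex) set \<Rightarrow> ('b \<times> 'a \<Rightarrow> complex) set \<Rightarrow> ('b \<times> 'a \<Rightarrow> complex) set" where
  "hmul X Y = tlift T (\<lambda>b a. tlift T (\<lambda>b' a'. tlift T (\<lambda>a1 a2. tlift T (\<lambda>b1 b2.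
      \<phi> a1 b1 \<odot>\<^bsub>T\<^esub> pure B A (b \<otimes>\<^bsub>B\<^esub> b2) (a2 \<otimes>\<^bsub>A\<^esub> a')) (dB b')) (dA a)) Y) X"

text \<open>The product of \<open>b \<sharp> a\<close> and \<open>b' \<sharp> a'\<close>. The Sweedler sum over the coproduct of \<open>b'\<close> has been carried out:
  it is the action of \<open>a1\<close> on \<open>b'\<close>.\<close>

definition hcore :: "'b \<Rightarrow> 'a \<Rightarrow> 'b \<Rightarrow> 'a \<Rightarrow> ('b \<times> 'a \<Rightarrow> complex) set" where
  "hcore b a b' a' = tlift T (\<lambda>a1 a2. pure B A (b \<otimes>\<^bsub>B\<^esub> act a1 b') (a2 \<otimes>\<^bsub>A\<^esub> a')) (dA a)"

lemma lin_pure_l: "a \<in> carrier A \<Longrightarrow> lin X B f \<Longrightarrow> lin X T (\<lambda>x. pure B A (f x) a)"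
  by (rule lin_comp[OF _ bilin2[OF pT]])
lemma lin_pure_r: "b \<in> carrier B \<Longrightarrow> lin X A f \<Longrightarrow> lin X T (\<lambda>x. pure B A b (f x))"
  by (rule lin_comp[OF _ bilin1[OF pT]])
lemma lin_mult_l: "b \<in> carrier B \<Longrightarrow> lin X B f \<Longrightarrow> lin X B (\<lambda>x. b \<otimes>\<^bsub>B\<^esub> f x)"
  by (rule lin_comp[OF _ nalg_lin1[OF nB]])
lemma bilin_hcore_inner:
  assumes "b \<in> carrier B" "b' \<in> carrier B" "a' \<in> carrier A"
  shows "bilin A A T (\<lambda>a1 a2. pure B A (b \<otimes>\<^bsub>B\<^esub> act a1 b') (a2 \<otimes>\<^bsub>A\<^esub> a'))"
  using assms
  by (intro bilinI) (auto intro!: lin_pure_l lin_pure_r lin_mult_l act2 nalg_lin2[OF nA] multA multB act_closed)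

lemma hcore_inner:
  assumes "b \<in> carrier B" "b' \<in> carrier B" "a' \<in> carrier A" "a1 \<in> carrier A" "a2 \<in> carrier A"
  shows "tlift T (\<lambda>b1 b2. \<phi> a1 b1 \<odot>\<^bsub>T\<^esub> pure B A (b \<otimes>\<^bsub>B\<^esub> b2) (a2 \<otimes>\<^bsub>A\<^esub> a')) (dB b') =
         pure B A (b \<otimes>\<^bsub>B\<^esub> act a1 b') (a2 \<otimes>\<^bsub>A\<^esub> a')"
proof -
  have L: "lin B T (\<lambda>y. pure B A (b \<otimes>\<^bsub>B\<^esub> y) (a2 \<otimes>\<^bsub>A\<^esub> a'))"
    using assms by (intro lin_pure_l nalg_lin1[OF nB] multA)
  have "pure B A (b \<otimes>\<^bsub>B\<^esub> act a1 b') (a2 \<otimes>\<^bsub>A\<^esub> a') =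
      tlift T (\<lambda>b1 b2. pure B A (b \<otimes>\<^bsub>B\<^esub> (\<phi> a1 b1 \<odot>\<^bsub>B\<^esub> b2)) (a2 \<otimes>\<^bsub>A\<^esub> a')) (dB b')"
    unfolding act_def by (rule tlift_comp[OF mB mB mB mT bilin_act_inner L dB]) fact+
  also have "\<dots> = tlift T (\<lambda>b1 b2. \<phi> a1 b1 \<odot>\<^bsub>T\<^esub> pure B A (b \<otimes>\<^bsub>B\<^esub> b2) (a2 \<otimes>\<^bsub>A\<^esub> a')) (dB b')"
    by (rule tlift_cong[OF mB mB mT _ _ dB])
       (use assms in \<open>auto simp: lin_smult[OF L] intro!: vs_smult[OF mT] pure_carrier[OF mB mA] multB multA vs_smult[OF mB]\<close>)
  finally show ?thesis ..
qed

lemma bilin_hcore_right: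
  assumes "b \<in> carrier B" "a \<in> carrier A"
  shows "bilin B A T (hcore b a)"
  unfolding hcore_def
  by (intro bilinI lin_tlift_param[OF mA mA mT bilin_hcore_inner _ _ dA[OF assms(2)]])
     (use assms in \<open>auto intro!: mA mB lin_pure_l lin_pure_r lin_mult_l act1 nalg_lin1[OF nA] multA multB act_closed\<close>)

lemma bilin_hcore_left:
  assumes "b' \<in> carrier B" "a' \<in> carrier A"
  shows "bilin B A T (\<lambda>b a. hcore b a b' a')"
  unfolding hcore_def
proof (rule bilinI)
  fix b assume "b \<in> carrier B"
  then show "lin A T (\<lambda>a. tlift T (\<lambda>a1 a2. pure B A (b \<otimes>\<^bsub>B\<^esub> act a1 b') (a2 \<otimes>\<^bsub>A\<^esub> a')) (dA a))"
    using assms by (intro lin_comp[OF lin_dA] lin_tlift[OF mA mA mT] bilin_hcore_inner)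
next
  fix a assume a: "a \<in> carrier A"
  show "lin B T (\<lambda>b. tlift T (\<lambda>a1 a2. pure B A (b \<otimes>\<^bsub>B\<^esub> act a1 b') (a2 \<otimes>\<^bsub>A\<^esub> a')) (dA a))"
    by (rule lin_tlift_param[OF mA mA mT bilin_hcore_inner mB _ dA[OF a]])
      (use assms in \<open>auto intro!: lin_pure_l nalg_lin2[OF nB] act_closed multA\<close>)
qed

lemma bilin_hmul_outer:
  assumes "Y \<in> carrier T"
  shows "bilin B A T (\<lambda>b a. tlift T (\<lambda>b' a'. hcore b a b' a') Y)"
  by (intro bilinI lin_tlift_param[OF mB mA mT bilin_hcore_right _ _ assms])
     (auto intro: mA mB bilin1[OF bilin_hcore_left] bilin2[OF bilin_hcore_left])

lemma hmul_hcore: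
  assumes X: "X \<in> carrier T" and Y: "Y \<in> carrier T"
  shows "hmul X Y = tlift T (\<lambda>b a. tlift T (\<lambda>b' a'. hcore b a b' a') Y) X"
  unfolding hmul_def
proof (rule tlift_cong[OF mB mA mT _ _ X, symmetric])
  fix b a assume ba: "b \<in> carrier B" "a \<in> carrier A"
  show "tlift T (\<lambda>b' a'. hcore b a b' a') Y \<in> carrier T"
    by (rule bilin_closed[OF bilin_hmul_outer[OF Y] ba])
  show "tlift T (\<lambda>b' a'. hcore b a b' a') Y = tlift T (\<lambda>b' a'. tlift T (\<lambda>a1 a2. tlift T (\<lambda>b1 b2.
      \<phi> a1 b1 \<odot>\<^bsub>T\<^esub> pure B A (b \<otimes>\<^bsub>B\<^esub> b2) (a2 \<otimes>\<^bsub>A\<^esub> a')) (dB b')) (dA a)) Y"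
  proof (rule tlift_cong[OF mB mA mT _ _ Y])
    fix b' a' assume ba': "b' \<in> carrier B" "a' \<in> carrier A"
    show "hcore b a b' a' \<in> carrier T" by (rule bilin_closed[OF bilin_hcore_right[OF ba] ba'])
    show "hcore b a b' a' = tlift T (\<lambda>a1 a2. tlift T (\<lambda>b1 b2.
      \<phi> a1 b1 \<odot>\<^bsub>T\<^esub> pure B A (b \<otimes>\<^bsub>B\<^esub> b2) (a2 \<otimes>\<^bsub>A\<^esub> a')) (dB b')) (dA a)"
      unfolding hcore_def
      by (rule tlift_cong[OF mA mA mT bilin_closed[OF bilin_hcore_inner[OF ba(1) ba']] _ dA[OF ba(2)]])
         (simp_all add: hcore_inner ba ba')
  qed
qed

lemma hmul_pure:
  assumes "b \<in> carrier B" "a \<in> carrier A" "b' \<in> carrier B" "a' \<in> carrier A"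
  shows "hmul (pure B A b a) (pure B A b' a') = hcore b a b' a'"
  using assms
  by (simp add: hmul_hcore pure_carrier[OF mB mA] tlift_pure[OF mB mA mT bilin_hmul_outer]
      tlift_pure[OF mB mA mT bilin_hcore_right])

lemma bilin_hmul: "bilin T T T hmul"
proof (rule bilinI)
  fix X assume X: "X \<in> carrier T"
  have "lin T T (\<lambda>Y. tlift T (\<lambda>b a. tlift T (\<lambda>b' a'. hcore b a b' a') Y) X)"
    by (rule lin_tlift_param[OF mB mA mT bilin_hmul_outer mT _ X])
       (auto intro: lin_tlift[OF mB mA mT bilin_hcore_right])
  then show "lin T T (hmul X)" by (rule lin_cong[OF _ mT]) (simp add: hmul_hcore X)
next
  fix Y assume Y: "Y \<in> carrier T"
  have "lin T T (\<lambda>X. tlift T (\<lambda>b a. tlift T (\<lambda>b' a'. hcore b a b' a') Y) X)"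
    by (rule lin_tlift[OF mB mA mT bilin_hmul_outer[OF Y]])
  then show "lin T T (\<lambda>X. hmul X Y)" by (rule lin_cong[OF _ mT]) (simp add: hmul_hcore Y)
qed

definition Hd :: "('b \<times> 'a \<Rightarrow> complex) set calg" where "Hd = T\<lparr>mult := hmul\<rparr>"

lemma Hd_simps [simp]: "carrier Hd = carrier T" "mult Hd = hmul" "\<zero>\<^bsub>Hd\<^esub> = \<zero>\<^bsub>T\<^esub>" "X \<oplus>\<^bsub>Hd\<^esub> Y = X \<oplus>\<^bsub>T\<^esub> Y"
  "c \<odot>\<^bsub>Hd\<^esub> X = c \<odot>\<^bsub>T\<^esub> X" "\<one>\<^bsub>Hd\<^esub> = pure B A \<one>\<^bsub>B\<^esub> \<one>\<^bsub>A\<^esub>"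
  using alg_tensor(3)[OF B A] by (simp_all add: Hd_def)

lemma nalg_Hd: "nalg Hd"
proof -
  have "module CC Hd" by (rule module_surj[OF mT, of _ "\<lambda>x. x"]) auto
  moreover have "bilin Hd Hd Hd (\<lambda>x y. x \<otimes>\<^bsub>Hd\<^esub> y)" using bilin_hmul by (simp add: bilin_def lin_def)
  ultimately show ?thesis unfolding nalg_def using pure_carrier[OF mB mA oneB oneA] by simp
qed

text \<open>The sum \<open>\<Sum> \<phi>(a1, 1) a2\<close> equals \<open>a\<close>, since it has the same pairings as \<open>a\<close>.\<close>

lemma hmul_r: "a \<in> carrier A \<Longrightarrow> a' \<in> carrier A \<Longrightarrow>
    hmul (pure B A \<one>\<^bsub>B\<^esub> a) (pure B A \<one>\<^bsub>B\<^esub> a') = pure B A \<one>\<^bsub>B\<^esub> (a \<otimes>\<^bsub>A\<^esub> a')"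
proof -
  assume a: "a \<in> carrier A" and a': "a' \<in> carrier A"
  have b: "bilin A A A (\<lambda>a1 a2. \<phi> a1 \<one>\<^bsub>B\<^esub> \<odot>\<^bsub>A\<^esub> a2)" by (rule bilin_functional[OF mA mA \<phi>2[OF oneB]])
  have counit: "tlift A (\<lambda>a1 a2. \<phi> a1 \<one>\<^bsub>B\<^esub> \<odot>\<^bsub>A\<^esub> a2) (dA a) = a"
  proof (rule eqA[OF lin_closed[OF lin_tlift[OF mA mA mA b] dA[OF a]] a])
    fix y assume y: "y \<in> carrier B"
    have "\<phi> (tlift A (\<lambda>a1 a2. \<phi> a1 \<one>\<^bsub>B\<^esub> \<odot>\<^bsub>A\<^esub> a2) (dA a)) y = tlift CC (\<lambda>a1 a2. \<phi> (\<phi> a1 \<one>\<^bsub>B\<^esub> \<odot>\<^bsub>A\<^esub> a2) y) (dA a)"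
      by (rule tlift_comp[OF mA mA mA module_CC b \<phi>2[OF y] dA[OF a]])
    also have "\<dots> = tlift CC (\<lambda>a1 a2. \<phi> a1 \<one>\<^bsub>B\<^esub> * \<phi> a2 y) (dA a)"
      by (rule tlift_cong[OF mA mA module_CC _ _ dA[OF a]]) (use y in \<open>auto simp: lin_smult[OF \<phi>2]\<close>)
    also have "\<dots> = \<phi> a y" using \<phi>_multB[OF a oneB y] alg_one(1)[OF B y] by simp
    finally show "\<phi> (tlift A (\<lambda>a1 a2. \<phi> a1 \<one>\<^bsub>B\<^esub> \<odot>\<^bsub>A\<^esub> a2) (dA a)) y = \<phi> a y" .
  qed
  have L: "lin A T (\<lambda>y. pure B A \<one>\<^bsub>B\<^esub> (y \<otimes>\<^bsub>A\<^esub> a'))" by (intro lin_pure_r nalg_lin2[OF nA] oneB a')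
  have "hmul (pure B A \<one>\<^bsub>B\<^esub> a) (pure B A \<one>\<^bsub>B\<^esub> a') = hcore \<one>\<^bsub>B\<^esub> a \<one>\<^bsub>B\<^esub> a'"
    by (rule hmul_pure[OF oneB a oneB a'])
  also have "\<dots> = tlift T (\<lambda>a1 a2. pure B A \<one>\<^bsub>B\<^esub> ((\<phi> a1 \<one>\<^bsub>B\<^esub> \<odot>\<^bsub>A\<^esub> a2) \<otimes>\<^bsub>A\<^esub> a')) (dA a)"
    unfolding hcore_def
  proof (rule tlift_cong[OF mA mA mT bilin_closed[OF bilin_hcore_inner[OF oneB oneB a']] _ dA[OF a]])
    fix a1 a2 assume *: "a1 \<in> carrier A" "a2 \<in> carrier A"
    then show "pure B A (\<one>\<^bsub>B\<^esub> \<otimes>\<^bsub>B\<^esub> act a1 \<one>\<^bsub>B\<^esub>) (a2 \<otimes>\<^bsub>A\<^esub> a') = pure B A \<one>\<^bsub>B\<^esub> ((\<phi> a1 \<one>\<^bsub>B\<^esub> \<odot>\<^bsub>A\<^esub> a2) \<otimes>\<^bsub>A\<^esub> a')"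
      using a' by (simp add: act_on_one alg_one[OF B] oneB vs_smult[OF mB] lin_smult[OF L]
          lin_smult[OF bilin2[OF pT]] multA)
  qed
  also have "\<dots> = pure B A \<one>\<^bsub>B\<^esub> (a \<otimes>\<^bsub>A\<^esub> a')"
    unfolding tlift_comp[OF mA mA mA mT b L dA[OF a], symmetric] counit ..
  finally show ?thesis .
qed

lemma hcore_one: "b \<in> carrier B \<Longrightarrow> b' \<in> carrier B \<Longrightarrow> a' \<in> carrier A \<Longrightarrow>
    hcore b \<one>\<^bsub>A\<^esub> b' a' = pure B A (b \<otimes>\<^bsub>B\<^esub> b') a'"
  unfolding hcore_def dA_one
  by (subst tlift_pure[OF mA mA mT bilin_hcore_inner]) (simp_all add: oneA act_one alg_one[OF A])

lemma hmul_l: "b \<in> carrier B \<Longrightarrow> b' \<in> carrier B \<Longrightarrow>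
    hmul (pure B A b \<one>\<^bsub>A\<^esub>) (pure B A b' \<one>\<^bsub>A\<^esub>) = pure B A (b \<otimes>\<^bsub>B\<^esub> b') \<one>\<^bsub>A\<^esub>"
  by (simp add: hmul_pure oneA hcore_one)

lemma hmul_lr: "b \<in> carrier B \<Longrightarrow> a \<in> carrier A \<Longrightarrow>
    hmul (pure B A b \<one>\<^bsub>A\<^esub>) (pure B A \<one>\<^bsub>B\<^esub> a) = pure B A b a"
  by (simp add: hmul_pure oneA oneB hcore_one alg_one[OF B])

text \<open>The analogue of the Fock representation. Its restriction to the subalgebra generated by the
  negative generators yields the induced modules.\<close>

definition rep :: "('b \<times> 'a \<Rightarrow> complex) set \<Rightarrow> 'b \<Rightarrow> 'b" where
  "rep X x = tlift B (\<lambda>b a. b \<otimes>\<^bsub>B\<^esub> act a x) X"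

lemma bilin_rep_inner: "x \<in> carrier B \<Longrightarrow> bilin B A B (\<lambda>b a. b \<otimes>\<^bsub>B\<^esub> act a x)"
  by (intro bilinI) (auto intro!: lin_mult_l act2 nalg_lin2[OF nB] act_closed)

lemma bilin_rep: "bilin T B B rep"
  unfolding rep_def
  by (intro bilinI lin_tlift_param[OF mB mA mB bilin_rep_inner mB] lin_tlift[OF mB mA mB bilin_rep_inner])
     (auto intro!: lin_mult_l act1)

lemma rep_pure: "b \<in> carrier B \<Longrightarrow> a \<in> carrier A \<Longrightarrow> x \<in> carrier B \<Longrightarrow> rep (pure B A b a) x = b \<otimes>\<^bsub>B\<^esub> act a x"
  unfolding rep_def by (rule tlift_pure[OF mB mA mB bilin_rep_inner])

text \<open>On pure tensors this is the identity
  \<open>b ((\<Sum> a1.b') (a2.(a'.x))) = b (a.(b' (a'.x)))\<close>, which is the module algebra property.\<close>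

lemma rep_hmul:
  assumes X: "X \<in> carrier T" and Y: "Y \<in> carrier T" and x: "x \<in> carrier B"
  shows "rep (hmul X Y) x = rep X (rep Y x)"
proof -
  note R2 = bilin2[OF bilin_rep] and R1 = bilin1[OF bilin_rep]
  have core: "rep (hcore b a b' a') x = b \<otimes>\<^bsub>B\<^esub> act a (b' \<otimes>\<^bsub>B\<^esub> act a' x)"
    if ba: "b \<in> carrier B" "a \<in> carrier A" "b' \<in> carrier B" "a' \<in> carrier A" for b a b' a'
  proof -
    have "rep (hcore b a b' a') x = tlift B (\<lambda>a1 a2. rep (pure B A (b \<otimes>\<^bsub>B\<^esub> act a1 b') (a2 \<otimes>\<^bsub>A\<^esub> a')) x) (dA a)"
      unfolding hcore_def
      by (rule tlift_comp[OF mA mA mT mB bilin_hcore_inner R2[OF x] dA]) (use ba in auto)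
    also have "\<dots> = tlift B (\<lambda>a1 a2. b \<otimes>\<^bsub>B\<^esub> (act a1 b' \<otimes>\<^bsub>B\<^esub> act a2 (act a' x))) (dA a)"
      by (rule tlift_cong[OF mA mA mB _ _ dA[OF ba(2)]])
         (use ba x in \<open>simp_all add: rep_pure act_mult multA multB act_closed alg_assoc[OF B]\<close>)
    also have "\<dots> = b \<otimes>\<^bsub>B\<^esub> tlift B (\<lambda>a1 a2. act a1 b' \<otimes>\<^bsub>B\<^esub> act a2 (act a' x)) (dA a)"
      by (rule tlift_comp[OF mA mA mB mB bilin_act_times nalg_lin1[OF nB] dA, symmetric]) (use ba x act_closed in auto)
    also have "\<dots> = b \<otimes>\<^bsub>B\<^esub> act a (b' \<otimes>\<^bsub>B\<^esub> act a' x)"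
      using ba x by (simp add: act_times act_closed)
    finally show ?thesis .
  qed
  show ?thesis
  proof (rule lin_eq_on_pure[OF mB mA lin_comp[OF bilin2[OF bilin_hmul Y] R2[OF x]] R2[OF bilin_closed[OF bilin_rep Y x]] _ X])
    fix b a assume ba: "b \<in> carrier B" "a \<in> carrier A"
    note p = pure_carrier[OF mB mA ba]
    show "rep (hmul (pure B A b a) Y) x = rep (pure B A b a) (rep Y x)"
    proof (rule lin_eq_on_pure[OF mB mA lin_comp[OF bilin1[OF bilin_hmul p] R2[OF x]] lin_comp[OF R2[OF x] R1[OF p]] _ Y])
      fix b' a' assume ba': "b' \<in> carrier B" "a' \<in> carrier A"
      then show "rep (hmul (pure B A b a) (pure B A b' a')) x = rep (pure B A b a) (rep (pure B A b' a') x)"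
        using ba x by (simp add: hmul_pure core rep_pure act_closed multB)
    qed
  qed
qed

end

section \<open>Torus elements and simple generators\<close>

text \<open>The shape of the quantized Borel algebras: \<open>t\<close>, \<open>t'\<close> are the torus elements, \<open>e\<close>, \<open>f\<close> the simple
  generators, \<open>\<beta> i\<close> stands for \<open>- \<alpha> i\<close> and \<open>\<kappa> i\<close> for \<open>q\<^sub>i\<^sup>-\<^sup>1 - q\<^sub>i\<close>, whose inverse is the value of the
  pairing at \<open>e i\<close> and \<open>f i\<close>. If \<open>\<kappa> i\<close> vanishes, this value is \<open>inverse 0 = 0\<close>; then \<open>e i\<close> and \<open>f i\<close>
  vanish by nondegeneracy, and the statements below hold for this index because all terms vanish.\<close>

locale hopf_gens = hopf_pair A B \<phi> dA dB
  for A :: "'a calg" and B :: "'b calg" and \<phi> dA dB +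
  fixes I :: "nat set" and \<Lambda> :: "'w set" and t :: "'w \<Rightarrow> 'a" and t' :: "'w \<Rightarrow> 'b"
    and e :: "nat \<Rightarrow> 'a" and f :: "nat \<Rightarrow> 'b" and \<kappa> :: "nat \<Rightarrow> complex" and \<alpha> \<beta> :: "nat \<Rightarrow> 'w"
  assumes t: "\<And>l. l \<in> \<Lambda> \<Longrightarrow> t l \<in> carrier A" and t': "\<And>l. l \<in> \<Lambda> \<Longrightarrow> t' l \<in> carrier B"
    and e: "\<And>i. i \<in> I \<Longrightarrow> e i \<in> carrier A" and f: "\<And>i. i \<in> I \<Longrightarrow> f i \<in> carrier B"
    and \<alpha>: "\<And>i. i \<in> I \<Longrightarrow> \<alpha> i \<in> \<Lambda>" and \<beta>: "\<And>i. i \<in> I \<Longrightarrow> \<beta> i \<in> \<Lambda>"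
    and dA_t: "\<And>l. l \<in> \<Lambda> \<Longrightarrow> dA (t l) = pure A A (t l) (t l)"
    and dA_e: "\<And>i. i \<in> I \<Longrightarrow> dA (e i) = pure A A (e i) (t (\<beta> i)) \<oplus>\<^bsub>tensor A A\<^esub> pure A A \<one>\<^bsub>A\<^esub> (e i)"
    and dB_t': "\<And>l. l \<in> \<Lambda> \<Longrightarrow> dB (t' l) = pure B B (t' l) (t' l)"
    and dB_f: "\<And>i. i \<in> I \<Longrightarrow> dB (f i) = pure B B (f i) \<one>\<^bsub>B\<^esub> \<oplus>\<^bsub>tensor B B\<^esub> pure B B (t' (\<alpha> i)) (f i)"
    and \<phi>_t_one: "\<And>l. l \<in> \<Lambda> \<Longrightarrow> \<phi> (t l) \<one>\<^bsub>B\<^esub> = 1" and \<phi>_one_t': "\<And>l. l \<in> \<Lambda> \<Longrightarrow> \<phi> \<one>\<^bsub>A\<^esub> (t' l) = 1"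
    and \<phi>_e_one: "\<And>i. i \<in> I \<Longrightarrow> \<phi> (e i) \<one>\<^bsub>B\<^esub> = 0" and \<phi>_one_f: "\<And>i. i \<in> I \<Longrightarrow> \<phi> \<one>\<^bsub>A\<^esub> (f i) = 0"
    and \<phi>_e_t': "\<And>i l. i \<in> I \<Longrightarrow> l \<in> \<Lambda> \<Longrightarrow> \<phi> (e i) (t' l) = 0"
    and \<phi>_t_f: "\<And>i l. i \<in> I \<Longrightarrow> l \<in> \<Lambda> \<Longrightarrow> \<phi> (t l) (f i) = 0"
    and \<phi>_e_f: "\<And>i j. i \<in> I \<Longrightarrow> j \<in> I \<Longrightarrow> \<phi> (e i) (f j) = (if i = j then inverse (\<kappa> i) else 0)"
    and t_inv: "\<And>i. i \<in> I \<Longrightarrow> t (\<alpha> i) \<otimes>\<^bsub>A\<^esub> t (\<beta> i) = \<one>\<^bsub>A\<^esub>" "\<And>i. i \<in> I \<Longrightarrow> t (\<beta> i) \<otimes>\<^bsub>A\<^esub> t (\<alpha> i) = \<one>\<^bsub>A\<^esub>"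
    and t_comm: "\<And>l m. l \<in> \<Lambda> \<Longrightarrow> m \<in> \<Lambda> \<Longrightarrow> t l \<otimes>\<^bsub>A\<^esub> t m = t m \<otimes>\<^bsub>A\<^esub> t l"
    and t_e: "\<And>l i. l \<in> \<Lambda> \<Longrightarrow> i \<in> I \<Longrightarrow> \<exists>c. c \<noteq> 0 \<and> t l \<otimes>\<^bsub>A\<^esub> e i = c \<odot>\<^bsub>A\<^esub> (e i \<otimes>\<^bsub>A\<^esub> t l)"
    and t'_f: "\<And>l i. l \<in> \<Lambda> \<Longrightarrow> i \<in> I \<Longrightarrow> \<exists>c. t' l \<otimes>\<^bsub>B\<^esub> f i = c \<odot>\<^bsub>B\<^esub> (f i \<otimes>\<^bsub>B\<^esub> t' l)"
    and genA: "\<And>x. x \<in> carrier A \<Longrightarrow> x \<in> carrier (subalg A (e ` I \<union> t ` \<Lambda>))"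
    and genB: "\<And>x. x \<in> carrier B \<Longrightarrow> x \<in> carrier (subalg B (f ` I \<union> t' ` \<Lambda>))"
begin

lemmas cA = multA oneA vs_add[OF mA] vs_smult[OF mA]
lemmas cB = multB oneB vs_add[OF mB] vs_smult[OF mB]
lemmas ppA = bilin_pure[OF mA mA]
lemmas pcA = pure_carrier[OF mA mA] and pcB = pure_carrier[OF mB mB]

lemma subA: "e ` I \<union> t ` \<Lambda> \<subseteq> carrier A" and subB: "f ` I \<union> t' ` \<Lambda> \<subseteq> carrier B"
  using e f t t' by auto

definition e' :: "nat \<Rightarrow> 'a" where "e' i = \<kappa> i \<odot>\<^bsub>A\<^esub> (t (\<alpha> i) \<otimes>\<^bsub>A\<^esub> e i)"

lemma e'_closed [simp]: "i \<in> I \<Longrightarrow> e' i \<in> carrier A"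
  by (simp add: e'_def cA t e \<alpha>)

lemma dA_e':
  assumes i: "i \<in> I"
  shows "dA (e' i) = pure A A (e' i) \<one>\<^bsub>A\<^esub> \<oplus>\<^bsub>tensor A A\<^esub> pure A A (t (\<alpha> i)) (e' i)"
proof -
  note c = t[OF \<alpha>[OF i]] t[OF \<beta>[OF i]] e[OF i] cA
  note AA = alg_tensor[OF A A]
  have "dA (t (\<alpha> i) \<otimes>\<^bsub>A\<^esub> e i) =
      pure A A (t (\<alpha> i)) (t (\<alpha> i)) \<otimes>\<^bsub>tensor A A\<^esub> (pure A A (e i) (t (\<beta> i)) \<oplus>\<^bsub>tensor A A\<^esub> pure A A \<one>\<^bsub>A\<^esub> (e i))"
    using c i by (simp add: dA_mult dA_t dA_e \<alpha>)
  also have "\<dots> = pure A A (t (\<alpha> i) \<otimes>\<^bsub>A\<^esub> e i) \<one>\<^bsub>A\<^esub> \<oplus>\<^bsub>tensor A A\<^esub> pure A A (t (\<alpha> i)) (t (\<alpha> i) \<otimes>\<^bsub>A\<^esub> e i)"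
    using c i by (simp add: lin_add[OF nalg_lin1[OF algD(1)[OF AA(1)]]] pcA AA(2) t_inv alg_one[OF A])
  finally show ?thesis
    unfolding e'_def using c
    by (simp add: lin_smult[OF lin_dA] vs_rdist[OF mAA] pcA lin_smult[OF bilin1[OF ppA]] lin_smult[OF bilin2[OF ppA]])
qed

lemma \<phi>_mult_f:
  assumes "a \<in> carrier A" "a' \<in> carrier A" "j \<in> I"
  shows "\<phi> (a \<otimes>\<^bsub>A\<^esub> a') (f j) = \<phi> a \<one>\<^bsub>B\<^esub> * \<phi> a' (f j) + \<phi> a (f j) * \<phi> a' (t' (\<alpha> j))"
proof -
  note b = bilin_\<phi>\<phi>B[OF assms(1,2)]
  show ?thesis
    using assms f[OF assms(3)] t'[OF \<alpha>[OF assms(3)]]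
    by (simp add: \<phi>_multA dB_f lin_add[OF lin_tlift[OF mB mB module_CC b]] pcB oneB tlift_pure[OF mB mB module_CC b])
qed

lemma \<phi>_mult_t':
  assumes "a \<in> carrier A" "a' \<in> carrier A" "l \<in> \<Lambda>"
  shows "\<phi> (a \<otimes>\<^bsub>A\<^esub> a') (t' l) = \<phi> a (t' l) * \<phi> a' (t' l)"
  using assms t'[OF assms(3)]
  by (simp add: \<phi>_multA dB_t' tlift_pure[OF mB mB module_CC bilin_\<phi>\<phi>B[OF assms(1,2)]])

lemma \<phi>_mult_one:
  assumes "a \<in> carrier A" "a' \<in> carrier A"
  shows "\<phi> (a \<otimes>\<^bsub>A\<^esub> a') \<one>\<^bsub>B\<^esub> = \<phi> a \<one>\<^bsub>B\<^esub> * \<phi> a' \<one>\<^bsub>B\<^esub>"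
  using assms by (simp add: \<phi>_multA dB_one oneB tlift_pure[OF mB mB module_CC bilin_\<phi>\<phi>B[OF assms(1,2)]])

lemma \<phi>_one_mult:
  assumes "b \<in> carrier B" "b' \<in> carrier B"
  shows "\<phi> \<one>\<^bsub>A\<^esub> (b \<otimes>\<^bsub>B\<^esub> b') = \<phi> \<one>\<^bsub>A\<^esub> b * \<phi> \<one>\<^bsub>A\<^esub> b'"
  using assms by (simp add: \<phi>_multB dA_one oneA tlift_pure[OF mA mA module_CC bilin_\<phi>\<phi>A[OF assms(1,2)]])

definition \<delta> :: "nat \<Rightarrow> nat \<Rightarrow> complex" where "\<delta> i j = (if i = j then \<kappa> i * inverse (\<kappa> i) else 0)"
definition \<chi> :: "nat \<Rightarrow> nat \<Rightarrow> complex" where "\<chi> i j = \<phi> (t (\<alpha> i)) (t' (\<alpha> j))"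

lemma \<phi>_e':
  assumes i: "i \<in> I"
  shows "j \<in> I \<Longrightarrow> \<phi> (e' i) (f j) = \<delta> i j" "l \<in> \<Lambda> \<Longrightarrow> \<phi> (e' i) (t' l) = 0" "\<phi> (e' i) \<one>\<^bsub>B\<^esub> = 0"
  unfolding e'_def using i
  by (simp_all add: lin_smult[OF \<phi>2] cA t e \<alpha> f t' oneB \<phi>_mult_f \<phi>_mult_t' \<phi>_mult_one \<phi>_t_one \<phi>_t_f \<phi>_e_f \<phi>_e_t' \<phi>_e_one \<delta>_def)

lemma act_f:
  assumes "a \<in> carrier A" "j \<in> I"
  shows "act a (f j) = \<phi> a (f j) \<odot>\<^bsub>B\<^esub> \<one>\<^bsub>B\<^esub> \<oplus>\<^bsub>B\<^esub> \<phi> a (t' (\<alpha> j)) \<odot>\<^bsub>B\<^esub> f j"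
  using assms f[OF assms(2)] t'[OF \<alpha>[OF assms(2)]] unfolding act_def
  by (simp add: dB_f lin_add[OF lin_tlift[OF mB mB mB bilin_act_inner]] pcB oneB tlift_pure[OF mB mB mB bilin_act_inner])

lemma act_t_mult:
  assumes "l \<in> \<Lambda>" "b \<in> carrier B" "x \<in> carrier B"
  shows "act (t l) (b \<otimes>\<^bsub>B\<^esub> x) = act (t l) b \<otimes>\<^bsub>B\<^esub> act (t l) x"
  using assms by (simp add: act_times t dA_t tlift_pure[OF mA mA mB bilin_act_times])

lemma act_e'_mult:
  assumes "i \<in> I" "b \<in> carrier B" "x \<in> carrier B"
  shows "act (e' i) (b \<otimes>\<^bsub>B\<^esub> x) = act (e' i) b \<otimes>\<^bsub>B\<^esub> x \<oplus>\<^bsub>B\<^esub> act (t (\<alpha> i)) b \<otimes>\<^bsub>B\<^esub> act (e' i) x"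
  using assms t[OF \<alpha>[OF assms(1)]]
  by (simp add: act_times dA_e' lin_add[OF lin_tlift[OF mA mA mB bilin_act_times]] pcA oneA
      tlift_pure[OF mA mA mB bilin_act_times] act_one)

lemma act_t_f: "l \<in> \<Lambda> \<Longrightarrow> j \<in> I \<Longrightarrow> act (t l) (f j) = \<phi> (t l) (t' (\<alpha> j)) \<odot>\<^bsub>B\<^esub> f j"
  by (simp add: act_f t \<phi>_t_f cB vs_szero[OF mB] vs_l_zero[OF mB] f)

lemma act_e'_f: "i \<in> I \<Longrightarrow> j \<in> I \<Longrightarrow> act (e' i) (f j) = \<delta> i j \<odot>\<^bsub>B\<^esub> \<one>\<^bsub>B\<^esub>"
  by (simp add: act_f \<phi>_e' \<alpha> cB vs_szero[OF mB] vs_r_zero[OF mB] f)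

text \<open>The normalized generators act by skew derivations, because their coproduct has \<open>e' i \<otimes> 1\<close> as first
  term and a torus element next to \<open>e' i\<close> in the second.\<close>

lemma act_e'_f_mult:
  assumes "i \<in> I" "j \<in> I" "x \<in> carrier B"
  shows "act (e' i) (f j \<otimes>\<^bsub>B\<^esub> x) = \<delta> i j \<odot>\<^bsub>B\<^esub> x \<oplus>\<^bsub>B\<^esub> \<chi> i j \<odot>\<^bsub>B\<^esub> (f j \<otimes>\<^bsub>B\<^esub> act (e' i) x)"
  using assms act_closed[OF e'_closed[OF assms(1)] assms(3)]
  by (simp add: act_e'_mult f act_e'_f act_t_f \<alpha> \<chi>_def oneB lin_smult[OF nalg_lin2[OF nB]] alg_one[OF B])

text \<open>The only relation needed to move positive generators to the right of negative ones. It makes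
  every element of the quantized Weyl algebra act on a vector killed by all \<open>e' i\<close> as it does on \<open>1 \<otimes> v\<close>.\<close>

lemma weyl_relation:
  assumes "i \<in> I" "j \<in> I"
  shows "hmul (pure B A \<one>\<^bsub>B\<^esub> (e' i)) (pure B A (f j) \<one>\<^bsub>A\<^esub>) =
     \<delta> i j \<odot>\<^bsub>T\<^esub> pure B A \<one>\<^bsub>B\<^esub> \<one>\<^bsub>A\<^esub> \<oplus>\<^bsub>T\<^esub> \<chi> i j \<odot>\<^bsub>T\<^esub> hmul (pure B A (f j) \<one>\<^bsub>A\<^esub>) (pure B A \<one>\<^bsub>B\<^esub> (e' i))"
proof -
  note c = e'_closed[OF assms(1)] f[OF assms(2)] oneA oneB t[OF \<alpha>[OF assms(1)]]
  note b = bilin_hcore_inner[OF c(4,2,3)]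
  have "hmul (pure B A \<one>\<^bsub>B\<^esub> (e' i)) (pure B A (f j) \<one>\<^bsub>A\<^esub>) =
     pure B A (act (e' i) (f j)) \<one>\<^bsub>A\<^esub> \<oplus>\<^bsub>T\<^esub> pure B A (act (t (\<alpha> i)) (f j)) (e' i)"
    using c assms act_closed[OF c(1,2)] act_closed[OF c(5,2)]
    by (simp add: hmul_pure hcore_def dA_e' lin_add[OF lin_tlift[OF mA mA mT b]] pcA
      tlift_pure[OF mA mA mT b] alg_one[OF A] alg_one[OF B])
  then show ?thesis
    using c assms by (simp add: act_e'_f act_t_f \<alpha> \<chi>_def lin_smult[OF bilin2[OF pT]] cB hmul_lr)
qed

subsection \<open>The subalgebras of positive and negative generators\<close>

abbreviation "E \<equiv> subalg A (e' ` I)"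
abbreviation "M \<equiv> subalg B (f ` I)"

lemma genE: "e' ` I \<subseteq> carrier A" and genM: "f ` I \<subseteq> carrier B" using f by auto

lemmas E_sub = subalg_sub[OF nA genE] and M_sub = subalg_sub[OF nB genM]
lemmas E_gen = subalg_gen[OF nA genE] and M_gen = subalg_gen[OF nB genM]
lemmas E_alg = alg_subalg[OF A genE] and M_alg = alg_subalg[OF B genM]
lemmas E_induct = subalg_induct[OF nA genE, consumes 1, case_names gen one add smult mult]
lemmas M_induct = subalg_induct[OF nB genM, consumes 1, case_names gen one add smult mult]

lemma E_closed: "\<one>\<^bsub>A\<^esub> \<in> carrier E" "x \<in> carrier E \<Longrightarrow> y \<in> carrier E \<Longrightarrow> x \<oplus>\<^bsub>A\<^esub> y \<in> carrier E"
  "x \<in> carrier E \<Longrightarrow> y \<in> carrier E \<Longrightarrow> x \<otimes>\<^bsub>A\<^esub> y \<in> carrier E" "x \<in> carrier E \<Longrightarrow> c \<odot>\<^bsub>A\<^esub> x \<in> carrier E"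
  using subalgebra_subalg[OF nA genE] by (auto simp: subalgebra_def)

lemma M_closed: "\<one>\<^bsub>B\<^esub> \<in> carrier M" "x \<in> carrier M \<Longrightarrow> y \<in> carrier M \<Longrightarrow> x \<oplus>\<^bsub>B\<^esub> y \<in> carrier M"
  "x \<in> carrier M \<Longrightarrow> y \<in> carrier M \<Longrightarrow> x \<otimes>\<^bsub>B\<^esub> y \<in> carrier M" "x \<in> carrier M \<Longrightarrow> c \<odot>\<^bsub>B\<^esub> x \<in> carrier M"
  using subalgebra_subalg[OF nB genM] by (auto simp: subalgebra_def)

lemma f_M: "i \<in> I \<Longrightarrow> f i \<in> carrier M" and e'_E: "i \<in> I \<Longrightarrow> e' i \<in> carrier E"
  by (auto intro: M_gen E_gen)

lemma act_t_M:
  assumes "l \<in> \<Lambda>" and x: "x \<in> carrier M"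
  shows "act (t l) x \<in> carrier M"
  using x
  by (induction rule: M_induct)
     (auto simp: act_t_f act_on_one act_t_mult assms(1) t M_sub lin_add[OF act1] lin_smult[OF act1]
       intro!: M_closed f_M)

lemma act_e'_M:
  assumes "i \<in> I" and x: "x \<in> carrier M"
  shows "act (e' i) x \<in> carrier M"
  using x
  by (induction rule: M_induct)
     (auto simp: act_e'_f act_on_one act_e'_mult assms(1) t M_sub lin_add[OF act1] lin_smult[OF act1]
       intro!: M_closed f_M act_t_M \<alpha>)

lemma act_M:
  assumes a: "a \<in> carrier E" and x: "x \<in> carrier M"
  shows "act a x \<in> carrier M"
  using a x
proof (induction arbitrary: x rule: E_induct)
  case (mult a b)
  then show ?case by (simp add: act_mult E_sub M_sub)
qed (auto simp: act_e'_M act_one M_sub E_sub lin_add[OF act2] lin_smult[OF act2] intro!: M_closed)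

text \<open>Torus elements are grouplike, so the set of \<open>x\<close> with this property is a subalgebra; it contains
  the \<open>f i\<close> since \<open>\<phi>(t l, 1) = 1\<close> and \<open>\<phi>(t l, f i) = 0\<close>. The next lemma is the mirror image.\<close>

lemma \<phi>_t_mult:
  assumes l: "l \<in> \<Lambda>" and x: "x \<in> carrier M" and a: "a \<in> carrier A"
  shows "\<phi> (t l \<otimes>\<^bsub>A\<^esub> a) x = \<phi> a x"
  using x a
proof (induction arbitrary: a rule: M_induct)
  case (gen s)
  then show ?case by (auto simp: \<phi>_mult_f t l \<phi>_t_one \<phi>_t_f)
next
  case one
  then show ?case by (simp add: \<phi>_mult_one t l \<phi>_t_one)
next
  case (mult x y)
  note xy = M_sub[OF mult(1)] M_sub[OF mult(2)]
  note tl = t[OF l]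
  let ?g = "\<lambda>p q. tlift CC (\<lambda>p' q'. \<phi> (p \<otimes>\<^bsub>A\<^esub> p') x * \<phi> (q \<otimes>\<^bsub>A\<^esub> q') y) (dA a)"
  have g: "bilin A A CC ?g"
    by (intro bilinI lin_tlift_param[OF mA mA module_CC _ _ _ dA[OF mult(5)]])
       (auto intro!: mA bilin_functionals[OF mA mA] lin_comp[OF nalg_lin1[OF nA] \<phi>2]
         lin_comp[OF nalg_lin2[OF nA] \<phi>2] lin_mult_CC lin_mult_CC' xy)
  have "\<phi> (t l \<otimes>\<^bsub>A\<^esub> a) (x \<otimes>\<^bsub>B\<^esub> y) = tlift CC (\<lambda>p q. \<phi> p x * \<phi> q y) (pure A A (t l) (t l) \<otimes>\<^bsub>tensor A A\<^esub> dA a)"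
    using xy mult(5) tl by (simp add: \<phi>_multB multA dA_mult dA_t l)
  also have "\<dots> = tlift CC ?g (pure A A (t l) (t l))"
    by (rule tlift_mult[OF A A module_CC bilin_\<phi>\<phi>A[OF xy] pcA[OF tl tl] dA[OF mult(5)]])
  also have "\<dots> = ?g (t l) (t l)" by (rule tlift_pure[OF mA mA module_CC g tl tl])
  also have "\<dots> = tlift CC (\<lambda>p' q'. \<phi> p' x * \<phi> q' y) (dA a)"
    by (rule tlift_cong[OF mA mA module_CC _ _ dA[OF mult(5)]]) (simp_all add: mult.IH)
  also have "\<dots> = \<phi> a (x \<otimes>\<^bsub>B\<^esub> y)" using xy mult(5) by (simp add: \<phi>_multB)
  finally show ?case .
qed (use t[OF l] in \<open>simp_all add: lin_add[OF \<phi>1] lin_smult[OF \<phi>1] M_sub multA\<close>)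

lemma \<phi>_mult_t'_right:
  assumes l: "l \<in> \<Lambda>" and a: "a \<in> carrier E" and b: "b \<in> carrier B"
  shows "\<phi> a (b \<otimes>\<^bsub>B\<^esub> t' l) = \<phi> a b"
  using a b
proof (induction arbitrary: b rule: E_induct)
  case (gen s)
  then obtain i where i: "i \<in> I" "s = e' i" by blast
  note c = t[OF \<alpha>[OF i(1)]] oneA e'_closed[OF i(1)] t'[OF l]
  note bb = bilin_\<phi>\<phi>A[OF gen(2) t'[OF l]]
  show ?case
    using c i gen(2)
    by (simp add: \<phi>_multB dA_e' lin_add[OF lin_tlift[OF mA mA module_CC bb]] pcA tlift_pure[OF mA mA module_CC bb]
      \<phi>_one_t' \<phi>_e' l)
next
  case one
  then show ?case by (simp add: \<phi>_one_mult t' l \<phi>_one_t')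
next
  case (mult x y)
  note xy = E_sub[OF mult(1)] E_sub[OF mult(2)]
  note tl = t'[OF l]
  let ?f = "\<lambda>p q. \<phi> x q * \<phi> y p"
  let ?g = "\<lambda>p' q'. ?f (p' \<otimes>\<^bsub>B\<^esub> t' l) (q' \<otimes>\<^bsub>B\<^esub> t' l)"
  have g0: "bilin B B CC (\<lambda>p' q'. ?f (p \<otimes>\<^bsub>B\<^esub> p') (q \<otimes>\<^bsub>B\<^esub> q'))" if "p \<in> carrier B" "q \<in> carrier B" for p q
    using that by (intro bilinI lin_mult_CC lin_mult_CC') (auto intro!: lin_comp[OF nalg_lin1[OF nB] \<phi>1] xy)
  have "\<phi> (x \<otimes>\<^bsub>A\<^esub> y) (b \<otimes>\<^bsub>B\<^esub> t' l) = tlift CC ?f (dB b \<otimes>\<^bsub>tensor B B\<^esub> pure B B (t' l) (t' l))"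
    using xy mult(5) tl by (simp add: \<phi>_multA multB dB_mult dB_t' l)
  also have "\<dots> = tlift CC (\<lambda>p q. tlift CC (\<lambda>p' q'. ?f (p \<otimes>\<^bsub>B\<^esub> p') (q \<otimes>\<^bsub>B\<^esub> q')) (pure B B (t' l) (t' l))) (dB b)"
    by (rule tlift_mult[OF B B module_CC bilin_\<phi>\<phi>B[OF xy] dB[OF mult(5)] pcB[OF tl tl]])
  also have "\<dots> = tlift CC ?f (dB b)"
    by (rule tlift_cong[OF mB mB module_CC _ _ dB[OF mult(5)]])
       (simp_all add: tlift_pure[OF mB mB module_CC g0] tl mult.IH)
  also have "\<dots> = \<phi> (x \<otimes>\<^bsub>A\<^esub> y) b" using xy mult(5) by (simp add: \<phi>_multA)
  finally show ?case .
qed (use t'[OF l] in \<open>simp_all add: lin_add[OF \<phi>2] lin_smult[OF \<phi>2] E_sub multB\<close>)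

lemma E_t_comm:
  assumes l: "l \<in> \<Lambda>" and a: "a \<in> carrier E"
  shows "\<exists>a'\<in>carrier E. a \<otimes>\<^bsub>A\<^esub> t l = t l \<otimes>\<^bsub>A\<^esub> a'"
  using a
proof (induction rule: E_induct)
  case (gen s)
  then obtain i where i: "i \<in> I" "s = e' i" by blast
  note c = t[OF \<alpha>[OF i(1)]] e[OF i(1)] t[OF l] e'_closed[OF i(1)] cA
  obtain d where d: "d \<noteq> 0" "t l \<otimes>\<^bsub>A\<^esub> e i = d \<odot>\<^bsub>A\<^esub> (e i \<otimes>\<^bsub>A\<^esub> t l)" using t_e[OF l i(1)] by blast
  have "t l \<otimes>\<^bsub>A\<^esub> e' i = \<kappa> i \<odot>\<^bsub>A\<^esub> (t l \<otimes>\<^bsub>A\<^esub> (t (\<alpha> i) \<otimes>\<^bsub>A\<^esub> e i))"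
    unfolding e'_def using c by (simp add: lin_smult[OF nalg_lin1[OF nA]])
  also have "t l \<otimes>\<^bsub>A\<^esub> (t (\<alpha> i) \<otimes>\<^bsub>A\<^esub> e i) = (t (\<alpha> i) \<otimes>\<^bsub>A\<^esub> t l) \<otimes>\<^bsub>A\<^esub> e i"
    using c t_comm[OF l \<alpha>[OF i(1)]] alg_assoc[OF A c(3) c(1) c(2)] by simp
  also have "\<dots> = d \<odot>\<^bsub>A\<^esub> ((t (\<alpha> i) \<otimes>\<^bsub>A\<^esub> e i) \<otimes>\<^bsub>A\<^esub> t l)"
    using c d by (simp add: alg_assoc[OF A] lin_smult[OF nalg_lin1[OF nA]])
  also have "\<kappa> i \<odot>\<^bsub>A\<^esub> \<dots> = d \<odot>\<^bsub>A\<^esub> (e' i \<otimes>\<^bsub>A\<^esub> t l)"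
    unfolding e'_def using c by (simp add: lin_smult[OF nalg_lin2[OF nA]] vs_sassoc[OF mA] mult.commute)
  finally have "t l \<otimes>\<^bsub>A\<^esub> (inverse d \<odot>\<^bsub>A\<^esub> e' i) = inverse d \<odot>\<^bsub>A\<^esub> (d \<odot>\<^bsub>A\<^esub> (e' i \<otimes>\<^bsub>A\<^esub> t l))"
    using c by (simp add: lin_smult[OF nalg_lin1[OF nA]])
  also have "\<dots> = e' i \<otimes>\<^bsub>A\<^esub> t l" using c d by (simp add: vs_sassoc[OF mA] vs_sone[OF mA])
  finally show ?case using i by (intro bexI[of _ "inverse d \<odot>\<^bsub>A\<^esub> e' i"]) (auto intro: E_closed E_gen)
next
  case one
  then show ?case using t[OF l] by (intro bexI[of _ "\<one>\<^bsub>A\<^esub>"]) (auto simp: alg_one[OF A] E_closed)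
next
  case (add x y)
  then obtain x' y' where "x' \<in> carrier E" "y' \<in> carrier E" "x \<otimes>\<^bsub>A\<^esub> t l = t l \<otimes>\<^bsub>A\<^esub> x'" "y \<otimes>\<^bsub>A\<^esub> t l = t l \<otimes>\<^bsub>A\<^esub> y'"
    by blast
  then show ?case using t[OF l] add(1,2)
    by (intro bexI[of _ "x' \<oplus>\<^bsub>A\<^esub> y'"]) (auto simp: E_closed E_sub lin_add[OF nalg_lin1[OF nA]] lin_add[OF nalg_lin2[OF nA]])
next
  case (smult c x)
  then obtain x' where "x' \<in> carrier E" "x \<otimes>\<^bsub>A\<^esub> t l = t l \<otimes>\<^bsub>A\<^esub> x'" by blast
  then show ?case using t[OF l] smult(1)
    by (intro bexI[of _ "c \<odot>\<^bsub>A\<^esub> x'"]) (auto simp: E_closed E_sub lin_smult[OF nalg_lin1[OF nA]] lin_smult[OF nalg_lin2[OF nA]])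
next
  case (mult x y)
  then obtain x' y' where *: "x' \<in> carrier E" "y' \<in> carrier E" "x \<otimes>\<^bsub>A\<^esub> t l = t l \<otimes>\<^bsub>A\<^esub> x'" "y \<otimes>\<^bsub>A\<^esub> t l = t l \<otimes>\<^bsub>A\<^esub> y'"
    by blast
  note c = E_sub[OF *(1)] E_sub[OF *(2)] E_sub[OF mult(1)] E_sub[OF mult(2)] t[OF l]
  have "(x \<otimes>\<^bsub>A\<^esub> y) \<otimes>\<^bsub>A\<^esub> t l = (x \<otimes>\<^bsub>A\<^esub> t l) \<otimes>\<^bsub>A\<^esub> y'"
    using alg_assoc[OF A c(3) c(4) c(5)] alg_assoc[OF A c(3) c(5) c(2)] *(4) by metis
  also have "\<dots> = t l \<otimes>\<^bsub>A\<^esub> (x' \<otimes>\<^bsub>A\<^esub> y')" using c * by (simp add: alg_assoc[OF A])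
  finally show ?case using * by (intro bexI[of _ "x' \<otimes>\<^bsub>A\<^esub> y'"]) (auto simp: E_closed)
qed

lemma t'_M_comm:
  assumes l: "l \<in> \<Lambda>" and x: "x \<in> carrier M"
  shows "\<exists>x'\<in>carrier M. t' l \<otimes>\<^bsub>B\<^esub> x = x' \<otimes>\<^bsub>B\<^esub> t' l"
  using x
proof (induction rule: M_induct)
  case (gen s)
  then obtain i where i: "i \<in> I" "s = f i" by blast
  obtain d where d: "t' l \<otimes>\<^bsub>B\<^esub> f i = d \<odot>\<^bsub>B\<^esub> (f i \<otimes>\<^bsub>B\<^esub> t' l)" using t'_f[OF l i(1)] by blast
  then show ?case using i t'[OF l] f[OF i(1)]
    by (intro bexI[of _ "d \<odot>\<^bsub>B\<^esub> f i"]) (auto intro: M_closed M_gen simp: lin_smult[OF nalg_lin2[OF nB]])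
next
  case one
  then show ?case using t'[OF l] by (intro bexI[of _ "\<one>\<^bsub>B\<^esub>"]) (auto simp: alg_one[OF B] M_closed)
next
  case (add x y)
  then obtain x' y' where "x' \<in> carrier M" "y' \<in> carrier M" "t' l \<otimes>\<^bsub>B\<^esub> x = x' \<otimes>\<^bsub>B\<^esub> t' l" "t' l \<otimes>\<^bsub>B\<^esub> y = y' \<otimes>\<^bsub>B\<^esub> t' l"
    by blast
  then show ?case using t'[OF l] add(1,2)
    by (intro bexI[of _ "x' \<oplus>\<^bsub>B\<^esub> y'"]) (auto simp: M_closed M_sub lin_add[OF nalg_lin1[OF nB]] lin_add[OF nalg_lin2[OF nB]])
next
  case (smult c x)
  then obtain x' where "x' \<in> carrier M" "t' l \<otimes>\<^bsub>B\<^esub> x = x' \<otimes>\<^bsub>B\<^esub> t' l" by blast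
  then show ?case using t'[OF l] smult(1)
    by (intro bexI[of _ "c \<odot>\<^bsub>B\<^esub> x'"]) (auto simp: M_closed M_sub lin_smult[OF nalg_lin1[OF nB]] lin_smult[OF nalg_lin2[OF nB]])
next
  case (mult x y)
  then obtain x' y' where *: "x' \<in> carrier M" "y' \<in> carrier M" "t' l \<otimes>\<^bsub>B\<^esub> x = x' \<otimes>\<^bsub>B\<^esub> t' l" "t' l \<otimes>\<^bsub>B\<^esub> y = y' \<otimes>\<^bsub>B\<^esub> t' l"
    by blast
  note c = M_sub[OF *(1)] M_sub[OF *(2)] M_sub[OF mult(1)] M_sub[OF mult(2)] t'[OF l]
  have "t' l \<otimes>\<^bsub>B\<^esub> (x \<otimes>\<^bsub>B\<^esub> y) = (t' l \<otimes>\<^bsub>B\<^esub> x) \<otimes>\<^bsub>B\<^esub> y" using c by (simp add: alg_assoc[OF B])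
  also have "\<dots> = x' \<otimes>\<^bsub>B\<^esub> (t' l \<otimes>\<^bsub>B\<^esub> y)" using c * by (simp add: alg_assoc[OF B])
  also have "\<dots> = (x' \<otimes>\<^bsub>B\<^esub> y') \<otimes>\<^bsub>B\<^esub> t' l" using c * by (simp add: alg_assoc[OF B])
  finally show ?case using * by (intro bexI[of _ "x' \<otimes>\<^bsub>B\<^esub> y'"]) (auto simp: M_closed)
qed

text \<open>If \<open>\<kappa> i = 0\<close> then \<open>e i\<close> pairs to zero with all generators, hence with everything.\<close>

lemma e_via_e':
  assumes i: "i \<in> I"
  shows "e i = inverse (\<kappa> i) \<odot>\<^bsub>A\<^esub> (t (\<beta> i) \<otimes>\<^bsub>A\<^esub> e' i)"
proof (cases "\<kappa> i = 0")
  case True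
  have "\<phi> (e i) b = 0" if "b \<in> carrier B" for b
    using genB[OF that]
  proof (induction rule: subalg_induct[OF nB subB, consumes 1, case_names gen one add smult mult])
    case (mult x y)
    note xy = subalg_sub[OF nB subB mult(1)] subalg_sub[OF nB subB mult(2)]
    note b = bilin_\<phi>\<phi>A[OF xy]
    show ?case using i xy mult(3,4) t[OF \<beta>[OF i]]
      by (simp add: \<phi>_multB e dA_e lin_add[OF lin_tlift[OF mA mA module_CC b]] pcA tlift_pure[OF mA mA module_CC b] oneA)
  qed (use True i subalg_sub[OF nB subB] in \<open>auto simp: \<phi>_e_f \<phi>_e_t' \<phi>_e_one lin_add[OF \<phi>1] lin_smult[OF \<phi>1] e\<close>)
  then have "e i = \<zero>\<^bsub>A\<^esub>" using nondegA e[OF i] by blast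
  then show ?thesis using True i by (simp add: vs_szero[OF mA] multA t \<beta>)
next
  case False
  note c = t[OF \<alpha>[OF i]] t[OF \<beta>[OF i]] e[OF i] cA
  have "t (\<beta> i) \<otimes>\<^bsub>A\<^esub> e' i = \<kappa> i \<odot>\<^bsub>A\<^esub> ((t (\<beta> i) \<otimes>\<^bsub>A\<^esub> t (\<alpha> i)) \<otimes>\<^bsub>A\<^esub> e i)"
    unfolding e'_def using c by (simp add: lin_smult[OF nalg_lin1[OF nA]] alg_assoc[OF A])
  then show ?thesis using c False i by (simp add: t_inv alg_one[OF A] vs_sassoc[OF mA] vs_sone[OF mA])
qed

text \<open>The set \<open>?N\<close> of all \<open>m\<close> with \<open>\<phi>(a m, x) = 0\<close> for all \<open>a\<close> in \<open>E\<close> is closed under left multiplication by the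
  \<open>e' i\<close> and by torus elements: the latter can be moved through \<open>a\<close> and then dropped by \<open>\<phi>_t_mult\<close>. These elements
  generate \<open>A\<close>, so orthogonality to \<open>E\<close> implies orthogonality to \<open>A\<close>.\<close>

lemma nondeg_M:
  assumes x: "x \<in> carrier M" and z: "\<And>a. a \<in> carrier E \<Longrightarrow> \<phi> a x = 0"
  shows "x = \<zero>\<^bsub>B\<^esub>"
proof (rule nondegB[OF M_sub[OF x]])
  let ?N = "{m \<in> carrier A. \<forall>a\<in>carrier E. \<phi> (a \<otimes>\<^bsub>A\<^esub> m) x = 0}"
  have e'N: "e' i \<otimes>\<^bsub>A\<^esub> m \<in> ?N" if i: "i \<in> I" and m: "m \<in> ?N" for i m
    using m i by (auto simp: multA alg_assoc[OF A, symmetric] E_sub) (metis E_closed(3) E_gen imageI)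
  have tN: "t l \<otimes>\<^bsub>A\<^esub> m \<in> ?N" if l: "l \<in> \<Lambda>" and m: "m \<in> ?N" for l m
  proof -
    have "\<phi> (a \<otimes>\<^bsub>A\<^esub> (t l \<otimes>\<^bsub>A\<^esub> m)) x = 0" if a: "a \<in> carrier E" for a
    proof -
      obtain a' where a': "a' \<in> carrier E" "a \<otimes>\<^bsub>A\<^esub> t l = t l \<otimes>\<^bsub>A\<^esub> a'" using E_t_comm[OF l a] by blast
      then have "a \<otimes>\<^bsub>A\<^esub> (t l \<otimes>\<^bsub>A\<^esub> m) = t l \<otimes>\<^bsub>A\<^esub> (a' \<otimes>\<^bsub>A\<^esub> m)"
        using m t[OF l] E_sub[OF a] E_sub[OF a'(1)] by (auto simp: alg_assoc[OF A, symmetric])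
      then show ?thesis using m \<phi>_t_mult[OF l x] a'(1) E_sub multA by auto
    qed
    then show ?thesis using m t[OF l] multA by auto
  qed
  have smN: "c \<odot>\<^bsub>A\<^esub> m \<in> ?N" if "m \<in> ?N" for c m
    using that M_sub[OF x] by (auto simp: cA lin_smult[OF nalg_lin1[OF nA]] E_sub lin_smult[OF \<phi>2])
  have "\<forall>m\<in>?N. a \<otimes>\<^bsub>A\<^esub> m \<in> ?N" if "a \<in> carrier A" for a
    using genA[OF that]
  proof (induction rule: subalg_induct[OF nA subA, consumes 1, case_names gen one add smult mult])
    case (gen s)
    then consider i where "i \<in> I" "s = e i" | l where "l \<in> \<Lambda>" "s = t l" by blast
    then show ?case
    proof cases
      case 1
      show ?thesis
      proof
        fix m assume m: "m \<in> ?N"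
        have "s \<otimes>\<^bsub>A\<^esub> m = inverse (\<kappa> i) \<odot>\<^bsub>A\<^esub> (t (\<beta> i) \<otimes>\<^bsub>A\<^esub> (e' i \<otimes>\<^bsub>A\<^esub> m))"
          unfolding 1(2) using 1(1) m t[OF \<beta>[OF 1(1)]]
          by (subst e_via_e'[OF 1(1)]) (simp add: lin_smult[OF nalg_lin2[OF nA]] multA alg_assoc[OF A])
        then show "s \<otimes>\<^bsub>A\<^esub> m \<in> ?N" using smN[OF tN[OF \<beta>[OF 1(1)] e'N[OF 1(1) m]]] by simp
      qed
    qed (use tN in auto)
  next
    case (add a b)
    then show ?case
      using subalg_sub[OF nA subA add(1)] subalg_sub[OF nA subA add(2)] M_sub[OF x]
      by (auto simp: cA lin_add[OF nalg_lin1[OF nA]] lin_add[OF nalg_lin2[OF nA]] E_sub lin_add[OF \<phi>2])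
  next
    case (smult c a)
    then show ?case using subalg_sub[OF nA subA smult(1)] smN
      by (auto simp: lin_smult[OF nalg_lin2[OF nA]])
  next
    case (mult a b)
    show ?case
    proof
      fix m assume m: "m \<in> ?N"
      then have "(a \<otimes>\<^bsub>A\<^esub> b) \<otimes>\<^bsub>A\<^esub> m = a \<otimes>\<^bsub>A\<^esub> (b \<otimes>\<^bsub>A\<^esub> m)"
        using subalg_sub[OF nA subA mult(1)] subalg_sub[OF nA subA mult(2)] by (simp add: alg_assoc[OF A])
      then show "(a \<otimes>\<^bsub>A\<^esub> b) \<otimes>\<^bsub>A\<^esub> m \<in> ?N" using bspec[OF mult(3) bspec[OF mult(4) m]] by (simp only:)
    qed
  qed (auto simp: alg_one[OF A])
  moreover have "\<one>\<^bsub>A\<^esub> \<in> ?N" using z by (auto simp: oneA alg_one[OF A] E_sub)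
  moreover fix a assume a: "a \<in> carrier A"
  ultimately have "a \<otimes>\<^bsub>A\<^esub> \<one>\<^bsub>A\<^esub> \<in> ?N" by (rule_tac bspec[of ?N]) simp_all
  then have "\<phi> (\<one>\<^bsub>A\<^esub> \<otimes>\<^bsub>A\<^esub> (a \<otimes>\<^bsub>A\<^esub> \<one>\<^bsub>A\<^esub>)) x = 0" using E_closed(1) by fast
  then show "\<phi> a x = 0" using a by (simp add: alg_one[OF A])
qed

lemma nondeg_E:
  assumes a: "a \<in> carrier E" and z: "\<And>x. x \<in> carrier M \<Longrightarrow> \<phi> a x = 0"
  shows "a = \<zero>\<^bsub>A\<^esub>"
proof (rule nondegA[OF E_sub[OF a]])
  let ?N = "{m \<in> carrier B. \<forall>x\<in>carrier M. \<phi> a (m \<otimes>\<^bsub>B\<^esub> x) = 0}"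
  have fN: "m \<otimes>\<^bsub>B\<^esub> f i \<in> ?N" if i: "i \<in> I" and m: "m \<in> ?N" for i m
    using m i f[OF i] by (auto simp: multB alg_assoc[OF B] M_sub) (metis M_closed(3) M_gen imageI)
  have tN: "m \<otimes>\<^bsub>B\<^esub> t' l \<in> ?N" if l: "l \<in> \<Lambda>" and m: "m \<in> ?N" for l m
  proof -
    have "\<phi> a ((m \<otimes>\<^bsub>B\<^esub> t' l) \<otimes>\<^bsub>B\<^esub> x) = 0" if x: "x \<in> carrier M" for x
    proof -
      obtain x' where x': "x' \<in> carrier M" "t' l \<otimes>\<^bsub>B\<^esub> x = x' \<otimes>\<^bsub>B\<^esub> t' l" using t'_M_comm[OF l x] by blast
      then have "(m \<otimes>\<^bsub>B\<^esub> t' l) \<otimes>\<^bsub>B\<^esub> x = (m \<otimes>\<^bsub>B\<^esub> x') \<otimes>\<^bsub>B\<^esub> t' l"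
        using m t'[OF l] M_sub[OF x] M_sub[OF x'(1)] by (auto simp: alg_assoc[OF B])
      then show ?thesis using m \<phi>_mult_t'_right[OF l a] x'(1) M_sub multB by auto
    qed
    then show ?thesis using m t'[OF l] multB by auto
  qed
  have "\<forall>m\<in>?N. m \<otimes>\<^bsub>B\<^esub> b \<in> ?N" if "b \<in> carrier B" for b
    using genB[OF that]
  proof (induction rule: subalg_induct[OF nB subB, consumes 1, case_names gen one add smult mult])
    case (gen s)
    then show ?case using fN tN by blast
  next
    case (add x y)
    then show ?case
      using subalg_sub[OF nB subB add(1)] subalg_sub[OF nB subB add(2)] E_sub[OF a]
      by (auto simp: cB lin_add[OF nalg_lin1[OF nB]] lin_add[OF nalg_lin2[OF nB]] M_sub lin_add[OF \<phi>1])
  next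
    case (smult c x)
    then show ?case using subalg_sub[OF nB subB smult(1)] E_sub[OF a]
      by (auto simp: cB lin_smult[OF nalg_lin2[OF nB]] lin_smult[OF nalg_lin1[OF nB]] M_sub lin_smult[OF \<phi>1])
  next
    case (mult x y)
    show ?case
    proof
      fix m assume m: "m \<in> ?N"
      then have "m \<otimes>\<^bsub>B\<^esub> (x \<otimes>\<^bsub>B\<^esub> y) = (m \<otimes>\<^bsub>B\<^esub> x) \<otimes>\<^bsub>B\<^esub> y"
        using subalg_sub[OF nB subB mult(1)] subalg_sub[OF nB subB mult(2)] by (simp add: alg_assoc[OF B])
      then show "m \<otimes>\<^bsub>B\<^esub> (x \<otimes>\<^bsub>B\<^esub> y) \<in> ?N" using bspec[OF mult(4) bspec[OF mult(3) m]] by (simp only:)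
    qed
  qed (auto simp: alg_one[OF B])
  moreover have "\<one>\<^bsub>B\<^esub> \<in> ?N" using z by (auto simp: oneB alg_one[OF B] M_sub)
  moreover fix b assume b: "b \<in> carrier B"
  ultimately have "\<one>\<^bsub>B\<^esub> \<otimes>\<^bsub>B\<^esub> b \<in> ?N" by (rule_tac bspec[of ?N]) simp_all
  then have "\<phi> a ((\<one>\<^bsub>B\<^esub> \<otimes>\<^bsub>B\<^esub> b) \<otimes>\<^bsub>B\<^esub> \<one>\<^bsub>B\<^esub>) = 0" using M_closed(1) by fast
  then show "\<phi> a b = 0" using b by (simp add: alg_one[OF B])
qed

subsection \<open>Words in the generators\<close>

abbreviation "ew \<equiv> word A e'"
abbreviation "fw \<equiv> word B f"

lemma ew_A: "u \<in> lists I \<Longrightarrow> ew u \<in> carrier A" using word_closed[OF nA, of I e'] by simp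
lemma fw_B: "w \<in> lists I \<Longrightarrow> fw w \<in> carrier B" using word_closed[OF nB, of I f] f by simp

lemma ew_E: "u \<in> lists I \<Longrightarrow> ew u \<in> carrier E"
  by (induction u) (auto intro: E_closed E_gen)
lemma fw_M: "w \<in> lists I \<Longrightarrow> fw w \<in> carrier M"
  by (induction w) (auto intro: M_closed M_gen)

lemma ew_append: "u \<in> lists I \<Longrightarrow> v \<in> lists I \<Longrightarrow> ew (u @ v) = ew u \<otimes>\<^bsub>A\<^esub> ew v"
  by (rule word_append[OF A, of I]) auto

lemma E_word_induct [consumes 1, case_names word add smult]:
  assumes "a \<in> carrier E" "\<And>u. u \<in> lists I \<Longrightarrow> Q (ew u)"
    "\<And>x y. x \<in> carrier E \<Longrightarrow> y \<in> carrier E \<Longrightarrow> Q x \<Longrightarrow> Q y \<Longrightarrow> Q (x \<oplus>\<^bsub>A\<^esub> y)"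
    "\<And>c x. x \<in> carrier E \<Longrightarrow> Q x \<Longrightarrow> Q (c \<odot>\<^bsub>A\<^esub> x)"
  shows "Q a"
  by (rule subalg_word_induct[OF A _ assms(1), of Q]) (use assms(2-) in auto)

lemma M_word_induct [consumes 1, case_names word add smult]:
  assumes "x \<in> carrier M" "\<And>u. u \<in> lists I \<Longrightarrow> Q (fw u)"
    "\<And>x y. x \<in> carrier M \<Longrightarrow> y \<in> carrier M \<Longrightarrow> Q x \<Longrightarrow> Q y \<Longrightarrow> Q (x \<oplus>\<^bsub>B\<^esub> y)"
    "\<And>c x. x \<in> carrier M \<Longrightarrow> Q x \<Longrightarrow> Q (c \<odot>\<^bsub>B\<^esub> x)"
  shows "Q x"
  by (rule subalg_word_induct[OF B f assms(1), of Q]) (use assms(2-) in auto)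

lemma nondeg_M_words:
  assumes x: "x \<in> carrier M" and z: "\<And>u. u \<in> lists I \<Longrightarrow> \<phi> (ew u) x = 0"
  shows "x = \<zero>\<^bsub>B\<^esub>"
proof (rule nondeg_M[OF x])
  fix a assume "a \<in> carrier E"
  then show "\<phi> a x = 0"
    by (induction rule: E_word_induct) (use M_sub[OF x] z in \<open>simp_all add: lin_add[OF \<phi>2] lin_smult[OF \<phi>2] E_sub\<close>)
qed

lemma nondeg_E_words:
  assumes a: "a \<in> carrier E" and z: "\<And>w. w \<in> lists I \<Longrightarrow> \<phi> a (fw w) = 0"
  shows "a = \<zero>\<^bsub>A\<^esub>"
proof (rule nondeg_E[OF a])
  fix x assume "x \<in> carrier M"
  then show "\<phi> a x = 0"
    by (induction rule: M_word_induct) (use E_sub[OF a] z in \<open>simp_all add: lin_add[OF \<phi>1] lin_smult[OF \<phi>1] M_sub\<close>)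
qed

lemma \<phi>_ew_act: "u \<in> lists I \<Longrightarrow> i \<in> I \<Longrightarrow> x \<in> carrier B \<Longrightarrow> \<phi> (ew u) (act (e' i) x) = \<phi> (ew (u @ [i])) x"
  by (simp add: \<phi>_act ew_A ew_append alg_one[OF A])

lemma \<phi>_ew_one: "u \<in> lists I \<Longrightarrow> \<phi> (ew u) \<one>\<^bsub>B\<^esub> = (if u = [] then 1 else 0)"
  by (cases u) (auto simp: \<phi>_one_one \<phi>_mult_one ew_A \<phi>_e')

text \<open>Left multiplication by \<open>f j\<close> raises the degree by one. Splitting off the last letter of \<open>u\<close> turns it into
  a skew derivation, which lowers the degree of \<open>x\<close>; the induction is over all \<open>x\<close> and \<open>d\<close>.\<close>

lemma f_mult_degree:
  assumes "j \<in> I" "u \<in> lists I" "x \<in> carrier B" "length u \<noteq> Suc d"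
    "\<And>v. v \<in> lists I \<Longrightarrow> length v \<noteq> d \<Longrightarrow> \<phi> (ew v) x = 0"
  shows "\<phi> (ew u) (f j \<otimes>\<^bsub>B\<^esub> x) = 0"
  using assms(2-)
proof (induction u arbitrary: x d rule: rev_induct)
  case Nil
  then show ?case using assms(1) by (simp add: \<phi>_one_mult f \<phi>_one_f)
next
  case (snoc i u)
  then have i: "i \<in> I" and u: "u \<in> lists I" and len: "length u \<noteq> d" by auto
  have x': "act (e' i) x \<in> carrier B" using i snoc.prems(2) act_closed by simp
  have "\<phi> (ew u) (f j \<otimes>\<^bsub>B\<^esub> act (e' i) x) = 0"
    \<comment> \<open>For \<open>d = 0\<close> the element \<open>act (e' i) x\<close> is orthogonal to all words, so it qualifies for any degree.\<close>
  proof (rule snoc.IH[OF u x'])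
    show "length u \<noteq> Suc (if d = 0 then length u else d - 1)" using len by auto
    fix v assume v: "v \<in> lists I" "length v \<noteq> (if d = 0 then length u else d - 1)"
    then have "\<phi> (ew (v @ [i])) x = 0"
      using i by (intro snoc.prems(4)) (auto split: if_splits)
    then show "\<phi> (ew v) (act (e' i) x) = 0" using \<phi>_ew_act[OF v(1) i snoc.prems(2)] by simp
  qed
  then show ?case
    using \<phi>_ew_act[OF u i, of "f j \<otimes>\<^bsub>B\<^esub> x", symmetric] i u assms(1) snoc.prems x' f[OF assms(1)] ew_A[OF u] len
    by (simp add: multB act_e'_f_mult lin_add[OF \<phi>1] lin_smult[OF \<phi>1] cB)
qed

lemma \<phi>_ew_fw:
  assumes "w \<in> lists I" "u \<in> lists I" "length u \<noteq> length w"
  shows "\<phi> (ew u) (fw w) = 0"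
  using assms
proof (induction w arbitrary: u)
  case Nil
  then show ?case by (simp add: \<phi>_ew_one)
next
  case (Cons j w)
  then have j: "j \<in> I" and w: "w \<in> lists I" by auto
  have "\<phi> (ew u) (f j \<otimes>\<^bsub>B\<^esub> fw w) = 0"
    by (rule f_mult_degree[OF j Cons.prems(1) fw_B[OF w], of "length w"]) (use Cons.prems(2) Cons.IH in auto)
  then show ?case by simp
qed

end

section \<open>The algebras \<^term>\<open>tU D s\<close>\<close>

lemma alg_free_algebra: "alg (free_algebra X)"
  unfolding free_algebra_def by (rule alg_monoid_algebra) (rule monoidI, auto)

lemma delta_free [simp]: "delta w \<in> carrier (free_algebra X) \<longleftrightarrow> w \<in> lists X"
  by (simp add: free_algebra_def)

lemma free_mult: "delta u \<otimes>\<^bsub>free_algebra X\<^esub> delta v = delta (u @ v)"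
  unfolding free_algebra_def by (subst delta_mult) (auto intro: monoidI)

lemma free_one: "\<one>\<^bsub>free_algebra X\<^esub> = delta []"
  by (simp add: free_algebra_def monoid_algebra_simps)

lemma free_supp: "r \<in> carrier (free_algebra X) \<Longrightarrow> r w \<noteq> 0 \<Longrightarrow> w \<in> lists X"
  by (auto simp: free_algebra_def monoid_algebra_simps supp_def)

lemma ideal_submodule:
  assumes A: "alg A" and I: "ideal N A"
  shows "alg_ideal A N"
proof -
  interpret N: ideal N A by (fact I)
  note mA = algD(3)[OF A] and nA = algD(1)[OF A]
  have "c \<odot>\<^bsub>A\<^esub> x \<in> N" if x: "x \<in> N" for c x
  proof -
    have xA: "x \<in> carrier A" using x N.a_subset by blast
    have "(c \<odot>\<^bsub>A\<^esub> \<one>\<^bsub>A\<^esub>) \<otimes>\<^bsub>A\<^esub> x \<in> N" using x nalgD(3)[OF nA] vs_smult[OF mA] by (intro N.I_l_closed) auto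
    then show ?thesis
      using xA nalgD(3)[OF nA] by (simp add: lin_smult[OF nalg_lin2[OF nA xA]] alg_one[OF A])
  qed
  then show ?thesis
    using N.a_subset N.zero_closed N.a_closed
    by (auto simp: alg_ideal_def submodule_CC_iff[OF mA] intro: ideal.I_l_closed[OF I] ideal.I_r_closed[OF I])
qed

text \<open>If some relation involved a weight outside of the given set, the ideal generated by the
  relations would be everything, the quotient would be zero, and it would have no counit. So
  the existence of a counit forces the set of weights to be closed under the operations used in
  the relations.\<close>

lemma U_rels_carrier:
  assumes h: "h \<in> alg_hom (tU D s) CC"
  shows "U_rels D s \<subseteq> carrier (free_algebra (gen_set D))"
proof (rule ccontr)
  let ?F = "free_algebra (gen_set D)"
  assume n: "\<not> ?thesis"
  have "ideal J ?F \<Longrightarrow> J \<subseteq> carrier ?F" for J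
    by (simp add: ideal.axioms(1) additive_subgroup.a_subset)
  then have "Idl\<^bsub>?F\<^esub> (U_rels D s) = UNIV" using n by (auto simp: genideal_def)
  then have tU: "tU D s = quot ?F UNIV" by (simp add: tU_def)
  have co: "UNIV +>\<^bsub>?F\<^esub> x = UNIV" for x
  proof -
    have "y \<in> UNIV +>\<^bsub>?F\<^esub> x" for y
      by (auto simp: a_r_coset_def' free_algebra_def monoid_algebra_simps intro!: exI[of _ "\<lambda>w. y w - x w"])
    then show ?thesis by blast
  qed
  have "UNIV <+>\<^bsub>?F\<^esub> UNIV = UNIV"
  proof -
    have "y \<in> UNIV <+>\<^bsub>?F\<^esub> UNIV" for y
      unfolding set_add_def'
      by (rule UN_I[of y], simp, rule UN_I[of "\<lambda>w. 0"]) (simp_all add: free_algebra_def monoid_algebra_simps)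
    then show ?thesis by blast
  qed
  then have ops: "\<one>\<^bsub>tU D s\<^esub> = UNIV" "UNIV \<oplus>\<^bsub>tU D s\<^esub> UNIV = UNIV" by (simp_all add: tU quot_def co)
  have "\<one>\<^bsub>?F\<^esub> \<in> carrier ?F" using algD(1)[OF alg_free_algebra] nalgD(3) by blast
  then have U: "UNIV \<in> carrier (tU D s)"
    unfolding tU quot_def using co by (auto simp: A_RCOSETS_def')
  have "h UNIV = 1" using h ops(1) by (auto simp: alg_hom_def ring_hom_def)
  moreover have "h (x \<oplus>\<^bsub>tU D s\<^esub> y) = h x + h y" if "x \<in> carrier (tU D s)" "y \<in> carrier (tU D s)" for x y
    using h that by (auto simp: alg_hom_def ring_hom_def)
  then have "h UNIV = h UNIV + h UNIV" using ops(2) U by metis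
  ultimately show False by simp
qed

context
  fixes D :: "'w::ab_group_add qdatum" and s :: complex
  assumes U: "U_rels D s \<subseteq> carrier (free_algebra (gen_set D))"
begin

abbreviation (input) "FA \<equiv> free_algebra (gen_set D)"
abbreviation (input) "RI \<equiv> Idl\<^bsub>free_algebra (gen_set D)\<^esub> (U_rels D s)"

lemma Tor_wts: "Tor \<mu> \<in> gen_set D \<longleftrightarrow> \<mu> \<in> wts D" and Gen_rank: "Gen i \<in> gen_set D \<longleftrightarrow> i < rank D"
  by (auto simp: gen_set_def)

lemma wts_add: "\<mu> \<in> wts D \<Longrightarrow> \<nu> \<in> wts D \<Longrightarrow> \<mu> + \<nu> \<in> wts D"
proof -
  assume "\<mu> \<in> wts D" "\<nu> \<in> wts D"
  then have "delta [Tor \<mu>, Tor \<nu>] - delta [Tor (\<mu> + \<nu>)] \<in> carrier FA"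
    using U by (auto simp: U_rels_def)
  then have "[Tor (\<mu> + \<nu>)] \<in> lists (gen_set D)" by (rule free_supp) (simp add: delta_def)
  then show ?thesis by (simp add: Tor_wts)
qed

lemma wts_zero: "0 \<in> wts D"
proof -
  have "delta [Tor 0] - delta [] \<in> carrier FA" using U by (auto simp: U_rels_def)
  then have "[Tor 0] \<in> lists (gen_set D)" by (rule free_supp) (simp add: delta_def)
  then show ?thesis by (simp add: Tor_wts)
qed

lemma wts_minus:
  assumes "i < rank D" "\<mu> \<in> wts D" shows "- \<mu> \<in> wts D"
proof -
  have "delta [Tor \<mu>, Gen i, Tor (- \<mu>)] - (\<lambda>p. qpow D (s * ip D (sroot D i) \<mu>) * delta [Gen i] p) \<in> carrier FA"
    using U assms by (auto simp: U_rels_def)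
  then have "[Tor \<mu>, Gen i, Tor (- \<mu>)] \<in> lists (gen_set D)" by (rule free_supp) (simp add: delta_def)
  then show ?thesis by (simp add: Tor_wts)
qed

lemma ideal_Id: "ideal RI FA"
  by (rule ring.genideal_ideal[OF alg_ring[OF alg_free_algebra] U])

lemma rel_Id: "r \<in> U_rels D s \<Longrightarrow> r \<in> RI"
  using ring.genideal_self[OF alg_ring[OF alg_free_algebra] U] by blast

lemmas RI_ideal = ideal_submodule[OF alg_free_algebra ideal_Id]

lemma Id_sub: "submodule RI CC FA"
  using RI_ideal by (simp add: alg_ideal_def)

lemmas mFA = algD(3)[OF alg_free_algebra[of "gen_set D"]]

lemma alg_tU: "alg (tU D s)"
  unfolding tU_def by (rule quot_alg(1)[OF alg_free_algebra RI_ideal])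

lemma tU_ops:
  "x \<in> carrier FA \<Longrightarrow> y \<in> carrier FA \<Longrightarrow> (RI +>\<^bsub>FA\<^esub> x) \<otimes>\<^bsub>tU D s\<^esub> (RI +>\<^bsub>FA\<^esub> y) = RI +>\<^bsub>FA\<^esub> (x \<otimes>\<^bsub>FA\<^esub> y)"
  "x \<in> carrier FA \<Longrightarrow> y \<in> carrier FA \<Longrightarrow> (RI +>\<^bsub>FA\<^esub> x) \<oplus>\<^bsub>tU D s\<^esub> (RI +>\<^bsub>FA\<^esub> y) = RI +>\<^bsub>FA\<^esub> (x \<oplus>\<^bsub>FA\<^esub> y)"
  "x \<in> carrier FA \<Longrightarrow> c \<odot>\<^bsub>tU D s\<^esub> (RI +>\<^bsub>FA\<^esub> x) = RI +>\<^bsub>FA\<^esub> (c \<odot>\<^bsub>FA\<^esub> x)"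
  "\<one>\<^bsub>tU D s\<^esub> = RI +>\<^bsub>FA\<^esub> \<one>\<^bsub>FA\<^esub>"
  "carrier (tU D s) = (\<lambda>x. RI +>\<^bsub>FA\<^esub> x) ` carrier FA"
  unfolding tU_def
  by (simp_all add: quot_alg(2)[OF alg_free_algebra RI_ideal] quot_alg(3)[OF alg_free_algebra RI_ideal]
      quot_add[OF mFA Id_sub] quot_smult[OF mFA Id_sub] quot_carrier[OF mFA Id_sub])

lemma tgen_carrier: "tgen D s g \<in> carrier (tU D s) \<longleftrightarrow> g \<in> gen_set D"
proof
  assume "tgen D s g \<in> carrier (tU D s)"
  then obtain x where x: "x \<in> carrier FA" "tgen D s g = RI +>\<^bsub>FA\<^esub> x" by (auto simp: tU_ops)
  have "(\<lambda>w. 0) \<in> RI" using Id_sub unfolding submodule_CC_iff[OF mFA] by (simp add: free_algebra_def monoid_algebra_simps)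
  then have "delta [g] \<in> tgen D s g"
    unfolding tgen_def by (force simp: a_r_coset_def' free_algebra_def monoid_algebra_simps)
  then have "delta [g] \<in> carrier FA" using x mem_coset[OF mFA Id_sub x(1)] by blast
  then show "g \<in> gen_set D" by simp
qed (auto simp: tU_ops tgen_def)

lemma coset_eqI:
  assumes "x \<in> carrier FA" "y \<in> carrier FA" "(\<lambda>w. x w - y w) \<in> RI"
  shows "RI +>\<^bsub>FA\<^esub> x = RI +>\<^bsub>FA\<^esub> y"
  using assms by (subst coset_eq_iff[OF mFA Id_sub]) (auto simp: free_algebra_def monoid_algebra_simps)

lemma tor_mult: "\<mu> \<in> wts D \<Longrightarrow> \<nu> \<in> wts D \<Longrightarrow> tgen D s (Tor \<mu>) \<otimes>\<^bsub>tU D s\<^esub> tgen D s (Tor \<nu>) = tgen D s (Tor (\<mu> + \<nu>))"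
proof -
  assume *: "\<mu> \<in> wts D" "\<nu> \<in> wts D"
  then have "delta [Tor \<mu>, Tor \<nu>] - delta [Tor (\<mu> + \<nu>)] \<in> RI" by (intro rel_Id) (auto simp: U_rels_def)
  then have "RI +>\<^bsub>FA\<^esub> delta [Tor \<mu>, Tor \<nu>] = RI +>\<^bsub>FA\<^esub> delta [Tor (\<mu> + \<nu>)]"
    using * wts_add by (intro coset_eqI) (auto simp: Tor_wts fun_diff_def)
  then show ?thesis using * by (simp add: tgen_def tU_ops Tor_wts free_mult)
qed

lemma tor_zero: "tgen D s (Tor 0) = \<one>\<^bsub>tU D s\<^esub>"
proof -
  have "delta [Tor 0] - delta [] \<in> RI" by (intro rel_Id) (auto simp: U_rels_def)
  then have "RI +>\<^bsub>FA\<^esub> delta [Tor 0] = RI +>\<^bsub>FA\<^esub> delta []"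
    using wts_zero by (intro coset_eqI) (auto simp: Tor_wts fun_diff_def)
  then show ?thesis by (simp add: tgen_def tU_ops free_one)
qed

lemma tor_gen:
  assumes \<mu>: "\<mu> \<in> wts D" and i: "i < rank D"
  shows "tgen D s (Tor \<mu>) \<otimes>\<^bsub>tU D s\<^esub> tgen D s (Gen i) =
     qpow D (s * ip D (sroot D i) \<mu>) \<odot>\<^bsub>tU D s\<^esub> (tgen D s (Gen i) \<otimes>\<^bsub>tU D s\<^esub> tgen D s (Tor \<mu>))"
proof -
  let ?t = "tgen D s (Tor \<mu>)" and ?u = "tgen D s (Tor (- \<mu>))" and ?g = "tgen D s (Gen i)"
    and ?q = "qpow D (s * ip D (sroot D i) \<mu>)"
  note A = alg_tU and nA = algD(1)[OF alg_tU]
  have c: "?t \<in> carrier (tU D s)" "?u \<in> carrier (tU D s)" "?g \<in> carrier (tU D s)"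
    using \<mu> i wts_minus by (auto simp: tgen_carrier Tor_wts Gen_rank)
  have "delta [Tor \<mu>, Gen i, Tor (- \<mu>)] - (\<lambda>p. ?q * delta [Gen i] p) \<in> RI"
    using \<mu> i by (intro rel_Id) (auto simp: U_rels_def)
  moreover have dd: "(\<lambda>p. ?q * delta [Gen i] p) = ?q \<odot>\<^bsub>FA\<^esub> delta [Gen i]"
    by (simp add: free_algebra_def monoid_algebra_simps)
  moreover have "?q \<odot>\<^bsub>FA\<^esub> delta [Gen i] \<in> carrier FA" using i by (intro vs_smult[OF mFA]) (simp add: Gen_rank)
  ultimately have "RI +>\<^bsub>FA\<^esub> delta [Tor \<mu>, Gen i, Tor (- \<mu>)] = RI +>\<^bsub>FA\<^esub> (?q \<odot>\<^bsub>FA\<^esub> delta [Gen i])"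
    using \<mu> i wts_minus by (intro coset_eqI) (auto simp: Tor_wts Gen_rank fun_diff_def)
  then have "(?t \<otimes>\<^bsub>tU D s\<^esub> ?g) \<otimes>\<^bsub>tU D s\<^esub> ?u = ?q \<odot>\<^bsub>tU D s\<^esub> ?g"
    using \<mu> i wts_minus by (simp add: tgen_def tU_ops Tor_wts Gen_rank free_mult)
  then have "((?t \<otimes>\<^bsub>tU D s\<^esub> ?g) \<otimes>\<^bsub>tU D s\<^esub> ?u) \<otimes>\<^bsub>tU D s\<^esub> ?t = (?q \<odot>\<^bsub>tU D s\<^esub> ?g) \<otimes>\<^bsub>tU D s\<^esub> ?t" by simp
  moreover have "((?t \<otimes>\<^bsub>tU D s\<^esub> ?g) \<otimes>\<^bsub>tU D s\<^esub> ?u) \<otimes>\<^bsub>tU D s\<^esub> ?t = ?t \<otimes>\<^bsub>tU D s\<^esub> ?g"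
    using c tor_mult[of "- \<mu>" \<mu>] tor_zero \<mu> wts_minus[OF i \<mu>] nalg_mult[OF nA]
    by (simp add: alg_assoc[OF A] alg_one[OF A])
  ultimately show ?thesis using c by (simp add: lin_smult[OF nalg_lin2[OF nA]])
qed

lemma tgen_sub: "tgen D s ` gen_set D \<subseteq> carrier (tU D s)"
  by (auto simp: tgen_carrier)

text \<open>Cosets of words are products of generators, and words span the free algebra.\<close>

lemma tU_generated:
  assumes "x \<in> carrier (tU D s)"
  shows "x \<in> carrier (subalg (tU D s) (tgen D s ` gen_set D))"
proof -
  let ?S = "carrier (subalg (tU D s) (tgen D s ` gen_set D))"
  note nA = algD(1)[OF alg_tU]
  note S = subalgebra_subalg[OF nA tgen_sub]
  have S': "\<one>\<^bsub>tU D s\<^esub> \<in> ?S" "\<And>x y. x \<in> ?S \<Longrightarrow> y \<in> ?S \<Longrightarrow> x \<oplus>\<^bsub>tU D s\<^esub> y \<in> ?S" "\<And>c x. x \<in> ?S \<Longrightarrow> c \<odot>\<^bsub>tU D s\<^esub> x \<in> ?S"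
    "\<And>x y. x \<in> ?S \<Longrightarrow> y \<in> ?S \<Longrightarrow> x \<otimes>\<^bsub>tU D s\<^esub> y \<in> ?S"
    using S by (auto simp: subalgebra_def)
  have w: "RI +>\<^bsub>FA\<^esub> delta w \<in> ?S" if "w \<in> lists (gen_set D)" for w
    using that
  proof (induction w)
    case Nil
    then show ?case using S'(1) by (simp add: tU_ops free_one)
  next
    case (Cons g w)
    have "RI +>\<^bsub>FA\<^esub> delta (g # w) = tgen D s g \<otimes>\<^bsub>tU D s\<^esub> (RI +>\<^bsub>FA\<^esub> delta w)"
      using Cons by (simp add: tgen_def tU_ops free_mult)
    then show ?case using Cons S'(4) subalg_gen[OF nA tgen_sub] by simp
  qed
  obtain r where r: "r \<in> carrier FA" "x = RI +>\<^bsub>FA\<^esub> r" using assms by (auto simp: tU_ops)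
  have "r \<in> carrier (monoid_algebra \<lparr>carrier = lists (gen_set D), mult = (@), one = []\<rparr>)"
    using r(1) by (simp add: free_algebra_def)
  then have "RI +>\<^bsub>FA\<^esub> r \<in> ?S"
  proof (induction rule: monoid_algebra_induct)
    case zero
    have "RI +>\<^bsub>FA\<^esub> (\<lambda>x. 0) = 0 \<odot>\<^bsub>tU D s\<^esub> (RI +>\<^bsub>FA\<^esub> delta [])"
      by (simp add: tU_ops) (simp add: free_algebra_def monoid_algebra_simps)
    then show ?case using S'(3) w[of "[]"] by simp
  next
    case (add r t)
    then have "RI +>\<^bsub>FA\<^esub> (\<lambda>x. r x + t x) = (RI +>\<^bsub>FA\<^esub> r) \<oplus>\<^bsub>tU D s\<^esub> (RI +>\<^bsub>FA\<^esub> t)"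
      by (subst tU_ops) (auto simp: free_algebra_def monoid_algebra_simps)
    then show ?case using S'(2) add by simp
  next
    case (smult c r)
    then have "RI +>\<^bsub>FA\<^esub> (\<lambda>x. c * r x) = c \<odot>\<^bsub>tU D s\<^esub> (RI +>\<^bsub>FA\<^esub> r)"
      by (subst tU_ops) (auto simp: free_algebra_def monoid_algebra_simps)
    then show ?case using S'(3) smult by simp
  qed (use w in auto)
  then show ?thesis using r by simp
qed

end

section \<open>Descent of the coproduct to quotients\<close>

text \<open>Let \<open>N\<close> be the common kernel of the functionals \<open>Fs\<close>. Pairs of these functionals separate the tensor square of
  the quotient, and on the coproducts of two representatives of a coset they agree. So the coproduct
  descends. Here \<open>pp\<close> is the projection of tensor squares.\<close>

lemma quot_cop_coset:
  fixes A :: "'a calg" and Fs :: "('a \<Rightarrow> complex) set"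
  assumes A: "alg A" and AN: "alg_ideal A N" and \<Delta>: "\<Delta> \<in> alg_hom A (tensor A A)"
    and Fs: "\<forall>f\<in>Fs. lin A CC f" and N_eq: "N = {a \<in> carrier A. \<forall>f\<in>Fs. f a = 0}"
    and coid: "\<forall>f\<in>Fs. \<forall>g\<in>Fs. \<forall>x\<in>N. tlift CC (\<lambda>u v. f u * g v) (\<Delta> x) = 0"
  defines "Q \<equiv> quot A N"
  defines "pp \<equiv> tlift (tensor Q Q) (\<lambda>u v. pure Q Q (N +>\<^bsub>A\<^esub> u) (N +>\<^bsub>A\<^esub> v))"
  shows "\<And>a. a \<in> carrier A \<Longrightarrow> quot_cop A N \<Delta> (N +>\<^bsub>A\<^esub> a) = pp (\<Delta> a)"
    and "\<And>s. s \<in> carrier (tensor A A) \<Longrightarrow> pp s \<in> carrier (tensor Q Q)"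
    and "\<And>s C f. s \<in> carrier (tensor A A) \<Longrightarrow> module CC C \<Longrightarrow> bilin Q Q C f \<Longrightarrow>
          tlift C f (pp s) = tlift C (\<lambda>u v. f (N +>\<^bsub>A\<^esub> u) (N +>\<^bsub>A\<^esub> v)) s"
    and "\<And>s t. s \<in> carrier (tensor A A) \<Longrightarrow> t \<in> carrier (tensor A A) \<Longrightarrow>
          pp (s \<otimes>\<^bsub>tensor A A\<^esub> t) = pp s \<otimes>\<^bsub>tensor Q Q\<^esub> pp t"
    and "\<And>a b. a \<in> carrier A \<Longrightarrow> b \<in> carrier A \<Longrightarrow> pp (pure A A a b) = pure Q Q (N +>\<^bsub>A\<^esub> a) (N +>\<^bsub>A\<^esub> b)"
    and "lin (tensor A A) (tensor Q Q) pp"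
proof -
  note mA = algD(3)[OF A]
  have N: "submodule N CC A" using AN by (simp add: alg_ideal_def)
  have lin: "\<And>f. f \<in> Fs \<Longrightarrow> lin A CC f" and van: "\<And>f x. f \<in> Fs \<Longrightarrow> x \<in> N \<Longrightarrow> f x = 0"
    and sep: "\<And>a. a \<in> carrier A \<Longrightarrow> (\<And>f. f \<in> Fs \<Longrightarrow> f a = 0) \<Longrightarrow> a \<in> N"
    and coideal: "\<And>f g x. f \<in> Fs \<Longrightarrow> g \<in> Fs \<Longrightarrow> x \<in> N \<Longrightarrow> tlift CC (\<lambda>u v. f u * g v) (\<Delta> x) = 0"
    using Fs N_eq coid by auto
  note Qa = quot_alg[OF A AN, folded Q_def] and Qp = quot_proj[OF mA N, folded Q_def]
  note mQ = algD(3)[OF Qa(1)] and mAA = module_tensor[OF mA mA] and mQQ = module_tensor[OF mQ mQ]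
  note AA = alg_tensor[OF A A] and QQ = alg_tensor[OF Qa(1) Qa(1)]
  note pQ = bilin_pure[OF mQ mQ]
  have b: "bilin A A C (\<lambda>u v. f (N +>\<^bsub>A\<^esub> u) (N +>\<^bsub>A\<^esub> v))" if "bilin Q Q C f" for C f
    by (intro bilinI) (auto intro: lin_comp[OF Qp bilin1[OF that]] lin_comp[OF Qp bilin2[OF that]] lin_closed[OF Qp])
  note pp = lin_tlift[OF mA mA mQQ b[OF pQ], folded pp_def]
  show "lin (tensor A A) (tensor Q Q) pp" by (rule pp)
  show c: "pp s \<in> carrier (tensor Q Q)" if "s \<in> carrier (tensor A A)" for s by (rule lin_closed[OF pp that])
  show ppp: "pp (pure A A a b') = pure Q Q (N +>\<^bsub>A\<^esub> a) (N +>\<^bsub>A\<^esub> b')" if "a \<in> carrier A" "b' \<in> carrier A" for a b'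
    unfolding pp_def by (rule tlift_pure[OF mA mA mQQ b[OF pQ] that])
  show pl: "tlift C f (pp s) = tlift C (\<lambda>u v. f (N +>\<^bsub>A\<^esub> u) (N +>\<^bsub>A\<^esub> v)) s"
    if s: "s \<in> carrier (tensor A A)" and C: "module CC C" and f: "bilin Q Q C f" for s C f
  proof -
    have "tlift C f (pp s) = tlift C (\<lambda>u v. tlift C f (pure Q Q (N +>\<^bsub>A\<^esub> u) (N +>\<^bsub>A\<^esub> v))) s"
      unfolding pp_def by (rule tlift_comp[OF mA mA mQQ C b[OF pQ] lin_tlift[OF mQ mQ C f] s])
    also have "\<dots> = tlift C (\<lambda>u v. f (N +>\<^bsub>A\<^esub> u) (N +>\<^bsub>A\<^esub> v)) s"
      by (rule tlift_cong[OF mA mA C _ _ s])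
         (auto simp: tlift_pure[OF mQ mQ C f] lin_closed[OF Qp] bilin_closed[OF f])
    finally show ?thesis .
  qed
  show "pp (s \<otimes>\<^bsub>tensor A A\<^esub> t) = pp s \<otimes>\<^bsub>tensor Q Q\<^esub> pp t"
    if s: "s \<in> carrier (tensor A A)" and t: "t \<in> carrier (tensor A A)" for s t
  proof -
    note nAA = algD(1)[OF AA(1)] and nQQ = algD(1)[OF QQ(1)]
    have 1: "pp (pure A A a b' \<otimes>\<^bsub>tensor A A\<^esub> t) = pp (pure A A a b') \<otimes>\<^bsub>tensor Q Q\<^esub> pp t"
      if ab: "a \<in> carrier A" "b' \<in> carrier A" for a b'
    proof (rule lin_eq_on_pure[OF mA mA lin_comp[OF nalg_lin1[OF nAA pure_carrier[OF mA mA ab]] pp]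
          lin_comp[OF pp nalg_lin1[OF nQQ c[OF pure_carrier[OF mA mA ab]]]] _ t])
      fix x y assume xy: "x \<in> carrier A" "y \<in> carrier A"
      have "pp (pure A A a b' \<otimes>\<^bsub>tensor A A\<^esub> pure A A x y) = pp (pure A A (a \<otimes>\<^bsub>A\<^esub> x) (b' \<otimes>\<^bsub>A\<^esub> y))"
        using AA(2)[OF ab xy] by simp
      also have "\<dots> = pure Q Q (N +>\<^bsub>A\<^esub> a) (N +>\<^bsub>A\<^esub> b') \<otimes>\<^bsub>tensor Q Q\<^esub> pure Q Q (N +>\<^bsub>A\<^esub> x) (N +>\<^bsub>A\<^esub> y)"
        using ab xy by (simp add: QQ(2) lin_closed[OF Qp] ppp nalg_mult[OF algD(1)[OF A]] Qa(2))
      finally show "pp (pure A A a b' \<otimes>\<^bsub>tensor A A\<^esub> pure A A x y) =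
          pp (pure A A a b') \<otimes>\<^bsub>tensor Q Q\<^esub> pp (pure A A x y)" using ab xy by (simp add: ppp)
    qed
    show ?thesis
      by (rule lin_eq_on_pure[OF mA mA lin_comp[OF nalg_lin2[OF nAA t] pp]
          lin_comp[OF pp nalg_lin2[OF nQQ c[OF t]]] 1 s])
  qed
  define fb :: "('a \<Rightarrow> complex) \<Rightarrow> 'a set \<Rightarrow> complex" where "fb = (\<lambda>f X. f (SOME a. a \<in> X))"
  have fb: "fb f (N +>\<^bsub>A\<^esub> a) = f a" if "f \<in> Fs" "a \<in> carrier A" for f a
  proof -
    have X: "N +>\<^bsub>A\<^esub> a \<in> carrier Q" using lin_closed[OF Qp that(2)] .
    note so = some_coset[OF mA N X[unfolded Q_def]]
    have "(SOME x. x \<in> N +>\<^bsub>A\<^esub> a) \<oplus>\<^bsub>A\<^esub> (-1) \<odot>\<^bsub>A\<^esub> a \<in> N"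
      using coset_eq_iff[OF mA N so(1) that(2)] so(2) by simp
    then have "f ((SOME x. x \<in> N +>\<^bsub>A\<^esub> a) \<oplus>\<^bsub>A\<^esub> (-1) \<odot>\<^bsub>A\<^esub> a) = 0" using van that by blast
    then show ?thesis
      using so(1) that vs_smult[OF mA] by (simp add: fb_def lin_add[OF lin[OF that(1)]] lin_smult[OF lin[OF that(1)]])
  qed
  have Qc: "carrier Q = (\<lambda>x. N +>\<^bsub>A\<^esub> x) ` carrier A" using quot_carrier[OF mA N] by (simp add: Q_def)
  have fbl: "lin Q CC (fb f)" if "f \<in> Fs" for f
    using that lin[OF that] vs_add[OF mA] vs_smult[OF mA]
    by (auto intro!: linI simp: Qc fb lin_add lin_smult lin_add[OF Qp, symmetric] lin_smult[OF Qp, symmetric])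
  have fbs: "X = \<zero>\<^bsub>Q\<^esub>" if "X \<in> carrier Q" "\<And>g. g \<in> fb ` Fs \<Longrightarrow> g X = 0" for X
  proof -
    obtain a where a: "a \<in> carrier A" "X = N +>\<^bsub>A\<^esub> a" using \<open>X \<in> carrier Q\<close> by (auto simp: Qc)
    have "f a = 0" if f: "f \<in> Fs" for f
      using fb[OF f a(1)] \<open>\<And>g. g \<in> fb ` Fs \<Longrightarrow> g X = 0\<close>[of "fb f"] f a(2) by simp
    then show ?thesis using sep[OF a(1)] coset_eq_zero_iff[OF mA N a(1), folded Q_def] a(2) by blast
  qed
  have \<Delta>c: "\<And>x. x \<in> carrier A \<Longrightarrow> \<Delta> x \<in> carrier (tensor A A)"
    and \<Delta>a: "\<And>x y. x \<in> carrier A \<Longrightarrow> y \<in> carrier A \<Longrightarrow> \<Delta> (x \<oplus>\<^bsub>A\<^esub> y) = \<Delta> x \<oplus>\<^bsub>tensor A A\<^esub> \<Delta> y"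
    and \<Delta>s: "\<And>c x. x \<in> carrier A \<Longrightarrow> \<Delta> (c \<odot>\<^bsub>A\<^esub> x) = c \<odot>\<^bsub>tensor A A\<^esub> \<Delta> x"
    using \<Delta> by (auto simp: alg_hom_def ring_hom_def)
  have \<Delta>l: "lin A (tensor A A) \<Delta>" by (rule linI[OF \<Delta>c \<Delta>a \<Delta>s])
  show "quot_cop A N \<Delta> (N +>\<^bsub>A\<^esub> a) = pp (\<Delta> a)" if a: "a \<in> carrier A" for a
  proof -
    define a' where "a' = (SOME x. x \<in> N +>\<^bsub>A\<^esub> a)"
    have X: "N +>\<^bsub>A\<^esub> a \<in> carrier Q" using lin_closed[OF Qp a] .
    note so = some_coset[OF mA N X[unfolded Q_def], folded a'_def]
    have d: "a' \<oplus>\<^bsub>A\<^esub> (-1) \<odot>\<^bsub>A\<^esub> a \<in> N" using coset_eq_iff[OF mA N so(1) a] so(2) by simp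
    have "pp (\<Delta> a') = pp (\<Delta> a)"
    proof (rule tensor_eq_by_functional_pairs[OF mQ mQ, of "fb ` Fs" "fb ` Fs"])
      show "X = \<zero>\<^bsub>Q\<^esub>" if "X \<in> carrier Q" "\<And>g. g \<in> fb ` Fs \<Longrightarrow> g X = 0" for X using fbs that by blast
      then show "X = \<zero>\<^bsub>Q\<^esub>" if "X \<in> carrier Q" "\<And>g. g \<in> fb ` Fs \<Longrightarrow> g X = 0" for X using that by blast
      show "lin Q CC g" if "g \<in> fb ` Fs" for g using that fbl by blast
      then show "lin Q CC g" if "g \<in> fb ` Fs" for g using that by blast
    next
      fix g h assume "g \<in> fb ` Fs" "h \<in> fb ` Fs"
      then obtain u v where uv: "u \<in> Fs" "v \<in> Fs" "g = fb u" "h = fb v" by blast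
      note L = lin_tlift[OF mA mA module_CC bilin_functionals[OF mA mA lin[OF uv(1)] lin[OF uv(2)]]]
      have *: "tlift CC (\<lambda>a b. g a * h b) (pp s) = tlift CC (\<lambda>x y. u x * v y) s" if s: "s \<in> carrier (tensor A A)" for s
        unfolding uv pl[OF s module_CC bilin_functionals[OF mQ mQ fbl[OF uv(1)] fbl[OF uv(2)]]]
        by (rule tlift_cong[OF mA mA module_CC _ _ s]) (simp_all add: fb uv)
      have "tlift CC (\<lambda>x y. u x * v y) (\<Delta> (a' \<oplus>\<^bsub>A\<^esub> (-1) \<odot>\<^bsub>A\<^esub> a)) = 0" using coideal[OF uv(1,2) d] .
      then have "tlift CC (\<lambda>x y. u x * v y) (\<Delta> a') = tlift CC (\<lambda>x y. u x * v y) (\<Delta> a)"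
        using so(1) a vs_smult[OF mA] vs_smult[OF mAA] \<Delta>c by (simp add: \<Delta>a \<Delta>s lin_add[OF L] lin_smult[OF L])
      then show "tlift CC (\<lambda>a b. g a * h b) (pp (\<Delta> a')) = tlift CC (\<lambda>a b. g a * h b) (pp (\<Delta> a))"
        using * \<Delta>c so(1) a by simp
    qed (use c \<Delta>c so(1) a in auto)
    then show ?thesis by (simp add: quot_cop_def pp_def Q_def a'_def)
  qed
qed

section \<open>The Borel algebras modulo the radicals\<close>

lemma tlift_zero:
  assumes A: "module CC A" and B: "module CC B" and t: "t \<in> carrier (tensor A B)"
    and z: "\<And>a b. a \<in> carrier A \<Longrightarrow> b \<in> carrier B \<Longrightarrow> f a b = 0"
  shows "tlift CC f t = 0"
proof -
  have b: "bilin A B CC (\<lambda>a b. 0)"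
    using lin_zero_map[OF module_CC, of A] lin_zero_map[OF module_CC, of B] by (simp add: bilin_def)
  have "tlift CC f t = tlift CC (\<lambda>a b. 0) t"
    by (rule tlift_cong[OF A B module_CC _ _ t]) (simp_all add: z)
  also have "\<dots> = 0"
    by (rule lin_eq_on_pure[OF A B lin_tlift[OF A B module_CC b] _ _ t])
       (use lin_zero_map[OF module_CC, of "tensor A B"] in \<open>simp_all add: tlift_pure[OF A B module_CC b]\<close>)
  finally show ?thesis .
qed

lemma quot_generated:
  assumes A: "alg A" and AN: "alg_ideal A N"
    and S: "S \<subseteq> carrier A" and gen: "\<And>x. x \<in> carrier A \<Longrightarrow> x \<in> carrier (subalg A S)"
    and X: "X \<in> carrier (quot A N)"
  shows "X \<in> carrier (subalg (quot A N) ((\<lambda>x. N +>\<^bsub>A\<^esub> x) ` S))"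
proof -
  have N: "submodule N CC A" using AN by (simp add: alg_ideal_def)
  note mA = algD(3)[OF A] and nA = algD(1)[OF A] and Q = quot_alg[OF A AN]
  note p = quot_proj[OF mA N]
  have S': "(\<lambda>x. N +>\<^bsub>A\<^esub> x) ` S \<subseteq> carrier (quot A N)" using S lin_closed[OF p] by auto
  note s = subalgebra_subalg[OF algD(1)[OF Q(1)] S', unfolded subalgebra_def]
  obtain x where x: "x \<in> carrier A" "X = N +>\<^bsub>A\<^esub> x" using X by (auto simp: quot_carrier[OF mA N])
  have "N +>\<^bsub>A\<^esub> x \<in> carrier (subalg (quot A N) ((\<lambda>x. N +>\<^bsub>A\<^esub> x) ` S))"
    using gen[OF x(1)]
  proof (induction rule: subalg_induct[OF nA S, consumes 1, case_names gen one add smult mult])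
    case (gen s)
    then show ?case by (intro subalg_gen[OF algD(1)[OF Q(1)] S']) auto
  next
    case one
    then show ?case using s Q(3) by simp
  next
    case (add x y)
    then show ?case using s lin_add[OF p] subalg_sub[OF nA S] by simp
  next
    case (smult c x)
    then show ?case using s lin_smult[OF p] subalg_sub[OF nA S] by simp
  next
    case (mult x y)
    then have "(N +>\<^bsub>A\<^esub> x) \<otimes>\<^bsub>quot A N\<^esub> (N +>\<^bsub>A\<^esub> y) \<in> carrier (subalg (quot A N) ((\<lambda>x. N +>\<^bsub>A\<^esub> x) ` S))"
      using s by blast
    then show ?case using Q(2) subalg_sub[OF nA S] mult(1,2) by simp
  qed
  then show ?thesis using x by simp
qed

definition gt' :: "'w::ab_group_add qdatum \<Rightarrow> 'w hopf_data \<Rightarrow> 'w \<Rightarrow> 'w U" where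
  "gt' D P \<mu> = right_rad D P +>\<^bsub>tUm D\<^esub> tt' D \<mu>"

definition kap :: "'w qdatum \<Rightarrow> nat \<Rightarrow> complex" where
  "kap D i = inverse (qi D i) - qi D i"

context
  fixes D :: "'w::ab_group_add qdatum" and P :: "'w hopf_data"
  assumes hp: "is_hopf_p D P" and hm: "is_hopf_m D P" and pr: "is_pairing D P"
    and qn: "\<And>r. qexp D r \<noteq> 0"
begin

lemma qpow_nonzero: "qpow D z \<noteq> 0"
  by (simp add: qpow_def qn)

lemma Upl: "U_rels D 1 \<subseteq> carrier (free_algebra (gen_set D))"
  using hp by (intro U_rels_carrier[of "cou_p P"]) (simp add: is_hopf_p_def)
lemma Umi: "U_rels D (-1) \<subseteq> carrier (free_algebra (gen_set D))"
  using hm by (intro U_rels_carrier[of "cou_m P"]) (simp add: is_hopf_m_def)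

lemmas Ap = alg_tU[OF Upl] and Am = alg_tU[OF Umi]
lemmas mAp = algD(3)[OF Ap] and mAm = algD(3)[OF Am] and nAp = algD(1)[OF Ap] and nAm = algD(1)[OF Am]
lemmas oneAp = nalgD(3)[OF nAp] and oneAm = nalgD(3)[OF nAm]
lemmas cAp = nalg_mult[OF nAp] oneAp vs_add[OF mAp] vs_smult[OF mAp]
lemmas cAm = nalg_mult[OF nAm] oneAm vs_add[OF mAm] vs_smult[OF mAm]

lemma cop_p: "cop_p P \<in> alg_hom (tUp D) (tensor (tUp D) (tUp D))"
  and cop_m: "cop_m P \<in> alg_hom (tUm D) (tensor (tUm D) (tUm D))"
  using hp hm by (auto simp: is_hopf_p_def is_hopf_m_def)

lemma cop_p_closed: "x \<in> carrier (tUp D) \<Longrightarrow> cop_p P x \<in> carrier (tensor (tUp D) (tUp D))"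
  and cop_m_closed: "x \<in> carrier (tUm D) \<Longrightarrow> cop_m P x \<in> carrier (tensor (tUm D) (tUm D))"
  using cop_p cop_m by (auto simp: alg_hom_def ring_hom_def)

lemma tt_closed: "\<mu> \<in> wts D \<Longrightarrow> tt D \<mu> \<in> carrier (tUp D)" and te_closed: "i < rank D \<Longrightarrow> te D i \<in> carrier (tUp D)"
  and tt'_closed: "\<mu> \<in> wts D \<Longrightarrow> tt' D \<mu> \<in> carrier (tUm D)" and tf_closed: "i < rank D \<Longrightarrow> tf D i \<in> carrier (tUm D)"
  using tgen_carrier[OF Upl] tgen_carrier[OF Umi] by (auto simp: gen_set_def)

text \<open>The coproduct of \<^term>\<open>te D i\<close> lies in the tensor product, which contains pure tensors of
  elements of the algebra only.\<close>

lemma minus_root_wts: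
  assumes i: "i < rank D" shows "- sroot D i \<in> wts D"
proof -
  let ?A = "tUp D" and ?F = "monoid_algebra (tUp D \<times>\<times> tUp D)" and ?K = "bilin_kernel (tUp D) (tUp D)"
  let ?x = "(te D i, tt D (- sroot D i))" and ?y = "(\<one>\<^bsub>tUp D\<^esub>, te D i)"
  note m = module_monoid_algebra[of "?A \<times>\<times> ?A"] and K = bilin_kernel_sub[OF mAp mAp]
  have "pure ?A ?A (fst ?x) (snd ?x) \<oplus>\<^bsub>tensor ?A ?A\<^esub> pure ?A ?A (fst ?y) (snd ?y) \<in> carrier (tensor ?A ?A)"
    using hp i cop_p_closed[OF te_closed[OF i]] by (simp add: is_hopf_p_def)
  moreover have "pure ?A ?A (fst ?x) (snd ?x) \<oplus>\<^bsub>tensor ?A ?A\<^esub> pure ?A ?A (fst ?y) (snd ?y) =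
     (?K +>\<^bsub>?F\<^esub> delta ?x) <+>\<^bsub>?F\<^esub> (?K +>\<^bsub>?F\<^esub> delta ?y)"
    by (simp add: tensor_def pure_def quot_def)
  ultimately obtain r where r: "r \<in> carrier ?F"
    "(?K +>\<^bsub>?F\<^esub> delta ?x) <+>\<^bsub>?F\<^esub> (?K +>\<^bsub>?F\<^esub> delta ?y) = ?K +>\<^bsub>?F\<^esub> r"
    unfolding tensor_def quot_carrier[OF m K] by auto
  have "(\<lambda>p. 0) \<in> ?K" using K unfolding submodule_CC_iff[OF m] by (simp add: monoid_algebra_simps)
  then have "delta z \<in> ?K +>\<^bsub>?F\<^esub> delta z" for z
    by (force simp: a_r_coset_def' monoid_algebra_simps)
  then have "(\<lambda>p. delta ?x p + delta ?y p) \<in> ?K +>\<^bsub>?F\<^esub> r"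
    unfolding r(2)[symmetric] set_add_def' by (force simp: monoid_algebra_simps)
  then have "(\<lambda>p. delta ?x p + delta ?y p) \<in> carrier ?F" using mem_coset[OF m K r(1)] by blast
  moreover have "delta ?x ?x + delta ?y ?x \<noteq> 0" by (simp add: delta_def)
  ultimately have "?x \<in> carrier (?A \<times>\<times> ?A)" by (auto simp: monoid_algebra_simps supp_def)
  then have "tt D (- sroot D i) \<in> carrier (tUp D)" by simp
  then show ?thesis using tgen_carrier[OF Upl] by (simp add: gen_set_def image_iff)
qed

lemma root_wts: "i < rank D \<Longrightarrow> sroot D i \<in> wts D"
  using wts_minus[OF Upl _ minus_root_wts] by simp

abbreviation (input) "\<phi>0 \<equiv> pairing P"

lemma pairing_bilin: "bilin (tUp D) (tUm D) CC \<phi>0"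
  using pr by (auto simp: is_pairing_def Let_def bilinear_form_def bilin_def lin_def)

lemmas p1 = bilin1[OF pairing_bilin] and p2 = bilin2[OF pairing_bilin]

lemma pairing_multB: "a \<in> carrier (tUp D) \<Longrightarrow> b \<in> carrier (tUm D) \<Longrightarrow> b' \<in> carrier (tUm D) \<Longrightarrow>
    \<phi>0 a (b \<otimes>\<^bsub>tUm D\<^esub> b') = tlift CC (\<lambda>a1 a2. \<phi>0 a1 b * \<phi>0 a2 b') (cop_p P a)"
  and pairing_multA: "a \<in> carrier (tUp D) \<Longrightarrow> a' \<in> carrier (tUp D) \<Longrightarrow> b \<in> carrier (tUm D) \<Longrightarrow>
    \<phi>0 (a \<otimes>\<^bsub>tUp D\<^esub> a') b = tlift CC (\<lambda>b1 b2. \<phi>0 a b2 * \<phi>0 a' b1) (cop_m P b)"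
  and pairing_one: "a \<in> carrier (tUp D) \<Longrightarrow> \<phi>0 a \<one>\<^bsub>tUm D\<^esub> = cou_p P a" "b \<in> carrier (tUm D) \<Longrightarrow> \<phi>0 \<one>\<^bsub>tUp D\<^esub> b = cou_m P b"
  and pairing_gens: "i < rank D \<Longrightarrow> j < rank D \<Longrightarrow> \<phi>0 (te D i) (tf D j) = (if i = j then inverse (kap D i) else 0)"
    "i < rank D \<Longrightarrow> \<mu> \<in> wts D \<Longrightarrow> \<phi>0 (te D i) (tt' D \<mu>) = 0" "i < rank D \<Longrightarrow> \<mu> \<in> wts D \<Longrightarrow> \<phi>0 (tt D \<mu>) (tf D i) = 0"
  using pr by (auto simp: is_pairing_def Let_def kap_def inverse_eq_divide)

subsection \<open>The radicals\<close>

text \<open>By the product rules of the pairing, multiplying a radical element yields a Sweedler sum all of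
  whose terms vanish.\<close>

lemma left_rad_sub: "submodule (left_rad D P) CC (tUp D)"
  using lin_zero[OF mAp module_CC p2] cAp vs_zero[OF mAp]
  by (auto simp: submodule_CC_iff[OF mAp] left_rad_def lin_add[OF p2] lin_smult[OF p2])

lemma right_rad_sub: "submodule (right_rad D P) CC (tUm D)"
  using lin_zero[OF mAm module_CC p1] cAm vs_zero[OF mAm]
  by (auto simp: submodule_CC_iff[OF mAm] right_rad_def lin_add[OF p1] lin_smult[OF p1])

lemma left_rad_mult:
  assumes "a \<in> carrier (tUp D)" "x \<in> left_rad D P"
  shows "a \<otimes>\<^bsub>tUp D\<^esub> x \<in> left_rad D P" "x \<otimes>\<^bsub>tUp D\<^esub> a \<in> left_rad D P"
proof -
  have x: "x \<in> carrier (tUp D)" "\<And>b. b \<in> carrier (tUm D) \<Longrightarrow> \<phi>0 x b = 0" using assms by (auto simp: left_rad_def)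
  have "tlift CC (\<lambda>b1 b2. \<phi>0 a b2 * \<phi>0 x b1) (cop_m P b) = 0" "tlift CC (\<lambda>b1 b2. \<phi>0 x b2 * \<phi>0 a b1) (cop_m P b) = 0"
    if b: "b \<in> carrier (tUm D)" for b
    by (rule tlift_zero[OF mAm mAm cop_m_closed[OF b]]; use x in simp)+
  then show "a \<otimes>\<^bsub>tUp D\<^esub> x \<in> left_rad D P" "x \<otimes>\<^bsub>tUp D\<^esub> a \<in> left_rad D P"
    using assms(1) x by (auto simp: left_rad_def cAp pairing_multA)
qed

lemma right_rad_mult:
  assumes "a \<in> carrier (tUm D)" "x \<in> right_rad D P"
  shows "a \<otimes>\<^bsub>tUm D\<^esub> x \<in> right_rad D P" "x \<otimes>\<^bsub>tUm D\<^esub> a \<in> right_rad D P"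
proof -
  have x: "x \<in> carrier (tUm D)" "\<And>b. b \<in> carrier (tUp D) \<Longrightarrow> \<phi>0 b x = 0" using assms by (auto simp: right_rad_def)
  have "tlift CC (\<lambda>b1 b2. \<phi>0 b1 a * \<phi>0 b2 x) (cop_p P b) = 0" "tlift CC (\<lambda>b1 b2. \<phi>0 b1 x * \<phi>0 b2 a) (cop_p P b) = 0"
    if b: "b \<in> carrier (tUp D)" for b
    by (rule tlift_zero[OF mAp mAp cop_p_closed[OF b]]; use x in simp)+
  then show "a \<otimes>\<^bsub>tUm D\<^esub> x \<in> right_rad D P" "x \<otimes>\<^bsub>tUm D\<^esub> a \<in> right_rad D P"
    using assms(1) x by (auto simp: right_rad_def cAm pairing_multB)
qed

lemma left_rad_ideal: "alg_ideal (tUp D) (left_rad D P)"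
  using left_rad_sub left_rad_mult by (simp add: alg_ideal_def)
lemma right_rad_ideal: "alg_ideal (tUm D) (right_rad D P)"
  using right_rad_sub right_rad_mult by (simp add: alg_ideal_def)

lemmas Upq = quot_alg[OF Ap left_rad_ideal, folded Up_def]
lemmas Umq = quot_alg[OF Am right_rad_ideal, folded Um_def]
lemmas Upp = quot_proj[OF mAp left_rad_sub, folded Up_def]
lemmas Ump = quot_proj[OF mAm right_rad_sub, folded Um_def]
lemmas Upc = quot_carrier[OF mAp left_rad_sub, folded Up_def]
lemmas Umc = quot_carrier[OF mAm right_rad_sub, folded Um_def]
lemmas mUp = algD(3)[OF Upq(1)] and mUm = algD(3)[OF Umq(1)]

abbreviation (input) "cp x \<equiv> left_rad D P +>\<^bsub>tUp D\<^esub> x"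
abbreviation (input) "cm x \<equiv> right_rad D P +>\<^bsub>tUm D\<^esub> x"

lemma phi_coset:
  assumes a: "a \<in> carrier (tUp D)" and b: "b \<in> carrier (tUm D)"
  shows "phi P (cp a) (cm b) = \<phi>0 a b"
proof -
  let ?a = "SOME x. x \<in> cp a" and ?b = "SOME x. x \<in> cm b"
  have A: "cp a \<in> carrier (quot (tUp D) (left_rad D P))" and B: "cm b \<in> carrier (quot (tUm D) (right_rad D P))"
    using Upc Umc a b by (auto simp: Up_def Um_def)
  note sa = some_coset[OF mAp left_rad_sub A] and sb = some_coset[OF mAm right_rad_sub B]
  have "?a \<oplus>\<^bsub>tUp D\<^esub> (-1) \<odot>\<^bsub>tUp D\<^esub> a \<in> left_rad D P"
    using coset_eq_iff[OF mAp left_rad_sub sa(1) a] sa(2) by simp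
  then have "\<phi>0 (?a \<oplus>\<^bsub>tUp D\<^esub> (-1) \<odot>\<^bsub>tUp D\<^esub> a) ?b = 0" using sb(1) by (auto simp: left_rad_def)
  then have 1: "\<phi>0 ?a ?b = \<phi>0 a ?b" using sa(1) sb(1) a by (simp add: cAp lin_add[OF p2] lin_smult[OF p2])
  have "?b \<oplus>\<^bsub>tUm D\<^esub> (-1) \<odot>\<^bsub>tUm D\<^esub> b \<in> right_rad D P"
    using coset_eq_iff[OF mAm right_rad_sub sb(1) b] sb(2) by simp
  then have "\<phi>0 a (?b \<oplus>\<^bsub>tUm D\<^esub> (-1) \<odot>\<^bsub>tUm D\<^esub> b) = 0" using a by (auto simp: right_rad_def)
  then have "\<phi>0 a ?b = \<phi>0 a b" using a sb(1) b by (simp add: cAm lin_add[OF p1] lin_smult[OF p1])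
  with 1 show ?thesis by (simp add: phi_def)
qed

lemma cop_p_coideal:
  "\<forall>f\<in>(\<lambda>b a. \<phi>0 a b) ` carrier (tUm D). \<forall>g\<in>(\<lambda>b a. \<phi>0 a b) ` carrier (tUm D). \<forall>x\<in>left_rad D P.
     tlift CC (\<lambda>u v. f u * g v) (cop_p P x) = 0"
proof (intro ballI)
  fix f g x
  assume fg: "f \<in> (\<lambda>b a. \<phi>0 a b) ` carrier (tUm D)" "g \<in> (\<lambda>b a. \<phi>0 a b) ` carrier (tUm D)" and x: "x \<in> left_rad D P"
  obtain b b' where b: "b \<in> carrier (tUm D)" "b' \<in> carrier (tUm D)" "f = (\<lambda>a. \<phi>0 a b)" "g = (\<lambda>a. \<phi>0 a b')"
    using fg by blast
  then show "tlift CC (\<lambda>u v. f u * g v) (cop_p P x) = 0"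
    using x pairing_multB[of x b b', symmetric] nalg_mult[OF nAm] by (simp add: left_rad_def)
qed

lemma cop_m_coideal:
  "\<forall>f\<in>\<phi>0 ` carrier (tUp D). \<forall>g\<in>\<phi>0 ` carrier (tUp D). \<forall>x\<in>right_rad D P.
     tlift CC (\<lambda>u v. f u * g v) (cop_m P x) = 0"
proof (intro ballI)
  fix f g x
  assume fg: "f \<in> \<phi>0 ` carrier (tUp D)" "g \<in> \<phi>0 ` carrier (tUp D)" and x: "x \<in> right_rad D P"
  obtain b b' where b: "b \<in> carrier (tUp D)" "b' \<in> carrier (tUp D)" "f = \<phi>0 b" "g = \<phi>0 b'"
    using fg by blast
  have "tlift CC (\<lambda>u v. \<phi>0 b u * \<phi>0 b' v) (cop_m P x) = \<phi>0 (b' \<otimes>\<^bsub>tUp D\<^esub> b) x"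
    using x b pairing_multA[of b' b x] by (simp add: right_rad_def mult.commute)
  then show "tlift CC (\<lambda>u v. f u * g v) (cop_m P x) = 0"
    using x b nalg_mult[OF nAp] by (simp add: right_rad_def)
qed

lemma Fp: "\<forall>f\<in>(\<lambda>b a. \<phi>0 a b) ` carrier (tUm D). lin (tUp D) CC f"
    "left_rad D P = {a \<in> carrier (tUp D). \<forall>f\<in>(\<lambda>b a. \<phi>0 a b) ` carrier (tUm D). f a = 0}"
  by (auto simp: left_rad_def intro: p2)
lemma Fm: "\<forall>f\<in>\<phi>0 ` carrier (tUp D). lin (tUm D) CC f"
    "right_rad D P = {a \<in> carrier (tUm D). \<forall>f\<in>\<phi>0 ` carrier (tUp D). f a = 0}"
  by (auto simp: right_rad_def intro: p1)

text \<open>Both coproducts descend by \<open>quot_cop_coset\<close>, the functionals being the pairings with elements of the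
  other algebra.\<close>

definition "proj2p = tlift (tensor (Up D P) (Up D P)) (\<lambda>u v. pure (Up D P) (Up D P) (cp u) (cp v))"
definition "proj2m = tlift (tensor (Um D P) (Um D P)) (\<lambda>u v. pure (Um D P) (Um D P) (cm u) (cm v))"

lemmas Dp = quot_cop_coset[OF Ap left_rad_ideal cop_p Fp cop_p_coideal,
    folded Up_def, folded proj2p_def Delta_p_def]
lemmas Dm = quot_cop_coset[OF Am right_rad_ideal cop_m Fm cop_m_coideal,
    folded Um_def, folded proj2m_def Delta_m_def]

lemma hopf_pair_U: "hopf_pair (Up D P) (Um D P) (phi P) (Delta_p D P) (Delta_m D P)"
proof
  show "alg (Up D P)" "alg (Um D P)" by (rule Upq(1) Umq(1))+
  show b: "bilin (Up D P) (Um D P) CC (phi P)"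
    by (intro bilinI linI)
       (auto simp: Upc Umc phi_coset lin_add[OF Upp, symmetric] lin_smult[OF Upp, symmetric] lin_add[OF Ump, symmetric]
         lin_smult[OF Ump, symmetric] cAp cAm lin_add[OF p1] lin_add[OF p2] lin_smult[OF p1] lin_smult[OF p2])
  note b1 = bilin1[OF b] and b2 = bilin2[OF b]
  show "X = \<zero>\<^bsub>Up D P\<^esub>" if X: "X \<in> carrier (Up D P)" and z: "\<And>Y. Y \<in> carrier (Um D P) \<Longrightarrow> phi P X Y = 0" for X
  proof -
    obtain a where a: "a \<in> carrier (tUp D)" "X = cp a" using X by (auto simp: Upc)
    have "\<phi>0 a b = 0" if "b \<in> carrier (tUm D)" for b
      using z[of "cm b"] phi_coset[OF a(1) that] a(2) that by (simp add: Umc)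
    then have "a \<in> left_rad D P" using a by (auto simp: left_rad_def)
    then show ?thesis using coset_eq_zero_iff[OF mAp left_rad_sub a(1)] a(2) by (simp add: Up_def)
  qed
  show "Y = \<zero>\<^bsub>Um D P\<^esub>" if X: "Y \<in> carrier (Um D P)" and z: "\<And>X. X \<in> carrier (Up D P) \<Longrightarrow> phi P X Y = 0" for Y
  proof -
    obtain a where a: "a \<in> carrier (tUm D)" "Y = cm a" using X by (auto simp: Umc)
    have "\<phi>0 b a = 0" if "b \<in> carrier (tUp D)" for b
      using z[of "cp b"] phi_coset[OF that a(1)] a(2) that by (simp add: Upc)
    then have "a \<in> right_rad D P" using a by (auto simp: right_rad_def)
    then show ?thesis using coset_eq_zero_iff[OF mAm right_rad_sub a(1)] a(2) by (simp add: Um_def)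
  qed
  show "Delta_p D P X \<in> carrier (tensor (Up D P) (Up D P))" if "X \<in> carrier (Up D P)" for X
    using that Dp(1,2) cop_p_closed by (auto simp: Upc)
  show "Delta_m D P X \<in> carrier (tensor (Um D P) (Um D P))" if "X \<in> carrier (Um D P)" for X
    using that Dm(1,2) cop_m_closed by (auto simp: Umc)
  show "phi P X (Y \<otimes>\<^bsub>Um D P\<^esub> Y') = tlift CC (\<lambda>X1 X2. phi P X1 Y * phi P X2 Y') (Delta_p D P X)"
    if XY: "X \<in> carrier (Up D P)" "Y \<in> carrier (Um D P)" "Y' \<in> carrier (Um D P)" for X Y Y'
  proof -
    obtain a y y' where a: "a \<in> carrier (tUp D)" "X = cp a" "y \<in> carrier (tUm D)" "Y = cm y" "y' \<in> carrier (tUm D)" "Y' = cm y'"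
      using XY by (auto simp: Upc Umc)
    have "tlift CC (\<lambda>X1 X2. phi P X1 Y * phi P X2 Y') (Delta_p D P X) =
        tlift CC (\<lambda>u v. phi P (cp u) Y * phi P (cp v) Y') (cop_p P a)"
      unfolding a(2) Dp(1)[OF a(1)]
      by (rule Dp(3)[OF cop_p_closed[OF a(1)] module_CC bilin_functionals[OF mUp mUp b2[OF XY(2)] b2[OF XY(3)]]])
    also have "\<dots> = tlift CC (\<lambda>u v. \<phi>0 u y * \<phi>0 v y') (cop_p P a)"
      by (rule tlift_cong[OF mAp mAp module_CC _ _ cop_p_closed[OF a(1)]]) (use a in \<open>simp_all add: phi_coset\<close>)
    also have "\<dots> = phi P X (Y \<otimes>\<^bsub>Um D P\<^esub> Y')"
      using a by (simp add: Umq(2) phi_coset cAm pairing_multB)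
    finally show ?thesis ..
  qed
  show "phi P (X \<otimes>\<^bsub>Up D P\<^esub> X') Y = tlift CC (\<lambda>Y1 Y2. phi P X Y2 * phi P X' Y1) (Delta_m D P Y)"
    if XY: "X \<in> carrier (Up D P)" "X' \<in> carrier (Up D P)" "Y \<in> carrier (Um D P)" for X X' Y
  proof -
    obtain a a' y where a: "a \<in> carrier (tUp D)" "X = cp a" "a' \<in> carrier (tUp D)" "X' = cp a'" "y \<in> carrier (tUm D)" "Y = cm y"
      using XY by (auto simp: Upc Umc)
    have bb: "bilin (Um D P) (Um D P) CC (\<lambda>Y1 Y2. phi P X Y2 * phi P X' Y1)"
      by (intro bilinI lin_mult_CC lin_mult_CC' b1 XY)
    have "tlift CC (\<lambda>Y1 Y2. phi P X Y2 * phi P X' Y1) (Delta_m D P Y) =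
        tlift CC (\<lambda>u v. phi P X (cm v) * phi P X' (cm u)) (cop_m P y)"
      unfolding a(6) Dm(1)[OF a(5)]
      by (rule Dm(3)[OF cop_m_closed[OF a(5)] module_CC bb])
    also have "\<dots> = tlift CC (\<lambda>u v. \<phi>0 a v * \<phi>0 a' u) (cop_m P y)"
      by (rule tlift_cong[OF mAm mAm module_CC _ _ cop_m_closed[OF a(5)]]) (use a in \<open>simp_all add: phi_coset\<close>)
    also have "\<dots> = phi P (X \<otimes>\<^bsub>Up D P\<^esub> X') Y"
      using a by (simp add: Upq(2) phi_coset cAp pairing_multA)
    finally show ?thesis ..
  qed
  have hp: "cop_p P (x \<otimes>\<^bsub>tUp D\<^esub> y) = cop_p P x \<otimes>\<^bsub>tensor (tUp D) (tUp D)\<^esub> cop_p P y"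
    if "x \<in> carrier (tUp D)" "y \<in> carrier (tUp D)" for x y
    using that cop_p by (auto simp: alg_hom_def ring_hom_def)
  have hm: "cop_m P (x \<otimes>\<^bsub>tUm D\<^esub> y) = cop_m P x \<otimes>\<^bsub>tensor (tUm D) (tUm D)\<^esub> cop_m P y"
    if "x \<in> carrier (tUm D)" "y \<in> carrier (tUm D)" for x y
    using that cop_m by (auto simp: alg_hom_def ring_hom_def)
  show "Delta_p D P (X \<otimes>\<^bsub>Up D P\<^esub> Y) = Delta_p D P X \<otimes>\<^bsub>tensor (Up D P) (Up D P)\<^esub> Delta_p D P Y"
    if XY: "X \<in> carrier (Up D P)" "Y \<in> carrier (Up D P)" for X Y
    using XY by (auto simp: Upc Upq(2) Dp(1) Dp(4) cAp hp cop_p_closed)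
  show "Delta_m D P (X \<otimes>\<^bsub>Um D P\<^esub> Y) = Delta_m D P X \<otimes>\<^bsub>tensor (Um D P) (Um D P)\<^esub> Delta_m D P Y"
    if XY: "X \<in> carrier (Um D P)" "Y \<in> carrier (Um D P)" for X Y
    using XY by (auto simp: Umc Umq(2) Dm(1) Dm(4) cAm hm cop_m_closed)
  have "cop_p P \<one>\<^bsub>tUp D\<^esub> = pure (tUp D) (tUp D) \<one>\<^bsub>tUp D\<^esub> \<one>\<^bsub>tUp D\<^esub>"
    using cop_p alg_tensor(3)[OF Ap Ap] by (auto simp: alg_hom_def ring_hom_def)
  then show "Delta_p D P \<one>\<^bsub>Up D P\<^esub> = pure (Up D P) (Up D P) \<one>\<^bsub>Up D P\<^esub> \<one>\<^bsub>Up D P\<^esub>"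
    by (simp add: Upq(3) Dp(1) Dp(5) oneAp)
  have "cop_m P \<one>\<^bsub>tUm D\<^esub> = pure (tUm D) (tUm D) \<one>\<^bsub>tUm D\<^esub> \<one>\<^bsub>tUm D\<^esub>"
    using cop_m alg_tensor(3)[OF Am Am] by (auto simp: alg_hom_def ring_hom_def)
  then show "Delta_m D P \<one>\<^bsub>Um D P\<^esub> = pure (Um D P) (Um D P) \<one>\<^bsub>Um D P\<^esub> \<one>\<^bsub>Um D P\<^esub>"
    by (simp add: Umq(3) Dm(1) Dm(5) oneAm)
  have "cou_p P \<one>\<^bsub>tUp D\<^esub> = 1" using \<open>is_hopf_p D P\<close> by (auto simp: is_hopf_p_def alg_hom_def ring_hom_def)
  then show "phi P \<one>\<^bsub>Up D P\<^esub> \<one>\<^bsub>Um D P\<^esub> = 1"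
    by (simp add: Upq(3) Umq(3) phi_coset oneAp oneAm pairing_one)
qed

lemma gen_values:
  "i < rank D \<Longrightarrow> cop_p P (te D i) = pure (tUp D) (tUp D) (te D i) (tt D (- sroot D i))
      \<oplus>\<^bsub>tensor (tUp D) (tUp D)\<^esub> pure (tUp D) (tUp D) \<one>\<^bsub>tUp D\<^esub> (te D i)"
  "i < rank D \<Longrightarrow> cop_m P (tf D i) = pure (tUm D) (tUm D) (tf D i) \<one>\<^bsub>tUm D\<^esub>
      \<oplus>\<^bsub>tensor (tUm D) (tUm D)\<^esub> pure (tUm D) (tUm D) (tt' D (sroot D i)) (tf D i)"
  "\<mu> \<in> wts D \<Longrightarrow> cop_p P (tt D \<mu>) = pure (tUp D) (tUp D) (tt D \<mu>) (tt D \<mu>)"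
  "\<mu> \<in> wts D \<Longrightarrow> cop_m P (tt' D \<mu>) = pure (tUm D) (tUm D) (tt' D \<mu>) (tt' D \<mu>)"
  "i < rank D \<Longrightarrow> cou_p P (te D i) = 0" "i < rank D \<Longrightarrow> cou_m P (tf D i) = 0"
  "\<mu> \<in> wts D \<Longrightarrow> cou_p P (tt D \<mu>) = 1" "\<mu> \<in> wts D \<Longrightarrow> cou_m P (tt' D \<mu>) = 1"
  using hp hm by (auto simp: is_hopf_p_def is_hopf_m_def)

lemma hopf_gens_U:
  "hopf_gens (Up D P) (Um D P) (phi P) (Delta_p D P) (Delta_m D P) {..<rank D} (wts D) (gt D P) (gt' D P)
     (ge D P) (gf D P) (kap D) (sroot D) (\<lambda>i. - sroot D i)"
proof (intro hopf_gens.intro hopf_pair_U, unfold_locales)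
  note d = gt_def gt'_def ge_def gf_def
  note mUU = module_tensor[OF mUp mUp] and mUUm = module_tensor[OF mUm mUm]
  fix i j \<mu> \<nu>
  {
    assume mu: "\<mu> \<in> wts D"
    note c = tt_closed[OF mu] tt'_closed[OF mu]
    show "gt D P \<mu> \<in> carrier (Up D P)" "gt' D P \<mu> \<in> carrier (Um D P)"
      using c by (auto simp: d Upc Umc)
    show "Delta_p D P (gt D P \<mu>) = pure (Up D P) (Up D P) (gt D P \<mu>) (gt D P \<mu>)"
      using c mu by (simp add: d Dp(1) gen_values Dp(5))
    show "Delta_m D P (gt' D P \<mu>) = pure (Um D P) (Um D P) (gt' D P \<mu>) (gt' D P \<mu>)"
      using c mu by (simp add: d Dm(1) gen_values Dm(5))
    show "phi P (gt D P \<mu>) \<one>\<^bsub>Um D P\<^esub> = 1" "phi P \<one>\<^bsub>Up D P\<^esub> (gt' D P \<mu>) = 1"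
      using c mu oneAp oneAm by (simp_all add: d Upq(3) Umq(3) phi_coset pairing_one gen_values)
    {
      assume i: "i \<in> {..<rank D}"
      then have ci: "te D i \<in> carrier (tUp D)" "tf D i \<in> carrier (tUm D)" "i < rank D" by (auto simp: te_closed tf_closed)
      show "phi P (ge D P i) (gt' D P \<mu>) = 0" "phi P (gt D P \<mu>) (gf D P i) = 0"
        using c ci mu by (simp_all add: d phi_coset pairing_gens)
      have "gt D P \<mu> \<otimes>\<^bsub>Up D P\<^esub> ge D P i = qpow D (ip D (sroot D i) \<mu>) \<odot>\<^bsub>Up D P\<^esub> (ge D P i \<otimes>\<^bsub>Up D P\<^esub> gt D P \<mu>)"
        using c ci tor_gen[OF Upl mu ci(3)] cAp by (simp add: d Upq(2) lin_smult[OF Upp])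
      then show "\<exists>c. c \<noteq> 0 \<and> gt D P \<mu> \<otimes>\<^bsub>Up D P\<^esub> ge D P i = c \<odot>\<^bsub>Up D P\<^esub> (ge D P i \<otimes>\<^bsub>Up D P\<^esub> gt D P \<mu>)"
        using qpow_nonzero by blast
      have "gt' D P \<mu> \<otimes>\<^bsub>Um D P\<^esub> gf D P i = qpow D (- ip D (sroot D i) \<mu>) \<odot>\<^bsub>Um D P\<^esub> (gf D P i \<otimes>\<^bsub>Um D P\<^esub> gt' D P \<mu>)"
        using c ci tor_gen[OF Umi mu ci(3)] cAm by (simp add: d Umq(2) lin_smult[OF Ump])
      then show "\<exists>c. gt' D P \<mu> \<otimes>\<^bsub>Um D P\<^esub> gf D P i = c \<odot>\<^bsub>Um D P\<^esub> (gf D P i \<otimes>\<^bsub>Um D P\<^esub> gt' D P \<mu>)" by blast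
    }
    assume nu: "\<nu> \<in> wts D"
    show "gt D P \<mu> \<otimes>\<^bsub>Up D P\<^esub> gt D P \<nu> = gt D P \<nu> \<otimes>\<^bsub>Up D P\<^esub> gt D P \<mu>"
      using c tt_closed[OF nu] mu nu by (simp add: d Upq(2) tor_mult[OF Upl] add.commute)
  }
  {
    assume i: "i \<in> {..<rank D}"
    then have i': "i < rank D" by simp
    note c = te_closed[OF i'] tf_closed[OF i'] tt_closed[OF root_wts[OF i']] tt_closed[OF minus_root_wts[OF i']]
      tt'_closed[OF root_wts[OF i']] oneAp oneAm root_wts[OF i'] minus_root_wts[OF i']
    show "ge D P i \<in> carrier (Up D P)" "gf D P i \<in> carrier (Um D P)"
      using c by (auto simp: d Upc Umc)
    show "sroot D i \<in> wts D" "- sroot D i \<in> wts D" by fact+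
    show "Delta_p D P (ge D P i) = pure (Up D P) (Up D P) (ge D P i) (gt D P (- sroot D i)) \<oplus>\<^bsub>tensor (Up D P) (Up D P)\<^esub>
        pure (Up D P) (Up D P) \<one>\<^bsub>Up D P\<^esub> (ge D P i)"
      using c i' by (simp add: d Dp(1) gen_values lin_add[OF Dp(6)] pure_carrier[OF mAp mAp] Dp(5) Upq(3))
    show "Delta_m D P (gf D P i) = pure (Um D P) (Um D P) (gf D P i) \<one>\<^bsub>Um D P\<^esub> \<oplus>\<^bsub>tensor (Um D P) (Um D P)\<^esub>
        pure (Um D P) (Um D P) (gt' D P (sroot D i)) (gf D P i)"
      using c i' by (simp add: d Dm(1) gen_values lin_add[OF Dm(6)] pure_carrier[OF mAm mAm] Dm(5) Umq(3))
    show "phi P (ge D P i) \<one>\<^bsub>Um D P\<^esub> = 0" "phi P \<one>\<^bsub>Up D P\<^esub> (gf D P i) = 0"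
      using c i' by (simp_all add: d Upq(3) Umq(3) phi_coset pairing_one gen_values)
    show "gt D P (sroot D i) \<otimes>\<^bsub>Up D P\<^esub> gt D P (- sroot D i) = \<one>\<^bsub>Up D P\<^esub>"
      "gt D P (- sroot D i) \<otimes>\<^bsub>Up D P\<^esub> gt D P (sroot D i) = \<one>\<^bsub>Up D P\<^esub>"
      using c by (simp_all add: d Upq(2,3) tor_mult[OF Upl] tor_zero[OF Upl])
    assume j: "j \<in> {..<rank D}"
    show "phi P (ge D P i) (gf D P j) = (if i = j then inverse (kap D i) else 0)"
      using c i' j tf_closed[of j] by (simp add: d phi_coset pairing_gens)
  }
  have g: "(\<lambda>x. cp x) ` tgen D 1 ` gen_set D = ge D P ` {..<rank D} \<union> gt D P ` wts D"
    "(\<lambda>x. cm x) ` tgen D (-1) ` gen_set D = gf D P ` {..<rank D} \<union> gt' D P ` wts D"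
    by (auto simp: d gen_set_def image_Un image_image)
  show "x \<in> carrier (subalg (Up D P) (ge D P ` {..<rank D} \<union> gt D P ` wts D))" if "x \<in> carrier (Up D P)" for x
    unfolding g(1)[symmetric] Up_def
    by (rule quot_generated[OF Ap left_rad_ideal tgen_sub[OF Upl] tU_generated[OF Upl]]) (use that in \<open>auto simp: Up_def\<close>)
  show "x \<in> carrier (subalg (Um D P) (gf D P ` {..<rank D} \<union> gt' D P ` wts D))" if "x \<in> carrier (Um D P)" for x
    unfolding g(2)[symmetric] Um_def
    by (rule quot_generated[OF Am right_rad_ideal tgen_sub[OF Umi] tU_generated[OF Umi]]) (use that in \<open>auto simp: Um_def\<close>)
qed

end

section \<open>Finite sums and generalized inverses\<close>

lemma finsum_CC: "finsum CC h S = sum h S"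
proof (cases "finite S")
  interpret C: module CC CC by (rule module_CC)
  case True
  then show ?thesis by (induction S) (auto simp: C.finsum_insert)
next
  interpret C: module CC CC by (rule module_CC)
  case False
  then show ?thesis by (simp add: C.finsum_infinite)
qed

lemma lin_finsum:
  assumes V: "module CC V" and W: "module CC W" and f: "lin V W f" and S: "finite S"
    and h: "\<And>s. s \<in> S \<Longrightarrow> h s \<in> carrier V"
  shows "f (finsum V h S) = finsum W (\<lambda>s. f (h s)) S" "finsum V h S \<in> carrier V"
proof -
  interpret V: module CC V by (fact V)
  interpret W: module CC W by (fact W)
  show "finsum V h S \<in> carrier V" using h by (intro V.finsum_closed) auto
  show "f (finsum V h S) = finsum W (\<lambda>s. f (h s)) S"
    using S h
  proof (induction S)
    case empty
    then show ?case using lin_zero[OF V W f] by simp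
  next
    case (insert s S)
    then have "finsum V h S \<in> carrier V" by (intro V.finsum_closed) auto
    moreover have "finsum V h (insert s S) = h s \<oplus>\<^bsub>V\<^esub> finsum V h S"
      using insert by (intro V.finsum_insert) auto
    moreover have "finsum W (\<lambda>s. f (h s)) (insert s S) = f (h s) \<oplus>\<^bsub>W\<^esub> finsum W (\<lambda>s. f (h s)) S"
      using insert lin_closed[OF f] by (intro W.finsum_insert) auto
    ultimately show ?case using insert lin_add[OF f] by simp
  qed
qed

lemma finsum_all_zero:
  assumes "module CC V" "\<And>s. s \<in> S \<Longrightarrow> h s = \<zero>\<^bsub>V\<^esub>" shows "finsum V h S = \<zero>\<^bsub>V\<^esub>"
proof -
  interpret V: module CC V by (fact assms(1))
  have "finsum V h S = finsum V (\<lambda>s. \<zero>\<^bsub>V\<^esub>) S" using assms(2) by (intro V.finsum_cong') auto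
  then show ?thesis by simp
qed

lemma sum_apply: "(\<Sum>x\<in>S. h x :: 'a \<Rightarrow> complex) z = (\<Sum>x\<in>S. h x z)"
  by (induction S rule: infinite_finite_induct) auto

text \<open>A linear map has a linear right inverse on its range; \<open>g\<close> is its matrix.\<close>

lemma generalized_inverse:
  fixes m :: "'x \<Rightarrow> 'y \<Rightarrow> complex"
  assumes S: "finite S" and R: "finite R"
  shows "\<exists>g. \<forall>x\<in>S. \<forall>y\<in>R. (\<Sum>x'\<in>S. (\<Sum>y'\<in>R. m x y' * g y' x') * m x' y) = m x y"
proof -
  let ?s1 = "\<lambda>(c::complex) (h::'y \<Rightarrow> complex) z. c * h z" and ?s2 = "\<lambda>(c::complex) (h::'x \<Rightarrow> complex) z. c * h z"
  interpret s1: vector_space ?s1 by unfold_locales (auto simp: algebra_simps)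
  interpret s2: vector_space ?s2 by unfold_locales (auto simp: algebra_simps)
  interpret vp: vector_space_pair ?s1 ?s2 by unfold_locales
  define f where "f h = (\<lambda>x. if x \<in> S then \<Sum>y\<in>R. m x y * h y else 0)" for h
  have lf: "Vector_Spaces.linear ?s1 ?s2 f"
    by unfold_locales (auto simp: f_def algebra_simps sum.distrib sum_distrib_left)
  obtain g where g: "Vector_Spaces.linear ?s2 ?s1 g" "\<forall>v\<in>f ` UNIV. f (g v) = v"
    using vp.linear_exists_right_inverse_on[OF lf, of UNIV] s1.subspace_UNIV by auto
  interpret g: Vector_Spaces.linear ?s2 ?s1 g by (fact g(1))
  define d where "d x = (\<lambda>z. if z = x then 1 else 0 :: complex)" for x :: 'x
  have expand: "h = (\<Sum>x\<in>S. ?s2 (h x) (d x))" if "\<And>x. x \<notin> S \<Longrightarrow> h x = 0" for h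
  proof
    fix z
    have "(\<Sum>x\<in>S. ?s2 (h x) (d x)) z = (\<Sum>x\<in>S. h x * d x z)" by (simp add: sum_apply)
    also have "\<dots> = (\<Sum>x\<in>S. if x = z then h x else 0)" by (intro sum.cong) (auto simp: d_def)
    also have "\<dots> = h z" using S that by (simp add: sum.delta)
    finally show "h z = (\<Sum>x\<in>S. ?s2 (h x) (d x)) z" ..
  qed
  have "(\<Sum>x'\<in>S. (\<Sum>y'\<in>R. m x y' * g (d x') y') * m x' y) = m x y" if x: "x \<in> S" and y: "y \<in> R" for x y
  proof -
    define u where "u = (\<lambda>z. if z = y then 1 else 0 :: complex)"
    have fu: "f u x' = m x' y" if "x' \<in> S" for x'
    proof -
      have "(\<Sum>z\<in>R. m x' z * u z) = (\<Sum>z\<in>R. if z = y then m x' z else 0)" by (intro sum.cong) (auto simp: u_def)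
      then show ?thesis using that y R by (simp add: f_def sum.delta)
    qed
    have "g (f u) = g (\<Sum>x'\<in>S. ?s2 (f u x') (d x'))"
      by (rule arg_cong[OF expand]) (simp add: f_def)
    also have "\<dots> = (\<Sum>x'\<in>S. ?s1 (f u x') (g (d x')))" by (simp add: g.sum g.scale)
    finally have gz: "g (f u) z = (\<Sum>x'\<in>S. f u x' * g (d x') z)" for z
      by (simp add: sum_apply)
    have f_at: "f h x = (\<Sum>y\<in>R. m x y * h y)" for h using x by (simp add: f_def)
    have "m x y = f (g (f u)) x" using g(2) fu[OF x] by simp
    also have "\<dots> = (\<Sum>y'\<in>R. m x y' * (\<Sum>x'\<in>S. f u x' * g (d x') y'))" by (simp only: f_at gz)
    also have "\<dots> = (\<Sum>y'\<in>R. \<Sum>x'\<in>S. m x y' * g (d x') y' * f u x')"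
      by (simp add: sum_distrib_left mult_ac)
    also have "\<dots> = (\<Sum>x'\<in>S. \<Sum>y'\<in>R. m x y' * g (d x') y' * f u x')" by (rule sum.swap)
    also have "\<dots> = (\<Sum>x'\<in>S. (\<Sum>y'\<in>R. m x y' * g (d x') y') * m x' y)"
      by (intro sum.cong refl) (simp add: fu flip: sum_distrib_right)
    finally show ?thesis ..
  qed
  then show ?thesis by (intro exI[of _ "\<lambda>y' x'. g (d x') y'"]) simp
qed

section \<open>The quantized Weyl algebra\<close>

locale weyl =
  hopf_gens "Up D P" "Um D P" "phi P" "Delta_p D P" "Delta_m D P" "{..<rank D}" "wts D" "gt D P" "gt' D P"
    "ge D P" "gf D P" "kap D" "sroot D" "\<lambda>i. - sroot D i"
  for D :: "'w::ab_group_add qdatum" and P :: "'w hopf_data"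
begin

abbreviation "I \<equiv> {..<rank D}"
abbreviation "jE \<equiv> inr_H D P"
abbreviation "jF \<equiv> inl_H D P"

lemma j_def: "jE a = pure (Um D P) (Up D P) \<one>\<^bsub>Um D P\<^esub> a" "jF b = pure (Um D P) (Up D P) b \<one>\<^bsub>Up D P\<^esub>"
  by (simp_all add: inr_H_def inl_H_def sharp_def)

lemma ge'_e': "ge' D P i = e' i"
  by (simp add: ge'_def e'_def kap_def)

lemma Bmm_M: "Bmm D P = M" and Bpp_E: "Bpp D P = E"
  by (simp_all add: Bmm_def Bpp_def ge'_e')

lemma skew_act_act: "skew_act D P = act"
  by (intro ext) (simp add: skew_act_def act_def)

lemma heis_Hd: "heis D P = Hd"
proof -
  have "heis_mult D P = hmul" by (intro ext) (simp add: heis_mult_def hmul_def Let_def sharp_def)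
  then show ?thesis by (simp add: heis_def Hd_def)
qed

abbreviation "wgens \<equiv> (\<lambda>j. jF (gf D P j)) ` I \<union> (\<lambda>i. jE (ge' D P i)) ` I"

lemma pure_Hd: "b \<in> carrier (Um D P) \<Longrightarrow> a \<in> carrier (Up D P) \<Longrightarrow> pure (Um D P) (Up D P) b a \<in> carrier Hd"
  using pure_carrier[OF mB mA] by simp

lemma bgens: "wgens \<union> (\<lambda>\<mu>. jE (gt D P \<mu>)) ` wts D \<subseteq> carrier Hd"
  using pure_Hd oneA oneB f t by (auto simp: j_def ge'_e')

lemma nalg_q: "nalg (q_boson D P)"
  using nalg_subalg[OF nalg_Hd bgens] by (simp add: q_boson_def heis_Hd)

lemma wgens_q: "wgens \<subseteq> carrier (q_boson D P)"
  using subalg_gen[OF nalg_Hd bgens] by (auto simp: q_boson_def heis_Hd)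

abbreviation "W \<equiv> Wq D P"

lemma nalg_W: "nalg W"
  using nalg_subalg[OF nalg_q wgens_q] by (simp add: Wq_def)

lemmas mW = nalgD(1)[OF nalg_W]

lemma W_T: "w \<in> carrier W \<Longrightarrow> w \<in> carrier T"
  using subalg_sub[OF nalg_q wgens_q, of w] subalg_sub[OF nalg_Hd bgens, of w]
  by (simp add: Wq_def q_boson_def heis_Hd)

lemma W_ops: "x \<otimes>\<^bsub>W\<^esub> y = hmul x y" "x \<oplus>\<^bsub>W\<^esub> y = x \<oplus>\<^bsub>T\<^esub> y" "c \<odot>\<^bsub>W\<^esub> x = c \<odot>\<^bsub>T\<^esub> x"
  "\<one>\<^bsub>W\<^esub> = pure (Um D P) (Up D P) \<one>\<^bsub>Um D P\<^esub> \<one>\<^bsub>Up D P\<^esub>"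
  by (simp_all add: Wq_def q_boson_def heis_Hd)

lemma W_closed: "x \<in> carrier W \<Longrightarrow> y \<in> carrier W \<Longrightarrow> x \<otimes>\<^bsub>W\<^esub> y \<in> carrier W"
  "x \<in> carrier W \<Longrightarrow> y \<in> carrier W \<Longrightarrow> x \<oplus>\<^bsub>W\<^esub> y \<in> carrier W" "x \<in> carrier W \<Longrightarrow> c \<odot>\<^bsub>W\<^esub> x \<in> carrier W"
  "\<one>\<^bsub>W\<^esub> \<in> carrier W"
  using nalg_W vs_add[OF mW] vs_smult[OF mW] by (auto intro: nalg_mult nalgD)

lemma W_induct [consumes 1, case_names F E one add smult mult]:
  assumes "w \<in> carrier W" "\<And>j. j \<in> I \<Longrightarrow> Q (jF (gf D P j))" "\<And>i. i \<in> I \<Longrightarrow> Q (jE (e' i))" "Q \<one>\<^bsub>W\<^esub>"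
    "\<And>x y. x \<in> carrier W \<Longrightarrow> y \<in> carrier W \<Longrightarrow> Q x \<Longrightarrow> Q y \<Longrightarrow> Q (x \<oplus>\<^bsub>W\<^esub> y)"
    "\<And>c x. x \<in> carrier W \<Longrightarrow> Q x \<Longrightarrow> Q (c \<odot>\<^bsub>W\<^esub> x)"
    "\<And>x y. x \<in> carrier W \<Longrightarrow> y \<in> carrier W \<Longrightarrow> Q x \<Longrightarrow> Q y \<Longrightarrow> Q (x \<otimes>\<^bsub>W\<^esub> y)"
  shows "Q w"
proof -
  have "w \<in> carrier (subalg (q_boson D P) wgens)" using assms(1) by (simp add: Wq_def)
  then show ?thesis
    by (induction rule: subalg_induct[OF nalg_q wgens_q, consumes 1, case_names gen one add smult mult])
       (use assms(2-) in \<open>auto simp: Wq_def ge'_e'\<close>)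
qed

lemma jE_ops:
  "a \<in> carrier (Up D P) \<Longrightarrow> b \<in> carrier (Up D P) \<Longrightarrow> jE (a \<otimes>\<^bsub>Up D P\<^esub> b) = jE a \<otimes>\<^bsub>W\<^esub> jE b"
  "a \<in> carrier (Up D P) \<Longrightarrow> b \<in> carrier (Up D P) \<Longrightarrow> jE (a \<oplus>\<^bsub>Up D P\<^esub> b) = jE a \<oplus>\<^bsub>W\<^esub> jE b"
  "a \<in> carrier (Up D P) \<Longrightarrow> jE (c \<odot>\<^bsub>Up D P\<^esub> a) = c \<odot>\<^bsub>W\<^esub> jE a" "jE \<one>\<^bsub>Up D P\<^esub> = \<one>\<^bsub>W\<^esub>"
  by (simp_all add: j_def W_ops hmul_r lin_add[OF bilin1[OF pT]] lin_smult[OF bilin1[OF pT]] oneB)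

lemma jF_ops:
  "a \<in> carrier (Um D P) \<Longrightarrow> b \<in> carrier (Um D P) \<Longrightarrow> jF (a \<otimes>\<^bsub>Um D P\<^esub> b) = jF a \<otimes>\<^bsub>W\<^esub> jF b"
  "a \<in> carrier (Um D P) \<Longrightarrow> b \<in> carrier (Um D P) \<Longrightarrow> jF (a \<oplus>\<^bsub>Um D P\<^esub> b) = jF a \<oplus>\<^bsub>W\<^esub> jF b"
  "a \<in> carrier (Um D P) \<Longrightarrow> jF (c \<odot>\<^bsub>Um D P\<^esub> a) = c \<odot>\<^bsub>W\<^esub> jF a" "jF \<one>\<^bsub>Um D P\<^esub> = \<one>\<^bsub>W\<^esub>"
  by (simp_all add: j_def W_ops hmul_l lin_add[OF bilin2[OF pT]] lin_smult[OF bilin2[OF pT]] oneA)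

lemma jE_W: "a \<in> carrier E \<Longrightarrow> jE a \<in> carrier W"
proof (induction rule: E_induct)
  case (gen s)
  then show ?case using subalg_gen[OF nalg_q wgens_q] by (auto simp: Wq_def ge'_e')
qed (simp_all add: jE_ops E_sub W_closed)

lemma jF_W: "a \<in> carrier M \<Longrightarrow> jF a \<in> carrier W"
proof (induction rule: M_induct)
  case (gen s)
  then show ?case using subalg_gen[OF nalg_q wgens_q] by (auto simp: Wq_def)
qed (simp_all add: jF_ops M_sub W_closed)

lemma EF_relation: "i \<in> I \<Longrightarrow> j \<in> I \<Longrightarrow> jE (e' i) \<otimes>\<^bsub>W\<^esub> jF (gf D P j) =
   \<delta> i j \<odot>\<^bsub>W\<^esub> \<one>\<^bsub>W\<^esub> \<oplus>\<^bsub>W\<^esub> \<chi> i j \<odot>\<^bsub>W\<^esub> (jF (gf D P j) \<otimes>\<^bsub>W\<^esub> jE (e' i))"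
  by (simp add: W_ops j_def weyl_relation)

lemma rep_M: "w \<in> carrier W \<Longrightarrow> x \<in> carrier M \<Longrightarrow> rep w x \<in> carrier M"
proof (induction arbitrary: x rule: W_induct)
  case (F j)
  then show ?case using f M_sub[OF F(2)] by (simp add: j_def rep_pure oneA act_one M_closed f_M)
next
  case (E i)
  then show ?case using M_sub[OF E(2)]
    by (simp add: j_def rep_pure oneB alg_one[OF B] act_closed act_e'_M)
next
  case one
  then show ?case using M_sub[OF one] by (simp add: W_ops rep_pure oneB oneA act_one alg_one[OF B])
next
  case (add v w)
  then show ?case by (simp add: W_ops lin_add[OF bilin2[OF bilin_rep]] W_T M_sub M_closed)
next
  case (smult c v)
  then show ?case by (simp add: W_ops lin_smult[OF bilin2[OF bilin_rep]] W_T M_sub M_closed)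
next
  case (mult v w)
  then show ?case by (simp add: W_ops rep_hmul W_T M_sub)
qed

lemmas mM = algD(3)[OF M_alg] and mE = algD(3)[OF E_alg]

subsection \<open>Coordinates on induced modules\<close>

text \<open>The map \<open>\<phi>(e, \<sqdot>) \<otimes> id\<close>. For \<open>e\<close> running through the words in the positive generators its values are the
  coordinates of \<open>t\<close>: they determine \<open>t\<close>, and almost all of them vanish.\<close>

definition cc :: "'u calg \<Rightarrow> 'w U \<Rightarrow> ('w U \<times> 'u \<Rightarrow> complex) set \<Rightarrow> 'u" where
  "cc V e t = tlift V (\<lambda>x v. phi P e x \<odot>\<^bsub>V\<^esub> v) t"

lemma lin_\<phi>M: "e \<in> carrier (Up D P) \<Longrightarrow> lin M CC (phi P e)"
  by (rule lin_subalg[OF nB genM \<phi>1])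

context
  fixes V :: "'u calg"
  assumes V: "module CC V"
begin

lemmas mMV = module_tensor[OF mM V] and pMV = bilin_pure[OF mM V] and pcMV = pure_carrier[OF mM V]

lemma bilin_cc: "e \<in> carrier (Up D P) \<Longrightarrow> bilin M V V (\<lambda>x v. phi P e x \<odot>\<^bsub>V\<^esub> v)"
  by (rule bilin_functional[OF mM V lin_\<phi>M])

lemma lin_cc: "e \<in> carrier (Up D P) \<Longrightarrow> lin (tensor M V) V (cc V e)"
  unfolding cc_def by (rule lin_tlift[OF mM V V bilin_cc])

lemma cc_pure: "e \<in> carrier (Up D P) \<Longrightarrow> x \<in> carrier M \<Longrightarrow> v \<in> carrier V \<Longrightarrow> cc V e (pure M V x v) = phi P e x \<odot>\<^bsub>V\<^esub> v"
  unfolding cc_def by (rule tlift_pure[OF mM V V bilin_cc])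

lemma lin_cc': "t \<in> carrier (tensor M V) \<Longrightarrow> lin (Up D P) V (\<lambda>e. cc V e t)"
  unfolding cc_def
  by (rule lin_tlift_param[OF mM V V bilin_cc mA]) (auto intro: lin_scale_left[OF V \<phi>2] M_sub)

lemma cc_eqI:
  assumes "s \<in> carrier (tensor M V)" "t \<in> carrier (tensor M V)"
    "\<And>u. u \<in> lists I \<Longrightarrow> cc V (ew u) s = cc V (ew u) t"
  shows "s = t"
proof (rule tensor_eq_by_functionals[OF mM V, of "(\<lambda>u. phi P (ew u)) ` lists I"])
  show "x = \<zero>\<^bsub>M\<^esub>" if x: "x \<in> carrier M" and z: "\<And>h. h \<in> (\<lambda>u. phi P (ew u)) ` lists I \<Longrightarrow> h x = 0" for x
    using nondeg_M_words[OF x] z by simp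
qed (use assms in \<open>auto simp: cc_def intro: lin_\<phi>M ew_A\<close>)

lemma \<phi>_bounded: "x \<in> carrier M \<Longrightarrow> \<exists>l. \<forall>u\<in>lists I. l \<le> length u \<longrightarrow> phi P (ew u) x = 0"
proof (induction rule: M_word_induct)
  case (word w)
  then show ?case by (intro exI[of _ "Suc (length w)"]) (auto intro: \<phi>_ew_fw)
next
  case (add x y)
  then obtain k l where "\<forall>u\<in>lists I. k \<le> length u \<longrightarrow> phi P (ew u) x = 0" "\<forall>u\<in>lists I. l \<le> length u \<longrightarrow> phi P (ew u) y = 0"
    by blast
  then show ?case using add(1,2) by (intro exI[of _ "max k l"]) (auto simp: lin_add[OF \<phi>1[OF ew_A]] M_sub)
next
  case (smult c x)
  then show ?case by (auto simp: lin_smult[OF \<phi>1[OF ew_A]] M_sub)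
qed

lemma cc_bounded: "t \<in> carrier (tensor M V) \<Longrightarrow> \<exists>l. \<forall>u\<in>lists I. l \<le> length u \<longrightarrow> cc V (ew u) t = \<zero>\<^bsub>V\<^esub>"
proof (induction rule: tensor_induct[OF mM V, consumes 1, case_names pure add])
  case (pure x v)
  then show ?case using \<phi>_bounded[OF pure(1)] by (auto simp: cc_pure ew_A) (metis vs_szero[OF V])
next
  case (add s t)
  then obtain k l where "\<forall>u\<in>lists I. k \<le> length u \<longrightarrow> cc V (ew u) s = \<zero>\<^bsub>V\<^esub>" "\<forall>u\<in>lists I. l \<le> length u \<longrightarrow> cc V (ew u) t = \<zero>\<^bsub>V\<^esub>"
    by blast
  then show ?case using add(1,2)
    by (intro exI[of _ "max k l"]) (auto simp: lin_add[OF lin_cc[OF ew_A]] vs_l_zero[OF V] vs_zero[OF V])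
qed

text \<open>A linear map \<open>g\<close> on \<open>E\<close> that vanishes on long words is pairing with some tensor. If \<open>g'\<close> is a
  generalized inverse of the Gram matrix of the words of length below \<open>l\<close>, and \<open>x u'\<close> is the
  combination of words with coefficients from the column \<open>u'\<close> of \<open>g'\<close>, then \<open>\<Sum> \<phi>(\<sqdot>, x u') g(u')\<close> agrees
  with \<open>g\<close>: the difference of \<open>ew u\<close> and \<open>\<Sum> \<phi>(ew u, x u') ew u'\<close> is orthogonal to all words, hence zero.\<close>

lemma tensor_of_functional:
  assumes g: "lin E V g" and van: "\<And>u. u \<in> lists I \<Longrightarrow> l \<le> length u \<Longrightarrow> g (ew u) = \<zero>\<^bsub>V\<^esub>"
  shows "\<exists>t\<in>carrier (tensor M V). \<forall>e\<in>carrier E. cc V e t = g e"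
proof -
  let ?U = "{u \<in> lists I. length u < l}"
  interpret V: module CC V by (fact V)
  interpret M': module CC "Um D P" by (rule mB)
  have U: "finite ?U"
  proof (rule finite_subset)
    show "?U \<subseteq> {xs. set xs \<subseteq> I \<and> length xs \<le> l}" by auto
  qed (rule finite_lists_length_le, simp)
  obtain g' where g': "\<forall>u\<in>?U. \<forall>w\<in>?U. (\<Sum>u'\<in>?U. (\<Sum>w'\<in>?U. phi P (ew u) (fw w') * g' w' u') * phi P (ew u') (fw w)) = phi P (ew u) (fw w)"
    using generalized_inverse[OF U U, of "\<lambda>u w. phi P (ew u) (fw w)"] by blast
  define x where "x u' = finsum M (\<lambda>w'. g' w' u' \<odot>\<^bsub>Um D P\<^esub> fw w') ?U" for u'
  have xM: "x u' \<in> carrier M" for u'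
    unfolding x_def by (rule lin_finsum(2)[OF mM mM lin_id[OF mM] U]) (auto intro: M_closed fw_M)
  have \<phi>x: "phi P (ew u) (x u') = (\<Sum>w'\<in>?U. phi P (ew u) (fw w') * g' w' u')" if u: "u \<in> lists I" for u u'
  proof -
    have "phi P (ew u) (x u') = finsum CC (\<lambda>w'. phi P (ew u) (g' w' u' \<odot>\<^bsub>Um D P\<^esub> fw w')) ?U"
      unfolding x_def by (rule lin_finsum(1)[OF mM module_CC lin_\<phi>M[OF ew_A[OF u]] U]) (auto intro: M_closed fw_M)
    also have "\<dots> = (\<Sum>w'\<in>?U. phi P (ew u) (fw w') * g' w' u')"
      unfolding finsum_CC by (intro sum.cong) (auto simp: lin_smult[OF \<phi>1[OF ew_A[OF u]]] fw_B mult.commute)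
    finally show ?thesis .
  qed
  have ew_eq: "ew u = finsum E (\<lambda>u'. phi P (ew u) (x u') \<odot>\<^bsub>Up D P\<^esub> ew u') ?U" (is "_ = ?r") if u: "u \<in> ?U" for u
  proof -
    have uI: "u \<in> lists I" using u by simp
    have rE: "?r \<in> carrier E"
      by (rule lin_finsum(2)[OF mE mE lin_id[OF mE] U]) (auto intro: E_closed ew_E)
    have eE: "ew u \<in> carrier E" using ew_E uI by blast
    have "ew u \<oplus>\<^bsub>Up D P\<^esub> (-1) \<odot>\<^bsub>Up D P\<^esub> ?r = \<zero>\<^bsub>Up D P\<^esub>"
    proof (rule nondeg_E_words)
      fix w assume w: "w \<in> lists I"
      note L = \<phi>2[OF fw_B[OF w]]
      have "phi P ?r (fw w) = finsum CC (\<lambda>u'. phi P (phi P (ew u) (x u') \<odot>\<^bsub>Up D P\<^esub> ew u') (fw w)) ?U"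
        by (rule lin_finsum(1)[OF mE module_CC lin_subalg[OF nA genE L] U]) (auto intro: E_closed ew_E)
      also have "\<dots> = (\<Sum>u'\<in>?U. phi P (ew u) (x u') * phi P (ew u') (fw w))"
        unfolding finsum_CC by (intro sum.cong) (auto simp: lin_smult[OF L] ew_A)
      also have "\<dots> = phi P (ew u) (fw w)"
      proof (cases "w \<in> ?U")
        case True
        then show ?thesis using g' u by (simp add: \<phi>x)
      next
        case False
        then have "length v \<noteq> length w" if "v \<in> ?U" for v using that w by auto
        then show ?thesis using w u by (auto simp: \<phi>_ew_fw intro!: sum.neutral)
      qed
      finally show "phi P (ew u \<oplus>\<^bsub>Up D P\<^esub> (-1) \<odot>\<^bsub>Up D P\<^esub> ?r) (fw w) = 0"
        using E_sub[OF rE] E_sub[OF eE] by (simp add: lin_add[OF L] lin_smult[OF L] cA)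
    qed (intro E_closed eE rE)
    then show ?thesis by (rule vs_diff_eq_zero[OF mA E_sub[OF eE] E_sub[OF rE]])
  qed
  define t where "t = finsum (tensor M V) (\<lambda>u'. pure M V (x u') (g (ew u'))) ?U"
  have pc: "pure M V (x u') (g (ew u')) \<in> carrier (tensor M V)" if "u' \<in> ?U" for u'
    using that by (intro pcMV xM lin_closed[OF g] ew_E) auto
  have tc: "t \<in> carrier (tensor M V)"
    unfolding t_def by (rule lin_finsum(2)[OF mMV mMV lin_id[OF mMV] U pc])
  have c: "cc V (ew u) t = g (ew u)" if u: "u \<in> lists I" for u
  proof -
    have "cc V (ew u) t = finsum V (\<lambda>u'. cc V (ew u) (pure M V (x u') (g (ew u')))) ?U"
      unfolding t_def by (rule lin_finsum(1)[OF mMV V lin_cc[OF ew_A[OF u]] U pc])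
    also have "\<dots> = finsum V (\<lambda>u'. phi P (ew u) (x u') \<odot>\<^bsub>V\<^esub> g (ew u')) ?U"
      using lin_closed[OF g ew_E] vs_smult[OF V] by (intro V.finsum_cong') (auto simp: cc_pure ew_A u xM)
    also have "\<dots> = g (ew u)"
    proof (cases "u \<in> ?U")
      case True
      have "g (ew u) = g (finsum E (\<lambda>u'. phi P (ew u) (x u') \<odot>\<^bsub>Up D P\<^esub> ew u') ?U)" using ew_eq[OF True] by simp
      also have "\<dots> = finsum V (\<lambda>u'. g (phi P (ew u) (x u') \<odot>\<^bsub>Up D P\<^esub> ew u')) ?U"
        by (rule lin_finsum(1)[OF mE V g U]) (auto intro: E_closed ew_E)
      also have "\<dots> = finsum V (\<lambda>u'. phi P (ew u) (x u') \<odot>\<^bsub>V\<^esub> g (ew u')) ?U"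
        using lin_closed[OF g ew_E] vs_smult[OF V] lin_smult[OF g ew_E]
        by (intro V.finsum_cong') auto
      finally show ?thesis ..
    next
      case False
      have "phi P (ew u) (x u') \<odot>\<^bsub>V\<^esub> g (ew u') = \<zero>\<^bsub>V\<^esub>" if u': "u' \<in> ?U" for u'
      proof -
        have "phi P (ew u) (x u') = 0"
          unfolding \<phi>x[OF u] using False u by (intro sum.neutral) (auto intro!: \<phi>_ew_fw)
        then show ?thesis using u' lin_closed[OF g ew_E] vs_szero[OF V] by auto
      qed
      then have "finsum V (\<lambda>u'. phi P (ew u) (x u') \<odot>\<^bsub>V\<^esub> g (ew u')) ?U = \<zero>\<^bsub>V\<^esub>"
        by (rule finsum_all_zero[OF V])
      then show ?thesis using van[OF u] False u by simp
    qed
    finally show ?thesis .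
  qed
  have "cc V e t = g e" if "e \<in> carrier E" for e
    using that
  proof (induction rule: E_word_induct)
    case (add x y)
    then show ?case using lin_add[OF lin_cc'[OF tc]] lin_add[OF g add(1,2)] by (simp add: E_sub)
  next
    case (smult d x)
    then show ?case using lin_smult[OF lin_cc'[OF tc]] lin_smult[OF g smult(1)] by (simp add: E_sub)
  qed (rule c)
  then show ?thesis using tc by blast
qed

end

section \<open>Induced modules\<close>

definition ind_ok :: "'u calg \<Rightarrow> ('w Heis \<Rightarrow> ('w U \<times> 'u \<Rightarrow> complex) set \<Rightarrow> ('w U \<times> 'u \<Rightarrow> complex) set) \<Rightarrow> bool" where
  "ind_ok V r \<longleftrightarrow> left_module W (tensor M V) r \<and>
     (\<forall>f\<in>carrier M. \<forall>x\<in>carrier M. \<forall>v\<in>carrier V. r (jF f) (pure M V x v) = pure M V (f \<otimes>\<^bsub>M\<^esub> x) v) \<and>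
     (\<forall>e\<in>carrier E. \<forall>x\<in>carrier M. \<forall>v\<in>carrier V. r (jE e) (pure M V x v) = pure M V (act e x) v)"

lemma left_moduleD:
  assumes "left_module W V r"
  shows "module CC V" "\<And>w v. w \<in> carrier W \<Longrightarrow> v \<in> carrier V \<Longrightarrow> r w v \<in> carrier V"
    "\<And>w. w \<in> carrier W \<Longrightarrow> lin V V (r w)" "\<And>v. v \<in> carrier V \<Longrightarrow> lin W V (\<lambda>w. r w v)"
    "\<And>w w' v. w \<in> carrier W \<Longrightarrow> w' \<in> carrier W \<Longrightarrow> v \<in> carrier V \<Longrightarrow> r (w \<otimes>\<^bsub>W\<^esub> w') v = r w (r w' v)"
    "\<And>v. v \<in> carrier V \<Longrightarrow> r \<one>\<^bsub>W\<^esub> v = v"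
  using assms unfolding left_module_def lin_def by blast+

context
  fixes V :: "'u calg"
  assumes V: "module CC V"
begin

lemmas tM = mMV[OF V] and tp = pMV[OF V] and tc = pcMV[OF V]

lemma ind_exists: "\<exists>r. ind_ok V r"
proof -
  let ?T = "tensor M V"
  define r where "r w = tlift ?T (\<lambda>x v. pure M V (rep w x) v)" for w
  have linrep: "lin M M (rep w)" if "w \<in> carrier W" for w
    using lin_subalg[OF nB genM bilin1[OF bilin_rep W_T[OF that]]] rep_M[OF that]
    by (auto simp: lin_def)
  have linrep': "lin W M (\<lambda>w. rep w x)" if "x \<in> carrier M" for x
    using bilin2[OF bilin_rep M_sub[OF that]] rep_M that W_T by (auto simp: lin_def W_ops)
  have b: "bilin M V ?T (\<lambda>x v. pure M V (rep w x) v)" if "w \<in> carrier W" for w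
    by (intro bilinI) (auto intro: lin_comp[OF linrep[OF that] bilin2[OF tp]] bilin1[OF tp] rep_M that)
  have rp: "r w (pure M V x v) = pure M V (rep w x) v" if "w \<in> carrier W" "x \<in> carrier M" "v \<in> carrier V" for w x v
    unfolding r_def by (rule tlift_pure[OF mM V tM b[OF that(1)] that(2,3)])
  have l1: "lin ?T ?T (r w)" if "w \<in> carrier W" for w
    unfolding r_def by (rule lin_tlift[OF mM V tM b[OF that]])
  have l2: "lin W ?T (\<lambda>w. r w t)" if "t \<in> carrier ?T" for t
    unfolding r_def by (rule lin_tlift_param[OF mM V tM b mW _ that]) (auto intro: lin_comp[OF linrep' bilin2[OF tp]])
  have m: "r (w \<otimes>\<^bsub>W\<^esub> w') t = r w (r w' t)" if w: "w \<in> carrier W" "w' \<in> carrier W" and t: "t \<in> carrier ?T" for w w' t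
    by (rule lin_eq_on_pure[OF mM V l1[OF W_closed(1)[OF w]] lin_comp[OF l1[OF w(2)] l1[OF w(1)]] _ t])
       (use w in \<open>simp add: rp W_closed rep_M\<close>, use w in \<open>simp add: W_ops rep_hmul W_T M_sub\<close>)
  have o: "r \<one>\<^bsub>W\<^esub> t = t" if t: "t \<in> carrier ?T" for t
    by (rule lin_eq_on_pure[OF mM V l1[OF W_closed(4)] lin_id[OF tM] _ t])
       (simp add: rp W_closed, simp add: W_ops rep_pure oneB oneA M_sub act_one alg_one[OF B])
  have "left_module W ?T r"
    unfolding left_module_def
    by (intro conjI allI ballI)
       (simp_all add: tM lin_closed[OF l1] lin_add[OF l1] lin_add[OF l2] m lin_smult[OF l1] lin_smult[OF l2] o)
  moreover have "r (jF f) (pure M V x v) = pure M V (f \<otimes>\<^bsub>M\<^esub> x) v"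
    if "f \<in> carrier M" "x \<in> carrier M" "v \<in> carrier V" for f x v
    using that by (simp add: rp jF_W) (simp add: j_def rep_pure M_sub oneA act_one)
  moreover have "r (jE e) (pure M V x v) = pure M V (act e x) v"
    if "e \<in> carrier E" "x \<in> carrier M" "v \<in> carrier V" for e x v
    using that by (simp add: rp jE_W) (simp add: j_def rep_pure M_sub E_sub oneB alg_one[OF B] act_closed)
  ultimately show ?thesis unfolding ind_ok_def by blast
qed

lemma ind_ok: "ind_ok V (ind_act D P V)"
proof -
  have "ind_act D P V = (SOME r. ind_ok V r)"
    unfolding ind_act_def ind_ok_def Bmm_M Bpp_E skew_act_act ..
  then show ?thesis using someI_ex[OF ind_exists] by simp
qed

abbreviation "ia \<equiv> ind_act D P V"

lemma ia_module: "left_module W (tensor M V) ia"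
  using ind_ok by (simp add: ind_ok_def)
lemmas iaD = left_moduleD[OF ia_module]

lemma ia_F: "f \<in> carrier M \<Longrightarrow> x \<in> carrier M \<Longrightarrow> v \<in> carrier V \<Longrightarrow> ia (jF f) (pure M V x v) = pure M V (f \<otimes>\<^bsub>Um D P\<^esub> x) v"
  and ia_E: "e \<in> carrier E \<Longrightarrow> x \<in> carrier M \<Longrightarrow> v \<in> carrier V \<Longrightarrow> ia (jE e) (pure M V x v) = pure M V (act e x) v"
  using ind_ok by (simp_all add: ind_ok_def)

text \<open>In coordinates, acting with \<open>a\<close> is right multiplication of the index by \<open>a\<close>.\<close>

lemma cc_ia_E:
  assumes e: "e \<in> carrier (Up D P)" and a: "a \<in> carrier E" and t: "t \<in> carrier (tensor M V)"
  shows "cc V e (ia (jE a) t) = cc V (e \<otimes>\<^bsub>Up D P\<^esub> a) t"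
  by (rule lin_eq_on_pure[OF mM V lin_comp[OF iaD(3)[OF jE_W[OF a]] lin_cc[OF V e]] lin_cc[OF V multA[OF e E_sub[OF a]]] _ t])
     (use e a in \<open>simp add: ia_E cc_pure[OF V] act_M multA E_sub \<phi>_act M_sub\<close>)

lemma ia_nilpotent:
  assumes t: "t \<in> carrier (tensor M V)"
  shows "\<exists>l. \<forall>u\<in>lists I. l \<le> length u \<longrightarrow> ia (jE (ew u)) t = \<zero>\<^bsub>tensor M V\<^esub>"
proof -
  obtain l where l: "\<forall>u\<in>lists I. l \<le> length u \<longrightarrow> cc V (ew u) t = \<zero>\<^bsub>V\<^esub>" using cc_bounded[OF V t] by blast
  have "ia (jE (ew u)) t = \<zero>\<^bsub>tensor M V\<^esub>" if u: "u \<in> lists I" "l \<le> length u" for u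
  proof (rule cc_eqI[OF V iaD(2)[OF jE_W[OF ew_E[OF u(1)]] t] vs_zero[OF tM]])
    fix w assume w: "w \<in> lists I"
    have "cc V (ew w) (ia (jE (ew u)) t) = cc V (ew (w @ u)) t"
      using u w t by (simp add: cc_ia_E ew_A ew_E ew_append)
    also have "\<dots> = \<zero>\<^bsub>V\<^esub>" using l u w by auto
    finally show "cc V (ew w) (ia (jE (ew u)) t) = cc V (ew w) \<zero>\<^bsub>tensor M V\<^esub>"
      using lin_zero[OF tM V lin_cc[OF V ew_A[OF w]]] by simp
  qed
  then show ?thesis by blast
qed

text \<open>All coordinates of \<open>t\<close> at nonempty words vanish.\<close>

lemma t_eq_pure_one:
  assumes t: "t \<in> carrier (tensor M V)" and z: "\<And>i. i \<in> I \<Longrightarrow> ia (jE (e' i)) t = \<zero>\<^bsub>tensor M V\<^esub>"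
  shows "t = pure M V \<one>\<^bsub>Um D P\<^esub> (cc V \<one>\<^bsub>Up D P\<^esub> t)"
proof (rule cc_eqI[OF V t tc])
  note v = lin_closed[OF lin_cc[OF V oneA] t]
  show "\<one>\<^bsub>Um D P\<^esub> \<in> carrier M" "cc V \<one>\<^bsub>Up D P\<^esub> t \<in> carrier V" using M_closed v by auto
  fix u assume u: "u \<in> lists I"
  show "cc V (ew u) t = cc V (ew u) (pure M V \<one>\<^bsub>Um D P\<^esub> (cc V \<one>\<^bsub>Up D P\<^esub> t))"
  proof (cases u rule: rev_cases)
    case Nil
    then show ?thesis using v by (simp add: cc_pure[OF V] oneA M_closed \<phi>_one_one vs_sone[OF V])
  next
    case (snoc w i)
    then have w: "w \<in> lists I" "i \<in> I" using u by auto
    have "cc V (ew u) t = cc V (ew w) (ia (jE (e' i)) t)"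
      using w t by (simp add: snoc cc_ia_E ew_A e'_E ew_append alg_one[OF A])
    also have "\<dots> = \<zero>\<^bsub>V\<^esub>" using z[OF w(2)] lin_zero[OF tM V lin_cc[OF V ew_A[OF w(1)]]] by simp
    finally show ?thesis using snoc u v by (simp add: cc_pure[OF V] ew_A M_closed \<phi>_ew_one vs_szero[OF V])
  qed
qed

lemma ia_E_pure_one:
  "i \<in> I \<Longrightarrow> v \<in> carrier V \<Longrightarrow> ia (jE (e' i)) (pure M V \<one>\<^bsub>Um D P\<^esub> v) = \<zero>\<^bsub>tensor M V\<^esub>"
  using lin_zero[OF mM tM bilin2[OF tp]]
  by (simp add: ia_E e'_E M_closed act_on_one \<phi>_e' vs_szero[OF mB] oneB)

end

section \<open>Modules in the category \<open>O\<close>, coactions and coinvariants\<close>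

lemma foldr_word:
  assumes lm: "left_module W V r" and m: "m \<in> carrier V" and u: "u \<in> lists I"
  shows "foldr (\<lambda>i x. r (jE (ge' D P i)) x) u m = r (jE (ew u)) m"
  using u
proof (induction u)
  case Nil
  then show ?case using left_moduleD(6)[OF lm m] by (simp add: jE_ops)
next
  case (Cons i u)
  then show ?case
    using left_moduleD(5)[OF lm jE_W[OF e'_E] jE_W[OF ew_E] m, of i u] by (simp add: ge'_e' jE_ops ew_A)
qed

definition O_mod :: "'u calg \<Rightarrow> ('w Heis \<Rightarrow> 'u \<Rightarrow> 'u) \<Rightarrow> bool" where
  "O_mod V r \<longleftrightarrow> left_module W V r \<and>
     (\<forall>m\<in>carrier V. \<exists>l. \<forall>u\<in>lists I. l \<le> length u \<longrightarrow> r (jE (ew u)) m = \<zero>\<^bsub>V\<^esub>)"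

lemma r_append:
  assumes lm: "left_module W V r" and m: "m \<in> carrier V" and u: "u \<in> lists I" "v \<in> lists I"
  shows "r (jE (ew (u @ v))) m = r (jE (ew u)) (r (jE (ew v)) m)"
  using left_moduleD(5)[OF lm jE_W[OF ew_E[OF u(1)]] jE_W[OF ew_E[OF u(2)]] m] u
  by (simp add: ew_append jE_ops ew_A)

text \<open>Words of length \<open>l\<close> kill \<open>m\<close> if and only if all words of length at least \<open>l\<close> do.\<close>

lemma Obj_OWq: "(V, r) \<in> Obj (OWq D P) \<longleftrightarrow> O_mod V r"
proof -
  have "(\<exists>l>0. \<forall>is. length is = l \<and> set is \<subseteq> I \<longrightarrow> foldr (\<lambda>i x. r (jE (ge' D P i)) x) is m = \<zero>\<^bsub>V\<^esub>) \<longleftrightarrow>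
      (\<exists>l. \<forall>u\<in>lists I. l \<le> length u \<longrightarrow> r (jE (ew u)) m = \<zero>\<^bsub>V\<^esub>)" (is "?L \<longleftrightarrow> ?R")
    if lm: "left_module W V r" and m: "m \<in> carrier V" for m
  proof
    assume ?L
    then obtain l where l: "l > 0" "\<And>is. length is = l \<Longrightarrow> set is \<subseteq> I \<Longrightarrow> foldr (\<lambda>i x. r (jE (ge' D P i)) x) is m = \<zero>\<^bsub>V\<^esub>"
      by blast
    have "r (jE (ew u)) m = \<zero>\<^bsub>V\<^esub>" if u: "u \<in> lists I" "l \<le> length u" for u
    proof -
      define a b where "a = take (length u - l) u" and "b = drop (length u - l) u"
      have ab: "u = a @ b" "length b = l" using u(2) by (auto simp: a_def b_def)
      then have ab': "a \<in> lists I" "b \<in> lists I" using u(1) by auto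
      then have "r (jE (ew b)) m = \<zero>\<^bsub>V\<^esub>" using l(2)[of b] ab(2) foldr_word[OF lm m ab'(2)] by auto
      then show ?thesis
        using r_append[OF lm m ab'] ab(1) lin_zero[OF left_moduleD(1)[OF lm] left_moduleD(1)[OF lm] left_moduleD(3)[OF lm jE_W[OF ew_E[OF ab'(1)]]]]
        by simp
    qed
    then show ?R by blast
  next
    assume ?R
    then obtain l where "\<forall>u\<in>lists I. l \<le> length u \<longrightarrow> r (jE (ew u)) m = \<zero>\<^bsub>V\<^esub>" by blast
    then have "foldr (\<lambda>i x. r (jE (ge' D P i)) x) u m = \<zero>\<^bsub>V\<^esub>" if "length u = Suc l" "set u \<subseteq> I" for u
      using foldr_word[OF lm m, of u] that by (simp add: in_lists_conv_set subset_iff)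
    then show ?L by (intro exI[of _ "Suc l"]) blast
  qed
  then show ?thesis by (auto simp: OWq_def O_mod_def)
qed

context
  fixes V :: "'u calg" and r
  assumes Om: "O_mod V r"
begin

lemma lm: "left_module W V r" using Om by (simp add: O_mod_def)
lemmas rD = left_moduleD[OF lm]
lemmas V = rD(1)

lemma lin_rE: "m \<in> carrier V \<Longrightarrow> lin E V (\<lambda>e. r (jE e) m)"
  using rD(4)[of m] by (auto simp: lin_def jE_W jE_ops E_sub)
lemma lin_rF: "m \<in> carrier V \<Longrightarrow> lin M V (\<lambda>x. r (jF x) m)"
  using rD(4)[of m] by (auto simp: lin_def jF_W jF_ops M_sub)

text \<open>The functional \<open>e \<mapsto> e m\<close> vanishes on long words.\<close>

lemma coaction_ex1:
  assumes m: "m \<in> carrier V"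
  shows "\<exists>!t. t \<in> carrier (tensor M V) \<and> (\<forall>e\<in>carrier E. r (jE e) m = cc V e t)"
proof -
  obtain l where "\<forall>u\<in>lists I. l \<le> length u \<longrightarrow> r (jE (ew u)) m = \<zero>\<^bsub>V\<^esub>" using Om m by (auto simp: O_mod_def)
  then obtain t where t: "t \<in> carrier (tensor M V)" "\<forall>e\<in>carrier E. cc V e t = r (jE e) m"
    using tensor_of_functional[OF V lin_rE[OF m], of l] by blast
  show ?thesis
  proof (rule ex1I[of _ t])
    fix s assume "s \<in> carrier (tensor M V) \<and> (\<forall>e\<in>carrier E. r (jE e) m = cc V e s)"
    then show "s = t" using t ew_E by (intro cc_eqI[OF V]) auto
  qed (use t in auto)
qed

lemma coaction_props:
  assumes m: "m \<in> carrier V"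
  shows "coaction D P (V, r) m \<in> carrier (tensor M V)" "e \<in> carrier E \<Longrightarrow> r (jE e) m = cc V e (coaction D P (V, r) m)"
proof -
  have "coaction D P (V, r) m = (THE t. t \<in> carrier (tensor M V) \<and> (\<forall>e\<in>carrier E. r (jE e) m = cc V e t))"
    by (simp add: coaction_def Bmm_M Bpp_E cc_def)
  then show "coaction D P (V, r) m \<in> carrier (tensor M V)" "e \<in> carrier E \<Longrightarrow> r (jE e) m = cc V e (coaction D P (V, r) m)"
    using theI'[OF coaction_ex1[OF m]] by auto
qed

lemma invariant_word:
  assumes m: "m \<in> carrier V" and z: "\<And>i. i \<in> I \<Longrightarrow> r (jE (e' i)) m = \<zero>\<^bsub>V\<^esub>" and u: "u \<in> lists I"
  shows "r (jE (ew u)) m = phi P (ew u) \<one>\<^bsub>Um D P\<^esub> \<odot>\<^bsub>V\<^esub> m"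
proof (cases u rule: rev_cases)
  case Nil
  then show ?thesis using rD(6)[OF m] m by (simp add: jE_ops \<phi>_one_one vs_sone[OF V])
next
  case (snoc w i)
  then have w: "w \<in> lists I" "i \<in> I" using u by auto
  have "r (jE (ew u)) m = r (jE (ew w)) (r (jE (e' i)) m)"
    using r_append[OF lm m w(1), of "[i]"] w by (simp add: snoc alg_one[OF A])
  also have "\<dots> = \<zero>\<^bsub>V\<^esub>" using z[OF w(2)] lin_zero[OF V V rD(3)[OF jE_W[OF ew_E[OF w(1)]]]] by simp
  finally show ?thesis using snoc u m by (simp add: \<phi>_ew_one vs_szero[OF V])
qed

lemma coinvariants_iff:
  "m \<in> coinvariants D P (V, r) \<longleftrightarrow> m \<in> carrier V \<and> (\<forall>i\<in>I. r (jE (e' i)) m = \<zero>\<^bsub>V\<^esub>)"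
proof -
  have "coaction D P (V, r) m = pure M V \<one>\<^bsub>Um D P\<^esub> m \<longleftrightarrow> (\<forall>i\<in>I. r (jE (e' i)) m = \<zero>\<^bsub>V\<^esub>)" (is "?L \<longleftrightarrow> ?R")
    if m: "m \<in> carrier V"
  proof
    assume L: ?L
    show ?R
    proof
      fix i assume i: "i \<in> I"
      have "r (jE (e' i)) m = cc V (e' i) (pure M V \<one>\<^bsub>Um D P\<^esub> m)"
        using coaction_props(2)[OF m e'_E[OF i]] L by simp
      then show "r (jE (e' i)) m = \<zero>\<^bsub>V\<^esub>" using i m by (simp add: cc_pure[OF V] M_closed \<phi>_e' vs_szero[OF V])
    qed
  next
    assume R: ?R
    show ?L
    proof (rule cc_eqI[OF V coaction_props(1)[OF m] pcMV[OF V M_closed(1) m]])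
      fix u assume u: "u \<in> lists I"
      then show "cc V (ew u) (coaction D P (V, r) m) = cc V (ew u) (pure M V \<one>\<^bsub>Um D P\<^esub> m)"
        using coaction_props(2)[OF m ew_E[OF u]] invariant_word[OF m _ u] R m
        by (simp add: cc_pure[OF V] M_closed ew_A)
    qed
  qed
  then show ?thesis by (auto simp: coinvariants_def Bmm_M)
qed

abbreviation "V0 \<equiv> V\<lparr>carrier := coinvariants D P (V, r)\<rparr>"

lemma module_V0: "module CC V0" and V0_sub: "v \<in> carrier V0 \<Longrightarrow> v \<in> carrier V"
proof -
  have "submodule (coinvariants D P (V, r)) CC V"
    using vs_zero[OF V] vs_add[OF V] vs_smult[OF V] lin_zero[OF V V rD(3)[OF jE_W[OF e'_E]]]
      lin_add[OF rD(3)[OF jE_W[OF e'_E]]] lin_smult[OF rD(3)[OF jE_W[OF e'_E]]] vs_l_zero[OF V] vs_smult_zero[OF V]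
    by (auto simp: submodule_CC_iff[OF V] coinvariants_iff)
  then show "module CC V0" by (rule submodule_restrict[OF V])
  show "v \<in> carrier V0 \<Longrightarrow> v \<in> carrier V" by (simp add: coinvariants_iff)
qed

lemma V0_inv: "v \<in> carrier V0 \<Longrightarrow> i \<in> I \<Longrightarrow> r (jE (e' i)) v = \<zero>\<^bsub>V\<^esub>"
  by (simp add: coinvariants_iff)

section \<open>Modules are induced from their coinvariants\<close>

definition Phi :: "('w U \<times> 'u \<Rightarrow> complex) set \<Rightarrow> 'u" where
  "Phi t = tlift V (\<lambda>x v. r (jF x) v) t"

lemma bilin_Phi: "bilin M V0 V (\<lambda>x v. r (jF x) v)"
proof (rule bilinI)
  fix x assume "x \<in> carrier M"
  then show "lin V0 V (r (jF x))" using rD(3)[OF jF_W] V0_sub by (auto simp: lin_def)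
qed (use lin_rF V0_sub in auto)

lemmas mT0 = mMV[OF module_V0]
lemmas ia0D = iaD[OF module_V0]

lemma lin_Phi: "lin (tensor M V0) V Phi"
  unfolding Phi_def by (rule lin_tlift[OF mM module_V0 V bilin_Phi])

lemma Phi_pure: "x \<in> carrier M \<Longrightarrow> v \<in> carrier V0 \<Longrightarrow> Phi (pure M V0 x v) = r (jF x) v"
  unfolding Phi_def by (rule tlift_pure[OF mM module_V0 V bilin_Phi])

text \<open>By \<open>EF_relation\<close> and the skew derivation rule both sides obey the same recursion on words, and they vanish
  for the empty word because \<open>v\<close> is invariant.\<close>

lemma rE_rF:
  assumes i: "i \<in> I" and v: "v \<in> carrier V0" and x: "x \<in> carrier M"
  shows "r (jE (e' i)) (r (jF x) v) = r (jF (act (e' i) x)) v"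
  using x
proof (induction rule: M_word_induct)
  note vV = V0_sub[OF v] and jEi = jE_W[OF e'_E[OF i]]
  case (word w)
  then show ?case
  proof (induction w)
    case Nil
    have "jF \<zero>\<^bsub>Um D P\<^esub> = 0 \<odot>\<^bsub>W\<^esub> jF \<one>\<^bsub>Um D P\<^esub>"
      using jF_ops(3)[OF oneB, of 0] vs_szero[OF mB oneB] by simp
    then have "r (jF \<zero>\<^bsub>Um D P\<^esub>) v = \<zero>\<^bsub>V\<^esub>"
      using lin_smult[OF rD(4)[OF vV] jF_W[OF M_closed(1)], of 0] rD(2)[OF jF_W[OF M_closed(1)] vV]
      by (simp add: vs_szero[OF V])
    then show ?case using V0_inv[OF v i] rD(6)[OF vV] i
      by (simp add: jF_ops act_on_one \<phi>_e' vs_szero[OF mB] oneB)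
  next
    case (Cons j w)
    then have j: "j \<in> I" and w: "w \<in> lists I" by auto
    note fj = f_M[OF j] and fwM = fw_M[OF w] and jFj = jF_W[OF f_M[OF j]]
    let ?y = "r (jF (fw w)) v"
    have y: "?y \<in> carrier V" by (rule rD(2)[OF jF_W[OF fwM] vV])
    have am: "act (e' i) (fw w) \<in> carrier M" by (rule act_e'_M[OF i fwM])
    have "r (jE (e' i)) (r (jF (fw (j # w))) v) = r (jE (e' i)) (r (jF (gf D P j)) ?y)"
      using rD(5)[OF jFj jF_W[OF fwM] vV] M_sub[OF fwM] M_sub[OF fj] by (simp add: jF_ops)
    also have "\<dots> = r (jE (e' i) \<otimes>\<^bsub>W\<^esub> jF (gf D P j)) ?y" using rD(5)[OF jEi jFj y] by simp
    also have "\<dots> = \<delta> i j \<odot>\<^bsub>V\<^esub> ?y \<oplus>\<^bsub>V\<^esub> \<chi> i j \<odot>\<^bsub>V\<^esub> r (jF (gf D P j)) (r (jE (e' i)) ?y)"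
      using EF_relation[OF i j] W_closed jEi jFj y
      by (simp add: lin_add[OF rD(4)] lin_smult[OF rD(4)] rD(5,6))
    also have "\<dots> = \<delta> i j \<odot>\<^bsub>V\<^esub> ?y \<oplus>\<^bsub>V\<^esub> \<chi> i j \<odot>\<^bsub>V\<^esub> r (jF (gf D P j \<otimes>\<^bsub>Um D P\<^esub> act (e' i) (fw w))) v"
    proof -
      have "r (jE (e' i)) ?y = r (jF (act (e' i) (fw w))) v" using Cons by simp
      moreover have "r (jF (gf D P j)) (r (jF (act (e' i) (fw w))) v) = r (jF (gf D P j \<otimes>\<^bsub>Um D P\<^esub> act (e' i) (fw w))) v"
        using rD(5)[OF jFj jF_W[OF am] vV] M_sub[OF am] M_sub[OF fj] by (simp add: jF_ops)
      ultimately show ?thesis by (simp only:)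
    qed
    also have "\<dots> = r (jF (\<delta> i j \<odot>\<^bsub>Um D P\<^esub> fw w \<oplus>\<^bsub>Um D P\<^esub> \<chi> i j \<odot>\<^bsub>Um D P\<^esub> (gf D P j \<otimes>\<^bsub>Um D P\<^esub> act (e' i) (fw w)))) v"
      using lin_add[OF lin_rF[OF vV]] lin_smult[OF lin_rF[OF vV]] fwM am fj by (simp add: M_closed)
    also have "\<dots> = r (jF (act (e' i) (fw (j # w)))) v"
      using act_e'_f_mult[OF i j M_sub[OF fwM]] by simp
    finally show ?case .
  qed
next
  note vV = V0_sub[OF v] and jEi = jE_W[OF e'_E[OF i]]
  case (add x y)
  then show ?case
    using lin_add[OF lin_rF[OF vV]] act_e'_M[OF i] lin_add[OF rD(3)[OF jEi]] rD(2)[OF jF_W _] vV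
    by (simp add: lin_add[OF act1[OF e'_closed[OF i]]] M_sub)
next
  note vV = V0_sub[OF v] and jEi = jE_W[OF e'_E[OF i]]
  case (smult c x)
  then show ?case
    using lin_smult[OF lin_rF[OF vV]] act_e'_M[OF i] lin_smult[OF rD(3)[OF jEi]] rD(2)[OF jF_W _] vV
    by (simp add: lin_smult[OF act1[OF e'_closed[OF i]]] M_sub)
qed

lemma Phi_equivariant:
  assumes w: "w \<in> carrier W" and t: "t \<in> carrier (tensor M V0)"
  shows "Phi (ind_act D P V0 w t) = r w (Phi t)"
  using w t
proof (induction arbitrary: t rule: W_induct)
  case (F j)
  note c = f_M[OF F(1)]
  show ?case
  proof (rule lin_eq_on_pure[OF mM module_V0 lin_comp[OF ia0D(3)[OF jF_W[OF c]] lin_Phi] lin_comp[OF lin_Phi rD(3)[OF jF_W[OF c]]] _ F(2)])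
    fix x v assume x: "x \<in> carrier M" "v \<in> carrier V0"
    then show "Phi (ind_act D P V0 (jF (gf D P j)) (pure M V0 x v)) = r (jF (gf D P j)) (Phi (pure M V0 x v))"
      using rD(5)[OF jF_W[OF c] jF_W[OF x(1)] V0_sub[OF x(2)]]
      by (simp add: ia_F[OF module_V0 c] Phi_pure c M_closed jF_ops M_sub)
  qed
next
  case (E i)
  note c = e'_E[OF E(1)]
  show ?case
    by (rule lin_eq_on_pure[OF mM module_V0 lin_comp[OF ia0D(3)[OF jE_W[OF c]] lin_Phi] lin_comp[OF lin_Phi rD(3)[OF jE_W[OF c]]] _ E(2)])
       (use E(1) in \<open>simp add: ia_E[OF module_V0 c] Phi_pure act_e'_M rE_rF\<close>)
next
  case one
  then show ?case using ia0D(6) rD(6) lin_closed[OF lin_Phi] by simp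
next
  case (add x y)
  then show ?case
    using lin_add[OF ia0D(4)] lin_add[OF rD(4)] ia0D(2) lin_closed[OF lin_Phi] by (simp add: lin_add[OF lin_Phi])
next
  case (smult c x)
  then show ?case
    using lin_smult[OF ia0D(4)] lin_smult[OF rD(4)] ia0D(2) lin_closed[OF lin_Phi] by (simp add: lin_smult[OF lin_Phi])
next
  case (mult x y)
  then show ?case
    using ia0D(5) rD(5) ia0D(2) lin_closed[OF lin_Phi] by simp
qed

text \<open>The kernel of \<open>Phi\<close> is stable under the \<open>e' i\<close>, which lower the degree. By induction they kill \<open>t\<close>, so \<open>t\<close> has the
  form \<open>1 \<otimes> v\<close> and is mapped to \<open>v\<close>.\<close>

lemma Phi_zero:
  assumes "t \<in> carrier (tensor M V0)" "Phi t = \<zero>\<^bsub>V\<^esub>" "\<And>u. u \<in> lists I \<Longrightarrow> l \<le> length u \<Longrightarrow> cc V0 (ew u) t = \<zero>\<^bsub>V\<^esub>"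
  shows "t = \<zero>\<^bsub>tensor M V0\<^esub>"
  using assms
proof (induction l arbitrary: t)
  case 0
  then show ?case
    using lin_zero[OF mT0 module_V0 lin_cc[OF module_V0 ew_A]] vs_zero[OF mT0] by (intro cc_eqI[OF module_V0]) auto
next
  case (Suc l)
  note v = lin_closed[OF lin_cc[OF module_V0 oneA] Suc.prems(1)]
  have "ind_act D P V0 (jE (e' i)) t = \<zero>\<^bsub>tensor M V0\<^esub>" if i: "i \<in> I" for i
  proof (rule Suc.IH[OF ia0D(2)[OF jE_W[OF e'_E[OF i]] Suc.prems(1)]])
    show "Phi (ind_act D P V0 (jE (e' i)) t) = \<zero>\<^bsub>V\<^esub>"
      using Phi_equivariant[OF jE_W[OF e'_E[OF i]] Suc.prems(1)] Suc.prems(2) lin_zero[OF V V rD(3)[OF jE_W[OF e'_E[OF i]]]] by simp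
    fix u assume u: "u \<in> lists I" "l \<le> length u"
    have "cc V0 (ew u) (ind_act D P V0 (jE (e' i)) t) = cc V0 (ew (u @ [i])) t"
      using i u Suc.prems(1) by (simp add: cc_ia_E[OF module_V0] ew_A e'_E ew_append alg_one[OF A])
    also have "\<dots> = \<zero>\<^bsub>V\<^esub>" using i u by (intro Suc.prems(3)) auto
    finally show "cc V0 (ew u) (ind_act D P V0 (jE (e' i)) t) = \<zero>\<^bsub>V\<^esub>" .
  qed
  then have t: "t = pure M V0 \<one>\<^bsub>Um D P\<^esub> (cc V0 \<one>\<^bsub>Up D P\<^esub> t)"
    by (rule t_eq_pure_one[OF module_V0 Suc.prems(1)])
  have "Phi t = r (jF \<one>\<^bsub>Um D P\<^esub>) (cc V0 \<one>\<^bsub>Up D P\<^esub> t)"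
    by (subst t) (rule Phi_pure[OF M_closed(1) v])
  then have "cc V0 \<one>\<^bsub>Up D P\<^esub> t = \<zero>\<^bsub>V0\<^esub>" using Suc.prems(2) rD(6)[OF V0_sub[OF v]] by (simp add: jF_ops)
  then show ?case using t lin_zero[OF module_V0 mT0 bilin1[OF pMV[OF module_V0] M_closed(1)]] by simp
qed

lemma Phi_inj: "inj_on Phi (carrier (tensor M V0))"
proof (rule inj_onI)
  fix s t assume st: "s \<in> carrier (tensor M V0)" "t \<in> carrier (tensor M V0)" "Phi s = Phi t"
  let ?d = "s \<oplus>\<^bsub>tensor M V0\<^esub> (-1) \<odot>\<^bsub>tensor M V0\<^esub> t"
  have d: "?d \<in> carrier (tensor M V0)" using st vs_add[OF mT0] vs_smult[OF mT0] by simp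
  obtain l where "\<forall>u\<in>lists I. l \<le> length u \<longrightarrow> cc V0 (ew u) ?d = \<zero>\<^bsub>V0\<^esub>" using cc_bounded[OF module_V0 d] by blast
  moreover have "Phi ?d = \<zero>\<^bsub>V\<^esub>"
    using st vs_smult[OF mT0] vs_right_minus[OF V] lin_closed[OF lin_Phi] by (simp add: lin_add[OF lin_Phi] lin_smult[OF lin_Phi])
  ultimately have "?d = \<zero>\<^bsub>tensor M V0\<^esub>" by (intro Phi_zero[OF d, of l]) auto
  then show "s = t" by (rule vs_diff_eq_zero[OF mT0 st(1,2)])
qed

text \<open>Surjectivity, by induction on the nilpotency degree of \<open>m\<close>. The elements \<open>e'\<^sub>i m\<close> are images of
  tensors \<open>t\<^sub>i\<close> by the induction hypothesis. The map \<open>e \<mapsto> e m - \<phi>(e, 1) m\<close> takes values in the image of \<open>Phi\<close>,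
  so its degree zero coordinate is a functional on \<open>E\<close>, which is pairing with a tensor \<open>t\<close>. By construction
  \<open>e'\<^sub>i t = t\<^sub>i\<close>, so \<open>m - Phi t\<close> is invariant.\<close>

lemma Phi_surj_aux:
  assumes "m \<in> carrier V" "\<And>u. u \<in> lists I \<Longrightarrow> l \<le> length u \<Longrightarrow> r (jE (ew u)) m = \<zero>\<^bsub>V\<^esub>"
  shows "m \<in> Phi ` carrier (tensor M V0)"
  using assms
proof (induction l arbitrary: m)
  case 0
  have "m = \<zero>\<^bsub>V\<^esub>" using 0(2)[of "[]"] rD(6)[OF 0(1)] by (simp add: jE_ops)
  then show ?case using lin_zero[OF mT0 V lin_Phi] vs_zero[OF mT0] by (metis imageI)
next
  case (Suc l)
  note m = Suc.prems(1)
  let ?T = "tensor M V0"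
  let ?ia = "ind_act D P V0"
  let ?Im = "Phi ` carrier ?T"
  define ps where "ps = inv_into (carrier ?T) Phi"
  have ps: "ps v \<in> carrier ?T" "Phi (ps v) = v" if "v \<in> ?Im" for v
    using that by (auto simp: ps_def inv_into_into f_inv_into_f)
  have ps_Phi: "ps (Phi t) = t" if "t \<in> carrier ?T" for t
    unfolding ps_def using Phi_inj that by (rule inv_into_f_f)
  have Im_add: "x \<oplus>\<^bsub>V\<^esub> y \<in> ?Im" "ps (x \<oplus>\<^bsub>V\<^esub> y) = ps x \<oplus>\<^bsub>?T\<^esub> ps y" if "x \<in> ?Im" "y \<in> ?Im" for x y
  proof -
    have "x \<oplus>\<^bsub>V\<^esub> y = Phi (ps x \<oplus>\<^bsub>?T\<^esub> ps y)" using that ps by (simp add: lin_add[OF lin_Phi])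
    then show "x \<oplus>\<^bsub>V\<^esub> y \<in> ?Im" "ps (x \<oplus>\<^bsub>V\<^esub> y) = ps x \<oplus>\<^bsub>?T\<^esub> ps y" using that ps(1) vs_add[OF mT0] ps_Phi by auto
  qed
  have Im_sm: "c \<odot>\<^bsub>V\<^esub> x \<in> ?Im" "ps (c \<odot>\<^bsub>V\<^esub> x) = c \<odot>\<^bsub>?T\<^esub> ps x" if "x \<in> ?Im" for c x
  proof -
    have "c \<odot>\<^bsub>V\<^esub> x = Phi (c \<odot>\<^bsub>?T\<^esub> ps x)" using that ps by (simp add: lin_smult[OF lin_Phi])
    then show "c \<odot>\<^bsub>V\<^esub> x \<in> ?Im" "ps (c \<odot>\<^bsub>V\<^esub> x) = c \<odot>\<^bsub>?T\<^esub> ps x" using that ps(1) vs_smult[OF mT0] ps_Phi by auto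
  qed
  have Im0: "\<zero>\<^bsub>V\<^esub> \<in> ?Im" "ps \<zero>\<^bsub>V\<^esub> = \<zero>\<^bsub>?T\<^esub>"
    using lin_zero[OF mT0 V lin_Phi] vs_zero[OF mT0] ps_Phi by (metis imageI)+
  have em: "r (jE (e' i)) m \<in> ?Im" if i: "i \<in> I" for i
  proof (rule Suc.IH)
    show "r (jE (e' i)) m \<in> carrier V" by (rule rD(2)[OF jE_W[OF e'_E[OF i]] m])
    fix u assume u: "u \<in> lists I" "l \<le> length u"
    have "r (jE (ew u)) (r (jE (e' i)) m) = r (jE (ew (u @ [i]))) m"
      using r_append[OF lm m u(1), of "[i]"] i by (simp add: alg_one[OF A])
    also have "\<dots> = \<zero>\<^bsub>V\<^esub>" using u i by (intro Suc.prems(2)) auto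
    finally show "r (jE (ew u)) (r (jE (e' i)) m) = \<zero>\<^bsub>V\<^esub>" .
  qed
  define tt where "tt i = ps (r (jE (e' i)) m)" for i
  have tt: "tt i \<in> carrier ?T" "Phi (tt i) = r (jE (e' i)) m" if "i \<in> I" for i
    using ps[OF em[OF that]] by (auto simp: tt_def)
  define d where "d e = r (jE e) m \<oplus>\<^bsub>V\<^esub> (- phi P e \<one>\<^bsub>Um D P\<^esub>) \<odot>\<^bsub>V\<^esub> m" for e
  have d_lin: "lin E V d"
    unfolding d_def
    by (intro lin_plus[OF V] lin_rE[OF m] lin_scale_left[OF V _ m] lin_subalg[OF nA genE])
       (use \<phi>2[OF oneB] in \<open>auto simp: lin_def\<close>)
  have d_snoc: "d (ew (u @ [i])) = Phi (?ia (jE (ew u)) (tt i))" if u: "u \<in> lists I" and i: "i \<in> I" for u i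
  proof -
    have "d (ew (u @ [i])) = r (jE (ew (u @ [i]))) m"
      using u i m rD(2)[OF jE_W[OF ew_E[of "u @ [i]"]] m] by (simp add: d_def \<phi>_ew_one vs_szero[OF V] vs_r_zero[OF V])
    also have "\<dots> = r (jE (ew u)) (r (jE (e' i)) m)"
      using r_append[OF lm m u, of "[i]"] i by (simp add: alg_one[OF A])
    also have "\<dots> = Phi (?ia (jE (ew u)) (tt i))"
      using Phi_equivariant[OF jE_W[OF ew_E[OF u]] tt(1)[OF i]] tt(2)[OF i] by simp
    finally show ?thesis .
  qed
  have d_Im: "d e \<in> ?Im" if "e \<in> carrier E" for e
    using that
  proof (induction rule: E_word_induct)
    case (word u)
    show ?case
    proof (cases u rule: rev_cases)
      case Nil
      then show ?thesis using rD(6)[OF m] vs_right_minus[OF V m] Im0(1) by (simp add: d_def jE_ops \<phi>_one_one)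
    next
      case (snoc w i)
      then show ?thesis using d_snoc[of w i] word ia0D(2)[OF jE_W[OF ew_E] tt(1)] by auto
    qed
  next
    case (add x y)
    then show ?case using Im_add(1) lin_add[OF d_lin] by simp
  next
    case (smult c x)
    then show ?case using Im_sm(1) lin_smult[OF d_lin] by simp
  qed
  define g where "g e = cc V0 \<one>\<^bsub>Up D P\<^esub> (ps (d e))" for e
  note lc = lin_cc[OF module_V0 oneA]
  have g: "lin E V0 g"
  proof (rule linI)
    show "g x \<in> carrier V0" if "x \<in> carrier E" for x
      unfolding g_def by (rule lin_closed[OF lc ps(1)[OF d_Im[OF that]]])
    show "g (x \<oplus>\<^bsub>E\<^esub> y) = g x \<oplus>\<^bsub>V0\<^esub> g y" if "x \<in> carrier E" "y \<in> carrier E" for x y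
      using that by (simp only: g_def lin_add[OF d_lin] Im_add(2)[OF d_Im d_Im] lin_add[OF lc] ps(1)[OF d_Im])
    show "g (c \<odot>\<^bsub>E\<^esub> x) = c \<odot>\<^bsub>V0\<^esub> g x" if "x \<in> carrier E" for c x
      using that by (simp only: g_def lin_smult[OF d_lin] Im_sm(2)[OF d_Im] lin_smult[OF lc] ps(1)[OF d_Im])
  qed
  have g_long: "g (ew u) = \<zero>\<^bsub>V0\<^esub>" if u: "u \<in> lists I" "Suc l \<le> length u" for u
  proof -
    have "u \<noteq> []" using u by auto
    then have "d (ew u) = \<zero>\<^bsub>V\<^esub>" using Suc.prems(2)[OF u] u m
      by (simp add: d_def \<phi>_ew_one vs_szero[OF V] vs_zero[OF V] vs_r_zero[OF V])
    then show ?thesis using Im0(2) lin_zero[OF mT0 module_V0 lc] by (simp add: g_def)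
  qed
  obtain t where t: "t \<in> carrier ?T" "\<forall>e\<in>carrier E. cc V0 e t = g e"
    using tensor_of_functional[OF module_V0 g g_long] by blast
  have et: "?ia (jE (e' i)) t = tt i" if i: "i \<in> I" for i
  proof (rule cc_eqI[OF module_V0 ia0D(2)[OF jE_W[OF e'_E[OF i]] t(1)] tt(1)[OF i]])
    fix u assume u: "u \<in> lists I"
    have "cc V0 (ew u) (?ia (jE (e' i)) t) = cc V0 (ew (u @ [i])) t"
      using i u t(1) by (simp add: cc_ia_E[OF module_V0] ew_A e'_E ew_append alg_one[OF A])
    also have "\<dots> = g (ew (u @ [i]))" using t(2) ew_E[of "u @ [i]"] u i by simp
    also have "\<dots> = cc V0 \<one>\<^bsub>Up D P\<^esub> (?ia (jE (ew u)) (tt i))"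
      unfolding g_def d_snoc[OF u i] using ps_Phi ia0D(2)[OF jE_W[OF ew_E[OF u]] tt(1)[OF i]] by simp
    also have "\<dots> = cc V0 (ew u) (tt i)"
      using cc_ia_E[OF module_V0 oneA ew_E[OF u] tt(1)[OF i]] ew_A[OF u] by (simp add: alg_one[OF A])
    finally show "cc V0 (ew u) (?ia (jE (e' i)) t) = cc V0 (ew u) (tt i)" .
  qed
  let ?m = "m \<oplus>\<^bsub>V\<^esub> (-1) \<odot>\<^bsub>V\<^esub> Phi t"
  have Pt: "Phi t \<in> carrier V" by (rule lin_closed[OF lin_Phi t(1)])
  have "?m \<in> carrier V0"
  proof -
    have "r (jE (e' i)) ?m = \<zero>\<^bsub>V\<^esub>" if i: "i \<in> I" for i
    proof -
      note L = rD(3)[OF jE_W[OF e'_E[OF i]]]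
      have "r (jE (e' i)) (Phi t) = r (jE (e' i)) m"
        using Phi_equivariant[OF jE_W[OF e'_E[OF i]] t(1)] et[OF i] tt(2)[OF i] by simp
      then show ?thesis
        using m Pt vs_smult[OF V] vs_right_minus[OF V] lin_closed[OF L] by (simp add: lin_add[OF L] lin_smult[OF L])
    qed
    then show ?thesis using m Pt vs_add[OF V] vs_smult[OF V] by (simp add: coinvariants_iff)
  qed
  note mv = this
  have p: "pure M V0 \<one>\<^bsub>Um D P\<^esub> ?m \<in> carrier ?T" by (rule pcMV[OF module_V0 M_closed(1) mv])
  have "Phi (pure M V0 \<one>\<^bsub>Um D P\<^esub> ?m \<oplus>\<^bsub>?T\<^esub> t) = ?m \<oplus>\<^bsub>V\<^esub> Phi t"
    using p t(1) Phi_pure[OF M_closed(1) mv] rD(6)[OF V0_sub[OF mv]] by (simp add: lin_add[OF lin_Phi] jF_ops)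
  also have "\<dots> = m" using m Pt vs_smult[OF V] vs_left_minus[OF V Pt]
    by (simp add: vs_assoc[OF V] vs_r_zero[OF V])
  finally have eq: "Phi (pure M V0 \<one>\<^bsub>Um D P\<^esub> ?m \<oplus>\<^bsub>?T\<^esub> t) = m" .
  show ?case by (rule image_eqI[where f = Phi, OF eq[symmetric]]) (rule vs_add[OF mT0 p t(1)])
qed

lemma Phi_bij: "bij_betw Phi (carrier (tensor M V0)) (carrier V)"
  unfolding bij_betw_def
proof
  show "Phi ` carrier (tensor M V0) = carrier V"
  proof
    show "carrier V \<subseteq> Phi ` carrier (tensor M V0)"
    proof
      fix m assume m: "m \<in> carrier V"
      then obtain l where "\<forall>u\<in>lists I. l \<le> length u \<longrightarrow> r (jE (ew u)) m = \<zero>\<^bsub>V\<^esub>" using Om by (auto simp: O_mod_def)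
      then show "m \<in> Phi ` carrier (tensor M V0)" using Phi_surj_aux[OF m, of l] by blast
    qed
  qed (use lin_closed[OF lin_Phi] in auto)
qed (rule Phi_inj)

end

end

section \<open>The induced module inside the universe\<close>

text \<open>A pairing function on \<open>S\<close> codes lists of known length, together with a natural number that
  determines this length.\<close>

lemma infinite_coding:
  fixes S :: "'a set"
  assumes "infinite S"
  shows "\<exists>c :: nat \<Rightarrow> 'a list \<Rightarrow> 'a. \<forall>k l xs ys. xs \<in> lists S \<longrightarrow> ys \<in> lists S \<longrightarrow> (k = l \<longrightarrow> length xs = length ys) \<longrightarrow>
     c k xs = c l ys \<longrightarrow> k = l \<and> xs = ys"
proof -
  obtain p where p: "bij_betw p (S \<times> S) S"
    using card_of_Times_same_infinite[OF assms] card_of_ordIso[of "S \<times> S" S] by blast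
  obtain n :: "nat \<Rightarrow> 'a" where n: "inj n" "range n \<subseteq> S"
    using assms by (auto simp: infinite_iff_countable_subset)
  have inj: "x = x' \<and> y = y'" if "p (x, y) = p (x', y')" "x \<in> S" "y \<in> S" "x' \<in> S" "y' \<in> S" for x y x' y'
    using that p unfolding bij_betw_def inj_on_def by blast
  have pS: "p (x, y) \<in> S" if "x \<in> S" "y \<in> S" for x y using p that unfolding bij_betw_def by blast
  have nS: "n k \<in> S" for k using n(2) by blast
  define h where "h = (\<lambda>xs. foldr (\<lambda>x y. p (x, y)) xs (n 0))"
  have h: "h [] = n 0" "h (x # xs) = p (x, h xs)" for x xs by (simp_all add: h_def)
  have hS: "xs \<in> lists S \<Longrightarrow> h xs \<in> S" for xs by (induction xs) (auto simp: h pS nS)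
  have hinj: "xs = ys" if "length xs = length ys" "xs \<in> lists S" "ys \<in> lists S" "h xs = h ys" for xs ys
    using that
  proof (induction xs ys rule: list_induct2)
    case (Cons x xs y ys)
    then have "x = y \<and> h xs = h ys" using hS by (intro inj) (auto simp: h)
    then show ?case using Cons by auto
  qed simp
  have "k = l \<and> xs = ys"
    if "xs \<in> lists S" "ys \<in> lists S" "k = l \<longrightarrow> length xs = length ys" "p (n k, h xs) = p (n l, h ys)" for k l xs ys
  proof -
    have "n k = n l \<and> h xs = h ys" using that hS nS by (intro inj) auto
    then show ?thesis using that hinj n(1) by (auto dest: injD)
  qed
  then show ?thesis by (intro exI[of _ "\<lambda>k xs. p (n k, h xs)"]) blast
qed

lemma infinite_module:
  fixes V :: "'u calg"
  assumes V: "module CC V" and v: "v \<in> carrier V" "v \<noteq> \<zero>\<^bsub>V\<^esub>"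
  shows "infinite (carrier V)"
proof -
  have "inj (\<lambda>c. c \<odot>\<^bsub>V\<^esub> v)"
  proof (rule injI)
    fix a b assume ab: "a \<odot>\<^bsub>V\<^esub> v = b \<odot>\<^bsub>V\<^esub> v"
    show "a = b"
    proof (rule ccontr)
      assume n: "a \<noteq> b"
      have "(a - b) \<odot>\<^bsub>V\<^esub> v = a \<odot>\<^bsub>V\<^esub> v \<oplus>\<^bsub>V\<^esub> (-1) \<odot>\<^bsub>V\<^esub> (b \<odot>\<^bsub>V\<^esub> v)"
        using vs_ldist[OF V v(1), of a "-b"] by (simp add: vs_sassoc[OF V v(1)])
      also have "\<dots> = \<zero>\<^bsub>V\<^esub>" using ab vs_right_minus[OF V vs_smult[OF V v(1)]] by simp
      finally have "inverse (a - b) \<odot>\<^bsub>V\<^esub> ((a - b) \<odot>\<^bsub>V\<^esub> v) = \<zero>\<^bsub>V\<^esub>" using vs_smult_zero[OF V] by simp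
      then show False using n v by (simp add: vs_sassoc[OF V] vs_sone[OF V])
    qed
  qed
  moreover have "range (\<lambda>c. c \<odot>\<^bsub>V\<^esub> v) \<subseteq> carrier V" using vs_smult[OF V v(1)] by auto
  moreover have "infinite (UNIV :: complex set)" by (rule infinite_UNIV_char_0)
  ultimately show ?thesis by (metis finite_imageD finite_subset)
qed

context weyl
begin

text \<open>A tensor is determined by a bound for the length of the words at which it has nonzero
  coordinates, and the finite list of coordinates below that bound.\<close>

lemma embed_exists:
  assumes V: "module CC V"
  shows "\<exists>j :: ('w U \<times> 'u \<Rightarrow> complex) set \<Rightarrow> 'u. inj_on j (carrier (tensor M V))"
proof (cases "\<exists>v\<in>carrier V. v \<noteq> \<zero>\<^bsub>V\<^esub>")
  case False
  have "s = t" if "s \<in> carrier (tensor M V)" "t \<in> carrier (tensor M V)" for s t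
  proof (rule cc_eqI[OF V that])
    fix u assume "u \<in> lists I"
    then show "cc V (ew u) s = cc V (ew u) t" using False that lin_closed[OF lin_cc[OF V ew_A]] by metis
  qed
  then show ?thesis by (auto simp: inj_on_def)
next
  case True
  then have inf: "infinite (carrier V)" using infinite_module[OF V] by blast
  have "\<exists>us. set us = {u \<in> lists I. length u < l}" for l
  proof (rule finite_list, rule finite_subset)
    show "{u \<in> lists I. length u < l} \<subseteq> {xs. set xs \<subseteq> I \<and> length xs \<le> l}" by auto
  qed (rule finite_lists_length_le, simp)
  then obtain us where us: "set (us l) = {u \<in> lists I. length u < l}" for l by metis
  obtain bd where bd: "\<And>t. t \<in> carrier (tensor M V) \<Longrightarrow> \<forall>u\<in>lists I. bd t \<le> length u \<longrightarrow> cc V (ew u) t = \<zero>\<^bsub>V\<^esub>"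
    using cc_bounded[OF V] by metis
  obtain c :: "nat \<Rightarrow> 'u list \<Rightarrow> 'u" where c: "\<And>k l xs ys. xs \<in> lists (carrier V) \<Longrightarrow> ys \<in> lists (carrier V) \<Longrightarrow>
      (k = l \<longrightarrow> length xs = length ys) \<Longrightarrow> c k xs = c l ys \<Longrightarrow> k = l \<and> xs = ys"
    using infinite_coding[OF inf] by blast
  define vals where "vals t = map (\<lambda>u. cc V (ew u) t) (us (bd t))" for t
  have vl: "vals t \<in> lists (carrier V)" if "t \<in> carrier (tensor M V)" for t
  proof -
    have "cc V (ew u) t \<in> carrier V" if "u \<in> set (us (bd t))" for u
      using that us lin_closed[OF lin_cc[OF V ew_A]] \<open>t \<in> carrier (tensor M V)\<close> by blast
    then show ?thesis by (auto simp: vals_def)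
  qed
  have "inj_on (\<lambda>t. c (bd t) (vals t)) (carrier (tensor M V))"
  proof (rule inj_onI)
    fix s t assume st: "s \<in> carrier (tensor M V)" "t \<in> carrier (tensor M V)" "c (bd s) (vals s) = c (bd t) (vals t)"
    have e: "bd s = bd t \<and> vals s = vals t"
      by (rule c[OF vl[OF st(1)] vl[OF st(2)] _ st(3)]) (simp add: vals_def)
    show "s = t"
    proof (rule cc_eqI[OF V st(1,2)])
      fix u assume u: "u \<in> lists I"
      show "cc V (ew u) s = cc V (ew u) t"
      proof (cases "length u < bd t")
        case True
        then have "u \<in> set (us (bd t))" using u us by blast
        then show ?thesis using e by (auto simp: vals_def)
      next
        case False
        then show ?thesis using bd[OF st(1)] bd[OF st(2)] e u by auto
      qed
    qed
  qed
  then show ?thesis by blast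
qed

context
  fixes V :: "'u calg"
  assumes V: "module CC V"
begin

abbreviation "jj \<equiv> embed D P V"
abbreviation "kk \<equiv> unembed D P V"
abbreviation "TM \<equiv> tensor M V"

lemma jj_inj: "inj_on jj (carrier TM)"
  using someI_ex[OF embed_exists[OF V]] by (simp add: embed_def Bmm_M)

lemma kk_jj [simp]: "t \<in> carrier TM \<Longrightarrow> kk (jj t) = t"
  unfolding unembed_def Bmm_M by (rule inv_into_f_f[OF jj_inj])

definition Ind :: "'u calg" where "Ind = transport TM jj kk"
definition ir :: "'w Heis \<Rightarrow> 'u \<Rightarrow> 'u" where "ir w y = jj (ind_act D P V w (kk y))"

lemma FOb_ind: "FOb (ind_functor D P) V = (Ind, ir)"
  by (simp add: ind_functor_def Ind_def ir_def Bmm_M fun_eq_iff)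

lemma Ind_simps:
  "carrier Ind = jj ` carrier TM" "\<zero>\<^bsub>Ind\<^esub> = jj \<zero>\<^bsub>TM\<^esub>"
  "s \<in> carrier TM \<Longrightarrow> t \<in> carrier TM \<Longrightarrow> jj s \<oplus>\<^bsub>Ind\<^esub> jj t = jj (s \<oplus>\<^bsub>TM\<^esub> t)"
  "t \<in> carrier TM \<Longrightarrow> c \<odot>\<^bsub>Ind\<^esub> jj t = jj (c \<odot>\<^bsub>TM\<^esub> t)"
  by (simp_all add: Ind_def transport_def)

lemma ir_jj: "t \<in> carrier TM \<Longrightarrow> ir w (jj t) = jj (ind_act D P V w t)"
  by (simp add: ir_def)

lemma module_Ind: "module CC Ind"
  by (rule module_surj[OF mMV[OF V] Ind_simps])

lemma kk_TM: "y \<in> carrier Ind \<Longrightarrow> kk y \<in> carrier TM" and jj_kk: "y \<in> carrier Ind \<Longrightarrow> jj (kk y) = y"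
  by (auto simp: Ind_simps)

lemma lin_kk: "lin Ind TM kk" and lin_jj: "lin TM Ind jj"
  using vs_add[OF mMV[OF V]] vs_smult[OF mMV[OF V]] by (auto simp: lin_def Ind_simps)

lemma O_mod_Ind: "O_mod Ind ir"
proof -
  note a = iaD[OF V] and m = mMV[OF V]
  have "left_module W Ind ir"
    unfolding left_module_def
  proof (intro conjI allI ballI module_Ind)
    fix w assume w: "w \<in> carrier W"
    note L = a(3)[OF w]
    fix y assume y: "y \<in> carrier Ind"
    then obtain t where t: "t \<in> carrier TM" "y = jj t" by (auto simp: Ind_simps)
    show "ir w y \<in> carrier Ind" using t w a(2) by (auto simp: ir_jj Ind_simps)
    show "ir (c \<odot>\<^bsub>W\<^esub> w) y = c \<odot>\<^bsub>Ind\<^esub> ir w y" "ir w (c \<odot>\<^bsub>Ind\<^esub> y) = c \<odot>\<^bsub>Ind\<^esub> ir w y" for c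
      using t w a(2) vs_smult[OF m] by (simp_all add: ir_jj Ind_simps lin_smult[OF L] lin_smult[OF a(4)])
    {
      fix z assume "z \<in> carrier Ind"
      then obtain s where s: "s \<in> carrier TM" "z = jj s" by (auto simp: Ind_simps)
      show "ir w (y \<oplus>\<^bsub>Ind\<^esub> z) = ir w y \<oplus>\<^bsub>Ind\<^esub> ir w z"
        using s t w a(2) vs_add[OF m] by (simp add: ir_jj Ind_simps lin_add[OF L])
    }
    fix w' assume w': "w' \<in> carrier W"
    show "ir (w \<oplus>\<^bsub>W\<^esub> w') y = ir w y \<oplus>\<^bsub>Ind\<^esub> ir w' y"
      using t w w' a(2) by (simp add: ir_jj Ind_simps lin_add[OF a(4)])
    show "ir (w \<otimes>\<^bsub>W\<^esub> w') y = ir w (ir w' y)"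
      using t w w' a(2) by (simp add: ir_jj a(5))
  next
    fix y assume y: "y \<in> carrier Ind"
    then obtain t where t: "t \<in> carrier TM" "y = jj t" by (auto simp: Ind_simps)
    then show "ir \<one>\<^bsub>W\<^esub> y = y" using a(6) by (simp add: ir_jj)
  qed
  moreover have "\<exists>l. \<forall>u\<in>lists I. l \<le> length u \<longrightarrow> ir (jE (ew u)) y = \<zero>\<^bsub>Ind\<^esub>" if y: "y \<in> carrier Ind" for y
  proof -
    obtain t where t: "t \<in> carrier TM" "y = jj t" using y by (auto simp: Ind_simps)
    obtain l where "\<forall>u\<in>lists I. l \<le> length u \<longrightarrow> ind_act D P V (jE (ew u)) t = \<zero>\<^bsub>TM\<^esub>"
      using ia_nilpotent[OF V t(1)] by blast
    then show ?thesis using t by (intro exI[of _ l]) (simp add: ir_jj Ind_simps)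
  qed
  ultimately show ?thesis by (simp add: O_mod_def)
qed

lemma coinv_Ind: "y \<in> coinvariants D P (Ind, ir) \<longleftrightarrow> (\<exists>v\<in>carrier V. y = jj (pure M V \<one>\<^bsub>Um D P\<^esub> v))"
proof
  assume y: "y \<in> coinvariants D P (Ind, ir)"
  then have y': "y \<in> carrier Ind" "\<And>i. i \<in> I \<Longrightarrow> ir (jE (e' i)) y = \<zero>\<^bsub>Ind\<^esub>" using coinvariants_iff[OF O_mod_Ind] by auto
  then obtain t where t: "t \<in> carrier TM" "y = jj t" by (auto simp: Ind_simps)
  have "ind_act D P V (jE (e' i)) t = \<zero>\<^bsub>TM\<^esub>" if i: "i \<in> I" for i
    using y'(2)[OF i] t iaD(2)[OF V jE_W[OF e'_E[OF i]] t(1)] vs_zero[OF mMV[OF V]] jj_inj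
    by (simp add: ir_jj Ind_simps inj_on_eq_iff)
  then have eq: "t = pure M V \<one>\<^bsub>Um D P\<^esub> (cc V \<one>\<^bsub>Up D P\<^esub> t)" by (rule t_eq_pure_one[OF V t(1)])
  have "y = jj (pure M V \<one>\<^bsub>Um D P\<^esub> (cc V \<one>\<^bsub>Up D P\<^esub> t))"
    unfolding t(2) by (rule arg_cong[OF eq, of jj])
  then show "\<exists>v\<in>carrier V. y = jj (pure M V \<one>\<^bsub>Um D P\<^esub> v)"
    by (rule bexI) (rule lin_closed[OF lin_cc[OF V oneA] t(1)])
next
  assume "\<exists>v\<in>carrier V. y = jj (pure M V \<one>\<^bsub>Um D P\<^esub> v)"
  then obtain v where v: "v \<in> carrier V" "y = jj (pure M V \<one>\<^bsub>Um D P\<^esub> v)" by blast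
  note p = pcMV[OF V M_closed(1) v(1)]
  show "y \<in> coinvariants D P (Ind, ir)"
    unfolding coinvariants_iff[OF O_mod_Ind]
    using p v ia_E_pure_one[OF V _ v(1)] by (auto simp: Ind_simps ir_jj)
qed

end

section \<open>Functoriality\<close>

definition Tm :: "'u calg \<Rightarrow> ('u \<Rightarrow> 'u) \<Rightarrow> ('w U \<times> 'u \<Rightarrow> complex) set \<Rightarrow> ('w U \<times> 'u \<Rightarrow> complex) set" where
  "Tm V' h t = tlift (tensor M V') (\<lambda>x v. pure M V' x (h v)) t"

context
  fixes V V' :: "'u calg" and h
  assumes V: "module CC V" and V': "module CC V'" and h: "lin V V' h"
begin

lemma bilin_Tm: "bilin M V (tensor M V') (\<lambda>x v. pure M V' x (h v))"
  by (intro bilinI) (auto intro: lin_comp[OF h bilin1[OF pMV[OF V']]] bilin2[OF pMV[OF V']] lin_closed[OF h])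

lemma lin_Tm: "lin (tensor M V) (tensor M V') (Tm V' h)"
  unfolding Tm_def by (rule lin_tlift[OF mM V mMV[OF V'] bilin_Tm])

lemma Tm_pure: "x \<in> carrier M \<Longrightarrow> v \<in> carrier V \<Longrightarrow> Tm V' h (pure M V x v) = pure M V' x (h v)"
  unfolding Tm_def by (rule tlift_pure[OF mM V mMV[OF V'] bilin_Tm])

lemma Tm_equivariant:
  assumes w: "w \<in> carrier W" and t: "t \<in> carrier (tensor M V)"
  shows "Tm V' h (ind_act D P V w t) = ind_act D P V' w (Tm V' h t)"
  using w t
proof (induction arbitrary: t rule: W_induct)
  case (F j)
  note c = f_M[OF F(1)]
  show ?case
    by (rule lin_eq_on_pure[OF mM V lin_comp[OF iaD(3)[OF V jF_W[OF c]] lin_Tm] lin_comp[OF lin_Tm iaD(3)[OF V' jF_W[OF c]]] _ F(2)])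
       (simp add: ia_F[OF V c] ia_F[OF V' c] Tm_pure c M_closed lin_closed[OF h])
next
  case (E i)
  note c = e'_E[OF E(1)]
  show ?case
    by (rule lin_eq_on_pure[OF mM V lin_comp[OF iaD(3)[OF V jE_W[OF c]] lin_Tm] lin_comp[OF lin_Tm iaD(3)[OF V' jE_W[OF c]]] _ E(2)])
       (simp add: ia_E[OF V c] ia_E[OF V' c] Tm_pure act_M[OF c] lin_closed[OF h])
next
  case one
  then show ?case using iaD(6)[OF V] iaD(6)[OF V'] lin_closed[OF lin_Tm] by simp
next
  case (add x y)
  then show ?case
    using lin_add[OF iaD(4)[OF V]] lin_add[OF iaD(4)[OF V']] iaD(2)[OF V] lin_closed[OF lin_Tm] by (simp add: lin_add[OF lin_Tm])
next
  case (smult c x)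
  then show ?case
    using lin_smult[OF iaD(4)[OF V]] lin_smult[OF iaD(4)[OF V']] iaD(2)[OF V] lin_closed[OF lin_Tm] by (simp add: lin_smult[OF lin_Tm])
next
  case (mult x y)
  then show ?case using iaD(5)[OF V] iaD(5)[OF V'] iaD(2)[OF V] lin_closed[OF lin_Tm] by simp
qed

lemma FMor_ind: "FMor (ind_functor D P) V V' h = restrict (\<lambda>y. embed D P V' (Tm V' h (unembed D P V y))) (carrier (Ind V))"
  by (simp add: ind_functor_def Ind_simps[OF V] Bmm_M Tm_def)

end

section \<open>The two categories\<close>

lemma lin_maps_iff: "h \<in> lin_maps V V' \<longleftrightarrow> lin V V' h \<and> h \<in> extensional (carrier V)"
  by (auto simp: lin_maps_def lin_def PiE_def Pi_def)

lemma Hom_Vect: "h \<in> Hom Vect V V' \<longleftrightarrow> lin V V' h \<and> h \<in> extensional (carrier V)"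
  by (simp add: Vect_def lin_maps_iff)

lemma Hom_OWq: "h \<in> Hom (OWq D P) (V, r) (V', r') \<longleftrightarrow> lin V V' h \<and> h \<in> extensional (carrier V) \<and>
     (\<forall>w\<in>carrier W. \<forall>m\<in>carrier V. h (r w m) = r' w (h m))"
  by (simp add: OWq_def lin_maps_iff conj_assoc)

lemma cat_simps [simp]:
  "Obj Vect = {V. module CC V}" "Idm Vect V = restrict (\<lambda>x. x) (carrier V)" "Cmp Vect X Y Z g h = compose (carrier X) g h"
  "Idm (OWq D P) N = restrict (\<lambda>x. x) (carrier (fst N))" "Cmp (OWq D P) N N' N'' g h = compose (carrier (fst N)) g h"
  by (simp_all add: Vect_def OWq_def)

lemma lin_restrict: "module CC V \<Longrightarrow> lin V V' (restrict h (carrier V)) \<longleftrightarrow> lin V V' h"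
  using vs_add[of V] vs_smult[of V] by (simp add: lin_def)

lemma lin_compose: "module CC V \<Longrightarrow> lin V V' h \<Longrightarrow> lin V' V'' g \<Longrightarrow> lin V V'' (compose (carrier V) g h)"
  unfolding compose_def using lin_restrict lin_comp by blast

lemma lin_funcset: "lin V V' h \<Longrightarrow> h \<in> carrier V \<rightarrow> carrier V'"
  by (auto simp: lin_def)

lemma compose_restrict_id: "h \<in> extensional S \<Longrightarrow> compose S h (restrict (\<lambda>x. x) S) = h"
  by (auto simp: compose_def extensional_def fun_eq_iff)

lemma category_Vect: "category (Vect :: ('u calg, 'u \<Rightarrow> 'u) cat)"
  unfolding category_def
  by (auto simp: Hom_Vect lin_restrict lin_id lin_compose Id_compose compose_restrict_id lin_funcset compose_assoc)

lemma O_modD: "O_mod V r \<Longrightarrow> module CC V" "O_mod V r \<Longrightarrow> w \<in> carrier W \<Longrightarrow> v \<in> carrier V \<Longrightarrow> r w v \<in> carrier V"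
  using left_moduleD(1,2)[of V r] by (auto simp: O_mod_def)

lemma category_OWq: "category (OWq D P :: (('w, 'u) wmod, 'u \<Rightarrow> 'u) cat)"
proof -
  have comp: "compose (carrier V) g h \<in> Hom (OWq D P) (V, r) (V'', r'')"
    if "O_mod V r" "h \<in> Hom (OWq D P) (V, r) (V', r')" "g \<in> Hom (OWq D P) (V', r') (V'', r'')"
    for V V' V'' :: "'u calg" and r r' r'' g h
    using that lin_compose[OF O_modD(1)[OF that(1)], of V' h V'' g] O_modD(2)[OF that(1)] lin_closed[of V V' h]
    by (simp add: Hom_OWq compose_eq)
  show ?thesis
    unfolding category_def
    using comp
    by (auto simp: Obj_OWq)
       (auto simp: Hom_OWq lin_restrict lin_id Id_compose compose_restrict_id lin_funcset compose_assoc O_modD)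
qed

lemma lin_inv:
  assumes V: "module CC V" and h: "lin V V' h" and b: "bij_betw h (carrier V) (carrier V')"
  shows "lin V' V (inv_into (carrier V) h)"
proof (rule linI)
  have inv: "inv_into (carrier V) h (h x) = x" if "x \<in> carrier V" for x
    using b that by (auto simp: bij_betw_def)
  have V': "carrier V' = h ` carrier V" using b by (simp add: bij_betw_def)
  fix x assume x: "x \<in> carrier V'"
  then obtain a where a: "a \<in> carrier V" "x = h a" by (auto simp: V')
  show "inv_into (carrier V) h x \<in> carrier V" using a inv by simp
  show "inv_into (carrier V) h (c \<odot>\<^bsub>V'\<^esub> x) = c \<odot>\<^bsub>V\<^esub> inv_into (carrier V) h x" for c
    using a inv vs_smult[OF V] lin_smult[OF h] by metis
  fix y assume y: "y \<in> carrier V'"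
  then obtain b where b: "b \<in> carrier V" "y = h b" by (auto simp: V')
  show "inv_into (carrier V) h (x \<oplus>\<^bsub>V'\<^esub> y) = inv_into (carrier V) h x \<oplus>\<^bsub>V\<^esub> inv_into (carrier V) h y"
    using a b inv vs_add[OF V] lin_add[OF h] by metis
qed

lemma iso_Vect:
  assumes V: "module CC V" and V': "module CC V'" and h: "lin V V' h" "h \<in> extensional (carrier V)"
    and b: "bij_betw h (carrier V) (carrier V')"
  shows "is_iso Vect V V' h"
  unfolding is_iso_def
  using assms lin_inv[OF V h(1) b] compose_inv_into_id[OF b] compose_id_inv_into[of h "carrier V" "carrier V'"]
  by (auto simp: Hom_Vect bij_betw_def lin_restrict intro!: bexI[of _ "restrict (inv_into (carrier V) h) (carrier V')"])

lemma iso_OWq_inv: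
  assumes V: "O_mod V r" and V': "O_mod V' r'" and h: "lin V V' h"
    and eq: "\<And>w m. w \<in> carrier W \<Longrightarrow> m \<in> carrier V \<Longrightarrow> h (r w m) = r' w (h m)"
    and b: "bij_betw h (carrier V) (carrier V')"
  shows "is_iso (OWq D P) (V', r') (V, r) (restrict (inv_into (carrier V) h) (carrier V'))"
proof -
  let ?g = "inv_into (carrier V) h"
  have g: "?g (h x) = x" if "x \<in> carrier V" for x using b that by (auto simp: bij_betw_def)
  have V'c: "carrier V' = h ` carrier V" using b by (simp add: bij_betw_def)
  note mV = O_modD(1)[OF V] and mV' = O_modD(1)[OF V']
  have 1: "restrict ?g (carrier V') \<in> Hom (OWq D P) (V', r') (V, r)"
    unfolding Hom_OWq
  proof (intro conjI ballI)
    show "lin V' V (restrict ?g (carrier V'))" using lin_inv[OF mV h b] lin_restrict[OF mV'] by blast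
    fix w m assume w: "w \<in> carrier W" and m: "m \<in> carrier V'"
    obtain a where a: "a \<in> carrier V" "m = h a" using m by (auto simp: V'c)
    have "r' w m \<in> carrier V'" using O_modD(2)[OF V' w m] .
    then show "restrict ?g (carrier V') (r' w m) = r w (restrict ?g (carrier V') m)"
      using m a eq[OF w a(1)] g[OF a(1)] g[OF O_modD(2)[OF V w a(1)]] by simp
  qed simp
  have 2: "restrict h (carrier V) \<in> Hom (OWq D P) (V, r) (V', r')"
    unfolding Hom_OWq using h eq lin_restrict[OF mV] O_modD(2)[OF V] by auto
  have 3: "compose (carrier V') (restrict h (carrier V)) (restrict ?g (carrier V')) = restrict (\<lambda>x. x) (carrier V')"
    using g by (auto simp: compose_def fun_eq_iff restrict_def V'c)
  have 4: "compose (carrier V) (restrict ?g (carrier V')) (restrict h (carrier V)) = restrict (\<lambda>x. x) (carrier V)"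
    using g by (auto simp: compose_def fun_eq_iff restrict_def V'c)
  show ?thesis unfolding is_iso_def using 1 2 3 4 by auto
qed

section \<open>The equivalence\<close>

abbreviation "CF \<equiv> coinv_functor D P"
abbreviation "IF \<equiv> ind_functor D P"

lemma FOb_coinv: "FOb CF (V, r) = V\<lparr>carrier := coinvariants D P (V, r)\<rparr>"
  and FMor_coinv: "FMor CF (V, r) N h = restrict h (coinvariants D P (V, r))"
  by (simp_all add: coinv_functor_def)

lemma coinv_lin:
  assumes Y: "O_mod Y s" and Z: "O_mod Z s'" and h: "h \<in> Hom (OWq D P) (Y, s) (Z, s')"
  shows "lin (Y\<lparr>carrier := coinvariants D P (Y, s)\<rparr>) (Z\<lparr>carrier := coinvariants D P (Z, s')\<rparr>) h"
proof -
  have l: "lin Y Z h" and eq: "\<And>w m. w \<in> carrier W \<Longrightarrow> m \<in> carrier Y \<Longrightarrow> h (s w m) = s' w (h m)"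
    using h by (auto simp: Hom_OWq)
  have "h m \<in> coinvariants D P (Z, s')" if m: "m \<in> coinvariants D P (Y, s)" for m
    using m lin_closed[OF l] eq[OF jE_W[OF e'_E], symmetric] lin_zero[OF O_modD(1)[OF Y] O_modD(1)[OF Z] l]
    unfolding coinvariants_iff[OF Y] coinvariants_iff[OF Z] by simp
  then show ?thesis using l by (auto simp: lin_def coinvariants_iff[OF Y])
qed

lemma functor_coinv: "is_functor (OWq D P :: (('w, 'u) wmod, 'u \<Rightarrow> 'u) cat) Vect CF"
  unfolding is_functor_def
proof (intro conjI ballI)
  fix X :: "('w, 'u) wmod" assume X: "X \<in> Obj (OWq D P)"
  obtain Vx r where x: "X = (Vx, r)" by (cases X)
  have ox: "O_mod Vx r" using X x by (simp add: Obj_OWq)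
  note sub = V0_sub[OF ox] and m0 = module_V0[OF ox]
  show "FOb CF X \<in> Obj Vect" using m0 by (simp add: x FOb_coinv)
  show "FMor CF X X (Idm (OWq D P) X) = Idm Vect (FOb CF X)"
    using sub by (auto simp: x FOb_coinv FMor_coinv restrict_def fun_eq_iff)
  fix Y :: "('w, 'u) wmod" assume Y: "Y \<in> Obj (OWq D P)"
  obtain Vy s where y: "Y = (Vy, s)" by (cases Y)
  have oy: "O_mod Vy s" using Y y by (simp add: Obj_OWq)
  fix h assume h: "h \<in> Hom (OWq D P) X Y"
  note hl = coinv_lin[OF ox oy h[unfolded x y]]
  show "FMor CF X Y h \<in> Hom Vect (FOb CF X) (FOb CF Y)"
    using hl lin_restrict[OF m0, of _ h] by (simp add: x y FOb_coinv FMor_coinv Hom_Vect)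
  fix Z :: "('w, 'u) wmod" assume Z: "Z \<in> Obj (OWq D P)"
  fix g assume g: "g \<in> Hom (OWq D P) Y Z"
  show "FMor CF X Z (Cmp (OWq D P) X Y Z g h) = Cmp Vect (FOb CF X) (FOb CF Y) (FOb CF Z) (FMor CF Y Z g) (FMor CF X Y h)"
    using lin_closed[OF hl] sub by (auto simp: x y FOb_coinv FMor_coinv compose_def restrict_def fun_eq_iff)
qed

lemma functor_ind: "is_functor Vect (OWq D P :: (('w, 'u) wmod, 'u \<Rightarrow> 'u) cat) IF"
  unfolding is_functor_def
proof (intro conjI ballI)
  fix X :: "'u calg" assume "X \<in> Obj Vect"
  then have X: "module CC X" by simp
  note mx = mMV[OF X]
  show "FOb IF X \<in> Obj (OWq D P)" using O_mod_Ind[OF X] by (simp add: FOb_ind[OF X] Obj_OWq)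
  have l: "lin X X (restrict (\<lambda>x. x) (carrier X))" using lin_id[OF X] lin_restrict[OF X] by blast
  have "Tm X (restrict (\<lambda>x. x) (carrier X)) t = t" if t: "t \<in> carrier (tensor M X)" for t
    by (rule lin_eq_on_pure[OF mM X lin_Tm[OF X X l] lin_id[OF mx] _ t]) (simp add: Tm_pure[OF X X l])
  then show "FMor IF X X (Idm Vect X) = Idm (OWq D P) (FOb IF X)"
    by (simp add: FMor_ind[OF X X l] FOb_ind[OF X]) (auto simp: restrict_def fun_eq_iff kk_TM[OF X] jj_kk[OF X])
  fix Y :: "'u calg" assume "Y \<in> Obj Vect"
  then have Y: "module CC Y" by simp
  fix h assume "h \<in> Hom Vect X Y"
  then have h: "lin X Y h" by (simp add: Hom_Vect)
  note lT = lin_Tm[OF X Y h]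
  note Lh = lin_comp[OF lin_comp[OF lin_kk[OF X] lT] lin_jj[OF Y]]
  show "FMor IF X Y h \<in> Hom (OWq D P) (FOb IF X) (FOb IF Y)"
    unfolding FMor_ind[OF X Y h] FOb_ind[OF X] FOb_ind[OF Y] Hom_OWq
  proof (intro conjI ballI)
    show "lin (Ind X) (Ind Y) (restrict (\<lambda>y. embed D P Y (Tm Y h (unembed D P X y))) (carrier (Ind X)))"
      using Lh lin_restrict[OF module_Ind[OF X]] by blast
    fix w m assume w: "w \<in> carrier W" and m: "m \<in> carrier (Ind X)"
    obtain t where t: "t \<in> carrier (tensor M X)" "m = embed D P X t" using m by (auto simp: Ind_simps[OF X])
    have "ir X w m \<in> carrier (Ind X)" by (rule O_modD(2)[OF O_mod_Ind[OF X] w m])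
    then show "restrict (\<lambda>y. embed D P Y (Tm Y h (unembed D P X y))) (carrier (Ind X)) (ir X w m) =
        ir Y w (restrict (\<lambda>y. embed D P Y (Tm Y h (unembed D P X y))) (carrier (Ind X)) m)"
      using m t iaD(2)[OF X w t(1)] lin_closed[OF lT t(1)]
      by (simp add: ir_jj[OF X] ir_jj[OF Y] kk_jj[OF X] Tm_equivariant[OF X Y h w])
  qed simp
  fix Z :: "'u calg" assume "Z \<in> Obj Vect"
  then have Z: "module CC Z" by simp
  fix g assume "g \<in> Hom Vect Y Z"
  then have g: "lin Y Z g" by (simp add: Hom_Vect)
  have gh: "lin X Z (compose (carrier X) g h)" by (rule lin_compose[OF X h g])
  have T: "Tm Z (compose (carrier X) g h) t = Tm Z g (Tm Y h t)" if t: "t \<in> carrier (tensor M X)" for t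
    by (rule lin_eq_on_pure[OF mM X lin_Tm[OF X Z gh] lin_comp[OF lT lin_Tm[OF Y Z g]] _ t])
       (simp add: Tm_pure[OF X Z gh] Tm_pure[OF X Y h] Tm_pure[OF Y Z g] lin_closed[OF h] compose_eq)
  show "FMor IF X Z (Cmp Vect X Y Z g h) = Cmp (OWq D P) (FOb IF X) (FOb IF Y) (FOb IF Z) (FMor IF Y Z g) (FMor IF X Y h)"
  proof
    fix y
    show "FMor IF X Z (Cmp Vect X Y Z g h) y = Cmp (OWq D P) (FOb IF X) (FOb IF Y) (FOb IF Z) (FMor IF Y Z g) (FMor IF X Y h) y"
    proof (cases "y \<in> carrier (Ind X)")
      case True
      note k = kk_TM[OF X True]
      have "embed D P Y (Tm Y h (unembed D P X y)) \<in> carrier (Ind Y)" by (rule lin_closed[OF Lh True])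
      then show ?thesis
        using True T[OF k] lin_closed[OF lT k]
        by (simp add: FMor_ind[OF X Z gh] FMor_ind[OF X Y h] FMor_ind[OF Y Z g] FOb_ind[OF X] compose_eq kk_jj[OF Y])
    next
      case False
      then show ?thesis by (simp add: FMor_ind[OF X Z gh] FOb_ind[OF X]) (simp add: compose_def)
    qed
  qed
qed

text \<open>The map \<^const>\<open>Phi\<close> read on the copy of the tensor product inside the universe.\<close>

definition Psi :: "('w, 'u) wmod \<Rightarrow> 'u \<Rightarrow> 'u" where
  "Psi N y = Phi (fst N) (snd N) (unembed D P (FOb CF N) y)"

lemma Psi_props:
  assumes o: "O_mod V r"
  defines "U \<equiv> V\<lparr>carrier := coinvariants D P (V, r)\<rparr>"
  shows "lin (Ind U) V (Psi (V, r))" "bij_betw (Psi (V, r)) (carrier (Ind U)) (carrier V)"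
    "\<And>w m. w \<in> carrier W \<Longrightarrow> m \<in> carrier (Ind U) \<Longrightarrow> Psi (V, r) (ir U w m) = r w (Psi (V, r) m)"
proof -
  have U: "module CC U" unfolding U_def by (rule module_V0[OF o])
  note lP = lin_Phi[OF o, folded U_def] and bP = Phi_bij[OF o, folded U_def]
  have e: "Psi (V, r) = (\<lambda>y. Phi V r (unembed D P U y))" by (simp add: Psi_def FOb_coinv U_def fun_eq_iff)
  show "lin (Ind U) V (Psi (V, r))" unfolding e by (rule lin_comp[OF lin_kk[OF U] lP])
  have "bij_betw (unembed D P U) (carrier (Ind U)) (carrier (tensor M U))"
    by (rule bij_betw_byWitness[where f' = "embed D P U"])
       (auto simp: jj_kk[OF U] kk_TM[OF U] Ind_simps[OF U] kk_jj[OF U])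
  then show "bij_betw (Psi (V, r)) (carrier (Ind U)) (carrier V)"
    unfolding e using bij_betw_trans[OF _ bP] by (simp add: comp_def)
  fix w m assume w: "w \<in> carrier W" and m: "m \<in> carrier (Ind U)"
  then show "Psi (V, r) (ir U w m) = r w (Psi (V, r) m)"
    using Phi_equivariant[OF o w, folded U_def] kk_TM[OF U m] iaD(2)[OF U w kk_TM[OF U m]]
    by (simp add: e ir_def[OF U] kk_jj[OF U])
qed

text \<open>The unit is the inverse of \<open>Psi\<close>. It is natural because \<open>Psi\<close> is: for \<open>h\<close> commuting with the negative
  generators, \<open>h (x v) = x (h v)\<close>.\<close>

lemma unit_iso:
  "\<exists>\<eta>. natural_iso (OWq D P :: (('w, 'u) wmod, 'u \<Rightarrow> 'u) cat) (OWq D P) id_functor (comp_functor IF CF) \<eta>"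
proof -
  define eta where "eta N = restrict (inv_into (carrier (Ind (FOb CF N))) (Psi N)) (carrier (fst N))" for N :: "('w, 'u) wmod"
  have "natural_iso (OWq D P) (OWq D P) id_functor (comp_functor IF CF) eta"
    unfolding natural_iso_def
  proof (intro conjI ballI)
    fix X :: "('w, 'u) wmod" assume X: "X \<in> Obj (OWq D P)"
    obtain V r where x: "X = (V, r)" by (cases X)
    have ox: "O_mod V r" using X x by (simp add: Obj_OWq)
    let ?U = "V\<lparr>carrier := coinvariants D P (V, r)\<rparr>"
    have U: "module CC ?U" by (rule module_V0[OF ox])
    note px = Psi_props[OF ox]
    show "is_iso (OWq D P) (FOb id_functor X) (FOb (comp_functor IF CF) X) (eta X)"
      using iso_OWq_inv[OF O_mod_Ind[OF U] ox px(1) px(3) px(2)]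
      by (simp add: id_functor_def comp_functor_def x FOb_coinv FOb_ind[OF U] eta_def)
    fix Y :: "('w, 'u) wmod" assume Y: "Y \<in> Obj (OWq D P)"
    obtain V' r' where y: "Y = (V', r')" by (cases Y)
    have oy: "O_mod V' r'" using Y y by (simp add: Obj_OWq)
    let ?U' = "V'\<lparr>carrier := coinvariants D P (V', r')\<rparr>"
    have U': "module CC ?U'" by (rule module_V0[OF oy])
    note py = Psi_props[OF oy]
    fix h assume h: "h \<in> Hom (OWq D P) X Y"
    have hl: "lin V V' h" "h \<in> extensional (carrier V)" and heq: "\<And>w m. w \<in> carrier W \<Longrightarrow> m \<in> carrier V \<Longrightarrow> h (r w m) = r' w (h m)"
      using h by (auto simp: x y Hom_OWq)
    let ?h = "restrict h (coinvariants D P (V, r))"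
    have lh: "lin ?U ?U' ?h" using coinv_lin[OF ox oy h[unfolded x y]] lin_restrict[OF U, of ?U' h] by simp
    have PT: "Phi V' r' (Tm ?U' ?h t) = h (Phi V r t)" if t: "t \<in> carrier (tensor M ?U)" for t
      by (rule lin_eq_on_pure[OF mM U lin_comp[OF lin_Tm[OF U U' lh] lin_Phi[OF oy]] lin_comp[OF lin_Phi[OF ox] hl(1)] _ t])
         (use V0_sub[OF ox] lin_closed[OF lh] in \<open>simp add: Tm_pure[OF U U' lh] Phi_pure[OF ox] Phi_pure[OF oy] heq jF_W\<close>)
    let ?G = "FMor IF ?U ?U' ?h"
    have "eta Y (h m) = ?G (eta X m)" if m: "m \<in> carrier V" for m
    proof -
      define z where "z = inv_into (carrier (Ind ?U)) (Psi (V, r)) m"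
      have z: "z \<in> carrier (Ind ?U)" "Psi (V, r) z = m"
        using px(2) m by (auto simp: z_def bij_betw_def inv_into_into f_inv_into_f)
      have Gz: "?G z = embed D P ?U' (Tm ?U' ?h (unembed D P ?U z))" using z(1) by (simp add: FMor_ind[OF U U' lh])
      have TT: "Tm ?U' ?h (unembed D P ?U z) \<in> carrier (tensor M ?U')" by (rule lin_closed[OF lin_Tm[OF U U' lh] kk_TM[OF U z(1)]])
      have G: "?G z \<in> carrier (Ind ?U')" unfolding Gz using TT by (auto simp: Ind_simps[OF U'])
      have "Psi (V', r') (?G z) = h m"
        unfolding Gz using z(2) PT[OF kk_TM[OF U z(1)]] TT by (simp add: Psi_def FOb_coinv kk_jj[OF U'])
      then have "inv_into (carrier (Ind ?U')) (Psi (V', r')) (h m) = ?G z"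
        using bij_betw_inv_into_left[OF py(2) G] by simp
      then show ?thesis using m lin_closed[OF hl(1) m] by (simp add: eta_def x y FOb_coinv z_def)
    qed
    then show "Cmp (OWq D P) (FOb id_functor X) (FOb id_functor Y) (FOb (comp_functor IF CF) Y) (eta Y) (FMor id_functor X Y h) =
        Cmp (OWq D P) (FOb id_functor X) (FOb (comp_functor IF CF) X) (FOb (comp_functor IF CF) Y) (FMor (comp_functor IF CF) X Y h) (eta X)"
      by (auto simp: id_functor_def comp_functor_def x y FOb_coinv FMor_coinv compose_def restrict_def fun_eq_iff)
  qed
  then show ?thesis by blast
qed

text \<open>The coinvariants of an induced module are the tensors \<open>1 \<otimes> v\<close>; the counit reads off \<open>v\<close> as the coordinate at
  the empty word.\<close>

lemma counit_iso:
  "\<exists>\<epsilon>. natural_iso (Vect :: ('u calg, 'u \<Rightarrow> 'u) cat) Vect (comp_functor CF IF) id_functor \<epsilon>"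
proof -
  let ?C = "\<lambda>V. Ind V\<lparr>carrier := coinvariants D P (Ind V, ir V)\<rparr>"
  define eps where "eps V = restrict (\<lambda>y. cc V \<one>\<^bsub>Up D P\<^esub> (unembed D P V y)) (coinvariants D P (Ind V, ir V))" for V :: "'u calg"
  have "natural_iso Vect Vect (comp_functor CF IF) id_functor eps"
    unfolding natural_iso_def
  proof (intro conjI ballI)
    fix X :: "'u calg" assume "X \<in> Obj Vect"
    then have X: "module CC X" by simp
    note oI = O_mod_Ind[OF X]
    have C: "module CC (?C X)" by (rule module_V0[OF oI])
    have val: "cc X \<one>\<^bsub>Up D P\<^esub> (unembed D P X (embed D P X (pure M X \<one>\<^bsub>Um D P\<^esub> v))) = v" if v: "v \<in> carrier X" for v
      using v pcMV[OF X M_closed(1) v] by (simp add: kk_jj[OF X] cc_pure[OF X] oneA M_closed \<phi>_one_one vs_sone[OF X])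
    have "lin (Ind X) X (\<lambda>y. cc X \<one>\<^bsub>Up D P\<^esub> (unembed D P X y))"
      by (rule lin_comp[OF lin_kk[OF X] lin_cc[OF X oneA]])
    then have l: "lin (?C X) X (eps X)"
      using V0_sub[OF oI] lin_restrict[OF C, of X "\<lambda>y. cc X \<one>\<^bsub>Up D P\<^esub> (unembed D P X y)"] by (auto simp: eps_def lin_def)
    have b: "bij_betw (eps X) (carrier (?C X)) (carrier X)"
      by (rule bij_betw_byWitness[where f' = "\<lambda>v. embed D P X (pure M X \<one>\<^bsub>Um D P\<^esub> v)"])
         (auto simp: eps_def coinv_Ind[OF X] val)
    show "is_iso Vect (FOb (comp_functor CF IF) X) (FOb id_functor X) (eps X)"
      using iso_Vect[OF C X l _ b] by (simp add: comp_functor_def id_functor_def FOb_ind[OF X] FOb_coinv eps_def)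
    fix Y :: "'u calg" assume "Y \<in> Obj Vect"
    then have Y: "module CC Y" by simp
    fix h assume "h \<in> Hom Vect X Y"
    then have h: "lin X Y h" "h \<in> extensional (carrier X)" by (auto simp: Hom_Vect)
    have val2: "FMor IF X Y h (embed D P X (pure M X \<one>\<^bsub>Um D P\<^esub> v)) = embed D P Y (pure M Y \<one>\<^bsub>Um D P\<^esub> (h v))"
      if v: "v \<in> carrier X" for v
      using v pcMV[OF X M_closed(1) v]
      by (simp add: FMor_ind[OF X Y h(1)] Ind_simps[OF X] kk_jj[OF X] Tm_pure[OF X Y h(1)] M_closed)
    have "eps Y (FMor IF X Y h y) = h (eps X y)" and "FMor IF X Y h y \<in> coinvariants D P (Ind Y, ir Y)"
      if y: "y \<in> coinvariants D P (Ind X, ir X)" for y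
    proof -
      obtain v where v: "v \<in> carrier X" "y = embed D P X (pure M X \<one>\<^bsub>Um D P\<^esub> v)" using y coinv_Ind[OF X] by blast
      have hv: "h v \<in> carrier Y" by (rule lin_closed[OF h(1) v(1)])
      show mem: "FMor IF X Y h y \<in> coinvariants D P (Ind Y, ir Y)"
        unfolding v(2) val2[OF v(1)] coinv_Ind[OF Y] using hv by blast
      have "cc Y \<one>\<^bsub>Up D P\<^esub> (unembed D P Y (embed D P Y (pure M Y \<one>\<^bsub>Um D P\<^esub> (h v)))) = h v"
        using hv pcMV[OF Y M_closed(1) hv] by (simp add: kk_jj[OF Y] cc_pure[OF Y] oneA M_closed \<phi>_one_one vs_sone[OF Y])
      then show "eps Y (FMor IF X Y h y) = h (eps X y)"
        using mem y val[OF v(1)] unfolding v(2) val2[OF v(1)] by (simp add: eps_def)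
    qed
    then show "Cmp Vect (FOb (comp_functor CF IF) X) (FOb (comp_functor CF IF) Y) (FOb id_functor Y) (eps Y) (FMor (comp_functor CF IF) X Y h) =
       Cmp Vect (FOb (comp_functor CF IF) X) (FOb id_functor X) (FOb id_functor Y) (FMor id_functor X Y h) (eps X)"
      by (auto simp: comp_functor_def id_functor_def FOb_ind[OF X] FOb_ind[OF Y] FOb_coinv FMor_coinv compose_def restrict_def fun_eq_iff)
  qed
  then show ?thesis by blast
qed

lemma equivalence: "equivalence_of_categories (OWq D P :: (('w, 'u) wmod, 'u \<Rightarrow> 'u) cat) Vect CF IF"
  unfolding equivalence_of_categories_def
  using category_OWq category_Vect functor_coinv functor_ind unit_iso counit_iso by blast

end

theorem theorem1:
  fixes scale :: "complex \<Rightarrow> 'g::ab_group_add \<Rightarrow> 'g"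
    and br :: "'g \<Rightarrow> 'g \<Rightarrow> 'g"
    and H :: "'g set"
    and \<alpha> :: "nat \<Rightarrow> 'g \<Rightarrow> complex"
    and q :: complex
    and qe :: "rat \<Rightarrow> complex"
    and D :: "('g \<Rightarrow> complex) qdatum"
    and P :: "('g \<Rightarrow> complex) hopf_data"
  assumes "complex_lie_algebra scale br"
    and "complex_lie_algebra.semisimple scale br"
    and "complex_lie_algebra.cartan_subalgebra scale br H"
    and "complex_lie_algebra.simple_roots scale br H \<alpha>"
    and "q \<noteq> 0" and "\<forall>k::nat. k > 0 \<longrightarrow> q ^ k \<noteq> 1"
    and "\<forall>r. qe r \<noteq> 0" and "\<forall>r s. qe (r + s) = qe r * qe s" and "qe 1 = q"
    and "D = lie_qdatum scale br H \<alpha> qe"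
    and "is_hopf_p D P" and "is_hopf_m D P" and "is_pairing D P"
  shows "equivalence_of_categories
           (OWq D P :: ((('g \<Rightarrow> complex), 'u) wmod, 'u \<Rightarrow> 'u) cat)
           (Vect :: ('u calg, 'u \<Rightarrow> 'u) cat)
           (coinv_functor D P)
           (ind_functor D P)"
proof -
  have "qexp D r \<noteq> 0" for r
    using assms(7,10) by (simp add: lie_qdatum_def)
  then have "weyl D P"
    unfolding weyl_def by (intro hopf_gens_U assms)
  then show ?thesis by (rule weyl.equivalence)
qed

end
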